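(* For (Lebesgue-)almost all $(x_1,x_2)\in\Delta_2=\{(x_1,x_2)\in\mathbb{R}^2:0\le x_1\le x_2\le1\}$, the $S$-adic shift $(X_{\boldsymbol{\sigma}},\Sigma)$ with $\boldsymbol{\sigma}=\Phi(x_1,x_2)$ is measurably conjugate to the translation by $\big(\frac{x_1}{1+x_1+x_2},\frac{x_2}{1+x_1+x_2}\big)$ on $\mathbb{T}^2$; then each $\omega\in X_{\boldsymbol{\sigma}}$ is a natural coding for this translation, $\mathcal{L}_{\boldsymbol{\sigma}}$ is balanced, and the subpieces of the Rauzy fractal provide bounded remainder sets for this translation.
   Context: $\mathcal{A}=\{1,2,3\}$, $\mathbb{N}=\{0,1,2,\ldots\}$. Brun's map $T_{\rm Brun}:\Delta_2\to\Delta_2$ is given by $(x_1,x_2)\mapsto\big(\frac{x_1}{1-x_2},\frac{x_2}{1-x_2}\big)$ on $B(1)=\{x_2\le\frac12\}$, $(x_1,x_2)\mapsto\big(\frac{x_1}{x_2},\frac{1-x_2}{x_2}\big)$ on $B(2)=\{\frac12\le x_2\le1-x_1\}$, $(x_1,x_2)\mapsto\big(\frac{1-x_2}{x_2},\frac{x_1}{x_2}\big)$ on $B(3)=\{1-x_1\le x_2\le1\}$. The Brun substitutions are $\beta_1:1\mapsto1,2\mapsto23,3\mapsto3$; $\beta_2:1\mapsto1,2\mapsto3,3\mapsto23$; $\beta_3:1\mapsto3,2\mapsto1,3\mapsto23$; $S=\{\beta_1,\beta_2,\beta_3\}$. The map $\Phi$, defined for almost all $(x_1,x_2)\in\Delta_2$,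 is $\Phi(x_1,x_2)=(\sigma_n)_{n\in\mathbb{N}}\in S^{\mathbb{N}}$ with $\sigma_n=\beta_i$ if $T_{\rm Brun}^n(x_1,x_2)\in B(i)$; it satisfies $\Phi\circ T_{\rm Brun}=\Sigma\circ\Phi$. For $\boldsymbol{\sigma}=(\sigma_n)$: $\sigma_{[0,n)}=\sigma_0\cdots\sigma_{n-1}$; $M_\sigma=(|\sigma(j)|_i)_{i,j}$ is the incidence matrix ($|w|_i$ the number of occurrences of $i$ in $w$); $M_{[0,n)}=M_{\sigma_0}\cdots M_{\sigma_{n-1}}$; $\mathcal{L}_{\boldsymbol{\sigma}}$ is the set of factors of the words $\sigma_{[0,n)}(i)$, $i\in\mathcal{A}$, $n\in\mathbb{N}$; $X_{\boldsymbol{\sigma}}$ is the set of infinite words all of whose factors are in $\mathcal{L}_{\boldsymbol{\sigma}}$, with shift $\Sigma$ and its (for almost all $(x_1,x_2)$) unique shift invariant probability measure. A language is balanced if there is $C$ with $\big||u|_j-|v|_j\big|\le C$ for all letters $j$ and all $u,v$ in it with $|u|=|v|$. Rauzy fractal: a limit word of $\boldsymbol{\sigma}$ is an infinite word $\omega=\omega^{(0)}$ for which there are infinite words $\omega^{(n)}$ with $\omega^{(n)}=\sigma_n(\omega^{(n+1)})$ for all $n$. $\mathbf{u}=(u_1,u_2,u_3)$ is the positive vector with $\bigcap_nM_{[0,n)}\mathbb{R}_+^3=\mathbb{R}_+\mathbf{u}$, normalized by $u_1+u_2+u_3=1$; $\pi_{\mathbf{u},\mathbf{1}}$ is the projection along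 $\mathbf{u}$ onto $\mathbf{1}^\bot$, $\mathbf{1}={}^t(1,1,1)$; $\mathbf{l}(w)={}^t(|w|_1,|w|_2,|w|_3)$. The subpieces of the Rauzy fractal are $\mathcal{R}(i)=\overline{\{\pi_{\mathbf{u},\mathbf{1}}\mathbf{l}(p):p\in\mathcal{A}^*,\ p\,i\text{ is a prefix of a limit word of }\boldsymbol{\sigma}\}}$, $i\in\mathcal{A}$. The torus $\mathbf{1}^\bot/(\mathbb{Z}(\mathbf{e}_3-\mathbf{e}_1)+\mathbb{Z}(\mathbf{e}_3-\mathbf{e}_2))$ is identified with $\mathbb{T}^2=\mathbb{R}^2/\mathbb{Z}^2$ through the basis $\mathbf{e}_3-\mathbf{e}_1,\ \mathbf{e}_3-\mathbf{e}_2$ ($\mathbf{e}_i$ standard unit vectors). Natural coding: for a full-rank lattice $\Lambda$ in a Euclidean space, a translation $T_{\mathbf{t}}$ on the quotient torus, a fundamental domain $R$ with induced map $\tilde T_{\mathbf{t}}:R\to R$, and a partition (up to measure zero) $R=R_1\cup\cdots\cup R_k$ such that each $\tilde T_{\mathbf{t}}|_{R_i}$ is a translation $\mathbf{x}\mapsto\mathbf{x}+\mathbf{t}_i$, a coding of (the orbit of) a point of $R$ with respect to this partition is called a natural coding of $T_{\mathbf{t}}$. A measurable subset $B$ of the torus is a bounded remainder set for $T_{\mathbf{t}}$ if there is $C'>0$ such that for a.e. $x$ and all $N\in\mathbb{N}$, $|\#\{n<N:T_{\mathbf{t}}^n(x)\in B\}-N\lambda(B)/\lambda(R)|<C'$ ($\lambda$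 Lebesgue measure). *)

theory Defs
  imports "HOL-Probability.Stream_Space" "HOL-Library.Sublist"
begin

text \<open>
  The alphabet is the three-element type \<^typ>\<open>3\<close>, which is also the index type of
  \<^typ>\<open>real^3\<close>; as elements of this type the letters are \<open>1\<close>, \<open>2\<close> and \<open>3\<close>.  Finite words are lists
  and infinite words (indexed by \<open>0,1,2,\<dots>\<close>) are streams, so the shift is \<^const>\<open>stl\<close>.
\<close>

type_synonym substitution = "3 \<Rightarrow> 3 list"


section \<open>The Brun algorithm\<close>

definition Delta2 :: "(real \<times> real) set" where
  "Delta2 = {(x1, x2). 0 \<le> x1 \<and> x1 \<le> x2 \<and> x2 \<le> 1}"

definition brun_cell :: "3 \<Rightarrow> (real \<times> real) set" where
  "brun_cell i = {(x1, x2) \<in> Delta2.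
     if i = 1 then x2 \<le> 1/2
     else if i = 2 then 1/2 \<le> x2 \<and> x2 \<le> 1 - x1
     else 1 - x1 \<le> x2 \<and> x2 \<le> 1}"

text \<open>
  The three cells cover \<^const>\<open>Delta2\<close> and overlap in segments.  The branches of the map agree on
  the overlaps; the coding does not, but only a null set of points ever visits an overlap, so the
  tie-breaking rule is immaterial for statements about almost all points.
\<close>

definition brun_index :: "real \<times> real \<Rightarrow> 3" where
  "brun_index x = (if x \<in> brun_cell 1 then 1 else if x \<in> brun_cell 2 then 2 else 3)"

definition brun_map :: "real \<times> real \<Rightarrow> real \<times> real" where
  "brun_map x = (case x of (x1, x2) \<Rightarrow>
     if brun_index x = 1 then (x1 / (1 - x2), x2 / (1 - x2))
     else if brun_index x = 2 then (x1 / x2, (1 - x2) / x2)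
     else ((1 - x2) / x2, x1 / x2))"

definition brun_subst :: "3 \<Rightarrow> substitution" where
  "brun_subst i =
     (if i = 1 then (\<lambda>j. if j = 1 then [1] else if j = 2 then [2, 3] else [3])
      else if i = 2 then (\<lambda>j. if j = 1 then [1] else if j = 2 then [3] else [2, 3])
      else (\<lambda>j. if j = 1 then [3] else if j = 2 then [1] else [2, 3]))"

definition brun_Phi :: "real \<times> real \<Rightarrow> nat \<Rightarrow> substitution" where
  "brun_Phi x n = brun_subst (brun_index ((brun_map ^^ n) x))"


section \<open>S-adic shifts\<close>

definition subst_word :: "substitution \<Rightarrow> 3 list \<Rightarrow> 3 list" where
  "subst_word s w = concat (map s w)"

text \<open>Meaningful for non-erasing substitutions, such as the Brun substitutions.\<close>

definition subst_stream :: "substitution \<Rightarrow> 3 stream \<Rightarrow> 3 stream" where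
  "subst_stream s \<omega> = flat (smap s \<omega>)"

primrec subst_upto :: "(nat \<Rightarrow> substitution) \<Rightarrow> nat \<Rightarrow> 3 list \<Rightarrow> 3 list" where
  "subst_upto \<sigma> 0 = id"
| "subst_upto \<sigma> (Suc n) = subst_upto \<sigma> n \<circ> subst_word (\<sigma> n)"

definition incidence_matrix :: "substitution \<Rightarrow> real^3^3" where
  "incidence_matrix s = (\<chi> i j. real (count_list (s j) i))"

primrec incidence_upto :: "(nat \<Rightarrow> substitution) \<Rightarrow> nat \<Rightarrow> real^3^3" where
  "incidence_upto \<sigma> 0 = mat 1"
| "incidence_upto \<sigma> (Suc n) = incidence_upto \<sigma> n ** incidence_matrix (\<sigma> n)"

definition sadic_language :: "(nat \<Rightarrow> substitution) \<Rightarrow> 3 list set" where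
  "sadic_language \<sigma> = {w. \<exists>i n. sublist w (subst_upto \<sigma> n [i])}"

definition sadic_shift :: "(nat \<Rightarrow> substitution) \<Rightarrow> 3 stream set" where
  "sadic_shift \<sigma> = {\<omega>. \<forall>m n. stake n (sdrop m \<omega>) \<in> sadic_language \<sigma>}"

definition balanced_language :: "3 list set \<Rightarrow> bool" where
  "balanced_language L \<longleftrightarrow>
     (\<exists>C::int. \<forall>u\<in>L. \<forall>v\<in>L. length u = length v \<longrightarrow>
        (\<forall>j. \<bar>int (count_list u j) - int (count_list v j)\<bar> \<le> C))"


section \<open>Invariant measures and measurable conjugacy\<close>

definition shift_invariant_prob :: "3 stream set \<Rightarrow> 3 stream measure \<Rightarrow> bool" where
  "shift_invariant_prob X \<mu> \<longleftrightarrow>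
     sets \<mu> = sets (restrict_space (stream_space (count_space UNIV)) X) \<and>
     prob_space \<mu> \<and> stl \<in> \<mu> \<rightarrow>\<^sub>M \<mu> \<and> distr \<mu> \<mu> stl = \<mu>"

definition measurably_conjugate ::
  "'a measure \<Rightarrow> ('a \<Rightarrow> 'a) \<Rightarrow> 'b measure \<Rightarrow> ('b \<Rightarrow> 'b) \<Rightarrow> bool" where
  "measurably_conjugate M T N S \<longleftrightarrow>
     (\<exists>X\<^sub>0 \<in> sets M. \<exists>Y\<^sub>0 \<in> sets N. \<exists>\<phi>.
        (AE x in M. x \<in> X\<^sub>0) \<and> (AE y in N. y \<in> Y\<^sub>0) \<and>
        T ` X\<^sub>0 \<subseteq> X\<^sub>0 \<and> S ` Y\<^sub>0 \<subseteq> Y\<^sub>0 \<and>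
        bij_betw \<phi> X\<^sub>0 Y\<^sub>0 \<and>
        \<phi> \<in> restrict_space M X\<^sub>0 \<rightarrow>\<^sub>M restrict_space N Y\<^sub>0 \<and>
        the_inv_into X\<^sub>0 \<phi> \<in> restrict_space N Y\<^sub>0 \<rightarrow>\<^sub>M restrict_space M X\<^sub>0 \<and>
        distr (restrict_space M X\<^sub>0) (restrict_space N Y\<^sub>0) \<phi> = restrict_space N Y\<^sub>0 \<and>
        (\<forall>x\<in>X\<^sub>0. \<phi> (T x) = S (\<phi> x)))"


section \<open>The two-dimensional torus\<close>

text \<open>The torus is modelled on the representatives \<open>[0,1)\<^sup>2\<close> of the cosets of \<open>\<int>\<^sup>2\<close>.\<close>

definition torus2 :: "(real \<times> real) measure" where
  "torus2 = restrict_space lborel ({0..<1} \<times> {0..<1})"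

definition torus2_translation :: "real \<times> real \<Rightarrow> real \<times> real \<Rightarrow> real \<times> real" where
  "torus2_translation t x = (frac (fst x + fst t), frac (snd x + snd t))"

definition bounded_remainder_set :: "'a measure \<Rightarrow> ('a \<Rightarrow> 'a) \<Rightarrow> 'a set \<Rightarrow> bool" where
  "bounded_remainder_set M T B \<longleftrightarrow> B \<in> sets M \<and>
     (\<exists>C'>0. AE x in M. \<forall>N::nat.
        \<bar>real (card {n. n < N \<and> (T ^^ n) x \<in> B}) - real N * (measure M B / measure M (space M))\<bar>
          < C')"


section \<open>Natural codings\<close>

text \<open>
  Exactly one representative is required only for almost every coset of the lattice \<open>\<Lambda>\<close>, so that
  closed tiles overlapping in their boundaries are allowed.
\<close>

definition fundamental_domain :: "'a::euclidean_space set \<Rightarrow> 'a set \<Rightarrow> bool" where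
  "fundamental_domain \<Lambda> R \<longleftrightarrow>
     R \<in> sets lebesgue \<and> bounded R \<and> (AE x in lebesgue. \<exists>!v. v \<in> \<Lambda> \<and> x + v \<in> R)"

definition induced_translation :: "'a::euclidean_space set \<Rightarrow> 'a \<Rightarrow> 'a set \<Rightarrow> 'a \<Rightarrow> 'a" where
  "induced_translation \<Lambda> t R x = (THE y. y \<in> R \<and> y - (x + t) \<in> \<Lambda>)"

text \<open>
  The fundamental domain is bounded and the pieces \<open>P i\<close> have negligible boundary.  For arbitrary
  measurable pieces the notion of a coding of an individual point would be void, since everything
  else is insensitive to null sets.
\<close>

definition natural_partition ::
  "'a::euclidean_space set \<Rightarrow> 'a \<Rightarrow> 'a set \<Rightarrow> ('i::finite \<Rightarrow> 'a set) \<Rightarrow> ('i \<Rightarrow> 'a) \<Rightarrow> bool" where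
  "natural_partition \<Lambda> t R P \<tau> \<longleftrightarrow>
     fundamental_domain \<Lambda> R \<and>
     (\<forall>i. P i \<in> sets lebesgue \<and> negligible (frontier (P i))) \<and>
     R = (\<Union>i. P i) \<and>
     (\<forall>i j. i \<noteq> j \<longrightarrow> negligible (P i \<inter> P j)) \<and>
     (\<forall>i. AE x in lebesgue. x \<in> P i \<longrightarrow> induced_translation \<Lambda> t R x = x + \<tau> i)"

text \<open>
  \<open>\<omega>\<close> is a coding of the point \<open>x\<close>.  The induced map and the partition are only determined up to
  null sets, whereas \<open>x\<close> may lie on the boundary of a piece.  Hence the orbit of \<open>x\<close> is followed
  with the translations prescribed by \<open>\<omega>\<close>, and in addition every initial block of \<open>\<omega>\<close> has to be
  the coding under the induced map of a non-null set of points arbitrarily close to \<open>x\<close>.  For a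
  point whose orbit stays in the interiors of the pieces and avoids the exceptional null set this
  just says that its \<open>n\<close>th iterate lies in \<open>P (\<omega> !! n)\<close>.
\<close>

definition codes_point ::
  "'a::euclidean_space set \<Rightarrow> 'a \<Rightarrow> 'a set \<Rightarrow> ('i::finite \<Rightarrow> 'a set) \<Rightarrow> ('i \<Rightarrow> 'a) \<Rightarrow>
   'i stream \<Rightarrow> 'a \<Rightarrow> bool" where
  "codes_point \<Lambda> t R P \<tau> \<omega> x \<longleftrightarrow>
     (\<forall>n. x + (\<Sum>k<n. \<tau> (\<omega> !! k)) \<in> P (\<omega> !! n)) \<and>
     (\<forall>n. \<forall>e>0. \<not> negligible
        {y \<in> ball x e. \<forall>k<n. (induced_translation \<Lambda> t R ^^ k) y \<in> P (\<omega> !! k)})"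

definition natural_coding ::
  "'a::euclidean_space set \<Rightarrow> 'a \<Rightarrow> 'a set \<Rightarrow> ('i::finite \<Rightarrow> 'a set) \<Rightarrow> ('i \<Rightarrow> 'a) \<Rightarrow>
   'i stream \<Rightarrow> bool" where
  "natural_coding \<Lambda> t R P \<tau> \<omega> \<longleftrightarrow>
     natural_partition \<Lambda> t R P \<tau> \<and> (\<exists>x\<in>R. codes_point \<Lambda> t R P \<tau> \<omega> x)"


section \<open>Rauzy fractals\<close>

definition limit_word :: "(nat \<Rightarrow> substitution) \<Rightarrow> 3 stream \<Rightarrow> bool" where
  "limit_word \<sigma> \<omega> \<longleftrightarrow>
     (\<exists>W. W 0 = \<omega> \<and> (\<forall>n. W n = subst_stream (\<sigma> n) (W (Suc n))))"

definition nonneg_cone :: "(real^3) set" where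
  "nonneg_cone = {v. \<forall>i. 0 \<le> v $ i}"

definition generalized_right_eigenvector :: "(nat \<Rightarrow> substitution) \<Rightarrow> real^3 \<Rightarrow> bool" where
  "generalized_right_eigenvector \<sigma> u \<longleftrightarrow>
     (\<forall>i. 0 < u $ i) \<and> u $ 1 + u $ 2 + u $ 3 = 1 \<and>
     (\<Inter>n. (\<lambda>v. incidence_upto \<sigma> n *v v) ` nonneg_cone) = {c *\<^sub>R u | c. 0 \<le> c}"

definition abelianization :: "3 list \<Rightarrow> real^3" where
  "abelianization w = (\<chi> i. real (count_list w i))"

text \<open>The projection along \<open>u\<close> onto the orthogonal complement of the all-ones vector \<open>1\<close>.\<close>

definition proj_along :: "real^3 \<Rightarrow> real^3 \<Rightarrow> real^3" where
  "proj_along u v = v - ((v \<bullet> 1) / (u \<bullet> 1)) *\<^sub>R u"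

definition rauzy_subpiece :: "(nat \<Rightarrow> substitution) \<Rightarrow> real^3 \<Rightarrow> 3 \<Rightarrow> (real^3) set" where
  "rauzy_subpiece \<sigma> u i =
     closure {proj_along u (abelianization p) | p.
       \<exists>\<omega>. limit_word \<sigma> \<omega> \<and> stake (Suc (length p)) \<omega> = p @ [i]}"

text \<open>
  Image in the torus of a subset of the orthogonal complement of the all-ones vector, by means of
  the lattice basis \<open>e\<^sub>3 - e\<^sub>1\<close>, \<open>e\<^sub>3 - e\<^sub>2\<close>.
\<close>

definition torus2_image :: "(real^3) set \<Rightarrow> (real \<times> real) set" where
  "torus2_image A = {(a, b). a \<in> {0..<1} \<and> b \<in> {0..<1} \<and>
     (\<exists>m n :: int. (a + of_int m) *\<^sub>R (axis 3 1 - axis 1 1) +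
                   (b + of_int n) *\<^sub>R (axis 3 1 - axis 2 1) \<in> A)}"

end

theory Submission
  imports Defs
begin

text \<open>
  Put \<open>t = (u\<^sub>1, u\<^sub>2)\<close> for the frequency vector \<open>u\<close> of \<open>x\<close>.  In the basis \<open>e\<^sub>3 - e\<^sub>1, e\<^sub>3 - e\<^sub>2\<close> the
  projection of a prefix of a limit word is a sum of the vectors \<open>err0 x j = t - (\<delta>\<^sub>j\<^sub>1, \<delta>\<^sub>j\<^sub>2)\<close>, all of
  which are congruent to \<open>t\<close>.  Six consecutive indices 3 contract these discrepancies by \<open>5/6\<close>, and for
  almost all \<open>x\<close> the total discrepancy is finite and, infinitely often, uniformly bounded after a
  long run of indices 3; this follows by integrating over the cylinders of an acceleration whose
  densities stay in a cone with bounded distortion, without an ergodic theorem.  The translates of the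
  subpieces by \<open>\<int>\<^sup>2\<close> cover the plane by density of the orbit of \<open>t\<close>.  They overlap in a null set: the
  pure word \<open>\<beta>\<^sub>3\<^sup>N\<close> obeys a finiteness property (a shift radix system attached to \<open>p\<^sup>3 + p = 1\<close>), so that
  every tile contains a subtile of fixed proportion that meets no other tile, and the overlap loses a
  fixed proportion of its measure at infinitely many levels.  Hence the fractal is a fundamental
  domain on which the shift acts as the translation by \<open>t\<close>.  A word determines its point, since
  otherwise an orbit could be pushed out of the fractal in an extremal direction; and the translation
  is uniquely ergodic, which transports all statements between the shift and the torus.
\<close>

text \<open>The overlap argument needs a subtile all of whose neighbours have the same ancestor.
  Planar positions alone are dense, so they offer no finite list of neighbours. A tile therefore
  also carries a height, counted in letters; positions then form a copy of Z^3, and only tiles whose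
  height interval contains 0 count. Two such tiles sharing a point have relative coordinates in a
  box whose size depends only on the discrepancy bound B of that level. The run of index 3 that
  brings the whole box under one ancestor has a length N depending on B, while B has to hold for the
  orbit after this run. Recurrence is therefore needed with N an arbitrary function of B. This is
  possible because the estimate of the exceptional set is uniform in N: whatever the first blocks
  are, the future is distributed like Lebesgue measure up to a factor 64. Runs of index 1 have
  unbounded length and need not contract, so they must cost nothing; this is why discrepancies are
  summed over the other indices only and why densities are studied for the acceleration.\<close>

section \<open>A shift radix system\<close>

text \<open>The reciprocal of the dominant eigenvalue of the incidence matrix of \<open>\<beta>\<^sub>3\<close>.\<close>

definition rootp :: real where
  "rootp = (SOME p. 0.6823 < p \<and> p < 0.6824 \<and> p ^ 3 + p = 1)"

lemma rootp: "0.6823 < rootp" "rootp < 0.6824" "rootp ^ 3 + rootp = 1"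
proof -
  have "\<exists>p\<ge>0.6823. p \<le> 0.6824 \<and> p ^ 3 + p = (1::real)"
    by (rule IVT') (auto intro!: continuous_intros simp: power3_eq_cube)
  then obtain p :: real where p: "p \<ge> 0.6823" "p \<le> 0.6824" "p ^ 3 + p = 1" by blast
  have "(0.6823::real) ^ 3 + 0.6823 \<noteq> 1" "(0.6824::real) ^ 3 + 0.6824 \<noteq> 1"
    by (simp_all add: power3_eq_cube)
  then have "p \<noteq> 0.6823" "p \<noteq> 0.6824" using p(3) by blast+
  with p have "\<exists>p. 0.6823 < p \<and> p < 0.6824 \<and> p ^ 3 + p = (1::real)"
    by (intro exI[of _ p]) auto
  from someI_ex[OF this] show "0.6823 < rootp" "rootp < 0.6824" "rootp ^ 3 + rootp = 1"
    unfolding rootp_def by blast+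
qed

lemma rootp_sq: "0.4655 < rootp ^ 2" "rootp ^ 2 < 0.4657"
proof -
  have "0.6823 ^ 2 < rootp ^ 2" "rootp ^ 2 < 0.6824 ^ 2"
    using rootp by (auto intro!: power_strict_mono)
  then show "0.4655 < rootp ^ 2" "rootp ^ 2 < 0.4657" by (auto simp: power2_eq_square)
qed

definition srs_form :: "int \<times> int \<Rightarrow> real" where
  "srs_form v = real_of_int (fst v) * rootp + real_of_int (snd v) * rootp ^ 2"

text \<open>Shift radix system with parameter (\<open>rootp\<close>, \<open>rootp ^ 2\<close>). It
  is what \<open>greedy3\<close> becomes when a vector of height in [0, 1) is reduced to two
  consecutive coordinates.\<close>

definition srs :: "int \<times> int \<Rightarrow> int \<times> int" where
  "srs v = (snd v, - \<lfloor>srs_form v\<rfloor>)"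

text \<open>Contains the unit vectors and their negatives and is closed under rounding the form up as well as down.\<close>

definition srs_witnesses :: "(int \<times> int) set" where
  "srs_witnesses = {(-2, 0), (-2, 1), (-1, -1), (-1, 0), (-1, 1), (-1, 2), (0, -2), (0, -1),
     (0, 0), (0, 1), (0, 2), (1, -2), (1, -1), (1, 0), (1, 1), (2, -1), (2, 0)}"

lemma srs_form_floor_ceiling:
  "\<lfloor>srs_form (-2, 0)\<rfloor> = -2" "\<lceil>srs_form (-2, 0)\<rceil> = -1"
  "\<lfloor>srs_form (-2, 1)\<rfloor> = -1" "\<lceil>srs_form (-2, 1)\<rceil> = 0"
  "\<lfloor>srs_form (-1, -1)\<rfloor> = -2" "\<lceil>srs_form (-1, -1)\<rceil> = -1"
  "\<lfloor>srs_form (-1, 0)\<rfloor> = -1" "\<lceil>srs_form (-1, 0)\<rceil> = 0"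
  "\<lfloor>srs_form (-1, 1)\<rfloor> = -1" "\<lceil>srs_form (-1, 1)\<rceil> = 0"
  "\<lfloor>srs_form (-1, 2)\<rfloor> = 0" "\<lceil>srs_form (-1, 2)\<rceil> = 1"
  "\<lfloor>srs_form (0, -2)\<rfloor> = -1" "\<lceil>srs_form (0, -2)\<rceil> = 0"
  "\<lfloor>srs_form (0, -1)\<rfloor> = -1" "\<lceil>srs_form (0, -1)\<rceil> = 0"
  "\<lfloor>srs_form (0, 0)\<rfloor> = 0" "\<lceil>srs_form (0, 0)\<rceil> = 0"
  "\<lfloor>srs_form (0, 1)\<rfloor> = 0" "\<lceil>srs_form (0, 1)\<rceil> = 1"
  "\<lfloor>srs_form (0, 2)\<rfloor> = 0" "\<lceil>srs_form (0, 2)\<rceil> = 1"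
  "\<lfloor>srs_form (1, -2)\<rfloor> = -1" "\<lceil>srs_form (1, -2)\<rceil> = 0"
  "\<lfloor>srs_form (1, -1)\<rfloor> = 0" "\<lceil>srs_form (1, -1)\<rceil> = 1"
  "\<lfloor>srs_form (1, 0)\<rfloor> = 0" "\<lceil>srs_form (1, 0)\<rceil> = 1"
  "\<lfloor>srs_form (1, 1)\<rfloor> = 1" "\<lceil>srs_form (1, 1)\<rceil> = 2"
  "\<lfloor>srs_form (2, -1)\<rfloor> = 0" "\<lceil>srs_form (2, -1)\<rceil> = 1"
  "\<lfloor>srs_form (2, 0)\<rfloor> = 1" "\<lceil>srs_form (2, 0)\<rceil> = 2"
  using rootp(1,2) rootp_sq unfolding srs_form_def
  by (simp_all add: floor_eq_iff ceiling_eq_iff)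

lemma srs_on_witnesses:
  "srs (-2, 0) = (0, 2)" "srs (-2, 1) = (1, 1)" "srs (-1, -1) = (-1, 2)"
  "srs (-1, 0) = (0, 1)" "srs (-1, 1) = (1, 1)" "srs (-1, 2) = (2, 0)"
  "srs (0, -2) = (-2, 1)" "srs (0, -1) = (-1, 1)" "srs (0, 0) = (0, 0)"
  "srs (0, 1) = (1, 0)" "srs (0, 2) = (2, 0)" "srs (1, -2) = (-2, 1)"
  "srs (1, -1) = (-1, 0)" "srs (1, 0) = (0, 0)" "srs (1, 1) = (1, -1)"
  "srs (2, -1) = (-1, 0)" "srs (2, 0) = (0, -1)"
  by (simp_all add: srs_def srs_form_floor_ceiling)

lemma srs_witnesses_closed:
  assumes "v \<in> srs_witnesses"
  shows "(snd v, - \<lfloor>srs_form v\<rfloor>) \<in> srs_witnesses" "(snd v, - \<lceil>srs_form v\<rceil>) \<in> srs_witnesses"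
proof -
  have "\<forall>v\<in>srs_witnesses. (snd v, - \<lfloor>srs_form v\<rfloor>) \<in> srs_witnesses \<and> (snd v, - \<lceil>srs_form v\<rceil>) \<in> srs_witnesses"
    unfolding srs_witnesses_def by (simp add: srs_form_floor_ceiling)
  with assms show "(snd v, - \<lfloor>srs_form v\<rfloor>) \<in> srs_witnesses" "(snd v, - \<lceil>srs_form v\<rceil>) \<in> srs_witnesses"
    by blast+
qed

text \<open>The only cycle among the witnesses is the fixed point (0, 0). The exponent 10 is the
  length of the longest path to it, starting for instance at (-2, 0).\<close>

lemma srs_witnesses_vanish:
  assumes "v \<in> srs_witnesses"
  shows "(srs ^^ 10) v = (0, 0)"
proof -
  have "\<forall>v\<in>srs_witnesses. (srs ^^ 10) v = (0, 0)"
    unfolding srs_witnesses_def by (simp add: srs_on_witnesses eval_nat_numeral)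
  with assms show ?thesis by blast
qed

text \<open>A floor is additive up to replacing the second floor by a ceiling, and the witnesses are
  closed under both roundings. Hence the difference of two orbits never leaves them.\<close>

lemma srs_add:
  assumes "v \<in> srs_witnesses"
  shows "srs (p + v) - srs p \<in> srs_witnesses"
proof -
  have add: "srs_form (p + v) = srs_form p + srs_form v"
    by (simp add: srs_form_def algebra_simps)
  have "\<lfloor>srs_form p + srs_form v\<rfloor> = \<lfloor>srs_form p\<rfloor> + \<lfloor>srs_form v\<rfloor> \<or>
        \<lfloor>srs_form p + srs_form v\<rfloor> = \<lfloor>srs_form p\<rfloor> + \<lceil>srs_form v\<rceil>"
    by linarith
  then have "srs (p + v) - srs p \<in> {(snd v, - \<lfloor>srs_form v\<rfloor>), (snd v, - \<lceil>srs_form v\<rceil>)}"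
    by (auto simp: srs_def add minus_prod_def)
  then show ?thesis using srs_witnesses_closed[OF assms] by auto
qed

lemma srs_vanish_add:
  assumes "(srs ^^ k) p = (0, 0)" "v \<in> srs_witnesses"
  shows "\<exists>k. (srs ^^ k) (p + v) = (0, 0)"
proof -
  have "(srs ^^ j) (p + v) - (srs ^^ j) p \<in> srs_witnesses" for j
  proof (induction j)
    case (Suc j)
    show ?case using srs_add[OF Suc, of "(srs ^^ j) p"] by simp
  qed (use assms in simp)
  from this[of k] have "(srs ^^ k) (p + v) \<in> srs_witnesses" using assms by (simp add: zero_prod_def[symmetric])
  then have "(srs ^^ (10 + k)) (p + v) = (0, 0)"
    by (simp add: srs_witnesses_vanish funpow_add del: funpow.simps)
  then show ?thesis by blast
qed

text \<open>Brunotte's argument: finiteness of the orbits spreads from the witnesses to all of the lattice.\<close>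

lemma srs_vanish: "\<exists>k. (srs ^^ k) (a, b) = (0, 0)"
proof -
  have V: "(1, 0) \<in> srs_witnesses" "(-1, 0) \<in> srs_witnesses"
          "(0, 1) \<in> srs_witnesses" "(0, -1) \<in> srs_witnesses"
    by (auto simp: srs_witnesses_def)
  have 1: "\<exists>k. (srs ^^ k) (a, 0) = (0, 0)" for a
  proof (induction a rule: int_induct[where k = 0])
    case base
    have "(srs ^^ 0) (0, 0) = (0, 0)" by simp
    then show ?case by blast
  next
    case (step1 i)
    then obtain k where "(srs ^^ k) (i, 0) = (0, 0)" by blast
    from srs_vanish_add[OF this V(1)] show ?case by simp
  next
    case (step2 i)
    then obtain k where "(srs ^^ k) (i, 0) = (0, 0)" by blast
    from srs_vanish_add[OF this V(2)] show ?case by simp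
  qed
  show ?thesis
  proof (induction b rule: int_induct[where k = 0])
    case base
    then show ?case by (rule 1)
  next
    case (step1 i)
    then obtain k where "(srs ^^ k) (a, i) = (0, 0)" by blast
    from srs_vanish_add[OF this V(3)] show ?case by simp
  next
    case (step2 i)
    then obtain k where "(srs ^^ k) (a, i) = (0, 0)" by blast
    from srs_vanish_add[OF this V(4)] show ?case by simp
  qed
qed

section \<open>Integer vectors under the incidence matrix of \<open>brun_subst 3\<close>\<close>

type_synonym int3 = "int \<times> int \<times> int"

text \<open>Incidence matrix of \<open>brun_subst 3\<close>, acting on the coefficients of a
  combination of letters; \<open>M3i\<close> is its inverse.\<close>

definition M3 :: "int3 \<Rightarrow> int3" where
  "M3 z = (case z of (a, b, c) \<Rightarrow> (b, c, a + c))"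

definition M3i :: "int3 \<Rightarrow> int3" where
  "M3i z = (case z of (a, b, c) \<Rightarrow> (c - b, a, b))"

text \<open>Left eigenvector (\<open>rootp\<close>, \<open>rootp ^ 2\<close>, 1) of
  \<open>M3\<close> for the dominant eigenvalue 1 / \<open>rootp\<close>: up to scale, the height of
  a vector in the limit of long runs of index 3.\<close>

definition ht3 :: "int3 \<Rightarrow> real" where
  "ht3 z = (case z of (a, b, c) \<Rightarrow> a * rootp + b * rootp ^ 2 + c)"

text \<open>The beta-transformation of base 1 / \<open>rootp\<close> on heights in [0, 1). As
  \<open>M3\<close> divides heights by \<open>rootp\<close>, one letter 3 has to be removed exactly
  when the old height is at least \<open>rootp\<close>.\<close>

definition greedy3 :: "int3 \<Rightarrow> int3" where
  "greedy3 z = (if ht3 z < rootp then M3 z else M3 z - (0, 0, 1))"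

lemma M3_M3i [simp]: "M3 (M3i z) = z" "M3i (M3 z) = z"
  by (auto simp: M3_def M3i_def split: prod.splits)

lemma M3_add: "M3 (y + z) = M3 y + M3 z" and M3_diff: "M3 (y - z) = M3 y - M3 z"
  by (auto simp: M3_def split: prod.splits)

lemma M3_pow_zero [simp]: "(M3 ^^ n) 0 = 0"
  by (induction n) (auto simp: M3_def zero_prod_def)

lemma ht3_add: "ht3 (y + z) = ht3 y + ht3 z" and ht3_diff: "ht3 (y - z) = ht3 y - ht3 z"
  and ht3_zero [simp]: "ht3 0 = 0" and ht3_minus: "ht3 (- z) = - ht3 z"
  by (auto simp: ht3_def algebra_simps zero_prod_def split: prod.splits)

lemma ht3_M3: "ht3 (M3 z) * rootp = ht3 z"
proof -
  obtain a b c where z: "z = (a, b, c)" by (cases z)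
  have "ht3 (M3 z) * rootp = b * rootp ^ 2 + a * rootp + c * (rootp ^ 3 + rootp)"
    by (simp add: z ht3_def M3_def algebra_simps power2_eq_square power3_eq_cube)
  then show ?thesis by (simp add: rootp z ht3_def)
qed

lemma ht3_M3i: "ht3 (M3i z) = ht3 z * rootp"
  using ht3_M3[of "M3i z"] by simp

lemma greedy3_range:
  assumes "0 \<le> ht3 z" "ht3 z < 1"
  shows "0 \<le> ht3 (greedy3 z)" "ht3 (greedy3 z) < 1"
proof -
  have e: "ht3 (M3 z) = ht3 z / rootp" using ht3_M3[of z] rootp by (simp add: field_simps)
  have e3: "ht3 (0,0,1) = 1" by (simp add: ht3_def)
  have "1 / rootp < 2" using rootp by (simp add: field_simps)
  moreover have "ht3 z / rootp \<le> 1 / rootp" using assms rootp by (simp add: divide_right_mono)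
  ultimately show "0 \<le> ht3 (greedy3 z)" "ht3 (greedy3 z) < 1" 
    using assms rootp by (auto simp: greedy3_def ht3_diff e e3 field_simps)
qed

text \<open>For given a and b only one integer c puts the height into [0, 1), namely minus the floor
  of \<open>srs_form\<close>; two coordinates therefore carry the whole dynamics.\<close>

lemma greedy3_srs:
  assumes "0 \<le> ht3 (a, b, c)" "ht3 (a, b, c) < 1"
  shows "greedy3 (a, b, c) = (b, c, snd (srs (b, c)))" "c = snd (srs (a, b))"
proof -
  have *: "c = snd (srs (a, b))" if "0 \<le> ht3 (a, b, c)" "ht3 (a, b, c) < 1" for a b c
  proof -
    have "\<lfloor>srs_form (a, b)\<rfloor> = - c"
      using that unfolding floor_eq_iff by (auto simp: srs_form_def ht3_def)
    then show ?thesis by (simp add: srs_def)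
  qed
  show "c = snd (srs (a, b))" using * assms by blast
  have "fst (greedy3 (a, b, c)) = b" "fst (snd (greedy3 (a, b, c))) = c"
    by (auto simp: greedy3_def M3_def)
  then obtain c' where "greedy3 (a, b, c) = (b, c, c')" by (metis prod.collapse)
  with * greedy3_range[OF assms] show "greedy3 (a, b, c) = (b, c, snd (srs (b, c)))" by auto
qed

text \<open>The finiteness property of the base 1 / \<open>rootp\<close>: greedy expansions of
  integer vectors terminate.\<close>

lemma greedy3_vanish:
  assumes "0 \<le> ht3 z" "ht3 z < 1"
  shows "\<exists>k. (greedy3 ^^ k) z = 0"
proof -
  obtain a b c where z: "z = (a, b, c)" by (cases z)
  obtain k where k: "(srs ^^ k) (a, b) = (0, 0)" using srs_vanish by blast
  have r: "0 \<le> ht3 ((greedy3 ^^ j) z) \<and> ht3 ((greedy3 ^^ j) z) < 1" for j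
    by (induction j) (use assms greedy3_range in auto)
  have "(greedy3 ^^ j) z = (fst ((srs ^^ j) (a, b)), snd ((srs ^^ j) (a, b)), snd ((srs ^^ Suc j) (a, b)))" for j
  proof (induction j)
    case 0
    then show ?case using greedy3_srs(2) assms by (auto simp: z)
  next
    case (Suc j)
    show ?case using r[of j] greedy3_srs[of "fst ((srs ^^ j) (a, b))" "snd ((srs ^^ j) (a, b))" "snd ((srs ^^ Suc j) (a, b))"]
      by (simp add: Suc) (simp add: srs_def)
  qed
  from this[of k] k have "(greedy3 ^^ k) z = 0"
    by (simp add: zero_prod_def srs_def srs_form_def)
  then show ?thesis by blast
qed

definition pos3 :: "int3 \<Rightarrow> bool" where
  "pos3 z \<longleftrightarrow> 1 \<le> fst z \<and> 1 \<le> fst (snd z) \<and> 1 \<le> snd (snd z)"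

definition nonneg3 :: "int3 \<Rightarrow> bool" where
  "nonneg3 z \<longleftrightarrow> 0 \<le> fst z \<and> 0 \<le> fst (snd z) \<and> 0 \<le> snd (snd z)"

lemma M3_pow_nonneg3: "nonneg3 z \<Longrightarrow> nonneg3 ((M3 ^^ n) z)"
  by (induction n) (auto simp: nonneg3_def M3_def split: prod.splits)

lemma M3_pos3: "pos3 z \<Longrightarrow> pos3 ((M3 ^^ n) z)"
  by (induction n) (auto simp: pos3_def M3_def split: prod.splits)

text \<open>Primitivity of the matrix; the second unit vector is the one that needs all four
  steps.\<close>

lemma M3_eventually_pos3:
  assumes "nonneg3 z" "z \<noteq> 0"
  shows "pos3 ((M3 ^^ 4) z)"
  using assms by (cases z) (auto simp: nonneg3_def pos3_def M3_def zero_prod_def eval_nat_numeral)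

lemma greedy3_M3_nonneg:
  "\<exists>y. nonneg3 y \<and> (M3 ^^ k) z = (greedy3 ^^ k) z + y"
proof (induction k)
  case 0
  have "nonneg3 0" by (simp add: nonneg3_def)
  then show ?case by (intro exI[of _ 0]) simp
next
  case (Suc k)
  then obtain y where y: "nonneg3 y" "(M3 ^^ k) z = (greedy3 ^^ k) z + y" by blast
  define d :: int3 where "d = (if ht3 ((greedy3 ^^ k) z) < rootp then 0 else (0,0,1))"
  have "greedy3 ((greedy3 ^^ k) z) = M3 ((greedy3 ^^ k) z) - d"
    by (simp add: greedy3_def d_def)
  then have "(M3 ^^ Suc k) z = (greedy3 ^^ Suc k) z + (M3 y + d)"
    by (simp add: y M3_add)
  moreover have "nonneg3 (M3 y + d)" 
    using M3_pow_nonneg3[of y 1] y by (auto simp: nonneg3_def d_def)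
  ultimately show ?case by blast
qed

lemma ht3_pow_M3i: "ht3 ((M3i ^^ n) z) = ht3 z * rootp ^ n"
  by (induction n) (auto simp: ht3_M3i)

lemma M3_pow_M3i_pow: "(M3 ^^ n) ((M3i ^^ n) z) = z"
  by (induction n) (auto simp: funpow_swap1[of M3])

text \<open>\<open>M3i ^^ n\<close> lowers the height below 1, where the greedy orbit ends at 0.
  What the greedy map has removed on the way is nonnegative and equals the image under a power of
  \<open>M3\<close>; applying \<open>M3 ^^ n\<close> afterwards preserves signs.\<close>

lemma M3_pow_nonneg3_of_ht3:
  assumes "0 \<le> ht3 z"
  shows "\<exists>k. nonneg3 ((M3 ^^ k) z)"
proof -
  have "(\<lambda>n. rootp ^ n) \<longlonglongrightarrow> 0" using rootp by (intro LIMSEQ_power_zero) auto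
  then have "(\<lambda>n. ht3 z * rootp ^ n) \<longlonglongrightarrow> 0" by (rule tendsto_mult_right_zero)
  then have "eventually (\<lambda>n. ht3 z * rootp ^ n < 1) sequentially" by (rule order_tendstoD) simp
  then obtain n where n: "ht3 z * rootp ^ n < 1" by (auto simp: eventually_sequentially)
  define y where "y = (M3i ^^ n) z"
  have y: "0 \<le> ht3 y" "ht3 y < 1" using n assms rootp by (auto simp: y_def ht3_pow_M3i)
  then obtain k where "(greedy3 ^^ k) y = 0" using greedy3_vanish by blast
  then have "nonneg3 ((M3 ^^ k) y)" using greedy3_M3_nonneg[of k y] by auto
  then have "nonneg3 ((M3 ^^ n) ((M3 ^^ k) y))" by (rule M3_pow_nonneg3)
  also have "(M3 ^^ n) ((M3 ^^ k) y) = (M3 ^^ k) z"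
    by (metis M3_pow_M3i_pow add.commute comp_apply funpow_add y_def)
  finally show ?thesis by blast
qed

lemma M3_pow_inj: "(M3 ^^ n) z = 0 \<Longrightarrow> z = 0"
proof (induction n)
  case (Suc n)
  then have "M3i (M3 ((M3 ^^ n) z)) = M3i 0" by simp
  also have "M3i 0 = 0" by (simp add: M3i_def zero_prod_def)
  finally show ?case using Suc by simp
qed simp

text \<open>Linear independence of 1, \<open>rootp\<close>, \<open>rootp ^ 2\<close> over the
  rationals: a nonzero vector of height 0 would become positive under powers of \<open>M3\<close>,
  while its height stays 0.\<close>

lemma ht3_eq_0: "ht3 z = 0 \<Longrightarrow> z = 0"
proof (rule ccontr)
  assume h: "ht3 z = 0" and z: "z \<noteq> 0"
  obtain k where k: "nonneg3 ((M3 ^^ k) z)" using M3_pow_nonneg3_of_ht3[of z] h by auto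
  then have "pos3 ((M3 ^^ 4) ((M3 ^^ k) z))" using z M3_pow_inj by (intro M3_eventually_pos3) blast+
  moreover have "ht3 ((M3 ^^ n) z) = 0" for n
  proof (induction n)
    case (Suc n)
    have "rootp \<noteq> 0" using rootp(1) by auto
    then show ?case using Suc ht3_M3[of "(M3 ^^ n) z"] by simp
  qed (use h in simp)
  then have "ht3 ((M3 ^^ (4 + k)) z) = 0" by blast
  ultimately have y: "pos3 ((M3 ^^ (4 + k)) z)" "ht3 ((M3 ^^ (4 + k)) z) = 0"
    by (simp_all add: funpow_add del: funpow.simps)
  obtain a b c where abc: "(M3 ^^ (4 + k)) z = (a, b, c)" by (cases "(M3 ^^ (4 + k)) z")
  have "0 < rootp * a" "0 < rootp ^ 2 * b" "0 < real_of_int c"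
    using y(1) rootp(1) unfolding abc pos3_def by (auto intro!: mult_pos_pos)
  then show False using y(2) unfolding abc ht3_def by (simp add: mult.commute)
qed

lemma ht3_pos_eventually:
  assumes "0 < ht3 z"
  shows "\<exists>q. \<forall>n\<ge>q. pos3 ((M3 ^^ n) z)"
proof -
  obtain k where k: "nonneg3 ((M3 ^^ k) z)" using M3_pow_nonneg3_of_ht3[of z] assms by auto
  moreover have "z \<noteq> 0" using assms by auto
  ultimately have "pos3 ((M3 ^^ 4) ((M3 ^^ k) z))" using M3_pow_inj by (intro M3_eventually_pos3) blast+
  then have p: "pos3 ((M3 ^^ (4 + k)) z)" by (simp add: funpow_add)
  have "pos3 ((M3 ^^ n) z)" if "n \<ge> 4 + k" for n
    using M3_pos3[OF p, of "n - (4 + k)"] that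
    by (metis comp_apply funpow_add le_add_diff_inverse2)
  then show ?thesis by blast
qed

section \<open>The Brun algorithm and the discrepancies of letters\<close>

lemma brun_subst_simps [simp]:
  "brun_subst 1 1 = [1]" "brun_subst 1 2 = [2, 3]" "brun_subst 1 3 = [3]"
  "brun_subst 2 1 = [1]" "brun_subst 2 2 = [3]" "brun_subst 2 3 = [2, 3]"
  "brun_subst 3 1 = [3]" "brun_subst 3 2 = [1]" "brun_subst 3 3 = [2, 3]"
  by (simp_all add: brun_subst_def)

text \<open>Rational independence of 1 and the two coordinates. It holds almost everywhere, passes
  along orbits because the branches are unimodular, and keeps orbits off the boundaries of the
  cells.\<close>

definition generic :: "real \<times> real \<Rightarrow> bool" where
  "generic x \<longleftrightarrow> x \<in> Delta2 \<and>
     (\<forall>a b c :: int. real_of_int a * fst x + real_of_int b * snd x + real_of_int c = 0 \<longrightarrow> a = 0 \<and> b = 0 \<and> c = 0)"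

lemma genericD:
  assumes "generic x" "real_of_int a * fst x + real_of_int b * snd x + real_of_int c = 0"
  shows "a = 0" "b = 0" "c = 0"
  using assms unfolding generic_def by blast+

lemma generic_bounds:
  assumes "generic x"
  shows "0 < fst x" "fst x < snd x" "snd x < 1" "snd x \<noteq> 1/2" "fst x + snd x \<noteq> 1"
  using assms genericD[OF assms, of 1 0 0] genericD[OF assms, of 1 "-1" 0]
    genericD[OF assms, of 0 1 "-1"] genericD[OF assms, of 0 2 "-1"] genericD[OF assms, of 1 1 "-1"]
  unfolding generic_def Delta2_def by (force split: prod.splits)+

lemma closed_Delta2: "closed Delta2"
proof -
  have "Delta2 = {x. 0 \<le> fst x \<and> fst x \<le> snd x \<and> snd x \<le> (1::real)}"
    by (auto simp: Delta2_def)
  moreover have "closed \<dots>"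
    by (intro closed_Collect_conj closed_Collect_le continuous_intros)
  ultimately show ?thesis by simp
qed

lemma Delta2_sets [measurable]: "Delta2 \<in> sets borel"
  using closed_Delta2 by (rule borel_closed)

lemma Delta2_lebesgue: "Delta2 \<inter> space lebesgue \<in> sets lebesgue"
  by simp

lemma AE_generic: "AE x in lebesgue_on Delta2. generic x"
proof -
  define H where "H = (\<lambda>(a, b, c). {x :: real \<times> real. real_of_int a * fst x + real_of_int b * snd x + real_of_int c = 0})"
  have "negligible (H (a, b, c))" if "(a, b, c) \<noteq> 0" for a b c
  proof (cases "a = 0 \<and> b = 0")
    case True
    then show ?thesis using that by (auto simp: H_def zero_prod_def)
  next
    case False
    have "H (a, b, c) = {x. (real_of_int a, real_of_int b) \<bullet> x = - real_of_int c}"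
      by (auto simp: H_def inner_prod_def)
    then show ?thesis using False
      by (metis negligible_hyperplane of_int_0 of_int_eq_iff zero_prod_def Pair_inject)
  qed
  then have "negligible (\<Union>(H ` (UNIV - {0})))"
    by (intro negligible_countable_Union) (auto intro!: countable_image)
  then have "AE x in lebesgue. x \<notin> \<Union>(H ` (UNIV - {0}))"
    by (intro AE_not_in) (simp add: negligible_iff_null_sets)
  then show ?thesis
    unfolding AE_restrict_space_iff[OF Delta2_lebesgue]
    by eventually_elim (auto simp: generic_def H_def zero_prod_def)
qed

lemma brun_index_generic:
  assumes "generic x"
  shows "brun_index x = 1 \<longleftrightarrow> snd x < 1/2"
    "brun_index x = 2 \<longleftrightarrow> 1/2 < snd x \<and> fst x + snd x < 1"
    "brun_index x = 3 \<longleftrightarrow> 1 < fst x + snd x"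
  using generic_bounds[OF assms]
  by (auto simp: brun_index_def brun_cell_def Delta2_def split: prod.splits)

lemma brun_map_cases:
  assumes "generic x"
  obtains "brun_index x = 1" "snd x < 1/2" "brun_map x = (fst x / (1 - snd x), snd x / (1 - snd x))"
  | "brun_index x = 2" "1/2 < snd x" "fst x + snd x < 1" "brun_map x = (fst x / snd x, (1 - snd x) / snd x)"
  | "brun_index x = 3" "1 < fst x + snd x" "1/2 < snd x" "brun_map x = ((1 - snd x) / snd x, fst x / snd x)"
  using brun_index_generic[OF assms] exhaust_3[of "brun_index x"] generic_bounds[OF assms]
  by (auto simp: brun_map_def case_prod_beta')

text \<open>An integer relation for \<open>y\<close>, multiplied by the common denominator
  \<open>s\<close>, is an integer relation for \<open>x\<close>; by \<open>unimod\<close> the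
  integer matrix of the branch kills no nonzero row.\<close>

lemma generic_scale:
  fixes a1 b1 c1 a2 b2 c2 a3 b3 c3 :: int and x y :: "real \<times> real" and s :: real
  assumes "generic x" "(0::real) < s"
    and y: "fst y = (a1 * fst x + b1 * snd x + c1) / s" "snd y = (a2 * fst x + b2 * snd x + c2) / s"
      "s = a3 * fst x + b3 * snd x + c3"
    and unimod: "\<And>a b c :: int. a * a1 + b * a2 + c * a3 = 0 \<Longrightarrow> a * b1 + b * b2 + c * b3 = 0 \<Longrightarrow>
        a * c1 + b * c2 + c * c3 = 0 \<Longrightarrow> a = 0 \<and> b = 0 \<and> c = 0"
    and "y \<in> Delta2"
  shows "generic y"
  unfolding generic_def
proof (intro conjI allI impI)
  fix a b c :: int
  assume "real_of_int a * fst y + real_of_int b * snd y + real_of_int c = 0"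
  then have "(real_of_int a * fst y + real_of_int b * snd y + real_of_int c) * s = 0" by simp
  then have "real_of_int a * (a1 * fst x + b1 * snd x + c1) + real_of_int b * (a2 * fst x + b2 * snd x + c2) + real_of_int c * s = 0"
  proof -
    have "fst y * s = a1 * fst x + b1 * snd x + c1" "snd y * s = a2 * fst x + b2 * snd x + c2"
      using \<open>0 < s\<close> by (simp_all add: y(1,2))
    with \<open>(real_of_int a * fst y + real_of_int b * snd y + real_of_int c) * s = 0\<close> show ?thesis
      by (metis (no_types, lifting) distrib_right mult.assoc)
  qed
  then have "real_of_int (a * a1 + b * a2 + c * a3) * fst x + real_of_int (a * b1 + b * b2 + c * b3) * snd x
     + real_of_int (a * c1 + b * c2 + c * c3) = 0"
    by (simp add: y(3) algebra_simps)
  from genericD[OF assms(1) this] show "a = 0" "b = 0" "c = 0" using unimod by blast+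
qed fact

lemma generic_brun_map:
  assumes "generic x"
  shows "generic (brun_map x)"
  using assms
proof (cases rule: brun_map_cases)
  case 1
  show ?thesis
    by (rule generic_scale[OF assms, where s = "1 - snd x" and ?a1.0 = 1 and ?b1.0 = 0 and ?c1.0 = 0 
        and ?a2.0 = 0 and ?b2.0 = 1 and ?c2.0 = 0 and ?a3.0 = 0 and ?b3.0 = "-1" and ?c3.0 = 1])
      (use 1 generic_bounds[OF assms] in \<open>auto simp: Delta2_def divide_le_eq_1 intro!: divide_right_mono\<close>)
next
  case 2
  show ?thesis
    by (rule generic_scale[OF assms, where s = "snd x" and ?a1.0 = 1 and ?b1.0 = 0 and ?c1.0 = 0 
        and ?a2.0 = 0 and ?b2.0 = "-1" and ?c2.0 = 1 and ?a3.0 = 0 and ?b3.0 = 1 and ?c3.0 = 0])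
      (use 2 generic_bounds[OF assms] in \<open>auto simp: Delta2_def divide_le_eq_1 intro!: divide_right_mono\<close>)
next
  case 3
  show ?thesis
    by (rule generic_scale[OF assms, where s = "snd x" and ?a1.0 = 0 and ?b1.0 = "-1" and ?c1.0 = 1 
        and ?a2.0 = 1 and ?b2.0 = 0 and ?c2.0 = 0 and ?a3.0 = 0 and ?b3.0 = 1 and ?c3.0 = 0])
      (use 3 generic_bounds[OF assms] in \<open>auto simp: Delta2_def divide_le_eq_1 intro!: divide_right_mono\<close>)
qed

lemma generic_brun_pow: "generic x \<Longrightarrow> generic ((brun_map ^^ n) x)"
  by (induction n) (auto intro: generic_brun_map)

section \<open>Homogeneous coordinates, letter frequencies and word sums\<close>

definition hom :: "real \<times> real \<Rightarrow> 3 \<Rightarrow> real" where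
  "hom x j = (if j = 1 then fst x else if j = 2 then snd x else 1)"

definition freq :: "real \<times> real \<Rightarrow> 3 \<Rightarrow> real" where
  "freq x j = hom x j / (1 + fst x + snd x)"

definition rotation :: "real \<times> real \<Rightarrow> real \<times> real" where
  "rotation x = (fst x / (1 + fst x + snd x), snd x / (1 + fst x + snd x))"

lemma hom_simps [simp]: "hom x 1 = fst x" "hom x 2 = snd x" "hom x 3 = 1"
  by (simp_all add: hom_def)

lemma hom_pos: "generic x \<Longrightarrow> 0 < hom x j" and hom_le_1: "generic x \<Longrightarrow> hom x j \<le> 1"
  using exhaust_3[of j] generic_bounds[of x] by auto

lemma freq_pos: "generic x \<Longrightarrow> 0 < freq x j"
  using generic_bounds[of x] hom_pos[of x j] by (simp add: freq_def)

lemma freq_sum: "generic x \<Longrightarrow> freq x 1 + freq x 2 + freq x 3 = 1"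
  using generic_bounds[of x] by (simp add: freq_def add_divide_distrib[symmetric])

lemma freq_le_1: "generic x \<Longrightarrow> freq x j \<le> 1"
  using exhaust_3[of j] freq_sum[of x] freq_pos[of x 1] freq_pos[of x 2] freq_pos[of x 3] by auto

lemma rotation_freq: "rotation x = (freq x 1, freq x 2)"
  by (simp add: rotation_def freq_def)

definition word_sum :: "(3 \<Rightarrow> 'a::comm_monoid_add) \<Rightarrow> 3 list \<Rightarrow> 'a" where
  "word_sum \<gamma> w = sum_list (map \<gamma> w)"

lemma word_sum_simps [simp]:
  "word_sum \<gamma> [] = 0" "word_sum \<gamma> (a # w) = \<gamma> a + word_sum \<gamma> w"
  "word_sum \<gamma> (v @ w) = word_sum \<gamma> v + word_sum \<gamma> w"
  by (simp_all add: word_sum_def)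

lemma subst_word_simps [simp]:
  "subst_word s [] = []" "subst_word s (a # w) = s a @ subst_word s w"
  "subst_word s (v @ w) = subst_word s v @ subst_word s w"
  by (simp_all add: subst_word_def)

lemma subst_upto_append [simp]: "subst_upto \<sigma> n (v @ w) = subst_upto \<sigma> n v @ subst_upto \<sigma> n w"
  by (induction n arbitrary: v w) auto

lemma subst_upto_Nil [simp]: "subst_upto \<sigma> n [] = []"
  by (induction n) auto

lemma subst_upto_Cons: "subst_upto \<sigma> n (a # w) = subst_upto \<sigma> n [a] @ subst_upto \<sigma> n w"
  by (metis append_Cons append_Nil subst_upto_append)

lemma subst_upto_add:
  "subst_upto \<sigma> (m + n) w = subst_upto \<sigma> m (subst_upto (\<lambda>k. \<sigma> (m + k)) n w)"
  by (induction n arbitrary: w) auto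

text \<open>A valuation of the letters of level 0, transported to level \<open>n\<close>.
  Discrepancies give \<open>err\<close>, the constant 1 gives lengths.\<close>

definition lift :: "(nat \<Rightarrow> substitution) \<Rightarrow> (3 \<Rightarrow> 'a::comm_monoid_add) \<Rightarrow> nat \<Rightarrow> 3 \<Rightarrow> 'a" where
  "lift \<sigma> \<gamma> n j = word_sum \<gamma> (subst_upto \<sigma> n [j])"

lemma word_sum_lift: "word_sum (lift \<sigma> \<gamma> n) w = word_sum \<gamma> (subst_upto \<sigma> n w)"
proof (induction w)
  case (Cons a w)
  have "word_sum \<gamma> (subst_upto \<sigma> n (a # w)) = lift \<sigma> \<gamma> n a + word_sum \<gamma> (subst_upto \<sigma> n w)"
    by (subst subst_upto_Cons) (simp add: lift_def)
  then show ?case by (simp add: Cons)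
qed simp

lemma lift_0 [simp]: "lift \<sigma> \<gamma> 0 = \<gamma>"
  by (auto simp: lift_def)

lemma lift_Suc: "lift \<sigma> \<gamma> (Suc n) j = word_sum (lift \<sigma> \<gamma> n) (\<sigma> n j)"
  by (simp add: word_sum_lift) (simp add: lift_def subst_word_def)

lemma lift_add: "lift \<sigma> \<gamma> (m + n) j = word_sum (lift \<sigma> \<gamma> m) (subst_upto (\<lambda>k. \<sigma> (m + k)) n [j])"
  by (simp add: word_sum_lift subst_upto_add[symmetric]) (simp add: lift_def)

abbreviation (input) brun_orbit :: "real \<times> real \<Rightarrow> nat \<Rightarrow> real \<times> real" where
  "brun_orbit x n \<equiv> (brun_map ^^ n) x"

lemma brun_orbit_add: "brun_orbit x (m + n) = brun_orbit (brun_orbit x m) n"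
  by (simp add: funpow_add add.commute[of m])

lemma brun_Phi_shift: "(\<lambda>k. brun_Phi x (m + k)) = brun_Phi (brun_orbit x m)"
  by (simp add: brun_Phi_def brun_orbit_add fun_eq_iff)

section \<open>Discrepancies of letters and their contraction\<close>

definition err0 :: "real \<times> real \<Rightarrow> 3 \<Rightarrow> real \<times> real" where
  "err0 x j = rotation x - (of_bool (j = 1), of_bool (j = 2))"

definition err :: "real \<times> real \<Rightarrow> nat \<Rightarrow> 3 \<Rightarrow> real \<times> real" where
  "err x = lift (brun_Phi x) (err0 x)"

lemma err_0 [simp]: "err x 0 = err0 x" by (simp add: err_def)

lemma err_Suc: "err x (Suc n) j = word_sum (err x n) (brun_subst (brun_index (brun_orbit x n)) j)"
  by (simp add: err_def lift_Suc brun_Phi_def)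

lemma word_sum_err: "word_sum (err x n) w = word_sum (err0 x) (subst_upto (brun_Phi x) n w)"
  by (simp add: err_def word_sum_lift)

lemma err_Suc_cases:
  "brun_index (brun_orbit x n) = 1 \<Longrightarrow> err x (Suc n) 1 = err x n 1 \<and> err x (Suc n) 2 = err x n 2 + err x n 3 \<and> err x (Suc n) 3 = err x n 3"
  "brun_index (brun_orbit x n) = 2 \<Longrightarrow> err x (Suc n) 1 = err x n 1 \<and> err x (Suc n) 2 = err x n 3 \<and> err x (Suc n) 3 = err x n 2 + err x n 3"
  "brun_index (brun_orbit x n) = 3 \<Longrightarrow> err x (Suc n) 1 = err x n 3 \<and> err x (Suc n) 2 = err x n 1 \<and> err x (Suc n) 3 = err x n 2 + err x n 3"
  by (simp_all add: err_Suc)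

text \<open>The frequency vector has discrepancy zero. Homogeneous coordinates of consecutive orbit
  points are related, up to a scalar, by the incidence matrix of the substitution, so every level
  inherits the relation.\<close>

lemma err_relation:
  assumes "generic x"
  shows "fst (brun_orbit x n) *\<^sub>R err x n 1 + snd (brun_orbit x n) *\<^sub>R err x n 2 + err x n 3 = 0"
proof (induction n)
  case 0
  define N where "N = 1 + fst x + snd x"
  have "0 < N" using generic_bounds[OF assms] by (simp add: N_def)
  have *: "fst x * c + snd x * c + c = N * c" for c by (simp add: N_def algebra_simps)
  have "fst x * (fst x / N) + snd x * (fst x / N) + fst x / N = fst x"
    "fst x * (snd x / N) + snd x * (snd x / N) + snd x / N = snd x"
    unfolding * using \<open>0 < N\<close> by simp_all
  then show ?case by (simp add: err0_def rotation_def prod_eq_iff algebra_simps) (simp add: N_def algebra_simps)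
next
  case (Suc n)
  let ?y = "brun_orbit x n"
  have y: "generic ?y" using assms by (rule generic_brun_pow)
  note b = generic_bounds[OF y]
  from Suc have e3: "err x n 3 = - (fst ?y *\<^sub>R err x n 1) - snd ?y *\<^sub>R err x n 2"
    by (simp add: algebra_simps eq_neg_iff_add_eq_0)
  define a b where "a = fst ?y" and "b = snd ?y"
  have nz: "1 - b \<noteq> 0" "b \<noteq> 0" using b by (auto simp: b_def)
  have e3: "err x n 3 = - (a *\<^sub>R err x n 1) - b *\<^sub>R err x n 2"
    using e3 by (simp add: a_def b_def)
  let ?v = "fst (brun_orbit x (Suc n)) *\<^sub>R err x (Suc n) 1 +
    snd (brun_orbit x (Suc n)) *\<^sub>R err x (Suc n) 2 + err x (Suc n) 3"
  from y show ?case
  proof (cases rule: brun_map_cases)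
    case 1
    have "(1 - b) *\<^sub>R ?v = 0"
      using 1 nz by (simp add: err_Suc_cases(1) a_def[symmetric] b_def[symmetric] scaleR_add_right)
        (simp add: e3 algebra_simps)
    then show ?thesis using nz by simp
  next
    case 2
    have "b *\<^sub>R ?v = 0"
      using 2 nz by (simp add: err_Suc_cases(2) a_def[symmetric] b_def[symmetric] scaleR_add_right)
        (simp add: e3 algebra_simps)
    then show ?thesis using nz by simp
  next
    case 3
    have "b *\<^sub>R ?v = 0"
      using 3 nz by (simp add: err_Suc_cases(3) a_def[symmetric] b_def[symmetric] scaleR_add_right)
        (simp add: e3 algebra_simps)
    then show ?thesis using nz by simp
  qed
qed

definition max_err :: "real \<times> real \<Rightarrow> nat \<Rightarrow> real" where
  "max_err x n = Max (range (\<lambda>j. norm (err x n j)))"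

lemma max_err_ge: "norm (err x n j) \<le> max_err x n"
  unfolding max_err_def by (rule Max_ge) auto

lemma max_err_le_iff: "max_err x n \<le> b \<longleftrightarrow> (\<forall>j. norm (err x n j) \<le> b)"
  unfolding max_err_def by (subst Max_le_iff) auto

lemma max_err_nonneg: "0 \<le> max_err x n"
  using max_err_ge[of x n 1] norm_ge_zero order_trans by blast

text \<open>By \<open>err_relation\<close> the only new vector, the sum for the letters 2 and 3, is
  a combination of those for 2 and 1 whose coefficients have total absolute value 1 - (x2 - x1),
  with (x1, x2) the orbit point. So discrepancies never grow, and they shrink when the coordinates
  stay apart.\<close>

lemma norm_err_sum_le:
  assumes "generic x" "norm (err x n 1) \<le> m" "norm (err x n 2) \<le> m"
    "snd (brun_orbit x n) - fst (brun_orbit x n) \<ge> \<delta>"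
  shows "norm (err x n 2 + err x n 3) \<le> (1 - \<delta>) * m"
proof -
  let ?y = "brun_orbit x n"
  note b = generic_bounds[OF generic_brun_pow[OF assms(1), of n]]
  have "err x n 2 + err x n 3 = (1 - snd ?y) *\<^sub>R err x n 2 - fst ?y *\<^sub>R err x n 1"
    using err_relation[OF assms(1), of n] by (simp add: algebra_simps eq_neg_iff_add_eq_0)
  also have "norm \<dots> \<le> (1 - snd ?y) * norm (err x n 2) + fst ?y * norm (err x n 1)"
    using b by (intro order_trans[OF norm_triangle_ineq4]) simp
  also have "\<dots> \<le> (1 - snd ?y) * m + fst ?y * m"
    using b assms by (intro add_mono mult_left_mono) auto
  also have "\<dots> = (1 - (snd ?y - fst ?y)) * m" by (simp add: algebra_simps)
  also have "\<dots> \<le> (1 - \<delta>) * m"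
    using assms norm_ge_zero[of "err x n 1"] by (intro mult_right_mono) (auto simp del: norm_ge_zero)
  finally show ?thesis .
qed

lemma max_err_Suc_le:
  assumes "generic x"
  shows "max_err x (Suc n) \<le> max_err x n"
proof -
  have "norm (err x n 2 + err x n 3) \<le> (1 - 0) * max_err x n"
    using generic_bounds[OF generic_brun_pow[OF assms(1), of n]]
    by (intro norm_err_sum_le assms max_err_ge) auto
  then show ?thesis
    using err_Suc_cases[of n x] exhaust_3[of "brun_index (brun_orbit x n)"]
    unfolding max_err_le_iff forall_3 by (auto simp: max_err_ge)
qed

lemma max_err_antimono: "generic x \<Longrightarrow> m \<le> n \<Longrightarrow> max_err x n \<le> max_err x m"
  by (rule lift_Suc_antimono_le[where f = "max_err x"]) (auto intro: max_err_Suc_le)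

lemma brun3_inverse:
  assumes "generic x" "brun_index x = 3"
  shows "fst x = snd (brun_map x) / (1 + fst (brun_map x))" "snd x = 1 / (1 + fst (brun_map x))"
  using assms(1)
  by (cases rule: brun_map_cases; use assms generic_bounds[OF assms(1)] in \<open>simp add: field_simps\<close>)+

text \<open>Pulling back through four inverse branches of index 3 gives x2 - x1 = 1 / (3 + 2 s + t),
  where (s, t) is the fourth iterate and s, t < 1.\<close>

lemma brun3_margin:
  assumes "generic x" "\<And>k. k < 4 \<Longrightarrow> brun_index (brun_orbit x k) = 3"
  shows "snd x - fst x \<ge> 1/6"
proof -
  let ?z = "brun_orbit x 4"
  have g: "generic (brun_orbit x k)" for k using assms by (auto intro: generic_brun_pow)
  note b = generic_bounds[OF g[of 4]]
  define s t where "s = fst ?z" and "t = snd ?z"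
  have st: "0 < s" "s < t" "t < 1" using b by (auto simp: s_def t_def)
  note i = brun3_inverse[OF g assms(2)]
  have e: "brun_map (brun_orbit x k) = brun_orbit x (Suc k)" for k by simp
  have 3: "fst (brun_orbit x 3) = t / (1 + s)" "snd (brun_orbit x 3) = 1 / (1 + s)"
    using i[of 3] e[of 3] by (simp_all add: s_def t_def del: funpow.simps)
  have 2: "fst (brun_orbit x 2) = 1 / (1 + s + t)" "snd (brun_orbit x 2) = (1 + s) / (1 + s + t)"
    using i[of 2] e[of 2] st by (simp_all add: 3 del: funpow.simps) (simp_all add: field_simps)
  have 1: "fst (brun_orbit x 1) = (1 + s) / (2 + s + t)" "snd (brun_orbit x 1) = (1 + s + t) / (2 + s + t)"
    using i[of 1] e[of 1] st by (simp_all add: 2 numeral_2_eq_2[symmetric] del: funpow.simps) (simp_all add: field_simps)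
  have 0: "fst x = (1 + s + t) / (3 + 2 * s + t)" "snd x = (2 + s + t) / (3 + 2 * s + t)"
    using i[of 0] e[of 0] st 1 by simp_all (simp_all add: field_simps)
  have "snd x - fst x = 1 / (3 + 2 * s + t)" using st by (simp add: 0 field_simps)
  also have "\<dots> \<ge> 1 / 6" using st by (intro divide_left_mono) auto
  finally show ?thesis .
qed

text \<open>Each step of index 3 puts a contracted vector into slot 3 and passes the old ones on to
  slots 1 and 2, so three steps renew all slots. The margin used at the third step looks at four
  indices, whence six in all.\<close>

lemma max_err_contract:
  assumes "generic x" "\<And>k. k < 6 \<Longrightarrow> brun_index (brun_orbit x (n + k)) = 3"
  shows "max_err x (n + 6) \<le> 5/6 * max_err x n"
proof -
  let ?m = "max_err x n"
  have mar: "snd (brun_orbit x (n + j)) - fst (brun_orbit x (n + j)) \<ge> 1/6" if "j < 3" for j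
  proof (rule brun3_margin)
    fix k :: nat assume "k < 4"
    then show "brun_index (brun_orbit (brun_orbit x (n + j)) k) = 3"
      using that assms(2)[of "j + k"] by (simp add: brun_orbit_add[symmetric] add.assoc)
  qed (rule generic_brun_pow[OF assms(1)])
  have st: "err x (Suc (n + j)) 1 = err x (n + j) 3 \<and> err x (Suc (n + j)) 2 = err x (n + j) 1 \<and>
     err x (Suc (n + j)) 3 = err x (n + j) 2 + err x (n + j) 3" if "j < 6" for j
    using err_Suc_cases(3)[of "n + j" x] assms(2)[OF that] by simp
  have m0: "norm (err x n j) \<le> ?m" for j by (rule max_err_ge)
  have m: "0 \<le> ?m" by (rule max_err_nonneg)
  have a: "norm (err x (Suc n) 3) \<le> 5/6 * ?m"
    using norm_err_sum_le[OF assms(1) m0 m0, where \<delta> = "1/6"] mar[of 0] st[of 0] by simp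
  have b: "norm (err x (Suc (Suc n)) 3) \<le> 5/6 * ?m"
    using norm_err_sum_le[OF assms(1), of "Suc n" ?m "1/6"] mar[of 1] st[of 0] st[of 1] m0 by simp
  have c: "norm (err x (Suc (Suc (Suc n))) 3) \<le> 5/6 * ?m"
    using norm_err_sum_le[OF assms(1), of "Suc (Suc n)" ?m "1/6"] mar[of 2] st[of 0] st[of 1] st[of 2] m0 a m
    by simp
  have "max_err x (Suc (Suc (Suc n))) \<le> 5/6 * ?m"
    unfolding max_err_le_iff forall_3 using a b c st[of 0] st[of 1] st[of 2] by simp
  moreover have "max_err x (n + 6) \<le> max_err x (Suc (Suc (Suc n)))"
    by (rule max_err_antimono[OF assms(1)]) simp
  ultimately show ?thesis by simp
qed

section \<open>Bounds on prefixes and the geometry of a level\<close>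

text \<open>An index 1 contributes nothing; the sum runs over the ends of the runs of index 1, where
  the substitution changes.\<close>

definition exit_err :: "real \<times> real \<Rightarrow> nat \<Rightarrow> real" where
  "exit_err x n = max_err x 0 + (\<Sum>k<n. if brun_index (brun_orbit x k) = 1 then 0 else max_err x (Suc k))"

definition err_bounded :: "real \<times> real \<Rightarrow> real \<Rightarrow> bool" where
  "err_bounded x B \<longleftrightarrow> (\<forall>n. exit_err x n \<le> B)"

lemma append_eq_append_Cons_cases:
  assumes "u @ v = p @ a # s"
  obtains s' where "u = p @ a # s'" | p' where "p = u @ p'" "v = p' @ a # s"
proof -
  from assms consider us where "u @ us = p" "v = us @ a # s" | us where "u = p @ us" "us @ v = a # s"
    unfolding append_eq_append_conv2 by blast
  then show thesis
  proof cases
    case (2 us)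
    then show ?thesis using that(1) that(2)[of "[]"] by (cases us) auto
  qed (use that(2) in auto)
qed

lemma subst_upto_Suc_single:
  "subst_upto (brun_Phi x) (Suc n) [j] = subst_upto (brun_Phi x) n (brun_subst (brun_index (brun_orbit x n)) j)"
  by (simp add: brun_Phi_def)

text \<open>The slack \<open>d\<close> makes runs of index 1 free. Under index 1 only letter 2 has a
  longer image, 23; crossing its first letter uses the slack kept for prefixes inside letter 3, and
  the letters 1 and 3 keep theirs. At an index 2 or 3 the slack is spent and renewed by the new term
  of \<open>exit_err\<close>.\<close>

lemma norm_prefix_sum_le_aux:
  assumes "generic x"
  shows "\<exists>d\<ge>max_err x n. \<forall>i p a s. subst_upto (brun_Phi x) n [i] = p @ a # s \<longrightarrow>
    norm (word_sum (err0 x) p) \<le> exit_err x n - (if i = 2 then 0 else d)"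
proof (induction n)
  case 0
  show ?case by (rule exI[of _ "max_err x 0"]) (auto simp: exit_err_def Cons_eq_append_conv max_err_nonneg)
next
  case (Suc n)
  then obtain d where d: "max_err x n \<le> d" and
    IH: "\<And>i p a s. subst_upto (brun_Phi x) n [i] = p @ a # s \<Longrightarrow>
       norm (word_sum (err0 x) p) \<le> exit_err x n - (if i = 2 then 0 else d)" by blast
  have d0: "0 \<le> d" using d max_err_nonneg[of x n] by linarith
  have split: "norm (word_sum (err0 x) p) \<le> exit_err x n"
    if "subst_upto (brun_Phi x) n [2, 3] = p @ a # s" for p a s
  proof -
    from that have "subst_upto (brun_Phi x) n [2] @ subst_upto (brun_Phi x) n [3] = p @ a # s"
      by (subst (asm) subst_upto_Cons)
    then show ?thesis
    proof (cases rule: append_eq_append_Cons_cases)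
      case (1 s')
      then show ?thesis using IH[of 2 p a s'] by simp
    next
      case (2 p')
      have "norm (word_sum (err0 x) p) \<le> norm (err x n 2) + norm (word_sum (err0 x) p')"
        unfolding 2 by (simp add: err_def lift_def norm_triangle_ineq)
      also have "\<dots> \<le> d + (exit_err x n - d)"
        using IH[OF 2(2)] max_err_ge[of x n 2] d by (intro add_mono) auto
      finally show ?thesis by simp
    qed
  qed
  have m: "max_err x (Suc n) \<le> max_err x n" by (rule max_err_Suc_le[OF assms])
  consider "brun_index (brun_orbit x n) = 1" | "brun_index (brun_orbit x n) = 2" | "brun_index (brun_orbit x n) = 3"
    using exhaust_3 by blast
  then show ?case
  proof cases
    case 1
    have e: "exit_err x (Suc n) = exit_err x n" using 1 by (simp add: exit_err_def)
    show ?thesis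
    proof (intro exI[of _ d] conjI allI impI)
      fix i p a s assume "subst_upto (brun_Phi x) (Suc n) [i] = p @ a # s"
      then show "norm (word_sum (err0 x) p) \<le> exit_err x (Suc n) - (if i = 2 then 0 else d)"
        unfolding subst_upto_Suc_single 1 e using exhaust_3[of i] IH[of 1] IH[of 3] split by auto
    qed (use m d in simp)
  next
    case 2
    have e: "exit_err x (Suc n) = exit_err x n + max_err x (Suc n)" using 2 by (simp add: exit_err_def)
    show ?thesis
    proof (intro exI[of _ "max_err x (Suc n)"] conjI allI impI)
      fix i p a s assume "subst_upto (brun_Phi x) (Suc n) [i] = p @ a # s"
      then have "norm (word_sum (err0 x) p) \<le> exit_err x n"
        unfolding subst_upto_Suc_single 2 using exhaust_3[of i] IH[of 1 p a s] IH[of 3 p a s] split[of p a s] d0 by auto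
      then show "norm (word_sum (err0 x) p) \<le> exit_err x (Suc n) - (if i = 2 then 0 else max_err x (Suc n))"
        unfolding e using max_err_nonneg[of x "Suc n"] by auto
    qed simp
  next
    case 3
    have e: "exit_err x (Suc n) = exit_err x n + max_err x (Suc n)" using 3 by (simp add: exit_err_def)
    show ?thesis
    proof (intro exI[of _ "max_err x (Suc n)"] conjI allI impI)
      fix i p a s assume "subst_upto (brun_Phi x) (Suc n) [i] = p @ a # s"
      then have "norm (word_sum (err0 x) p) \<le> exit_err x n"
        unfolding subst_upto_Suc_single 3 using exhaust_3[of i] IH[of 1 p a s] IH[of 3 p a s] split[of p a s] d0 by auto
      then show "norm (word_sum (err0 x) p) \<le> exit_err x (Suc n) - (if i = 2 then 0 else max_err x (Suc n))"
        unfolding e using max_err_nonneg[of x "Suc n"] by auto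
    qed simp
  qed
qed

lemma norm_prefix_sum_le:
  assumes "generic x" "err_bounded x B" "subst_upto (brun_Phi x) n [i] = p @ a # s"
  shows "norm (word_sum (err0 x) p) \<le> B"
proof -
  obtain d where d: "max_err x n \<le> d"
    "norm (word_sum (err0 x) p) \<le> exit_err x n - (if i = 2 then 0 else d)"
    using norm_prefix_sum_le_aux[OF assms(1), of n] assms(3) by blast
  have "0 \<le> d" using d(1) max_err_nonneg[of x n] by linarith
  then have "norm (word_sum (err0 x) p) \<le> exit_err x n" using d(2) by (auto split: if_splits)
  also have "\<dots> \<le> B" using assms(2) by (simp add: err_bounded_def)
  finally show ?thesis .
qed

section \<open>Renormalisation to a level and its Jacobian\<close>

definition lin :: "real \<times> real \<Rightarrow> nat \<Rightarrow> real \<times> real \<Rightarrow> real \<times> real" where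
  "lin x n v = fst v *\<^sub>R (err x n 3 - err x n 1) + snd v *\<^sub>R (err x n 3 - err x n 2)"

lemma linear_lin: "linear (lin x n)"
  by (rule linearI) (auto simp: lin_def algebra_simps)

lemma lin_add: "lin x n (v + w) = lin x n v + lin x n w" and lin_zero [simp]: "lin x n 0 = 0"
  and lin_diff: "lin x n (v - w) = lin x n v - lin x n w"
  using linear_lin by (simp_all add: linear_add linear_0 linear_diff)

lemma err_freq_relation:
  assumes "generic x"
  shows "freq (brun_orbit x n) 1 *\<^sub>R err x n 1 + freq (brun_orbit x n) 2 *\<^sub>R err x n 2 +
    freq (brun_orbit x n) 3 *\<^sub>R err x n 3 = 0"
proof -
  let ?y = "brun_orbit x n"
  have "(1 / (1 + fst ?y + snd ?y)) *\<^sub>R (fst ?y *\<^sub>R err x n 1 + snd ?y *\<^sub>R err x n 2 + err x n 3) = 0"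
    by (simp add: err_relation[OF assms])
  then show ?thesis by (simp add: scaleR_add_right freq_def)
qed

text \<open>By construction \<open>lin\<close> is right on differences of letters, and
  \<open>err_freq_relation\<close> makes it right on the letters themselves. Bounds at level 0 of an
  orbit point become bounds at level \<open>n\<close> of \<open>x\<close> in this way.\<close>

lemma lin_err0:
  assumes "generic x"
  shows "lin x n (err0 (brun_orbit x n) j) = err x n j"
proof -
  let ?y = "brun_orbit x n"
  define a b c where "a = freq ?y 1" and "b = freq ?y 2" and "c = freq ?y 3"
  have r: "a *\<^sub>R err x n 1 + b *\<^sub>R err x n 2 = - (c *\<^sub>R err x n 3)"
    using err_freq_relation[OF assms, of n] by (simp add: a_def b_def c_def eq_neg_iff_add_eq_0)
  have s: "c = 1 - a - b"
    using freq_sum[OF generic_brun_pow[OF assms], of n] by (simp add: a_def b_def c_def)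
  have "lin x n (rotation ?y) = a *\<^sub>R err x n 3 + b *\<^sub>R err x n 3 - (a *\<^sub>R err x n 1 + b *\<^sub>R err x n 2)"
    by (simp add: lin_def rotation_freq a_def[symmetric] b_def[symmetric] algebra_simps)
  also have "\<dots> = err x n 3" unfolding r by (simp add: s algebra_simps)
  finally have "lin x n (rotation ?y) = err x n 3" .
  then show ?thesis unfolding err0_def lin_diff using exhaust_3[of j] by (auto simp: lin_def)
qed

lemma lin_word_sum:
  assumes "generic x"
  shows "lin x n (word_sum (err0 (brun_orbit x n)) w) = word_sum (err x n) w"
  by (induction w) (simp_all add: lin_add lin_err0[OF assms])

lemma norm_lin_le: "norm (lin x n v) \<le> 4 * max_err x n * norm v"
proof -
  have *: "norm (err x n i - err x n j) \<le> 2 * max_err x n" for i j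
    using norm_triangle_ineq4[of "err x n i" "err x n j"] max_err_ge[of x n i] max_err_ge[of x n j] by linarith
  have f: "\<bar>fst v\<bar> \<le> norm v" "\<bar>snd v\<bar> \<le> norm v"
    using norm_fst_le[of "fst v" "snd v"] norm_snd_le[of "snd v" "fst v"] by simp_all
  have "norm (lin x n v) \<le> \<bar>fst v\<bar> * norm (err x n 3 - err x n 1) + \<bar>snd v\<bar> * norm (err x n 3 - err x n 2)"
    unfolding lin_def by (rule order_trans[OF norm_triangle_ineq]) simp
  also have "\<dots> \<le> norm v * (2 * max_err x n) + norm v * (2 * max_err x n)"
    using f * by (intro add_mono mult_mono) auto
  finally show ?thesis by (simp add: algebra_simps)
qed

definition cross :: "real \<times> real \<Rightarrow> real \<times> real \<Rightarrow> real" where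
  "cross u v = fst u * snd v - snd u * fst v"

lemma cross_simps: "cross (u + v) w = cross u w + cross v w" "cross w (u + v) = cross w u + cross w v"
  "cross (a *\<^sub>R u) v = a * cross u v" "cross u (a *\<^sub>R v) = a * cross u v" "cross u u = 0"
  "cross (- u) v = - cross u v" "cross u (- v) = - cross u v"
  "cross (u - v) w = cross u w - cross v w" "cross w (u - v) = cross w u - cross w v"
  by (simp_all add: cross_def algebra_simps)

lemma cross_commute: "cross v u = - cross u v" by (simp add: cross_def)

definition kap :: "real \<times> real \<Rightarrow> nat \<Rightarrow> real" where
  "kap x n = cross (err x n 1) (err x n 2)"

text \<open>Stands in for the area of a tile with letter \<open>j\<close> of level \<open>n\<close>:
  additive under subdivision and comparable to the Jacobian of \<open>lin\<close>, long before tiles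
  are known not to overlap.\<close>

definition wt :: "real \<times> real \<Rightarrow> nat \<Rightarrow> 3 \<Rightarrow> real" where
  "wt x n j = \<bar>kap x n\<bar> * hom (brun_orbit x n) j"

lemma cross_err:
  assumes "generic x"
  shows "cross (err x n 2) (err x n 3) = fst (brun_orbit x n) * kap x n"
    "cross (err x n 3) (err x n 1) = snd (brun_orbit x n) * kap x n"
proof -
  have e: "err x n 3 = - (fst (brun_orbit x n) *\<^sub>R err x n 1) - snd (brun_orbit x n) *\<^sub>R err x n 2"
    using err_relation[OF assms, of n] by (simp add: algebra_simps eq_neg_iff_add_eq_0)
  show "cross (err x n 2) (err x n 3) = fst (brun_orbit x n) * kap x n"
    "cross (err x n 3) (err x n 1) = snd (brun_orbit x n) * kap x n"
    unfolding e kap_def by (simp_all add: cross_simps cross_commute[of "err x n 2" "err x n 1"])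
qed

lemma kap_Suc:
  assumes "generic x"
  shows "brun_index (brun_orbit x n) = 1 \<Longrightarrow> kap x (Suc n) = (1 - snd (brun_orbit x n)) * kap x n"
    "brun_index (brun_orbit x n) = 2 \<Longrightarrow> kap x (Suc n) = - snd (brun_orbit x n) * kap x n"
    "brun_index (brun_orbit x n) = 3 \<Longrightarrow> kap x (Suc n) = snd (brun_orbit x n) * kap x n"
  using cross_err[OF assms, of n] cross_commute[of "err x n 3" "err x n 1"]
  by (simp_all add: kap_def err_Suc_cases cross_simps algebra_simps)

lemma kap_nonzero: "generic x \<Longrightarrow> kap x n \<noteq> 0"
proof (induction n)
  case 0
  have "kap x 0 = freq x 3"
    using freq_sum[OF 0] by (simp add: kap_def cross_def err0_def rotation_freq algebra_simps)
  then show ?case using freq_pos[OF 0, of 3] by simp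
next
  case (Suc n)
  have "1 - snd (brun_orbit x n) \<noteq> 0" "snd (brun_orbit x n) \<noteq> 0"
    using generic_bounds[OF generic_brun_pow[OF Suc.prems], of n] by auto
  then show ?case using kap_Suc[OF Suc.prems, of n] Suc exhaust_3[of "brun_index (brun_orbit x n)"] by auto
qed

lemma wt_pos: "generic x \<Longrightarrow> 0 < wt x n j"
  using kap_nonzero[of x n] hom_pos[OF generic_brun_pow, of x n j] by (simp add: wt_def)

text \<open>Up to sign, \<open>kap\<close> changes by the denominator of the Brun branch. This
  factor clears the denominators of the homogeneous coordinates and leaves the incidence
  matrix.\<close>

lemma wt_Suc:
  assumes "generic x"
  shows "wt x n a = (\<Sum>j\<in>UNIV. real (count_list (brun_Phi x n j) a) * wt x (Suc n) j)"
proof -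
  let ?y = "brun_orbit x n"
  have g: "generic ?y" by (rule generic_brun_pow[OF assms])
  note b = generic_bounds[OF g]
  from g show ?thesis
  proof (cases rule: brun_map_cases)
    case 1
    have "\<bar>kap x (Suc n)\<bar> = (1 - snd ?y) * \<bar>kap x n\<bar>" using kap_Suc(1)[OF assms 1(1)] b by (simp add: abs_mult)
    then have "wt x (Suc n) 1 = \<bar>kap x n\<bar> * fst ?y" "wt x (Suc n) 2 = \<bar>kap x n\<bar> * snd ?y"
      "wt x (Suc n) 3 = \<bar>kap x n\<bar> * (1 - snd ?y)" using 1 b by (simp_all add: wt_def)
    then show ?thesis using exhaust_3[of a]
      by (auto simp: sum_3 brun_Phi_def 1 wt_def algebra_simps)
  next
    case 2
    have "\<bar>kap x (Suc n)\<bar> = snd ?y * \<bar>kap x n\<bar>" using kap_Suc(2)[OF assms 2(1)] b by (simp add: abs_mult)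
    then have "wt x (Suc n) 1 = \<bar>kap x n\<bar> * fst ?y" "wt x (Suc n) 2 = \<bar>kap x n\<bar> * (1 - snd ?y)"
      "wt x (Suc n) 3 = \<bar>kap x n\<bar> * snd ?y" using 2 b by (simp_all add: wt_def)
    then show ?thesis using exhaust_3[of a]
      by (auto simp: sum_3 brun_Phi_def 2 wt_def algebra_simps)
  next
    case 3
    have "\<bar>kap x (Suc n)\<bar> = snd ?y * \<bar>kap x n\<bar>" using kap_Suc(3)[OF assms 3(1)] b by (simp add: abs_mult)
    then have "wt x (Suc n) 1 = \<bar>kap x n\<bar> * (1 - snd ?y)" "wt x (Suc n) 2 = \<bar>kap x n\<bar> * fst ?y"
      "wt x (Suc n) 3 = \<bar>kap x n\<bar> * snd ?y" using 3 b by (simp_all add: wt_def)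
    then show ?thesis using exhaust_3[of a]
      by (auto simp: sum_3 brun_Phi_def 3 wt_def algebra_simps)
  qed
qed

lemma count_list_subst_upto:
  "count_list (subst_upto \<sigma> n w) a = (\<Sum>b\<in>UNIV. count_list w b * count_list (subst_upto \<sigma> n [b]) a)"
proof (induction w)
  case (Cons c w)
  show ?case
    by (subst subst_upto_Cons) (simp add: Cons sum.distrib[symmetric] if_distrib[of "\<lambda>x. x * _"] sum.delta
      cong: if_cong, simp add: sum_3, use exhaust_3[of c] in auto)
qed simp

lemma wt_add:
  assumes "generic x"
  shows "wt x m a = (\<Sum>j\<in>UNIV. real (count_list (subst_upto (\<lambda>k. brun_Phi x (m + k)) q [j]) a) * wt x (m + q) j)"
proof (induction q)
  case 0
  show ?case using exhaust_3[of a] by (auto simp: sum_3)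
next
  case (Suc q)
  let ?c = "\<lambda>j. subst_upto (\<lambda>k. brun_Phi x (m + k)) q [j]"
  have "wt x m a = (\<Sum>b\<in>UNIV. real (count_list (?c b) a) * (\<Sum>j\<in>UNIV. real (count_list (brun_Phi x (m + q) j) b) * wt x (Suc (m + q)) j))"
    by (subst Suc, subst wt_Suc[OF assms]) simp
  also have "\<dots> = (\<Sum>j\<in>UNIV. (\<Sum>b\<in>UNIV. real (count_list (brun_Phi x (m + q) j) b) * real (count_list (?c b) a)) * wt x (Suc (m + q)) j)"
    by (simp add: sum_3 algebra_simps)
  also have "\<dots> = (\<Sum>j\<in>UNIV. real (count_list (subst_upto (\<lambda>k. brun_Phi x (m + k)) (Suc q) [j]) a) * wt x (m + Suc q) j)"
  proof (intro sum.cong refl)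
    fix j :: 3
    have "count_list (subst_upto (\<lambda>k. brun_Phi x (m + k)) (Suc q) [j]) a =
      (\<Sum>b\<in>UNIV. count_list (brun_Phi x (m + q) j) b * count_list (?c b) a)"
      by (simp add: count_list_subst_upto[of _ _ "brun_Phi x (m + q) j"])
    then show "(\<Sum>b\<in>UNIV. real (count_list (brun_Phi x (m + q) j) b) * real (count_list (?c b) a)) * wt x (Suc (m + q)) j =
       real (count_list (subst_upto (\<lambda>k. brun_Phi x (m + k)) (Suc q) [j]) a) * wt x (m + Suc q) j"
      by simp
  qed
  finally show ?case .
qed

text \<open>Moves planar measure to \<open>real^2\<close>, where linear images have their
  determinant formula.\<close>

lemma distr_vec2_lborel: "distr lborel borel (\<lambda>v::real^2. (v $ 1, v $ 2)) = (lborel :: (real \<times> real) measure)"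
proof (rule lborel_eqI[symmetric])
  fix l u :: "real \<times> real"
  assume lu: "\<And>b. b \<in> Basis \<Longrightarrow> l \<bullet> b \<le> u \<bullet> b"
  have l: "fst l \<le> fst u" "snd l \<le> snd u" using lu[of "(1, 0)"] lu[of "(0, 1)"]
    by (auto simp: Basis_prod_def inner_prod_def)
  define l' u' :: "real^2" where "l' = vector [fst l, snd l]" and "u' = vector [fst u, snd u]"
  have c: "l' $ 1 = fst l" "l' $ 2 = snd l" "u' $ 1 = fst u" "u' $ 2 = snd u"
    by (simp_all add: l'_def u'_def)
  have e: "(\<lambda>v::real^2. (v $ 1, v $ 2)) -` box l u = box l' u'"
    by (auto simp: mem_box_cart mem_box forall_2 Basis_prod_def inner_prod_def c)
  have [measurable]: "(\<lambda>v::real^2. (v $ 1, v $ 2)) \<in> borel_measurable borel"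
    by (intro borel_measurable_continuous_onI continuous_intros)
  have "emeasure (distr lborel borel (\<lambda>v::real^2. (v $ 1, v $ 2))) (box l u) = emeasure lborel (box l' u')"
    by (subst emeasure_distr) (simp_all add: e)
  also have "\<dots> = emeasure lborel (cbox l' u')"
    by (simp add: emeasure_lborel_box_eq emeasure_lborel_cbox_eq)
  also have "\<dots> = ennreal (measure lborel (cbox l' u'))"
    by (intro emeasure_eq_ennreal_measure) (use emeasure_lborel_cbox_finite[of l' u'] in auto)
  also have "measure lborel (cbox l' u') = (fst u - fst l) * (snd u - snd l)"
    using l by (subst content_cbox_cart) (auto simp: interval_ne_empty_cart forall_2 c UNIV_2)
  also have "\<dots> = (\<Prod>b\<in>Basis. (u - l) \<bullet> b)"
    by (simp add: Basis_prod_def inner_prod_def)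
  finally show "emeasure (distr lborel borel (\<lambda>v::real^2. (v $ 1, v $ 2))) (box l u) = (\<Prod>b\<in>Basis. (u - l) \<bullet> b)" .
qed simp

lemma measure_vec2:
  assumes "compact (S :: (real \<times> real) set)"
  shows "compact ((\<lambda>v::real^2. (v $ 1, v $ 2)) -` S)"
    "measure lebesgue ((\<lambda>v::real^2. (v $ 1, v $ 2)) -` S) = measure lebesgue S"
proof -
  let ?q = "\<lambda>v::real^2. (v $ 1, v $ 2)" and ?r = "\<lambda>p. vector [fst p, snd p] :: real^2"
  have "?q -` S = ?r ` S"
    by (auto simp: image_iff vec_eq_iff forall_2) force
  moreover have "linear ?r"
    by (rule linearI) (auto simp: vec_eq_iff forall_2)
  ultimately show c: "compact (?q -` S)"
    using assms by (simp add: compact_continuous_image linear_continuous_on linear_conv_bounded_linear)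
  have [measurable]: "?q \<in> borel_measurable borel"
    by (intro borel_measurable_continuous_onI continuous_intros)
  have [measurable]: "S \<in> sets borel" "?q -` S \<in> sets borel"
    using assms c by (auto intro: borel_compact)
  have "measure lebesgue S = measure (distr lborel borel ?q) S"
    by (simp add: distr_vec2_lborel)
  also have "\<dots> = measure lborel (?q -` S)"
    by (subst measure_distr) auto
  finally show "measure lebesgue (?q -` S) = measure lebesgue S" by simp
qed

lemma measure_linear_image_prod:
  fixes f :: "real \<times> real \<Rightarrow> real \<times> real"
  assumes "linear f" "compact S"
  shows "measure lebesgue (f ` S) = \<bar>cross (f (1, 0)) (f (0, 1))\<bar> * measure lebesgue S"
proof -
  let ?q = "\<lambda>v::real^2. (v $ 1, v $ 2)" and ?r = "\<lambda>p. vector [fst p, snd p] :: real^2"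
  define g where "g = (\<lambda>v. ?r (f (?q v)))"
  have g: "linear g" 
    unfolding g_def using linear_add[OF assms(1), of "(_, _)" "(_, _)"] linear_scale[OF assms(1), of _ "(_, _)"]
    by (intro linearI) (auto simp: vec_eq_iff forall_2)
  have qf: "?q -` (f ` S) = g ` (?q -` S)"
  proof (intro equalityI subsetI)
    fix v assume "v \<in> ?q -` (f ` S)"
    then obtain p where p: "p \<in> S" "?q v = f p" by auto
    then have "v = g (?r p)" by (simp add: g_def vec_eq_iff forall_2) (metis fst_conv snd_conv)
    moreover have "?r p \<in> ?q -` S" using p by simp
    ultimately show "v \<in> g ` (?q -` S)" by blast
  qed (auto simp: g_def)
  have "compact (f ` S)"
    using assms by (simp add: compact_continuous_image linear_continuous_on linear_conv_bounded_linear)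
  then have "measure lebesgue (f ` S) = measure lebesgue (g ` (?q -` S))"
    by (simp add: measure_vec2(2)[symmetric] qf)
  also have "\<dots> = \<bar>det (matrix g)\<bar> * measure lebesgue (?q -` S)"
    by (rule measure_linear_image[OF g]) (use measure_vec2(1)[OF assms(2)] in \<open>auto intro: lmeasurable_compact\<close>)
  also have "det (matrix g) = cross (f (1, 0)) (f (0, 1))"
    by (simp add: det_2 matrix_def g_def axis_def cross_def mult.commute)
  finally show ?thesis by (simp add: measure_vec2(2)[OF assms(2)])
qed

lemma measure_lin_image:
  assumes "generic x" "compact S"
  shows "measure lebesgue (lin x n ` S) =
    \<bar>kap x n\<bar> * (1 + fst (brun_orbit x n) + snd (brun_orbit x n)) * measure lebesgue S"
proof -
  let ?y = "brun_orbit x n"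
  have "cross (lin x n (1, 0)) (lin x n (0, 1)) = (1 + fst ?y + snd ?y) * kap x n"
    using cross_err[OF assms(1), of n] cross_commute[of "err x n 3" "err x n 2"]
      cross_commute[of "err x n 3" "err x n 1"]
    by (simp add: lin_def cross_simps kap_def algebra_simps)
  moreover have "0 \<le> 1 + fst ?y + snd ?y" using generic_bounds[OF generic_brun_pow[OF assms(1), of n]] by simp
  ultimately show ?thesis
    using measure_linear_image_prod[OF linear_lin assms(2), of x n] by (simp add: abs_mult)
qed

lemma inj_lin:
  assumes "generic x" "lin x n v = 0"
  shows "v = 0"
proof -
  let ?y = "brun_orbit x n"
  have c: "cross (lin x n (1, 0)) (lin x n (0, 1)) = (1 + fst ?y + snd ?y) * kap x n"
    using cross_err[OF assms(1), of n] cross_commute[of "err x n 3" "err x n 2"]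
      cross_commute[of "err x n 3" "err x n 1"]
    by (simp add: lin_def cross_simps kap_def algebra_simps)
  have "0 < 1 + fst ?y + snd ?y" using generic_bounds[OF generic_brun_pow[OF assms(1), of n]] by simp
  with c kap_nonzero[OF assms(1)] have nz: "cross (lin x n (1, 0)) (lin x n (0, 1)) \<noteq> 0" by simp
  have e: "fst v *\<^sub>R lin x n (1, 0) + snd v *\<^sub>R lin x n (0, 1) = 0"
    using assms(2) by (simp add: lin_def)
  have "cross (fst v *\<^sub>R lin x n (1, 0) + snd v *\<^sub>R lin x n (0, 1)) (lin x n (0, 1)) = 0"
    "cross (lin x n (1, 0)) (fst v *\<^sub>R lin x n (1, 0) + snd v *\<^sub>R lin x n (0, 1)) = 0"
    by (simp_all add: e cross_def)
  then show ?thesis using nz by (simp add: cross_simps prod_eq_iff)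
qed

section \<open>Tiles and their subtiles\<close>

definition len :: "real \<times> real \<Rightarrow> nat \<Rightarrow> 3 \<Rightarrow> int" where
  "len x n j = int (length (subst_upto (brun_Phi x) n [j]))"

text \<open>Planar discrepancy together with a number of letters. Integer combinations of the
  letters form a discrete set in this product although their planar parts are dense.\<close>

type_synonym pos = "(real \<times> real) \<times> int"

definition gam :: "real \<times> real \<Rightarrow> nat \<Rightarrow> 3 \<Rightarrow> pos" where
  "gam x n j = (err x n j, len x n j)"

lemma length_subst_upto: "int (length (subst_upto (brun_Phi x) n w)) = word_sum (len x n) w"
proof (induction w)
  case (Cons a w)
  have "int (length (subst_upto (brun_Phi x) n (a # w))) = len x n a + int (length (subst_upto (brun_Phi x) n w))"
    by (subst subst_upto_Cons) (simp add: len_def)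
  then show ?case by (simp add: Cons)
qed simp

lemma word_sum_gam: "word_sum (gam x n) w = (word_sum (err x n) w, word_sum (len x n) w)"
  by (induction w) (simp_all add: gam_def zero_prod_def)

lemma len_Suc: "len x (Suc n) j = word_sum (len x n) (brun_subst (brun_index (brun_orbit x n)) j)"
  by (simp add: length_subst_upto[symmetric]) (simp add: len_def brun_Phi_def)

lemma gam_Suc: "gam x (Suc n) j = word_sum (gam x n) (brun_subst (brun_index (brun_orbit x n)) j)"
  by (simp add: word_sum_gam gam_def len_Suc err_Suc)

lemma gam_add: "gam x (m + q) j = word_sum (gam x m) (subst_upto (\<lambda>k. brun_Phi x (m + k)) q [j])"
  by (simp add: word_sum_gam gam_def err_def lift_add length_subst_upto[symmetric])
    (simp add: len_def subst_upto_add)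

lemma len_pos: "0 < len x n j"
proof (induction n arbitrary: j)
  case (Suc n)
  show ?case using exhaust_3[of j] exhaust_3[of "brun_index (brun_orbit x n)"] Suc[of 1] Suc[of 2] Suc[of 3]
    by (auto simp: len_Suc add_pos_pos)
qed (simp add: len_def)

lemma word_sum_len_nonneg: "0 \<le> word_sum (len x n) w"
  by (simp add: length_subst_upto[symmetric])

text \<open>A tile of level \<open>n\<close> is a letter \<open>j\<close> placed at a position; it is relevant if the interval
  \<open>[h, h + len x n j)\<close> of its heights contains \<open>0\<close>.\<close>

definition strad :: "real \<times> real \<Rightarrow> nat \<Rightarrow> pos \<Rightarrow> 3 \<Rightarrow> bool" where
  "strad x n g j \<longleftrightarrow> snd g \<le> 0 \<and> 0 < snd g + len x n j"

text \<open>The tile \<open>(g', j)\<close> of level \<open>m + q\<close> is a subtile of the tile \<open>(g, a)\<close> of level \<open>m\<close>.\<close>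

definition desc :: "real \<times> real \<Rightarrow> nat \<Rightarrow> nat \<Rightarrow> pos \<Rightarrow> 3 \<Rightarrow> pos \<Rightarrow> 3 \<Rightarrow> bool" where
  "desc x m q g a g' j \<longleftrightarrow> (\<exists>p s. subst_upto (\<lambda>k. brun_Phi x (m + k)) q [j] = p @ a # s \<and>
     g = g' + word_sum (gam x m) p)"

lemma desc_0: "desc x m 0 g a g j \<longleftrightarrow> a = j"
  by (auto simp: desc_def Cons_eq_append_conv)

text \<open>Heights run opposite to areas: a subtile belongs to a longer word, so its height
  interval contains that of the tile.\<close>

lemma desc_strad:
  assumes "strad x m g a" "desc x m q g a g' j"
  shows "strad x (m + q) g' j"
proof -
  obtain p s where ps: "subst_upto (\<lambda>k. brun_Phi x (m + k)) q [j] = p @ a # s"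
    "g = g' + word_sum (gam x m) p" using assms(2) by (auto simp: desc_def)
  have "gam x (m + q) j = word_sum (gam x m) (p @ a # s)" by (simp add: gam_add ps)
  then have "len x (m + q) j = word_sum (len x m) p + len x m a + word_sum (len x m) s"
    by (simp add: word_sum_gam) (simp add: gam_def)
  moreover have "snd g = snd g' + word_sum (len x m) p" by (simp add: ps word_sum_gam)
  ultimately show ?thesis using assms(1) word_sum_len_nonneg[of x m p] word_sum_len_nonneg[of x m s]
    by (auto simp: strad_def)
qed

text \<open>The height intervals of the letters of one word are disjoint, so only one of them
  contains 0. Together with \<open>desc_exists\<close> this makes ancestry a function on relevant
  tiles.\<close>

lemma desc_unique:
  assumes "desc x m q g1 a1 g' j" "desc x m q g2 a2 g' j" "strad x m g1 a1" "strad x m g2 a2"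
  shows "g1 = g2 \<and> a1 = a2"
proof -
  obtain p1 s1 where 1: "subst_upto (\<lambda>k. brun_Phi x (m + k)) q [j] = p1 @ a1 # s1"
    "g1 = g' + word_sum (gam x m) p1" using assms(1) by (auto simp: desc_def)
  obtain p2 s2 where 2: "subst_upto (\<lambda>k. brun_Phi x (m + k)) q [j] = p2 @ a2 # s2"
    "g2 = g' + word_sum (gam x m) p2" using assms(2) by (auto simp: desc_def)
  have no: False if h: "p1 @ a1 # s1 = p2 @ a2 # s2" "length p1 < length p2"
    "g1 = g' + word_sum (gam x m) p1" "g2 = g' + word_sum (gam x m) p2" "strad x m g1 a1" "strad x m g2 a2"
    for p1 a1 s1 p2 a2 s2 g1 g2
  proof -
    obtain us where us: "p2 = p1 @ us"
      using h(1,2) by (auto simp: append_eq_append_conv2)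
    with h obtain us' where "us = a1 # us'" by (cases us) auto
    then have "snd g2 = snd g1 + len x m a1 + word_sum (len x m) us'"
      using h(3,4) us by (simp add: word_sum_gam) (simp add: gam_def)
    then show False using h(5,6) word_sum_len_nonneg[of x m us'] by (auto simp: strad_def)
  qed
  have "p1 @ a1 # s1 = p2 @ a2 # s2" using 1 2 by simp
  moreover have "length p1 = length p2"
    using no[of p1 a1 s1 p2 a2 s2 g1 g2] no[of p2 a2 s2 p1 a1 s1 g2 g1] 1 2 assms(3,4)
    by (metis linorder_neqE_nat)
  ultimately show ?thesis using 1(2) 2(2) by simp
qed

lemma strad_word:
  assumes "h \<le> 0" "0 < h + word_sum (len x m) w"
  shows "\<exists>p a s. w = p @ a # s \<and> h + word_sum (len x m) p \<le> 0 \<and> 0 < h + word_sum (len x m) p + len x m a"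
  using assms
proof (induction w arbitrary: h)
  case (Cons b w)
  show ?case
  proof (cases "0 < h + len x m b")
    case True
    then show ?thesis using Cons.prems by (intro exI[of _ "[]"] exI[of _ b] exI[of _ w]) simp
  next
    case False
    then obtain p a s where "w = p @ a # s" "h + len x m b + word_sum (len x m) p \<le> 0"
       "0 < h + len x m b + word_sum (len x m) p + len x m a"
      using Cons.IH[of "h + len x m b"] Cons.prems by (auto simp: add.assoc)
    then show ?thesis by (intro exI[of _ "b # p"] exI[of _ a] exI[of _ s]) (simp add: add.assoc)
  qed
qed simp

lemma desc_exists:
  assumes "strad x (m + q) g' j"
  shows "\<exists>g a. desc x m q g a g' j \<and> strad x m g a"
proof -
  have "len x (m + q) j = word_sum (len x m) (subst_upto (\<lambda>k. brun_Phi x (m + k)) q [j])"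
    using gam_add[of x m q j] by (simp add: word_sum_gam gam_def)
  with assms obtain p a s where "subst_upto (\<lambda>k. brun_Phi x (m + k)) q [j] = p @ a # s"
    "snd g' + word_sum (len x m) p \<le> 0" "0 < snd g' + word_sum (len x m) p + len x m a"
    using strad_word[of "snd g'" x m] unfolding strad_def by metis
  then show ?thesis
    by (intro exI[of _ "g' + word_sum (gam x m) p"] exI[of _ a]) (auto simp: desc_def strad_def word_sum_gam)
qed

lemma desc_trans:
  assumes "desc x m q g a g' j" "desc x (m + q) r g' j g'' k"
  shows "desc x m (q + r) g a g'' k"
proof -
  let ?\<sigma> = "\<lambda>k. brun_Phi x (m + k)"
  obtain p1 s1 where 1: "subst_upto ?\<sigma> q [j] = p1 @ a # s1"
    "g = g' + word_sum (gam x m) p1" using assms(1) by (auto simp: desc_def)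
  obtain p2 s2 where 2: "subst_upto (\<lambda>k. brun_Phi x (m + q + k)) r [k] = p2 @ j # s2"
    "g' = g'' + word_sum (gam x (m + q)) p2" using assms(2) by (auto simp: desc_def)
  have "word_sum (gam x (m + q)) p2 = word_sum (gam x m) (subst_upto ?\<sigma> q p2)"
  proof (induction p2)
    case (Cons b p)
    have "word_sum (gam x m) (subst_upto ?\<sigma> q (b # p)) = gam x (m + q) b + word_sum (gam x m) (subst_upto ?\<sigma> q p)"
      by (subst subst_upto_Cons) (simp add: gam_add)
    then show ?case by (simp add: Cons)
  qed simp
  moreover have "subst_upto ?\<sigma> (q + r) [k] = subst_upto ?\<sigma> q p2 @ p1 @ a # s1 @ subst_upto ?\<sigma> q s2"
    using 2(1) by (subst subst_upto_add) (simp add: add.assoc, subst subst_upto_Cons, simp add: 1)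
  ultimately show ?thesis unfolding desc_def using 1(2) 2(2)
    by (intro exI[of _ "subst_upto ?\<sigma> q p2 @ p1"] exI[of _ "s1 @ subst_upto ?\<sigma> q s2"]) (simp add: algebra_simps)
qed

section \<open>Integer coordinates with respect to the letters of a level\<close>

definition comb :: "real \<times> real \<Rightarrow> nat \<Rightarrow> int3 \<Rightarrow> pos" where
  "comb x n z = (case z of (a, b, c) \<Rightarrow>
     (real_of_int a *\<^sub>R err x n 1 + real_of_int b *\<^sub>R err x n 2 + real_of_int c *\<^sub>R err x n 3,
      a * len x n 1 + b * len x n 2 + c * len x n 3))"

definition unit3 :: "3 \<Rightarrow> int3" where
  "unit3 j = (of_bool (j = 1), of_bool (j = 2), of_bool (j = 3))"

lemma comb_add: "comb x n (y + z) = comb x n y + comb x n z"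
  and comb_diff: "comb x n (y - z) = comb x n y - comb x n z"
  and comb_0 [simp]: "comb x n 0 = 0"
  by (auto simp: comb_def algebra_simps zero_prod_def split: prod.splits)

lemma comb_unit3: "comb x n (unit3 j) = gam x n j"
  using exhaust_3[of j] by (auto simp: comb_def unit3_def gam_def)

lemma comb_Suc_M3:
  "brun_index (brun_orbit x n) = 3 \<Longrightarrow> comb x (Suc n) z = comb x n (M3 z)"
  by (auto simp: comb_def M3_def err_Suc len_Suc algebra_simps split: prod.splits)

lemma comb_add_M3:
  assumes "\<And>k. k < r \<Longrightarrow> brun_index (brun_orbit x (m + k)) = 3"
  shows "comb x (m + r) z = comb x m ((M3 ^^ r) z)"
  using assms
proof (induction r arbitrary: z)
  case (Suc r)
  have "comb x (m + Suc r) z = comb x (m + r) (M3 z)" using Suc.prems[of r] by (simp add: comb_Suc_M3)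
  also have "\<dots> = comb x m ((M3 ^^ r) (M3 z))" using Suc by simp
  finally show ?case by (simp add: funpow_swap1)
qed simp

text \<open>The three Brun matrices are invertible over the integers; the inverse is written out in
  each case.\<close>

lemma range_comb_Suc: "range (comb x (Suc n)) = range (comb x n)"
proof -
  have 1: "comb x (Suc n) (a, b, c) = comb x n (a, b, b + c)" "comb x n (a, b, c) = comb x (Suc n) (a, b, c - b)"
    if "brun_index (brun_orbit x n) = 1" for a b c
    using that by (auto simp: comb_def err_Suc len_Suc algebra_simps)
  have 2: "comb x (Suc n) (a, b, c) = comb x n (a, c, b + c)" "comb x n (a, b, c) = comb x (Suc n) (a, c - b, b)"
    if "brun_index (brun_orbit x n) = 2" for a b c
    using that by (auto simp: comb_def err_Suc len_Suc algebra_simps)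
  have 3: "comb x (Suc n) (a, b, c) = comb x n (b, c, a + c)" "comb x n (a, b, c) = comb x (Suc n) (c - b, a, b)"
    if "brun_index (brun_orbit x n) = 3" for a b c
    using that by (auto simp: comb_def err_Suc len_Suc algebra_simps)
  have "comb x (Suc n) z \<in> range (comb x n) \<and> comb x n z \<in> range (comb x (Suc n))" for z
  proof -
    obtain a b c where z: "z = (a, b, c)" by (cases z)
    consider "brun_index (brun_orbit x n) = 1" | "brun_index (brun_orbit x n) = 2" | "brun_index (brun_orbit x n) = 3"
      using exhaust_3 by blast
    then show ?thesis unfolding z by cases (metis 1 rangeI, metis 2 rangeI, metis 3 rangeI)
  qed
  then show ?thesis by auto
qed

lemma range_comb: "range (comb x n) = range (comb x 0)"
  by (induction n) (simp_all add: range_comb_Suc)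

lemma ht3_unit3: "ht3 (unit3 1) = rootp" "ht3 (unit3 2) = rootp ^ 2" "ht3 (unit3 3) = 1" "ht3 (unit3 j) \<le> 1"
  using rootp(1,2) rootp_sq exhaust_3[of j] by (auto simp: ht3_def unit3_def)

text \<open>After \<open>q\<close> steps of index 3 the sign of the limit height decides the sign of
  every coordinate.\<close>

definition sign_ok :: "nat \<Rightarrow> int3 \<Rightarrow> bool" where
  "sign_ok q z \<longleftrightarrow> (\<forall>n\<ge>q. (0 < ht3 z \<longrightarrow> pos3 ((M3 ^^ n) z)) \<and> (ht3 z < 0 \<longrightarrow> pos3 ((M3 ^^ n) (- z))))"

lemma sign_ok_exists: "\<exists>q. sign_ok q z"
proof -
  obtain q1 where "0 < ht3 z \<Longrightarrow> \<forall>n\<ge>q1. pos3 ((M3 ^^ n) z)" using ht3_pos_eventually by blast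
  moreover obtain q2 where "0 < ht3 (- z) \<Longrightarrow> \<forall>n\<ge>q2. pos3 ((M3 ^^ n) (- z))" using ht3_pos_eventually by blast
  ultimately show ?thesis by (intro exI[of _ "max q1 q2"]) (auto simp: sign_ok_def ht3_minus)
qed

lemma sign_ok_mono: "sign_ok q z \<Longrightarrow> q \<le> r \<Longrightarrow> sign_ok r z"
  by (auto simp: sign_ok_def)

lemma sign_ok_finite:
  assumes "finite S"
  shows "\<exists>q. \<forall>z\<in>S. sign_ok q z"
  using assms
proof induction
  case (insert z S)
  then obtain q where q: "\<forall>z\<in>S. sign_ok q z" by blast
  obtain r where r: "sign_ok r z" using sign_ok_exists by blast
  show ?case by (rule exI[of _ "max q r"]) (use q r in \<open>auto intro: sign_ok_mono\<close>)
qed simp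

lemma snd_comb_pos3: "pos3 z \<Longrightarrow> snd (comb x n z) \<ge> len x n 3"
proof -
  assume "pos3 z"
  then obtain a b c where z: "z = (a, b, c)" "1 \<le> a" "1 \<le> b" "1 \<le> c"
    by (cases z) (auto simp: pos3_def)
  have "0 \<le> a * len x n 1" "0 \<le> b * len x n 2" "1 * len x n 3 \<le> c * len x n 3"
    using z len_pos[of x n] by (auto intro!: mult_nonneg_nonneg mult_right_mono simp: less_imp_le)
  then show ?thesis by (simp add: comb_def z)
qed

text \<open>Rewritten at level \<open>m\<close>, a vector of nonzero limit height has all
  coordinates of one sign, so its true height is at least \<open>len x m 3\<close> in absolute
  value. This outweighs the reference height \<open>snd T\<close>, and containing height 0 can be
  read off from \<open>ht3\<close>.\<close>

lemma strad_sign: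
  assumes "strad x (m + r) g j" "g + gam x (m + r) j = T + comb x (m + r) z"
    and "0 < snd T" "snd T \<le> len x m 3"
    and "\<And>k. k < r \<Longrightarrow> brun_index (brun_orbit x (m + k)) = 3"
    and "sign_ok r z" "sign_ok r (z - unit3 j)"
  shows "0 \<le> ht3 z" "ht3 (z - unit3 j) < 0"
proof -
  have M: "comb x (m + r) y = comb x m ((M3 ^^ r) y)" for y
    by (rule comb_add_M3) (rule assms(5))
  have L: "len x m 3 \<le> snd (comb x (m + r) y)" if "pos3 ((M3 ^^ r) y)" for y
    unfolding M by (rule snd_comb_pos3[OF that])
  have s: "snd g + len x (m + r) j = snd T + snd (comb x (m + r) z)"
    using arg_cong[OF assms(2), of snd] by (simp add: gam_def)
  show "0 \<le> ht3 z"
  proof (rule ccontr)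
    assume "\<not> 0 \<le> ht3 z"
    then have "pos3 ((M3 ^^ r) (- z))" using assms(6) by (simp add: sign_ok_def)
    then have "len x m 3 \<le> snd (comb x (m + r) (- z))" by (rule L)
    also have "comb x (m + r) (- z) = - comb x (m + r) z" using comb_diff[of x "m + r" 0 z] by simp
    finally show False using assms(1,3,4) s by (simp add: strad_def)
  qed
  have g: "g = T + comb x (m + r) (z - unit3 j)" using assms(2) by (simp add: comb_diff comb_unit3 algebra_simps)
  show "ht3 (z - unit3 j) < 0"
  proof (rule ccontr)
    assume "\<not> ht3 (z - unit3 j) < 0"
    then consider "ht3 (z - unit3 j) = 0" | "0 < ht3 (z - unit3 j)" by linarith
    then have "0 \<le> snd (comb x (m + r) (z - unit3 j))"
    proof cases
      case 1
      then have "z - unit3 j = 0" by (rule ht3_eq_0)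
      then show ?thesis by simp
    next
      case 2
      then have "pos3 ((M3 ^^ r) (z - unit3 j))" using assms(7) by (simp add: sign_ok_def)
      then have "len x m 3 \<le> snd (comb x (m + r) (z - unit3 j))" by (rule L)
      then show ?thesis using len_pos[of x m 3] by simp
    qed
    then show False using assms(1,3) unfolding g by (simp add: strad_def)
  qed
qed

lemma ht3_M3_less: "ht3 (M3 z) < 1 \<longleftrightarrow> ht3 z < rootp"
proof -
  have "ht3 (M3 z) = ht3 z / rootp" using ht3_M3[of z] rootp(1) by (simp add: field_simps)
  then show ?thesis using rootp(1) by simp
qed

text \<open>Tiles are located by their end points, because in an image under
  \<open>brun_subst 3\<close> any letter is followed by nothing or by a single final 3. These two
  cases are the two branches of \<open>greedy3\<close>.\<close>

lemma desc_step3: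
  assumes i: "brun_index (brun_orbit x n) = 3" and s: "strad x (Suc n) g j"
    and t: "g + gam x (Suc n) j = T + comb x (Suc n) z"
  shows "\<exists>g' a z'. desc x n 1 g' a g j \<and> strad x n g' a \<and> g' + gam x n a = T + comb x n z' \<and>
    (z' = M3 z \<or> z' = M3 z - unit3 3)"
proof -
  have "strad x (n + 1) g j" using s by simp
  then obtain g' a where d: "desc x n 1 g' a g j" "strad x n g' a" using desc_exists by blast
  then obtain p s where ps: "brun_subst 3 j = p @ a # s" "g' = g + word_sum (gam x n) p"
    by (auto simp: desc_def brun_Phi_def i subst_word_def)
  have "gam x (Suc n) j = word_sum (gam x n) (p @ a # s)" by (simp add: gam_Suc i ps)
  then have e: "g' + gam x n a = T + comb x n (M3 z) - word_sum (gam x n) s"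
    using t by (simp add: ps comb_Suc_M3[OF i] algebra_simps)
  have "s = [] \<or> s = [3]"
    using ps(1) exhaust_3[of j] by (auto simp: Cons_eq_append_conv append_eq_Cons_conv)
  then show ?thesis
  proof
    assume "s = []"
    then show ?thesis using d e by (intro exI[of _ g'] exI[of _ a] exI[of _ "M3 z"]) simp
  next
    assume "s = [3]"
    then have "g' + gam x n a = T + comb x n (M3 z - unit3 3)"
      using e by (simp add: comb_diff comb_unit3)
    then show ?thesis using d by blast
  qed
qed

text \<open>Already the square of \<open>brun_subst 3\<close> sends the letters to 23, 3 and
  123.\<close>

lemma subst_upto_3_last:
  assumes "\<And>k. k < Suc (Suc r) \<Longrightarrow> \<sigma> k = brun_subst 3"
  shows "\<exists>p. subst_upto \<sigma> (Suc (Suc r)) [j] = p @ [3]"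
  using assms
proof (induction r arbitrary: j)
  case 0
  then show ?case using exhaust_3[of j] by (auto simp: subst_word_def)
next
  case (Suc r)
  have "\<exists>w b. brun_subst 3 j = w @ [b]" using exhaust_3[of j] by auto
  then obtain w b where w: "brun_subst 3 j = w @ [b]" by blast
  obtain p where "subst_upto \<sigma> (Suc (Suc r)) [b] = p @ [3]" using Suc by auto
  moreover have "subst_upto \<sigma> (Suc (Suc (Suc r))) [j] = subst_upto \<sigma> (Suc (Suc r)) (w @ [b])"
    using Suc.prems[of "Suc (Suc r)"] w by (simp add: subst_word_def)
  ultimately show ?case by (simp del: subst_upto.simps)
qed

lemma greedy3_zero [simp]: "greedy3 0 = 0"
  using rootp(1) by (simp add: greedy3_def M3_def zero_prod_def ht3_def)

lemma greedy3_pow_zero_mono: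
  assumes "(greedy3 ^^ k) z = 0" "k \<le> l"
  shows "(greedy3 ^^ l) z = 0"
proof -
  have "(greedy3 ^^ n) 0 = 0" for n by (induction n) auto
  moreover obtain d where "l = d + k" using assms(2) by (metis add.commute le_Suc_ex)
  ultimately show ?thesis using assms(1) by (simp add: funpow_add)
qed

text \<open>Of the two possible end points at each step, a relevant tile can only have the one of
  limit height in [0, 1). Going down the levels is therefore the greedy expansion of the end
  point.\<close>

lemma desc_greedy:
  assumes "strad x (m + r + k) g j" "g + gam x (m + r + k) j = T + comb x (m + r + k) z"
    and T: "0 < snd T" "snd T \<le> len x m 3"
    and ix: "\<And>i. i < r + k \<Longrightarrow> brun_index (brun_orbit x (m + i)) = 3"
    and z: "0 \<le> ht3 z" "ht3 z < 1"
    and ok: "\<And>l j y. l < k \<Longrightarrow> y \<in> {M3 ((greedy3 ^^ l) z), M3 ((greedy3 ^^ l) z) - unit3 3} \<Longrightarrow>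
       sign_ok r y \<and> sign_ok r (y - unit3 j)"
  shows "\<exists>g' a. desc x (m + r) k g' a g j \<and> g' + gam x (m + r) a = T + comb x (m + r) ((greedy3 ^^ k) z)"
  using assms(1,2) ix z ok
proof (induction k arbitrary: g j z)
  case 0
  then show ?case by (intro exI[of _ g] exI[of _ j]) (simp add: desc_0)
next
  case (Suc k)
  let ?n = "m + r + k"
  have n: "m + r + Suc k = Suc ?n" by simp
  have i: "brun_index (brun_orbit x ?n) = 3" using Suc.prems(3)[of "r + k"] by (simp add: add.assoc)
  obtain g' a z' where d: "desc x ?n 1 g' a g j" "strad x ?n g' a" "g' + gam x ?n a = T + comb x ?n z'"
    "z' = M3 z \<or> z' = M3 z - unit3 3"
    using desc_step3[OF i Suc.prems(1,2)[unfolded n]] by blast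
  have ok: "sign_ok (r + k) z'" "sign_ok (r + k) (z' - unit3 a)"
    using Suc.prems(6)[of 0 z' a] d(4) by (auto intro: sign_ok_mono)
  have "0 \<le> ht3 z'" "ht3 (z' - unit3 a) < 0"
    using strad_sign[of x m "r + k" g' a T z'] d(2,3) T ok Suc.prems(3) by (auto simp: add.assoc)
  then have h: "0 \<le> ht3 z'" "ht3 z' < 1" using ht3_unit3(4)[of a] by (auto simp: ht3_diff)
  have "z' = greedy3 z"
  proof (cases "z' = M3 z")
    case True
    then have "ht3 z < rootp" using h ht3_M3_less[of z] by simp
    then show ?thesis using True by (simp add: greedy3_def)
  next
    case False
    then have e: "z' = M3 z - unit3 3" using d(4) by simp
    then have "\<not> ht3 z < rootp" using h ht3_M3_less[of z] by (simp add: ht3_diff ht3_unit3)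
    then show ?thesis using e by (simp add: greedy3_def unit3_def)
  qed
  then have "\<exists>g'' b. desc x (m + r) k g'' b g' a \<and> g'' + gam x (m + r) b = T + comb x (m + r) ((greedy3 ^^ k) z')"
  proof (intro Suc.IH)
    show "sign_ok r y \<and> sign_ok r (y - unit3 j)"
      if "l < k" "y \<in> {M3 ((greedy3 ^^ l) z'), M3 ((greedy3 ^^ l) z') - unit3 3}" for l j y
      using Suc.prems(6)[of "Suc l" y j] that \<open>z' = greedy3 z\<close> by (simp add: funpow_swap1)
  qed (use d h Suc.prems(3) in auto)
  then obtain g'' b where "desc x (m + r) k g'' b g' a"
     "g'' + gam x (m + r) b = T + comb x (m + r) ((greedy3 ^^ k) (greedy3 z))"
    using \<open>z' = greedy3 z\<close> by blast
  moreover from this(1) d(1) have "desc x (m + r) (k + 1) g'' b g j" by (intro desc_trans)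
  moreover have "(greedy3 ^^ Suc k) z = (greedy3 ^^ k) (greedy3 z)" by (simp add: funpow_swap1)
  ultimately show ?case by (intro exI[of _ g''] exI[of _ b]) simp
qed

text \<open>After a long run of \<open>\<beta>\<^sub>3\<close> every relevant tile contains a subtile all of whose neighbours,
  within the bounded region described by \<open>Y\<close>, belong to the same tile.\<close>

lemma deep_tile:
  assumes "finite (Y :: int3 set)"
  shows "\<exists>N\<ge>n0. \<forall>x m g i. (\<forall>k<N. brun_index (brun_orbit x (m + k)) = 3) \<longrightarrow> strad x m g i \<longrightarrow>
    (\<exists>g0. desc x m N g i g0 3 \<and> (\<forall>g' j z. strad x (m + N) g' j \<longrightarrow> z \<in> Y \<longrightarrow>
       g' + gam x (m + N) j = g0 + gam x (m + N) 3 + comb x (m + N) z \<longrightarrow> desc x m N g i g' j))"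
proof -
  \<comment> \<open>Relevant tiles have relative end points of limit height in [0, 1); for these the
    greedy orbit is finite.\<close>
  define Y' where "Y' = {z \<in> Y. 0 \<le> ht3 z \<and> ht3 z < 1}"
  have Y': "finite Y'" using assms by (simp add: Y'_def)
  have "\<forall>z\<in>Y'. \<exists>k. (greedy3 ^^ k) z = 0" using greedy3_vanish by (auto simp: Y'_def)
  then obtain kf where kf: "\<And>z. z \<in> Y' \<Longrightarrow> (greedy3 ^^ kf z) z = 0" by metis
  define K where "K = Max (insert 0 (kf ` Y'))"
  have K: "(greedy3 ^^ K) z = 0" if "z \<in> Y'" for z
    using kf[OF that] by (rule greedy3_pow_zero_mono) (use that Y' in \<open>auto simp: K_def\<close>)
  define Or where "Or = (\<Union>l\<le>K. (greedy3 ^^ l) ` Y')"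
  define S where "S = Y \<union> M3 ` Or \<union> (\<lambda>z. M3 z - unit3 3) ` Or"
  have "finite (S \<union> (\<Union>j. (\<lambda>y. y - unit3 j) ` S))"
    using assms Y' by (auto simp: S_def Or_def)
  then obtain q where q: "\<forall>y\<in>S \<union> (\<Union>j. (\<lambda>y. y - unit3 j) ` S). sign_ok q y" using sign_ok_finite by blast
  \<comment> \<open>\<open>q\<close> makes all signs decisive, 2 makes the words of these levels end
    in the letter 3, and \<open>n0\<close> yields the required lower bound on
    \<open>N\<close>.\<close>
  define r where "r = q + n0 + 2"
  have ok: "sign_ok s y \<and> sign_ok s (y - unit3 j)" if "y \<in> S" "r \<le> s" for y j s
    using q that by (auto simp: r_def intro!: sign_ok_mono[of q _ s])
  \<comment> \<open>Seen from the top: \<open>K\<close> steps for the greedy orbits to reach 0,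
    \<open>r\<close> steps of decisive signs and common last letter, and 2 steps because the second
    image of 3 is 123 and contains every letter \<open>i\<close>.\<close>
  define N where "N = 2 + (r + K)"
  have "\<exists>g0. desc x m N g i g0 3 \<and> (\<forall>g' j z. strad x (m + N) g' j \<longrightarrow> z \<in> Y \<longrightarrow>
       g' + gam x (m + N) j = g0 + gam x (m + N) 3 + comb x (m + N) z \<longrightarrow> desc x m N g i g' j)"
    if ix: "\<forall>k<N. brun_index (brun_orbit x (m + k)) = 3" and st: "strad x m g i" for x m g i
  proof -
    let ?m = "m + 2"
    have sig: "brun_Phi x (m + k) = brun_subst 3" if "k < N" for k using ix that by (simp add: brun_Phi_def)
    have "subst_upto (\<lambda>k. brun_Phi x (m + k)) 2 [3] = [1, 2, 3]"
      using sig[of 0] sig[of 1] by (simp add: numeral_2_eq_2 N_def subst_word_def)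
    moreover have "\<exists>p s. [1, 2, 3] = p @ i # s" using exhaust_3[of i] by (auto simp: Cons_eq_append_conv)
    ultimately obtain p s where "subst_upto (\<lambda>k. brun_Phi x (m + k)) 2 [3] = p @ i # s" by metis
    then have d1: "desc x m 2 g i (g - word_sum (gam x m) p) 3" by (auto simp: desc_def)
    define g1 where "g1 = g - word_sum (gam x m) p"
    have s1: "strad x ?m g1 3" using desc_strad[OF st d1] by (simp add: g1_def)
    define T where "T = g1 + gam x ?m 3"
    have T: "0 < snd T" "snd T \<le> len x ?m 3" using s1 by (auto simp: strad_def T_def gam_def)
    \<comment> \<open>Tiles ending at \<open>T\<close> have the same last letter 3 whatever their
      own letter is; hence they all lie below \<open>(g1, 3)\<close>.\<close>
    have last: "desc x ?m n g1 3 g' j" if "2 \<le> n" "n \<le> r + K" "g' + gam x (?m + n) j = T" for n g' j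
    proof -
      define n' where "n' = n - 2"
      have n': "n = Suc (Suc n')" using that(1) unfolding n'_def by arith
      have "\<exists>p. subst_upto (\<lambda>k. brun_Phi x (?m + k)) n [j] = p @ [3]"
        unfolding n'
      proof (rule subst_upto_3_last)
        fix k assume "k < Suc (Suc n')"
        then show "brun_Phi x (m + 2 + k) = brun_subst 3" using sig[of "2 + k"] that(2) by (simp add: N_def n' add.assoc)
      qed
      then obtain p where p: "subst_upto (\<lambda>k. brun_Phi x (?m + k)) n [j] = p @ [3]" by blast
      then have "gam x (?m + n) j = word_sum (gam x ?m) p + gam x ?m 3" by (subst gam_add) simp
      then have "g1 = g' + word_sum (gam x ?m) p" using that(3) by (simp add: T_def algebra_simps)
      then show ?thesis using p by (auto simp: desc_def)
    qed
    have mN: "m + N = ?m + (r + K)" by (simp add: N_def)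
    define g0 where "g0 = T - gam x (m + N) 3"
    have d2: "desc x ?m (r + K) g1 3 g0 3" by (rule last) (simp_all add: r_def g0_def mN)
    have d3: "desc x m N g i g' j" if "desc x ?m (r + K) g1 3 g' j" for g' j
      using desc_trans[OF d1[folded g1_def] that] by (simp add: N_def)
    show ?thesis
    proof (intro exI[of _ g0] conjI allI impI)
      show "desc x m N g i g0 3" using d2 by (rule d3)
      fix g' j z
      assume s': "strad x (m + N) g' j" and z: "z \<in> Y"
        and t: "g' + gam x (m + N) j = g0 + gam x (m + N) 3 + comb x (m + N) z"
      have t': "g' + gam x (?m + (r + K)) j = T + comb x (?m + (r + K)) z" using t by (simp add: g0_def mN)
      have ix': "brun_index (brun_orbit x (?m + k)) = 3" if "k < r + K" for k
        using ix that by (simp add: N_def add.assoc del: add_2_eq_Suc add_2_eq_Suc')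
      have zS: "z \<in> S" using z by (simp add: S_def)
      have "0 \<le> ht3 z" "ht3 (z - unit3 j) < 0"
        using strad_sign[of x ?m "r + K" g' j T z] s' t' T ix' ok[OF zS, of "r + K" j] by (auto simp: mN)
      then have zY: "z \<in> Y'" using z ht3_unit3(4)[of j] by (auto simp: Y'_def ht3_diff)
      have "\<exists>g'' a. desc x (?m + r) K g'' a g' j \<and> g'' + gam x (?m + r) a = T + comb x (?m + r) ((greedy3 ^^ K) z)"
      proof (rule desc_greedy)
        show "sign_ok r y \<and> sign_ok r (y - unit3 j)"
          if "l < K" "y \<in> {M3 ((greedy3 ^^ l) z), M3 ((greedy3 ^^ l) z) - unit3 3}" for l j y
        proof -
          have "(greedy3 ^^ l) z \<in> Or" using that(1) zY unfolding Or_def by (intro UN_I[of l]) auto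
          then have "y \<in> S" using that(2) unfolding S_def by blast
          then show ?thesis by (intro ok) auto
        qed
      qed (use s' t' T ix' zY in \<open>auto simp: mN Y'_def add.assoc\<close>)
      then obtain g'' a where d4: "desc x (?m + r) K g'' a g' j" "g'' + gam x (?m + r) a = T"
        using K[OF zY] by auto
      have "desc x ?m r g1 3 g'' a" by (rule last) (use d4 in \<open>auto simp: r_def\<close>)
      then have "desc x ?m (r + K) g1 3 g' j" using d4(1) by (rule desc_trans)
      then show "desc x m N g i g' j" by (rule d3)
    qed
  qed
  moreover have "n0 \<le> N" by (simp add: N_def r_def)
  ultimately show ?thesis by blast
qed

section \<open>The accelerated algorithm and its invariant cone of densities\<close>

text \<open>The Brun map accelerated over runs of index 1: a block \<open>(k, b)\<close> stands for \<open>k - 1\<close> indices 1 followed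
  by index 2 if \<open>b\<close> holds and by index 3 otherwise.\<close>

definition gmap :: "real \<times> real \<Rightarrow> real \<times> real" where
  "gmap x = (min (frac (1 / snd x)) (fst x / snd x), max (frac (1 / snd x)) (fst x / snd x))"

definition gblk :: "real \<times> real \<Rightarrow> nat \<times> bool" where
  "gblk x = (nat \<lfloor>1 / snd x\<rfloor>, fst x / snd x \<le> frac (1 / snd x))"

fun bl :: "nat \<Rightarrow> real \<times> real \<Rightarrow> (nat \<times> bool) list" where
  "bl 0 x = []" | "bl (Suc n) x = gblk x # bl n (gmap x)"

lemma bl_add: "bl (m + n) x = bl m x @ bl n ((gmap ^^ m) x)"
  by (induction m arbitrary: x) (simp_all add: funpow_swap1)

lemma length_bl [simp]: "length (bl n x) = n"
  by (induction n arbitrary: x) simp_all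

lemma gmap_measurable [measurable]: "gmap \<in> borel \<rightarrow>\<^sub>M borel"
  unfolding gmap_def frac_def borel_prod[symmetric] by measurable

lemma gblk_measurable [measurable]: "gblk \<in> borel \<rightarrow>\<^sub>M count_space UNIV"
proof -
  have "(\<lambda>x :: real \<times> real. nat \<lfloor>1 / snd x\<rfloor>) \<in> borel \<rightarrow>\<^sub>M count_space UNIV"
    unfolding borel_prod[symmetric] by measurable
  moreover have "(\<lambda>x :: real \<times> real. fst x / snd x \<le> frac (1 / snd x)) \<in> borel \<rightarrow>\<^sub>M count_space UNIV"
    unfolding frac_def borel_prod[symmetric] by measurable
  ultimately have "gblk \<in> borel \<rightarrow>\<^sub>M (count_space UNIV \<Otimes>\<^sub>M count_space UNIV)"
    unfolding gblk_def by (rule measurable_Pair)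
  then show ?thesis by (simp add: pair_measure_countable)
qed

lemma gmap_pow_measurable [measurable]: "(gmap ^^ n) \<in> borel \<rightarrow>\<^sub>M borel"
  by (induction n) (auto intro: measurable_comp)

lemma bl_measurable [measurable]: "bl n \<in> borel \<rightarrow>\<^sub>M count_space UNIV"
proof (induction n)
  case (Suc n)
  have 1: "bl n \<circ> gmap \<in> borel \<rightarrow>\<^sub>M count_space UNIV" using gmap_measurable Suc by (rule measurable_comp)
  have "(\<lambda>x. (gblk x, bl n (gmap x))) \<in> borel \<rightarrow>\<^sub>M (count_space UNIV \<Otimes>\<^sub>M count_space UNIV)"
    using gblk_measurable 1 by (intro measurable_Pair) (auto simp: comp_def)
  then have "(\<lambda>x. (gblk x, bl n (gmap x))) \<in> borel \<rightarrow>\<^sub>M count_space UNIV"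
    by (simp add: pair_measure_countable)
  then have "case_prod (#) \<circ> (\<lambda>x. (gblk x, bl n (gmap x))) \<in> borel \<rightarrow>\<^sub>M count_space UNIV"
    by (rule measurable_comp) simp
  then show ?case by (simp add: comp_def)
qed simp

type_synonym row = "real \<times> real \<times> real"

text \<open>Branches of the acceleration map Lebesgue measure to densities of this form; on \<open>cone\<close>, which they
  preserve, the distortion of the densities is bounded.\<close>

definition dens :: "row \<Rightarrow> real \<times> real \<Rightarrow> ennreal" where
  "dens r y = (case r of (a, b, c) \<Rightarrow> ennreal (1 / (a * fst y + b * snd y + c) ^ 3))"

text \<open>With 1 / x2 = k + w and x1 / x2 = v, the denominator a x1 + b x2 + c becomes (a v + c w
  + (b + k c)) / (k + w). The flag tells whether (v, w) or (w, v) is the sorted new point.\<close>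

definition blk_row :: "nat \<times> bool \<Rightarrow> row \<Rightarrow> row" where
  "blk_row g r = (case r of (a, b, c) \<Rightarrow> if snd g then (a, c, b + real (fst g) * c) else (c, a, b + real (fst g) * c))"

definition cone :: "row set" where
  "cone = {(a, b, c). 0 \<le> a \<and> 0 \<le> b \<and> b \<le> c \<and> a \<le> b + c \<and> 0 < c}"

text \<open>The inequality a <= b + c is what gives b <= c after a swap. It is needed that blocks
  have length at least 1, hence the \<open>Suc k\<close>.\<close>

lemma mat_cone:
  assumes "r \<in> cone"
  shows "blk_row (Suc k, t) r \<in> cone"
proof -
  obtain a b c where r: "r = (a, b, c)" "0 \<le> a" "0 \<le> b" "b \<le> c" "a \<le> b + c" "0 < c"
    using assms by (auto simp: cone_def)
  define d where "d = real k * c"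
  have "real (Suc k) * c = d + c" "0 \<le> d" using r by (simp_all add: d_def algebra_simps)
  then show ?thesis using r by (auto simp: blk_row_def cone_def simp del: of_nat_Suc)
qed

lemma dens_measurable [measurable]: "dens r \<in> borel_measurable borel"
  unfolding dens_def by (cases r) (simp add: borel_prod[symmetric])

definition gint :: "row \<Rightarrow> (real \<times> real \<Rightarrow> ennreal) \<Rightarrow> ennreal" where
  "gint r F = (\<integral>\<^sup>+x. F x * indicator Delta2 x * dens r x \<partial>lborel)"

section \<open>Change of variables on the branches\<close>

lemma nn_integral_inverse_subst:
  fixes f :: "real \<Rightarrow> ennreal"
  assumes [measurable]: "f \<in> borel_measurable borel" and "1 \<le> (k::real)"
  shows "(\<integral>\<^sup>+s. f s * indicator {1/(k+1)..1/k} s \<partial>lborel) =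
    (\<integral>\<^sup>+w. f (1 / (k + w)) * ennreal (1 / (k + w)^2) * indicator {0..1} w \<partial>lborel)"
proof -
  \<comment> \<open>Written in u = 1 - w, since the substitution has to be increasing.\<close>
  have "(\<integral>\<^sup>+s. f s * indicator {1/(k+1-0)..1/(k+1-1)} s \<partial>lborel) =
    (\<integral>\<^sup>+u. f (1/(k+1-u)) * ennreal (1 / (k+1-u)^2) * indicator {0..1} u \<partial>lborel)"
    using assms(2)
    by (intro nn_integral_substitution_aux)
      (auto intro!: derivative_eq_intros continuous_intros simp: power2_eq_square)
  also have "\<dots> = (\<integral>\<^sup>+w. f (1/(k+w)) * ennreal (1 / (k+w)^2) * indicator {0..1} (1 - w) \<partial>lborel)"
    using nn_integral_real_affine[of "\<lambda>u. f (1/(k+1-u)) * ennreal (1 / (k+1-u)^2) * indicator {0..1} u" "-1" 1]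
    by (simp add: algebra_simps)
  also have "\<dots> = (\<integral>\<^sup>+w. f (1/(k+w)) * ennreal (1 / (k+w)^2) * indicator {0..1} w \<partial>lborel)"
    by (intro nn_integral_cong) (auto simp: indicator_def)
  finally show ?thesis by simp
qed

lemma nn_integral_lborel_prod:
  fixes F :: "real \<times> real \<Rightarrow> ennreal"
  assumes "F \<in> borel_measurable borel"
  shows "(\<integral>\<^sup>+x. F x \<partial>lborel) = (\<integral>\<^sup>+s. (\<integral>\<^sup>+u. F (u, s) \<partial>lborel) \<partial>lborel)"
    "(\<integral>\<^sup>+x. F x \<partial>lborel) = (\<integral>\<^sup>+u. (\<integral>\<^sup>+s. F (u, s) \<partial>lborel) \<partial>lborel)"
proof -
  have F: "F \<in> borel_measurable (lborel \<Otimes>\<^sub>M lborel)" using assms by (simp add: lborel_prod)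
  show "(\<integral>\<^sup>+x. F x \<partial>lborel) = (\<integral>\<^sup>+s. (\<integral>\<^sup>+u. F (u, s) \<partial>lborel) \<partial>lborel)"
    unfolding lborel_prod[symmetric] by (rule lborel_pair.nn_integral_snd[OF F, symmetric])
  show "(\<integral>\<^sup>+x. F x \<partial>lborel) = (\<integral>\<^sup>+u. (\<integral>\<^sup>+s. F (u, s) \<partial>lborel) \<partial>lborel)"
    unfolding lborel_prod[symmetric] by (rule lborel.nn_integral_fst[OF F, symmetric])
qed

text \<open>Coordinates w = 1 / x2 - k and b = x1 / x2. The Jacobian, the inverse cube of k + w, has
  one factor from x1 = b x2 and two from x2 = 1 / (k + w).\<close>

lemma nn_integral_Delta_slice:
  fixes h :: "real \<times> real \<Rightarrow> ennreal"
  assumes [measurable]: "h \<in> borel_measurable borel" and "1 \<le> (k::real)"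
  shows "(\<integral>\<^sup>+x. h x * indicator (Delta2 \<inter> {x. snd x \<in> {1/(k+1)..1/k}}) x \<partial>lborel) =
    (\<integral>\<^sup>+w. (\<integral>\<^sup>+b. h (b / (k + w), 1 / (k + w)) * ennreal (1 / (k + w)^3) * indicator {0..1} b \<partial>lborel) * indicator {0..1} w \<partial>lborel)"
proof -
  have [measurable]: "h \<in> borel_measurable (borel \<Otimes>\<^sub>M borel)" by (simp add: borel_prod)
  have "{x :: real \<times> real. snd x \<in> {1/(k+1)..1/k}} \<in> sets borel"
    by (intro borel_closed closed_Collect_conj closed_Collect_le continuous_intros | simp)+
  then have D: "Delta2 \<inter> {x. snd x \<in> {1/(k+1)..1/k}} \<in> sets borel" by (rule sets.Int[OF Delta2_sets])
  have [measurable]: "(\<lambda>x. h x * indicator (Delta2 \<inter> {x. snd x \<in> {1/(k+1)..1/k}}) x) \<in> borel_measurable borel"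
    by (intro borel_measurable_times_ennreal borel_measurable_indicator D assms(1))
  have "(\<integral>\<^sup>+x. h x * indicator (Delta2 \<inter> {x. snd x \<in> {1/(k+1)..1/k}}) x \<partial>lborel) =
    (\<integral>\<^sup>+s. (\<integral>\<^sup>+u. h (u, s) * indicator (Delta2 \<inter> {x. snd x \<in> {1/(k+1)..1/k}}) (u, s) \<partial>lborel) \<partial>lborel)"
    by (rule nn_integral_lborel_prod(1)) measurable
  also have "\<dots> = (\<integral>\<^sup>+s. (\<integral>\<^sup>+b. h (b * s, s) * ennreal s * indicator {0..1} b \<partial>lborel) * indicator {1/(k+1)..1/k} s \<partial>lborel)"
  proof (intro nn_integral_cong)
    fix s :: real
    show "(\<integral>\<^sup>+u. h (u, s) * indicator (Delta2 \<inter> {x. snd x \<in> {1/(k+1)..1/k}}) (u, s) \<partial>lborel) =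
      (\<integral>\<^sup>+b. h (b * s, s) * ennreal s * indicator {0..1} b \<partial>lborel) * indicator {1/(k+1)..1/k} s"
    proof (cases "s \<in> {1/(k+1)..1/k}")
      case True
      have "0 < 1 / (k + 1)" "1 / k \<le> 1" using assms(2) by auto
      then have s: "0 < s" "s \<le> 1" using True unfolding atLeastAtMost_iff by linarith+
      have "(\<integral>\<^sup>+u. h (u, s) * indicator (Delta2 \<inter> {x. snd x \<in> {1/(k+1)..1/k}}) (u, s) \<partial>lborel) =
         (\<integral>\<^sup>+u. h (u, s) * indicator {0..s} u \<partial>lborel)"
        using True s by (intro nn_integral_cong) (auto simp: indicator_def Delta2_def)
      also have "\<dots> = ennreal s * (\<integral>\<^sup>+b. h (s * b, s) * indicator {0..s} (s * b) \<partial>lborel)"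
        using nn_integral_real_affine[of "\<lambda>u. h (u, s) * indicator {0..s} u" s 0] s by simp
      also have "\<dots> = (\<integral>\<^sup>+b. ennreal s * (h (s * b, s) * indicator {0..s} (s * b)) \<partial>lborel)"
        by (subst nn_integral_cmult) auto
      also have "\<dots> = (\<integral>\<^sup>+b. h (b * s, s) * ennreal s * indicator {0..1} b \<partial>lborel)"
        using s by (intro nn_integral_cong) (auto simp: indicator_def mult.commute zero_le_mult_iff)
      finally show ?thesis using True by simp
    next
      case False
      then have "indicator (Delta2 \<inter> {x. snd x \<in> {1/(k+1)..1/k}}) (u, s) = (0::ennreal)" for u
        by (auto simp: indicator_def)
      then show ?thesis using False by simp
    qed
  qed
  also have "\<dots> = (\<integral>\<^sup>+w. (\<integral>\<^sup>+b. h (b * (1/(k+w)), 1/(k+w)) * ennreal (1/(k+w)) * indicator {0..1} b \<partial>lborel) * ennreal (1 / (k + w)^2) * indicator {0..1} w \<partial>lborel)"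
    by (rule nn_integral_inverse_subst[OF _ assms(2)]) measurable
  also have "\<dots> = (\<integral>\<^sup>+w. (\<integral>\<^sup>+b. h (b / (k + w), 1 / (k + w)) * ennreal (1 / (k + w)^3) * indicator {0..1} b \<partial>lborel) * indicator {0..1} w \<partial>lborel)"
  proof (intro nn_integral_cong)
    fix w :: real
    show "(\<integral>\<^sup>+b. h (b * (1/(k+w)), 1/(k+w)) * ennreal (1/(k+w)) * indicator {0..1} b \<partial>lborel) * ennreal (1 / (k + w)^2) * indicator {0..1} w =
      (\<integral>\<^sup>+b. h (b / (k + w), 1 / (k + w)) * ennreal (1 / (k + w)^3) * indicator {0..1} b \<partial>lborel) * indicator {0..1} w"
    proof (cases "w \<in> {0..1}")
      case True
      then have p: "0 < k + w" using assms(2) by simp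
      have "ennreal (1 / (k + w)^3) = ennreal (1/(k+w)) * ennreal (1 / (k + w)^2)"
        using p by (simp add: ennreal_mult[symmetric] power3_eq_cube power2_eq_square)
      then have e: "h (b / (k + w), 1 / (k + w)) * ennreal (1 / (k + w)^3) * indicator {0..1} b =
        (h (b * (1/(k+w)), 1/(k+w)) * ennreal (1/(k+w)) * indicator {0..1} b) * ennreal (1 / (k + w)^2)" for b
        by (simp add: mult_ac)
      show ?thesis unfolding e by (subst nn_integral_multc) auto
    qed simp
  qed
  finally show ?thesis .
qed

lemma AE_lborel_line:
  assumes "(p, q) \<noteq> (0, 0)"
  shows "AE x in (lborel :: (real \<times> real) measure). p * fst x + q * snd x \<noteq> c"
proof -
  have "negligible {x. (p, q) \<bullet> x = c}" using assms by (intro negligible_hyperplane) (auto simp: zero_prod_def)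
  then have "AE x in lebesgue. x \<notin> {x. (p, q) \<bullet> x = c}"
    by (intro AE_not_in) (simp add: negligible_iff_null_sets)
  then have "AE x in lborel. x \<notin> {x. (p, q) \<bullet> x = c}"
    by (simp add: AE_completion_iff)
  then show ?thesis by eventually_elim (auto simp: inner_prod_def)
qed

definition blk_set :: "nat \<times> bool \<Rightarrow> (real \<times> real) set" where
  "blk_set g = {x \<in> Delta2. 0 < snd x \<and> gblk x = g}"

lemma blk_set_measurable [measurable]: "blk_set g \<in> sets borel"
proof -
  have "{x :: real \<times> real. 0 < snd x} \<in> sets borel" "{x. gblk x = g} \<in> sets borel"
    using measurable_sets[OF gblk_measurable, of "{g}"]
    by (auto simp: vimage_def intro!: borel_open open_Collect_less continuous_intros)
  moreover have "blk_set g = Delta2 \<inter> {x. 0 < snd x} \<inter> {x. gblk x = g}" by (auto simp: blk_set_def)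
  ultimately show ?thesis by auto
qed

text \<open>For fixed \<open>k\<close> both branches live on the unsorted unit square, and
  \<open>t\<close> selects one of its triangles. The Jacobian combines with \<open>dens\<close>
  without remainder, which is the reason for inverse cubes of linear forms.\<close>

lemma gint_branch_aux:
  assumes f [measurable]: "f \<in> borel_measurable borel" and r: "(a, b, c) \<in> cone" and k: "1 \<le> k"
  shows "(\<integral>\<^sup>+x. f (gmap x) * indicator (blk_set (k, t)) x * dens (a, b, c) x \<partial>lborel) =
    (\<integral>\<^sup>+w. (\<integral>\<^sup>+v. (if v \<le> w \<longleftrightarrow> t then f (min w v, max w v) * ennreal (1 / (a * v + c * w + (b + k * c))^3) else 0) * indicator {0..1} v \<partial>lborel) * indicator {0..1} w \<partial>lborel)"
proof -
  define h where "h x = f (gmap x) * indicator (blk_set (k, t)) x * dens (a, b, c) x" for x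
  have [measurable]: "h \<in> borel_measurable borel" unfolding h_def by measurable
  have k1: "1 \<le> real k" using k by simp
  have "(\<integral>\<^sup>+x. h x \<partial>lborel) = (\<integral>\<^sup>+x. h x * indicator (Delta2 \<inter> {x. snd x \<in> {1/(real k+1)..1/real k}}) x \<partial>lborel)"
  proof (intro nn_integral_cong)
    fix x :: "real \<times> real"
    show "h x = h x * indicator (Delta2 \<inter> {x. snd x \<in> {1/(real k+1)..1/real k}}) x"
    proof (cases "x \<in> blk_set (k, t)")
      case True
      then have "0 < snd x" "nat \<lfloor>1 / snd x\<rfloor> = k" "x \<in> Delta2" by (auto simp: blk_set_def gblk_def)
      then have "real k \<le> 1 / snd x" "1 / snd x < real k + 1" using k by linarith+
      then have "snd x \<in> {1/(real k+1)..1/real k}" using k1 \<open>0 < snd x\<close> by (auto simp: field_simps)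
      then show ?thesis using \<open>x \<in> Delta2\<close> by simp
    qed (simp add: h_def)
  qed
  also have "\<dots> = (\<integral>\<^sup>+w. (\<integral>\<^sup>+v. h (v / (k + w), 1 / (k + w)) * ennreal (1 / (k + w)^3) * indicator {0..1} v \<partial>lborel) * indicator {0..1} w \<partial>lborel)"
    by (rule nn_integral_Delta_slice[OF _ k1]) measurable
  also have "\<dots> = (\<integral>\<^sup>+w. (\<integral>\<^sup>+v. (if v \<le> w \<longleftrightarrow> t then f (min w v, max w v) * ennreal (1 / (a * v + c * w + (b + k * c))^3) else 0) * indicator {0..1} v \<partial>lborel) * indicator {0..1} w \<partial>lborel)"
  proof (intro nn_integral_cong_AE)
    \<comment> \<open>At w = 1 the floor of 1 / x2 would be k + 1 instead of k.\<close>
    have "AE w in lborel. w \<noteq> (1::real)" by (rule AE_lborel_singleton)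
    then show "AE w in lborel. (\<integral>\<^sup>+v. h (v / (k + w), 1 / (k + w)) * ennreal (1 / (k + w)^3) * indicator {0..1} v \<partial>lborel) * indicator {0..1} w =
      (\<integral>\<^sup>+v. (if v \<le> w \<longleftrightarrow> t then f (min w v, max w v) * ennreal (1 / (a * v + c * w + (b + k * c))^3) else 0) * indicator {0..1} v \<partial>lborel) * indicator {0..1} w"
    proof eventually_elim
      case (elim w)
      show ?case
      proof (cases "w \<in> {0..1}")
        case True
        then have w: "0 \<le> w" "w < 1" using elim by auto
        have p: "0 < k + w" using w k1 by simp
        have fl: "\<lfloor>real k + w\<rfloor> = int k" "frac (real k + w) = w" using w by (simp_all add: floor_eq_iff frac_def)
        have key: "h (v / (k + w), 1 / (k + w)) * ennreal (1 / (k + w)^3) =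
            (if v \<le> w \<longleftrightarrow> t then f (min w v, max w v) * ennreal (1 / (a * v + c * w + (b + k * c))^3) else 0)"
          if v: "v \<in> {0..1}" for v
        proof -
          let ?x = "(v / (k + w), 1 / (k + w))"
          have xD: "?x \<in> Delta2" using v w p k1 by (auto simp: Delta2_def divide_right_mono)
          have g: "gmap ?x = (min w v, max w v)" "gblk ?x = (k, v \<le> w)"
            using p fl by (simp_all add: gmap_def gblk_def)
          have rr: "0 \<le> a" "0 \<le> b" "0 < c" using r by (auto simp: cone_def)
          have q: "0 < a * v + c * w + (b + k * c)"
            using rr v w k1 by (intro add_nonneg_pos add_nonneg_nonneg mult_nonneg_nonneg) auto
          have "a * (v / (k + w)) + b * (1 / (k + w)) + c = (a * v + c * w + (b + k * c)) / (k + w)"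
          proof -
            define K where "K = k + w"
            have e: "a * v + c * w + (b + k * c) = a * v + b * 1 + K * c" by (simp add: K_def algebra_simps)
            show ?thesis using p unfolding e K_def[symmetric] by (simp add: add_divide_distrib)
          qed
          then have "1 / (a * (v / (k + w)) + b * (1 / (k + w)) + c)^3 * (1 / (k + w)^3) = 1 / (a * v + c * w + (b + k * c))^3"
            using p q by (simp add: power_divide)
          moreover have "0 \<le> a * (v / (k + w)) + b * (1 / (k + w)) + c" using rr p v by auto
          ultimately have "dens (a, b, c) ?x * ennreal (1 / (k + w)^3) = ennreal (1 / (a * v + c * w + (b + k * c))^3)"
            using p by (simp add: dens_def ennreal_mult[symmetric])
          then show ?thesis using g xD p by (auto simp: h_def blk_set_def mult.assoc)
        qed
        have z: "indicator {0..1} v = (0::ennreal)" if "v \<notin> {0..1}" for v :: real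
          using that by (simp add: indicator_def)
        have "h (v / (k + w), 1 / (k + w)) * ennreal (1 / (k + w)^3) * indicator {0..1} v =
            (if v \<le> w \<longleftrightarrow> t then f (min w v, max w v) * ennreal (1 / (a * v + c * w + (b + k * c))^3) else 0) * indicator {0..1} v" for v
        proof (cases "v \<in> {0..1}")
          case True
          show ?thesis unfolding key[OF True] ..
        next
          case False
          show ?thesis unfolding z[OF False] mult_zero_right ..
        qed
        then show ?thesis by (simp only:)
      qed simp
    qed
  qed
  finally show ?thesis by (simp add: h_def)
qed

text \<open>The branches are full: up to null sets every block maps its cylinder onto
  \<open>Delta2\<close>, so only the row changes.\<close>

lemma gint_branch:
  assumes f [measurable]: "f \<in> borel_measurable borel" and r: "r \<in> cone" and k: "1 \<le> k"
  shows "(\<integral>\<^sup>+x. f (gmap x) * indicator (blk_set (k, t)) x * dens r x \<partial>lborel) = gint (blk_row (k, t) r) f"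
proof -
  obtain a b c where abc: "r = (a, b, c)" by (cases r)
  have [measurable]: "f \<in> borel_measurable (borel \<Otimes>\<^sub>M borel)" "Delta2 \<in> sets (borel \<Otimes>\<^sub>M borel)"
    "dens r' \<in> borel_measurable (borel \<Otimes>\<^sub>M borel)" for r' unfolding borel_prod by measurable
  note aux = gint_branch_aux[OF f r[unfolded abc] k]
  show ?thesis
  proof (cases t)
    case True
    have "gint (blk_row (k, t) r) f = (\<integral>\<^sup>+w. (\<integral>\<^sup>+v. f (v, w) * indicator Delta2 (v, w) * dens (blk_row (k, t) r) (v, w) \<partial>lborel) \<partial>lborel)"
      unfolding gint_def by (rule nn_integral_lborel_prod(1)) measurable
    also have "\<dots> = (\<integral>\<^sup>+w. (\<integral>\<^sup>+v. (if v \<le> w \<longleftrightarrow> t then f (min w v, max w v) * ennreal (1 / (a * v + c * w + (b + k * c))^3) else 0) * indicator {0..1} v \<partial>lborel) * indicator {0..1} w \<partial>lborel)"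
    proof (intro nn_integral_cong)
      fix w :: real
      show "(\<integral>\<^sup>+v. f (v, w) * indicator Delta2 (v, w) * dens (blk_row (k, t) r) (v, w) \<partial>lborel) =
        (\<integral>\<^sup>+v. (if v \<le> w \<longleftrightarrow> t then f (min w v, max w v) * ennreal (1 / (a * v + c * w + (b + k * c))^3) else 0) * indicator {0..1} v \<partial>lborel) * indicator {0..1} w"
      proof (subst nn_integral_multc[symmetric])
        show "(\<integral>\<^sup>+v. f (v, w) * indicator Delta2 (v, w) * dens (blk_row (k, t) r) (v, w) \<partial>lborel) =
          (\<integral>\<^sup>+v. (if v \<le> w \<longleftrightarrow> t then f (min w v, max w v) * ennreal (1 / (a * v + c * w + (b + k * c))^3) else 0) * indicator {0..1} v * indicator {0..1} w \<partial>lborel)"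
          by (rule nn_integral_cong) (auto simp: True abc blk_row_def dens_def Delta2_def indicator_def)
      qed measurable
    qed
    finally show ?thesis using aux[of t] by (simp add: abc)
  next
    case False
    have "gint (blk_row (k, t) r) f = (\<integral>\<^sup>+w. (\<integral>\<^sup>+v. f (w, v) * indicator Delta2 (w, v) * dens (blk_row (k, t) r) (w, v) \<partial>lborel) \<partial>lborel)"
      unfolding gint_def by (rule nn_integral_lborel_prod(2)) measurable
    also have "\<dots> = (\<integral>\<^sup>+w. (\<integral>\<^sup>+v. (if v \<le> w \<longleftrightarrow> t then f (min w v, max w v) * ennreal (1 / (a * v + c * w + (b + k * c))^3) else 0) * indicator {0..1} v \<partial>lborel) * indicator {0..1} w \<partial>lborel)"
    proof (intro nn_integral_cong)
      fix w :: real
      have "(\<integral>\<^sup>+v. f (w, v) * indicator Delta2 (w, v) * dens (blk_row (k, t) r) (w, v) \<partial>lborel) =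
        (\<integral>\<^sup>+v. (if v \<le> w \<longleftrightarrow> t then f (min w v, max w v) * ennreal (1 / (a * v + c * w + (b + k * c))^3) else 0) * indicator {0..1} v * indicator {0..1} w \<partial>lborel)"
      proof (rule nn_integral_cong_AE)
        have "AE v in lborel. v \<noteq> w" by (rule AE_lborel_singleton)
        then show "AE v in lborel. f (w, v) * indicator Delta2 (w, v) * dens (blk_row (k, t) r) (w, v) =
           (if v \<le> w \<longleftrightarrow> t then f (min w v, max w v) * ennreal (1 / (a * v + c * w + (b + k * c))^3) else 0) * indicator {0..1} v * indicator {0..1} w"
          by eventually_elim (auto simp: False abc blk_row_def dens_def Delta2_def indicator_def algebra_simps)
      qed
      then show "(\<integral>\<^sup>+v. f (w, v) * indicator Delta2 (w, v) * dens (blk_row (k, t) r) (w, v) \<partial>lborel) =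
        (\<integral>\<^sup>+v. (if v \<le> w \<longleftrightarrow> t then f (min w v, max w v) * ennreal (1 / (a * v + c * w + (b + k * c))^3) else 0) * indicator {0..1} v \<partial>lborel) * indicator {0..1} w"
        by (subst nn_integral_multc[symmetric]) auto
    qed
    finally show ?thesis using aux[of t] by (simp add: abc)
  qed
qed

lemma gint_split:
  assumes [measurable]: "F \<in> borel_measurable borel"
  shows "gint r F = (\<Sum>k. (\<integral>\<^sup>+x. F x * indicator (blk_set (Suc k, True)) x * dens r x \<partial>lborel) +
    (\<integral>\<^sup>+x. F x * indicator (blk_set (Suc k, False)) x * dens r x \<partial>lborel))"
proof -
  have "gint r F = (\<integral>\<^sup>+x. (\<Sum>k. F x * indicator (blk_set (Suc k, True)) x * dens r x + F x * indicator (blk_set (Suc k, False)) x * dens r x) \<partial>lborel)"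
    unfolding gint_def
  proof (rule nn_integral_cong_AE)
    have "AE x in (lborel :: (real \<times> real) measure). 0 * fst x + 1 * snd x \<noteq> 0"
      by (rule AE_lborel_line) simp
    then show "AE x in lborel. F x * indicator Delta2 x * dens r x =
      (\<Sum>k. F x * indicator (blk_set (Suc k, True)) x * dens r x + F x * indicator (blk_set (Suc k, False)) x * dens r x)"
    proof eventually_elim
      case (elim x)
      show ?case
      proof (cases "x \<in> Delta2")
        case True
        then have x: "0 < snd x" "snd x \<le> 1" using elim by (auto simp: Delta2_def)
        then have "1 \<le> 1 / snd x" by simp
        then have "1 \<le> nat \<lfloor>1 / snd x\<rfloor>" by linarith
        then obtain k0 where k0: "nat \<lfloor>1 / snd x\<rfloor> = Suc k0" by (cases "nat \<lfloor>1 / snd x\<rfloor>") auto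
        have "(\<Sum>k. F x * indicator (blk_set (Suc k, True)) x * dens r x + F x * indicator (blk_set (Suc k, False)) x * dens r x) =
          (\<Sum>k\<in>{k0}. F x * indicator (blk_set (Suc k, True)) x * dens r x + F x * indicator (blk_set (Suc k, False)) x * dens r x)"
          by (rule suminf_finite) (auto simp: blk_set_def gblk_def k0 indicator_def)
        also have "\<dots> = F x * indicator Delta2 x * dens r x"
          using True x by (auto simp: blk_set_def gblk_def k0 indicator_def)
        finally show ?thesis by simp
      qed (auto simp: blk_set_def indicator_def)
    qed
  qed
  also have "\<dots> = (\<Sum>k. (\<integral>\<^sup>+x. F x * indicator (blk_set (Suc k, True)) x * dens r x + F x * indicator (blk_set (Suc k, False)) x * dens r x \<partial>lborel))"
    by (rule nn_integral_suminf) measurable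
  also have "\<dots> = (\<Sum>k. (\<integral>\<^sup>+x. F x * indicator (blk_set (Suc k, True)) x * dens r x \<partial>lborel) +
    (\<integral>\<^sup>+x. F x * indicator (blk_set (Suc k, False)) x * dens r x \<partial>lborel))"
    by (intro suminf_cong nn_integral_add) measurable
  finally show ?thesis .
qed

lemma blocks_measurable [measurable]:
  fixes f :: "(nat \<times> bool) list \<Rightarrow> ennreal"
  shows "(\<lambda>x. f (bl n x)) \<in> borel_measurable borel"
  using measurable_comp[OF bl_measurable[of n], of f borel] by (simp add: comp_def)

text \<open>Given the first \<open>n\<close> blocks, the point reached after them has a density
  proportional to \<open>dens\<close> of a row in \<open>cone\<close>. A bound uniform over the cone
  is inherited for any weight \<open>f\<close> on the past; this takes the place of
  independence.\<close>

lemma gint_blocks: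
  fixes f :: "(nat \<times> bool) list \<Rightarrow> ennreal"
  assumes B [measurable]: "B \<in> borel_measurable borel" and \<kappa>: "\<And>r. r \<in> cone \<Longrightarrow> gint r B \<le> \<kappa> * gint r (\<lambda>_. 1)"
  shows "r \<in> cone \<Longrightarrow> gint r (\<lambda>x. f (bl n x) * B ((gmap ^^ n) x)) \<le> \<kappa> * gint r (\<lambda>x. f (bl n x))"
proof (induction n arbitrary: f r)
  case 0
  have "gint r (\<lambda>x. f [] * B x) = f [] * gint r B" "gint r (\<lambda>x. f []) = f [] * gint r (\<lambda>_. 1)"
    unfolding gint_def by (subst nn_integral_cmult[symmetric]; simp add: mult.assoc)+
  then show ?case using \<kappa>[OF 0] by (simp add: mult_left_mono mult.left_commute[of \<kappa>])
next
  case (Suc n)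
  have *: "gint r (\<lambda>x. f (bl (Suc n) x) * C ((gmap ^^ Suc n) x)) =
     (\<Sum>k. gint (blk_row (Suc k, True) r) (\<lambda>x. f ((Suc k, True) # bl n x) * C ((gmap ^^ n) x)) +
          gint (blk_row (Suc k, False) r) (\<lambda>x. f ((Suc k, False) # bl n x) * C ((gmap ^^ n) x)))"
    if [measurable]: "C \<in> borel_measurable borel" for C :: "real \<times> real \<Rightarrow> ennreal"
  proof -
    have [measurable]: "(\<lambda>x. C ((gmap ^^ m) x)) \<in> borel_measurable borel" for m
      using measurable_comp[OF gmap_pow_measurable[of m] that] by (simp add: comp_def)
    have "(\<integral>\<^sup>+x. f (bl (Suc n) x) * C ((gmap ^^ Suc n) x) * indicator (blk_set (Suc k, t)) x * dens r x \<partial>lborel) =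
      gint (blk_row (Suc k, t) r) (\<lambda>x. f ((Suc k, t) # bl n x) * C ((gmap ^^ n) x))" for k t
    proof (subst gint_branch[OF _ Suc.prems, symmetric])
      show "(\<lambda>x. f ((Suc k, t) # bl n x) * C ((gmap ^^ n) x)) \<in> borel_measurable borel"
        using blocks_measurable[of "\<lambda>l. f ((Suc k, t) # l)" n] by measurable
      show "(\<integral>\<^sup>+x. f (bl (Suc n) x) * C ((gmap ^^ Suc n) x) * indicator (blk_set (Suc k, t)) x * dens r x \<partial>lborel) =
        (\<integral>\<^sup>+x. f ((Suc k, t) # bl n (gmap x)) * C ((gmap ^^ n) (gmap x)) * indicator (blk_set (Suc k, t)) x * dens r x \<partial>lborel)"
        by (intro nn_integral_cong) (auto simp: indicator_def blk_set_def funpow_swap1)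
    qed simp
    then show ?thesis by (subst gint_split) (simp_all del: bl.simps funpow.simps)
  qed
  have "gint r (\<lambda>x. f (bl (Suc n) x) * B ((gmap ^^ Suc n) x)) \<le>
     (\<Sum>k. \<kappa> * (gint (blk_row (Suc k, True) r) (\<lambda>x. f ((Suc k, True) # bl n x) * 1) +
          gint (blk_row (Suc k, False) r) (\<lambda>x. f ((Suc k, False) # bl n x) * 1)))"
    unfolding *[OF B]
  proof (intro suminf_le)
    show "gint (blk_row (Suc k, True) r) (\<lambda>x. f ((Suc k, True) # bl n x) * B ((gmap ^^ n) x)) +
          gint (blk_row (Suc k, False) r) (\<lambda>x. f ((Suc k, False) # bl n x) * B ((gmap ^^ n) x)) \<le>
       \<kappa> * (gint (blk_row (Suc k, True) r) (\<lambda>x. f ((Suc k, True) # bl n x) * 1) +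
          gint (blk_row (Suc k, False) r) (\<lambda>x. f ((Suc k, False) # bl n x) * 1))" for k
      unfolding distrib_left mult_1_right
      using Suc.IH[OF mat_cone[OF Suc.prems], of k True "\<lambda>l. f ((Suc k, True) # l)"]
        Suc.IH[OF mat_cone[OF Suc.prems], of k False "\<lambda>l. f ((Suc k, False) # l)"]
      by (intro add_mono) auto
  qed auto
  also have "\<dots> = \<kappa> * gint r (\<lambda>x. f (bl (Suc n) x) * 1)"
    using *[of "\<lambda>_. 1"] by (simp only: ennreal_suminf_cmult) simp
  finally show ?case by (simp del: bl.simps)
qed

section \<open>Recurrence to bounded discrepancy\<close>

definition row0 :: row where "row0 = (0, 0, 1)"

lemma row0_cone: "row0 \<in> cone" by (simp add: row0_def cone_def)

lemma gint_row0: "gint row0 F = (\<integral>\<^sup>+x. F x * indicator Delta2 x \<partial>lborel)"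
  by (simp add: gint_def dens_def row0_def)

lemma gint_mono: "(\<And>x. x \<in> Delta2 \<Longrightarrow> F x \<le> F' x) \<Longrightarrow> gint r F \<le> gint r F'"
  unfolding gint_def by (intro nn_integral_mono) (auto simp: indicator_def intro!: mult_right_mono)

lemma gint_indicator: "A \<in> sets borel \<Longrightarrow> gint row0 (indicator A) = emeasure lborel (A \<inter> Delta2)"
proof -
  assume A: "A \<in> sets borel"
  have "gint row0 (indicator A) = (\<integral>\<^sup>+x. indicator (A \<inter> Delta2) x \<partial>lborel)"
    unfolding gint_row0 by (intro nn_integral_cong) (simp add: indicator_def)
  also have "\<dots> = emeasure lborel (A \<inter> Delta2)"
    using A Delta2_sets by (intro nn_integral_indicator) auto
  finally show ?thesis .
qed

lemma gint_add:
  assumes [measurable]: "F \<in> borel_measurable borel" "F' \<in> borel_measurable borel"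
  shows "gint r (\<lambda>x. F x + F' x) = gint r F + gint r F'"
  unfolding gint_def by (subst nn_integral_add[symmetric]) (auto simp: distrib_right)

lemma gint_cmult:
  assumes [measurable]: "F \<in> borel_measurable borel"
  shows "gint r (\<lambda>x. k * F x) = k * gint r F"
  unfolding gint_def by (subst nn_integral_cmult[symmetric]) (auto simp: mult.assoc)

lemma gint_suminf:
  assumes [measurable]: "\<And>i. F i \<in> borel_measurable borel"
  shows "gint r (\<lambda>x. \<Sum>i. F i x) = (\<Sum>i. gint r (F i))"
  unfolding gint_def by (subst nn_integral_suminf[symmetric]) (auto simp: mult.assoc ennreal_suminf_multc)

lemma Delta2_measure: obtains l where "0 < l" "emeasure lborel Delta2 = ennreal l" "gint row0 (\<lambda>_. 1) = ennreal l"
proof -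
  have "bounded Delta2"
    by (rule bounded_subset[OF bounded_cbox, of _ "(0, 0)" "(1, 1)"]) (auto simp: Delta2_def cbox_Pair_eq)
  then have fin: "emeasure lborel Delta2 < \<infinity>" by (rule emeasure_bounded_finite)
  have "box (0 :: real, 1/2 :: real) (1/2, 1) \<subseteq> Delta2" by (auto simp: Delta2_def box_prod)
  moreover have "0 < emeasure lborel (box (0 :: real, 1/2 :: real) (1/2, 1))"
    by (subst emeasure_lborel_box) (auto simp: Basis_prod_def)
  ultimately have "0 < emeasure lborel Delta2"
    by (elim order_less_le_trans) (auto intro!: emeasure_mono)
  then have "0 < measure lborel Delta2" "emeasure lborel Delta2 = ennreal (measure lborel Delta2)"
    using fin by (auto simp: emeasure_eq_ennreal_measure)
  moreover have "gint row0 (\<lambda>_. 1) = emeasure lborel Delta2"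
    unfolding gint_row0 by (simp add: nn_integral_indicator)
  ultimately show ?thesis using that by metis
qed

text \<open>On \<open>Delta2\<close> the linear form lies between c and 4 c, by b <= c and a <= b +
  c; 64 is the cube of 4.\<close>

lemma dens_bounds:
  assumes "(a, b, c) \<in> cone" "y \<in> Delta2"
  shows "ennreal (1 / (64 * c ^ 3)) \<le> dens (a, b, c) y" "dens (a, b, c) y \<le> ennreal (1 / c ^ 3)"
proof -
  have r: "0 \<le> a" "0 \<le> b" "b \<le> c" "a \<le> b + c" "0 < c" using assms(1) by (auto simp: cone_def)
  have y: "0 \<le> fst y" "fst y \<le> 1" "0 \<le> snd y" "snd y \<le> 1" using assms(2) by (auto simp: Delta2_def)
  let ?s = "a * fst y + b * snd y + c"
  have "0 \<le> a * fst y" "0 \<le> b * snd y" using r y by auto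
  moreover have "a * fst y \<le> a * 1" "b * snd y \<le> b * 1" using r y by (intro mult_left_mono; simp)+
  ultimately have s: "c \<le> ?s" "?s \<le> 4 * c" using r by linarith+
  have "c ^ 3 \<le> ?s ^ 3" "?s ^ 3 \<le> (4 * c) ^ 3" using s r by (intro power_mono; simp)+
  then have "1 / (64 * c ^ 3) \<le> 1 / ?s ^ 3" "1 / ?s ^ 3 \<le> 1 / c ^ 3"
    using r s by (auto intro!: divide_left_mono simp: power_mult_distrib)
  then show "ennreal (1 / (64 * c ^ 3)) \<le> dens (a, b, c) y" "dens (a, b, c) y \<le> ennreal (1 / c ^ 3)"
    by (auto simp: dens_def intro!: ennreal_leI)
qed

lemma gint_bounds:
  assumes [measurable]: "F \<in> borel_measurable borel" and r: "(a, b, c) \<in> cone"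
  shows "ennreal (1 / (64 * c ^ 3)) * gint row0 F \<le> gint (a, b, c) F" "gint (a, b, c) F \<le> ennreal (1 / c ^ 3) * gint row0 F"
proof -
  have "ennreal (1 / (64 * c ^ 3)) * gint row0 F = (\<integral>\<^sup>+x. ennreal (1 / (64 * c ^ 3)) * (F x * indicator Delta2 x) \<partial>lborel)"
    unfolding gint_row0 by (subst nn_integral_cmult) auto
  also have "\<dots> \<le> gint (a, b, c) F"
    unfolding gint_def using dens_bounds(1)[OF r]
    by (intro nn_integral_mono) (auto simp: indicator_def mult.commute intro!: mult_left_mono)
  finally show "ennreal (1 / (64 * c ^ 3)) * gint row0 F \<le> gint (a, b, c) F" .
  have "gint (a, b, c) F \<le> (\<integral>\<^sup>+x. ennreal (1 / c ^ 3) * (F x * indicator Delta2 x) \<partial>lborel)"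
    unfolding gint_def using dens_bounds(2)[OF r]
    by (intro nn_integral_mono) (auto simp: indicator_def mult.commute intro!: mult_left_mono)
  also have "\<dots> = ennreal (1 / c ^ 3) * gint row0 F"
    unfolding gint_row0 by (subst nn_integral_cmult) auto
  finally show "gint (a, b, c) F \<le> ennreal (1 / c ^ 3) * gint row0 F" .
qed

text \<open>The power of c cancels, because it bounds both the integral of \<open>F\<close> and the
  total mass. Only the ratio 64 and the area \<open>l\<close> of \<open>Delta2\<close>
  remain.\<close>

lemma gint_distortion:
  assumes F: "F \<in> borel_measurable borel" and r: "r \<in> cone" and l: "0 < l" "gint row0 (\<lambda>_. 1) = ennreal l"
  shows "gint r F \<le> (ennreal (64 / l) * gint row0 F) * gint r (\<lambda>_. 1)"
    "(ennreal (1 / (64 * l)) * gint row0 F) * gint r (\<lambda>_. 1) \<le> gint r F"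
proof -
  obtain a b c where abc: "r = (a, b, c)" by (cases r)
  have c: "0 < c" using r by (auto simp: abc cone_def)
  note r' = r[unfolded abc]
  have m: "(\<lambda>_. 1 :: ennreal) \<in> borel_measurable borel" by simp
  have "gint r F \<le> ennreal (1 / c ^ 3) * gint row0 F" unfolding abc by (rule gint_bounds[OF F r'])
  also have "ennreal (1 / c ^ 3) = ennreal (64 / l) * (ennreal (1 / (64 * c ^ 3)) * ennreal l)"
    using l c by (simp add: ennreal_mult[symmetric])
  also have "\<dots> * gint row0 F \<le> ennreal (64 / l) * gint r (\<lambda>_. 1) * gint row0 F"
    using gint_bounds(1)[OF m r'] unfolding l(2) abc by (intro mult_right_mono mult_left_mono) auto
  finally show "gint r F \<le> (ennreal (64 / l) * gint row0 F) * gint r (\<lambda>_. 1)" by (simp add: mult_ac)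
  have "(ennreal (1 / (64 * l)) * gint row0 F) * gint r (\<lambda>_. 1) \<le>
     (ennreal (1 / (64 * l)) * gint row0 F) * (ennreal (1 / c ^ 3) * ennreal l)"
    using gint_bounds(2)[OF m r'] unfolding l(2) abc by (intro mult_left_mono) auto
  also have "\<dots> = (ennreal (1 / (64 * l)) * (ennreal (1 / c ^ 3) * ennreal l)) * gint row0 F" by (simp add: mult_ac)
  also have "ennreal (1 / (64 * l)) * (ennreal (1 / c ^ 3) * ennreal l) = ennreal (1 / (64 * c ^ 3))"
    using l c by (simp add: ennreal_mult[symmetric])
  also have "\<dots> * gint row0 F \<le> gint r F" unfolding abc by (rule gint_bounds[OF F r'])
  finally show "(ennreal (1 / (64 * l)) * gint row0 F) * gint r (\<lambda>_. 1) \<le> gint r F" .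
qed

lemma gint_one_finite: 
  assumes "r \<in> cone"
  obtains m where "0 < m" "gint r (\<lambda>_. 1) = ennreal m"
proof -
  obtain l where l: "0 < l" "gint row0 (\<lambda>_. 1) = ennreal l" by (rule Delta2_measure)
  obtain a b c where abc: "r = (a, b, c)" by (cases r)
  have c: "0 < c" using assms by (auto simp: abc cone_def)
  have m: "(\<lambda>_. 1 :: ennreal) \<in> borel_measurable borel" by simp
  note b = gint_bounds[OF m assms[unfolded abc], unfolded l(2)]
  have "gint r (\<lambda>_. 1) \<le> ennreal (1 / c ^ 3 * l)" using b(2) l c by (simp add: abc ennreal_mult del: times_divide_eq_left)
  then have "gint r (\<lambda>_. 1) < \<infinity>" by (metis ennreal_less_top infinity_ennreal_def le_less_trans)
  then obtain m where m: "0 \<le> m" "gint r (\<lambda>_. 1) = ennreal m" by (auto simp: less_top_ennreal)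
  have "0 < ennreal (1 / (64 * c ^ 3) * l)" using l c by simp
  also have "\<dots> \<le> gint r (\<lambda>_. 1)" using b(1) l c by (simp add: abc ennreal_mult del: times_divide_eq_left)
  finally have "0 < m" using m by simp
  then show ?thesis using that m by blast
qed

abbreviation (input) run3 :: "nat \<Rightarrow> (nat \<times> bool) list" where
  "run3 N \<equiv> replicate N (Suc 0, False)"

text \<open>Full branches give every cylinder positive mass; one block is removed at a time, and the
  total mass of any row in the cone is positive.\<close>

lemma gint_run3_pos: "r \<in> cone \<Longrightarrow> 0 < gint r (\<lambda>x. indicator {l. l = run3 N} (bl N x))"
proof (induction N arbitrary: r)
  case 0
  obtain m where "0 < m" "gint r (\<lambda>_. 1) = ennreal m" using gint_one_finite[OF 0] by blast
  then show ?case by simp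
next
  case (Suc N)
  have "0 < gint (blk_row (Suc 0, False) r) (\<lambda>x. indicator {l. l = run3 N} (bl N x))"
    using Suc mat_cone[OF Suc.prems] by simp
  also have "\<dots> = (\<integral>\<^sup>+x. indicator {l. l = run3 N} (bl N (gmap x)) * indicator (blk_set (Suc 0, False)) x * dens r x \<partial>lborel)"
    by (rule gint_branch[OF _ Suc.prems, symmetric]) auto
  also have "\<dots> \<le> gint r (\<lambda>x. indicator {l. l = run3 (Suc N)} (bl (Suc N) x))"
    unfolding gint_def by (intro nn_integral_mono) (auto simp: indicator_def blk_set_def)
  finally show ?case .
qed

text \<open>At least the fraction d / (64 l) of the mass starts with the run, where the weight is
  \<theta> instead of 1. The value 5/6 serves for contraction, the value 0 for the waiting time
  until a run.\<close>

lemma gint_run3_weight: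
  assumes "0 \<le> \<theta>" "\<theta> < 1"
  shows "\<exists>q. 0 \<le> q \<and> q < 1 \<and> (\<forall>r\<in>cone. gint r (\<lambda>x. if bl N x = run3 N then ennreal \<theta> else 1) \<le> ennreal q * gint r (\<lambda>_. 1))"
proof -
  obtain l where l: "0 < l" "gint row0 (\<lambda>_. 1) = ennreal l" by (rule Delta2_measure)
  let ?C = "\<lambda>x. indicator {l. l = run3 N} (bl N x) :: ennreal"
  let ?B = "\<lambda>x. if bl N x = run3 N then ennreal \<theta> else 1"
  have C [measurable]: "?C \<in> borel_measurable borel" by simp
  have B [measurable]: "?B \<in> borel_measurable borel"
    using blocks_measurable[of "\<lambda>l. if l = run3 N then ennreal \<theta> else 1" N] .
  have "gint row0 ?C \<le> gint row0 (\<lambda>_. 1)" by (rule gint_mono) (simp add: indicator_def)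
  then have "gint row0 ?C < \<infinity>" unfolding l(2) by (metis ennreal_less_top infinity_ennreal_def le_less_trans)
  then obtain d where d: "0 \<le> d" "gint row0 ?C = ennreal d" by (auto simp: less_top_ennreal)
  have "0 < d" using gint_run3_pos[OF row0_cone, of N] d by simp
  define q where "q = max 0 (1 - (1 - \<theta>) * (d / (64 * l)))"
  have "q < 1" using \<open>0 < d\<close> l assms by (simp add: q_def)
  moreover have "gint r ?B \<le> ennreal q * gint r (\<lambda>_. 1)" if r: "r \<in> cone" for r
  proof -
    obtain m where m: "0 < m" "gint r (\<lambda>_. 1) = ennreal m" using gint_one_finite[OF r] by blast
    have sum: "gint r ?B + ennreal (1 - \<theta>) * gint r ?C = ennreal m"
    proof -
      have "ennreal \<theta> + ennreal (1 - \<theta>) = 1" using assms by (subst ennreal_plus[symmetric]) auto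
      then have "?B x + ennreal (1 - \<theta>) * ?C x = 1" for x by (simp add: indicator_def)
      moreover have "gint r (\<lambda>x. ?B x + ennreal (1 - \<theta>) * ?C x) = gint r ?B + ennreal (1 - \<theta>) * gint r ?C"
        by (subst gint_add) (auto simp: gint_cmult)
      ultimately show ?thesis unfolding m(2)[symmetric] by simp
    qed
    have low: "ennreal (d / (64 * l) * m) \<le> gint r ?C"
    proof -
      have "ennreal (d / (64 * l) * m) = (ennreal (1 / (64 * l)) * gint row0 ?C) * gint r (\<lambda>_. 1)"
        unfolding d(2) m(2) using \<open>0 < d\<close> l m by (simp add: ennreal_mult[symmetric])
      also have "\<dots> \<le> gint r ?C" by (rule gint_distortion(2)[OF C r l])
      finally show ?thesis .
    qed
    have "gint r ?B \<le> ennreal m" using sum by (metis le_iff_add)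
    then obtain \<beta> where \<beta>: "0 \<le> \<beta>" "gint r ?B = ennreal \<beta>" by (cases "gint r ?B") (auto simp: top_unique)
    have "gint r ?C \<le> ennreal m" using gint_mono[of ?C "\<lambda>_. 1" r] m by (simp add: indicator_def)
    then obtain \<gamma> where \<gamma>: "0 \<le> \<gamma>" "gint r ?C = ennreal \<gamma>" by (cases "gint r ?C") (auto simp: top_unique)
    have "\<beta> + (1 - \<theta>) * \<gamma> = m"
      using sum assms \<beta> \<gamma> m by (simp add: ennreal_mult[symmetric] ennreal_plus[symmetric] del: ennreal_plus)
    moreover have "d / (64 * l) * m \<le> \<gamma>" using low \<gamma> by simp
    then have "(1 - \<theta>) * (d / (64 * l) * m) \<le> (1 - \<theta>) * \<gamma>" using assms by (intro mult_left_mono) auto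
    ultimately have "\<beta> \<le> (1 - (1 - \<theta>) * (d / (64 * l))) * m" by (simp add: algebra_simps)
    also have "\<dots> \<le> q * m" using m by (intro mult_right_mono) (auto simp: q_def)
    finally show ?thesis using \<beta> m by (simp add: ennreal_mult[symmetric] q_def)
  qed
  moreover have "0 \<le> q" by (simp add: q_def)
  ultimately show ?thesis by blast
qed

section \<open>Integrability of the total contraction\<close>

primrec contr :: "nat \<Rightarrow> real \<times> real \<Rightarrow> ennreal" where
  "contr 0 x = 1"
| "contr (Suc j) x = contr j x * (if bl 6 ((gmap ^^ (6 * j)) x) = run3 6 then ennreal (5/6) else 1)"

text \<open>Sum over consecutive windows of six blocks of the contraction that is guaranteed by
  then; up to a constant it dominates all values of \<open>exit_err\<close>.\<close>

definition total_contr :: "real \<times> real \<Rightarrow> ennreal" where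
  "total_contr x = (\<Sum>j. contr j x)"

lemma contr_blocks: "\<exists>f. \<forall>x. contr j x = f (bl (6 * j) x)"
proof (induction j)
  case 0
  then show ?case by (intro exI[of _ "\<lambda>_. 1"]) simp
next
  case (Suc j)
  then obtain f where f: "\<And>x. contr j x = f (bl (6 * j) x)" by blast
  have "bl (6 * Suc j) x = bl (6 * j) x @ bl 6 ((gmap ^^ (6 * j)) x)" for x
    using bl_add[of "6 * j" 6 x] by (simp add: add.commute)
  then show ?case
    by (intro exI[of _ "\<lambda>l. f (take (6 * j) l) * (if drop (6 * j) l = run3 6 then ennreal (5/6) else 1)"])
      (simp add: f)
qed

lemma contr_measurable [measurable]: "contr j \<in> borel_measurable borel"
proof -
  obtain f where "\<And>x. contr j x = f (bl (6 * j) x)" using contr_blocks by blast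
  then have "contr j = (\<lambda>x. f (bl (6 * j) x))" by auto
  then show ?thesis by simp
qed

lemma total_contr_measurable [measurable]: "total_contr \<in> borel_measurable borel"
  unfolding total_contr_def by measurable

text \<open>Every window lowers the integral by the same factor \<open>q\<close>, whatever the
  earlier blocks are, so the integrals decay geometrically.\<close>

lemma gint_total_contr_finite: "gint row0 total_contr < \<infinity>"
proof -
  obtain l where l: "0 < l" "gint row0 (\<lambda>_. 1) = ennreal l" by (rule Delta2_measure)
  obtain q where q: "0 \<le> q" "q < 1" and
    B: "\<And>r. r \<in> cone \<Longrightarrow> gint r (\<lambda>x. if bl 6 x = run3 6 then ennreal (5/6) else 1) \<le> ennreal q * gint r (\<lambda>_. 1)"
    using gint_run3_weight[of "5/6" 6] by auto
  have "gint row0 (contr j) \<le> ennreal (q ^ j * l)" for j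
  proof (induction j)
    case 0
    then show ?case using l by (simp add: contr_def)
  next
    case (Suc j)
    obtain f where f: "\<And>x. contr j x = f (bl (6 * j) x)" using contr_blocks by blast
    have "gint row0 (contr (Suc j)) = gint row0 (\<lambda>x. f (bl (6 * j) x) * (if bl 6 ((gmap ^^ (6 * j)) x) = run3 6 then ennreal (5/6) else 1))"
      unfolding contr.simps f ..
    also have "\<dots> \<le> ennreal q * gint row0 (\<lambda>x. f (bl (6 * j) x))"
      by (rule gint_blocks[OF _ B row0_cone])
        (rule blocks_measurable[of "\<lambda>l. if l = run3 6 then ennreal (5/6) else 1" 6])
    also have "\<dots> = ennreal q * gint row0 (contr j)"
    proof -
      have "contr j = (\<lambda>x. f (bl (6 * j) x))" by (rule ext) (rule f)
      then show ?thesis by simp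
    qed
    also have "\<dots> \<le> ennreal q * ennreal (q ^ j * l)" using Suc by (rule mult_left_mono) simp
    finally show ?case using q l by (simp add: ennreal_mult[symmetric] mult.assoc del: contr.simps)
  qed
  then have "gint row0 total_contr \<le> (\<Sum>j. ennreal (q ^ j * l))"
    unfolding total_contr_def by (subst gint_suminf) (auto intro!: suminf_le)
  also have "\<dots> < \<infinity>"
  proof -
    have "summable (\<lambda>j. q ^ j * l)" using q by (intro summable_mult2 summable_geometric) auto
    then show ?thesis using q l by (subst suminf_ennreal2) auto
  qed
  finally show ?thesis .
qed

lemma bl_window: "p + N \<le> n \<Longrightarrow> bl N ((gmap ^^ p) x) = take N (drop p (bl n x))"
proof -
  assume "p + N \<le> n"
  then obtain d where d: "n = p + (N + d)" by (metis le_Suc_ex add.assoc)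
  show ?thesis unfolding d by (simp add: bl_add)
qed

section \<open>Long runs followed by small total contraction\<close>

definition bad_set :: "nat \<Rightarrow> nat \<Rightarrow> nat \<Rightarrow> (real \<times> real) set" where
  "bad_set C N m0 = {x. \<forall>m\<ge>m0. \<not> (bl N ((gmap ^^ m) x) = run3 N \<and> total_contr ((gmap ^^ (m + N)) x) \<le> of_nat C)}"

lemma bad_set_measurable [measurable]: "bad_set C N m0 \<in> sets borel"
proof -
  have "{x. bl N ((gmap ^^ m) x) = run3 N} \<in> sets borel" for m
    using measurable_sets[OF measurable_comp[OF gmap_pow_measurable[of m] bl_measurable[of N]], of "{run3 N}"]
    by (simp add: vimage_def)
  moreover have "{x. total_contr ((gmap ^^ m) x) \<le> of_nat C} \<in> sets borel" for m
    using measurable_sets[OF measurable_comp[OF gmap_pow_measurable[of m] total_contr_measurable], of "{..of_nat C}"]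
    by (simp add: vimage_def)
  ultimately have "(\<Inter>m\<in>{m0..}. - ({x. bl N ((gmap ^^ m) x) = run3 N} \<inter> {x. total_contr ((gmap ^^ (m + N)) x) \<le> of_nat C})) \<in> sets borel"
    by (intro sets.countable_INT') auto
  also have "(\<Inter>m\<in>{m0..}. - ({x. bl N ((gmap ^^ m) x) = run3 N} \<inter> {x. total_contr ((gmap ^^ (m + N)) x) \<le> of_nat C})) = bad_set C N m0"
    by (auto simp: bad_set_def)
  finally show ?thesis .
qed

text \<open>Stop at the first run among the disjoint windows starting at m0 + j N. Whether window j
  is the first is decided by the blocks up to its end, so the future there is Lebesgue up to the
  factor 64, and a bad point must have a large \<open>total_contr\<close> at that time. The bound
  involves neither \<open>N\<close> nor \<open>m0\<close>.\<close>

lemma gint_bad_set: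
  assumes l: "0 < l" "gint row0 (\<lambda>_. 1) = ennreal l"
  shows "gint row0 (indicator (bad_set C N m0)) \<le> ennreal 64 * gint row0 (indicator {x. of_nat C < total_contr x})"
proof -
  let ?A = "{x. of_nat C < total_contr x}"
  have A [measurable]: "?A \<in> sets borel" by measurable
  define \<kappa> where "\<kappa> = ennreal (64 / l) * gint row0 (indicator ?A)"
  have A\<kappa>: "gint r (indicator ?A) \<le> \<kappa> * gint r (\<lambda>_. 1)" if "r \<in> cone" for r
    unfolding \<kappa>_def by (rule gint_distortion(1)[OF _ that l]) simp
  define win where "win p ls = (take N (drop p ls) = run3 N)" for p and ls :: "(nat \<times> bool) list"
  define f where "f j ls = (indicator {ls. win (m0 + j * N) ls \<and> (\<forall>i<j. \<not> win (m0 + i * N) ls)} ls :: ennreal)" for j ls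
  define g where "g j ls = (indicator {ls. \<forall>i<j. \<not> win (m0 + i * N) ls} ls :: ennreal)" for j ls
  let ?n = "\<lambda>j. m0 + Suc j * N"
  \<comment> \<open>Points without a run in any of these windows; they are null by the weight
    \<theta> = 0.\<close>
  define Z where "Z = {x. \<forall>j. bl N ((gmap ^^ (m0 + j * N)) x) \<noteq> run3 N}"
  have win: "win (m0 + i * N) (bl (?n j) x) \<longleftrightarrow> bl N ((gmap ^^ (m0 + i * N)) x) = run3 N" if "i \<le> j" for i j x
  proof -
    have "m0 + i * N + N \<le> ?n j" using mult_le_mono1[of "Suc i" "Suc j" N] that by simp
    then show ?thesis by (simp only: win_def bl_window)
  qed
  have Zj: "gint row0 (indicator Z) \<le> gint row0 (\<lambda>x. g j (bl (m0 + j * N) x))" for j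
  proof (rule gint_mono)
    fix x
    have "m0 + i * N + N \<le> m0 + j * N" if "i < j" for i using mult_le_mono1[of "Suc i" j N] that by simp
    then show "indicator Z x \<le> g j (bl (m0 + j * N) x)"
      by (auto simp: Z_def g_def indicator_def win_def bl_window[symmetric])
  qed
  obtain q where q: "0 \<le> q" "q < 1" and
    B: "\<And>r. r \<in> cone \<Longrightarrow> gint r (\<lambda>x. if bl N x = run3 N then ennreal 0 else 1) \<le> ennreal q * gint r (\<lambda>_. 1)"
    using gint_run3_weight[of 0 N] by auto
  have "gint row0 (\<lambda>x. g j (bl (m0 + j * N) x)) \<le> ennreal (q ^ j * l)" for j
  proof (induction j)
    case 0
    then show ?case using l by (simp add: g_def)
  next
    case (Suc j)
    have "g (Suc j) (bl (m0 + Suc j * N) x) = g j (bl (m0 + j * N) x) * (if bl N ((gmap ^^ (m0 + j * N)) x) = run3 N then ennreal 0 else 1)" for x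
    proof -
      have "m0 + i * N + N \<le> m0 + j * N" if "i < j" for i using mult_le_mono1[of "Suc i" j N] that by simp
      then have "win (m0 + i * N) (bl (m0 + j * N) x) \<longleftrightarrow> win (m0 + i * N) (bl (m0 + Suc j * N) x)" if "i < j" for i
        using that win[of i j x] by (simp add: win_def bl_window[symmetric])
      then show ?thesis using win[of j j x] by (auto simp: g_def indicator_def less_Suc_eq)
    qed
    then have "gint row0 (\<lambda>x. g (Suc j) (bl (m0 + Suc j * N) x)) =
      gint row0 (\<lambda>x. g j (bl (m0 + j * N) x) * (if bl N ((gmap ^^ (m0 + j * N)) x) = run3 N then ennreal 0 else 1))" by simp
    also have "\<dots> \<le> ennreal q * gint row0 (\<lambda>x. g j (bl (m0 + j * N) x))"
      by (rule gint_blocks[OF _ B row0_cone])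
        (rule blocks_measurable[of "\<lambda>l. if l = run3 N then ennreal 0 else 1" N])
    also have "\<dots> \<le> ennreal q * ennreal (q ^ j * l)" using Suc by (rule mult_left_mono) simp
    finally show ?case using q l by (simp add: ennreal_mult[symmetric] mult.assoc)
  qed
  then have Zq: "gint row0 (indicator Z) \<le> ennreal (q ^ j * l)" for j using Zj order_trans by blast
  have "gint row0 (indicator Z) \<le> 0"
  proof (rule LIMSEQ_le_const)
    have "(\<lambda>j. q ^ j * l) \<longlonglongrightarrow> 0" using q by (intro tendsto_mult_left_zero LIMSEQ_power_zero) auto
    then have "(\<lambda>j. ennreal (q ^ j * l)) \<longlonglongrightarrow> ennreal 0" by (rule tendsto_ennrealI)
    then show "(\<lambda>j. ennreal (q ^ j * l)) \<longlonglongrightarrow> 0" by simp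
  qed (use Zq in blast)
  then have Z0: "gint row0 (indicator Z) = 0" by simp
  have [measurable]: "(\<lambda>x. f j (bl n x)) \<in> borel_measurable borel" for j n by (rule blocks_measurable)
  have Am: "(\<lambda>x. indicator ?A ((gmap ^^ n) x) :: ennreal) \<in> borel_measurable borel" for n
    using measurable_comp[OF gmap_pow_measurable[of n], of "indicator ?A :: _ \<Rightarrow> ennreal" borel] by (simp add: comp_def)
  have Zm: "Z \<in> sets borel"
  proof -
    have "{x. bl N ((gmap ^^ m) x) = run3 N} \<in> sets borel" for m
      using measurable_sets[OF measurable_comp[OF gmap_pow_measurable[of m] bl_measurable[of N]], of "{run3 N}"]
      by (simp add: vimage_def)
    then have "(\<Inter>j. - {x. bl N ((gmap ^^ (m0 + j * N)) x) = run3 N}) \<in> sets borel" by auto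
    moreover have "(\<Inter>j. - {x. bl N ((gmap ^^ (m0 + j * N)) x) = run3 N}) = Z" by (auto simp: Z_def)
    ultimately show ?thesis by simp
  qed
  have "gint row0 (indicator (bad_set C N m0)) \<le>
     gint row0 (\<lambda>x. (\<Sum>j. f j (bl (?n j) x) * indicator ?A ((gmap ^^ ?n j) x)) + indicator Z x)"
  proof (rule gint_mono)
    fix x
    show "indicator (bad_set C N m0) x \<le> (\<Sum>j. f j (bl (?n j) x) * indicator ?A ((gmap ^^ ?n j) x)) + (indicator Z x :: ennreal)"
    proof (cases "x \<in> bad_set C N m0 \<and> x \<notin> Z")
      case True
      define j where "j = (LEAST j. bl N ((gmap ^^ (m0 + j * N)) x) = run3 N)"
      have "\<exists>j. bl N ((gmap ^^ (m0 + j * N)) x) = run3 N" using True by (auto simp: Z_def)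
      then have j: "bl N ((gmap ^^ (m0 + j * N)) x) = run3 N" and j': "\<And>i. i < j \<Longrightarrow> bl N ((gmap ^^ (m0 + i * N)) x) \<noteq> run3 N"
        unfolding j_def by (rule LeastI_ex) (blast dest: not_less_Least)
      have "f j (bl (?n j) x) = 1" using j j' win[of _ j x] by (auto simp: f_def indicator_def)
      moreover have "(gmap ^^ ?n j) x \<in> ?A"
        using True j unfolding bad_set_def by (auto simp: not_le add.commute add.left_commute)
      ultimately have "1 = f j (bl (?n j) x) * indicator ?A ((gmap ^^ ?n j) x)" by simp
      also have "\<dots> \<le> (\<Sum>j. f j (bl (?n j) x) * indicator ?A ((gmap ^^ ?n j) x))"
      proof -
        have "sum h {j} \<le> suminf h" for h :: "nat \<Rightarrow> ennreal" by (rule sum_le_suminf) auto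
        from this[of "\<lambda>j. f j (bl (?n j) x) * indicator ?A ((gmap ^^ ?n j) x)"] show ?thesis
          by (simp only: sum.insert finite.emptyI sum.empty add_0_right empty_iff not_False_eq_True)
      qed
      finally show ?thesis using True by (simp add: add_increasing2 del: funpow.simps)
    qed (auto simp: indicator_def)
  qed
  also have "\<dots> = (\<Sum>j. gint row0 (\<lambda>x. f j (bl (?n j) x) * indicator ?A ((gmap ^^ ?n j) x))) + gint row0 (indicator Z)"
    using Am Zm by (subst gint_add) (auto simp: gint_suminf intro!: borel_measurable_suminf simp del: funpow.simps)
  also have "\<dots> \<le> (\<Sum>j. \<kappa> * gint row0 (\<lambda>x. f j (bl (?n j) x)))"
    unfolding Z0 add_0_right by (intro suminf_le gint_blocks[OF _ A\<kappa> row0_cone]) auto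
  also have "\<dots> = \<kappa> * gint row0 (\<lambda>x. \<Sum>j. f j (bl (?n j) x))"
    by (subst gint_suminf) auto
  also have "\<dots> \<le> \<kappa> * gint row0 (\<lambda>_. 1)"
  proof (intro mult_left_mono gint_mono)
    fix x
    show "(\<Sum>j. f j (bl (?n j) x)) \<le> 1"
    proof (cases "\<exists>j. bl N ((gmap ^^ (m0 + j * N)) x) = run3 N")
      case True
      define j where "j = (LEAST j. bl N ((gmap ^^ (m0 + j * N)) x) = run3 N)"
      have j: "bl N ((gmap ^^ (m0 + j * N)) x) = run3 N" and j': "\<And>i. i < j \<Longrightarrow> bl N ((gmap ^^ (m0 + i * N)) x) \<noteq> run3 N"
        using True unfolding j_def by - (rule LeastI_ex, blast dest: not_less_Least)+
      have "f i (bl (?n i) x) = 0" if "i \<noteq> j" for i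
        using j j'[of i] win[of i i x] win[of j i x] that
        by (cases "i < j") (auto simp: f_def indicator_def dest!: linorder_neqE_nat intro!: exI[of _ j])
      then have "(\<Sum>j. f j (bl (?n j) x)) = (\<Sum>i\<in>{j}. f i (bl (?n i) x))" by (intro suminf_finite) auto
      also have "\<dots> = f j (bl (?n j) x)" by (simp only: sum.insert finite.emptyI sum.empty add_0_right empty_iff not_False_eq_True)
      also have "\<dots> \<le> 1" by (simp add: f_def indicator_def)
      finally show ?thesis .
    next
      case False
      then have "f i (bl (?n i) x) = 0" for i using win[of i i x] by (auto simp: f_def indicator_def)
      then show ?thesis by simp
    qed
  qed simp
  also have "\<dots> = ennreal 64 * gint row0 (indicator ?A)"
  proof -
    have "ennreal (64 / l) * ennreal l = ennreal 64" using l by (simp add: ennreal_mult[symmetric])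
    then show ?thesis unfolding \<kappa>_def l(2) by (metis mult.assoc mult.commute)
  qed
  finally show ?thesis .
qed

text \<open>By Markov's inequality the set where \<open>total_contr\<close> exceeds C has measure of
  order 1 / C, so the points that are bad for every C form a null set. The run length may be any
  function of C, since it does not enter the estimate.\<close>

lemma AE_blocks_recurrent:
  "AE x in lborel. x \<in> Delta2 \<longrightarrow> total_contr x < \<infinity> \<and>
     (\<exists>C. \<forall>m0. \<exists>m\<ge>m0. bl (Nf C) ((gmap ^^ m) x) = run3 (Nf C) \<and> total_contr ((gmap ^^ (m + Nf C)) x) \<le> of_nat C)"
proof -
  obtain l where l: "0 < l" "gint row0 (\<lambda>_. 1) = ennreal l" by (rule Delta2_measure)
  obtain I where I: "0 \<le> I" "gint row0 total_contr = ennreal I"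
    using gint_total_contr_finite by (auto simp: less_top_ennreal)
  have "AE x in lborel. total_contr x * indicator Delta2 x \<noteq> \<infinity>"
    using gint_total_contr_finite unfolding gint_row0 by (intro nn_integral_noteq_infinite) auto
  moreover define E where "E = (\<Inter>C. \<Union>m0. bad_set C (Nf C) m0)"
  have E [measurable]: "E \<in> sets borel" unfolding E_def by measurable
  have "emeasure lborel (E \<inter> Delta2) \<le> ennreal (64 * I / real (Suc C))" for C
  proof -
    let ?C = "Suc C"
    have "emeasure lborel (E \<inter> Delta2) \<le> emeasure lborel (\<Union>m0. bad_set ?C (Nf ?C) m0 \<inter> Delta2)"
      by (rule emeasure_mono) (auto simp: E_def)
    \<comment> \<open>The bad sets increase with \<open>m0\<close>, so their union obeys the same
      bound.\<close>
    also have "\<dots> = (SUP m0. emeasure lborel (bad_set ?C (Nf ?C) m0 \<inter> Delta2))"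
      by (rule SUP_emeasure_incseq[symmetric]) (auto simp: incseq_def bad_set_def)
    also have "\<dots> \<le> ennreal 64 * gint row0 (indicator {x. of_nat ?C < total_contr x})"
      using gint_bad_set[OF l, of ?C "Nf ?C"] unfolding gint_indicator[OF bad_set_measurable] by (rule SUP_least)
    also have "\<dots> \<le> ennreal 64 * (ennreal (1 / real ?C) * gint row0 total_contr)"
    proof (intro mult_left_mono)
      have "gint row0 (indicator {x. of_nat ?C < total_contr x}) \<le> gint row0 (\<lambda>x. ennreal (1 / real ?C) * total_contr x)"
      proof (rule gint_mono)
        fix x
        show "indicator {x. of_nat ?C < total_contr x} x \<le> ennreal (1 / real ?C) * total_contr x"
        proof (cases "of_nat ?C < total_contr x")
          case True
          have "1 = ennreal (1 / real ?C) * ennreal (real ?C)"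
            by (subst ennreal_mult[symmetric]) (simp_all del: of_nat_Suc)
          also have "\<dots> \<le> ennreal (1 / real ?C) * total_contr x"
            using True by (intro mult_left_mono) (auto simp: ennreal_of_nat_eq_real_of_nat simp del: of_nat_Suc)
          finally show ?thesis by (simp add: indicator_def)
        qed (simp add: indicator_def)
      qed
      then show "gint row0 (indicator {x. of_nat ?C < total_contr x}) \<le> ennreal (1 / real ?C) * gint row0 total_contr"
        by (simp add: gint_cmult)
    qed simp
    also have "\<dots> = ennreal (64 * I / real ?C)"
      unfolding I(2) using I(1) by (subst ennreal_mult[symmetric], simp, simp)+ simp
    finally show ?thesis .
  qed
  then have "emeasure lborel (E \<inter> Delta2) \<le> 0"
  proof (intro LIMSEQ_le_const)
    have "(\<lambda>C. 64 * I * (1 / real (Suc C))) \<longlonglongrightarrow> 64 * I * 0"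
      by (intro tendsto_mult tendsto_const LIMSEQ_Suc[OF lim_1_over_n])
    then have "(\<lambda>C. ennreal (64 * I * (1 / real (Suc C)))) \<longlonglongrightarrow> ennreal 0" by (intro tendsto_ennrealI) simp
    then show "(\<lambda>C. ennreal (64 * I / real (Suc C))) \<longlonglongrightarrow> 0" by simp
  qed blast
  then have "AE x in lborel. x \<notin> E \<inter> Delta2"
    by (intro AE_not_in) (auto simp: null_sets_def)
  ultimately show ?thesis
  proof eventually_elim
    case (elim x)
    show ?case
    proof
      assume x: "x \<in> Delta2"
      then have "x \<notin> E" using elim by simp
      then obtain C where "\<And>m0. x \<notin> bad_set C (Nf C) m0" by (auto simp: E_def)
      then show "total_contr x < \<infinity> \<and>
         (\<exists>C. \<forall>m0. \<exists>m\<ge>m0. bl (Nf C) ((gmap ^^ m) x) = run3 (Nf C) \<and> total_contr ((gmap ^^ (m + Nf C)) x) \<le> of_nat C)"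
        using x elim by (auto simp: bad_set_def less_top)
    qed
  qed
qed

section \<open>The acceleration as a subsequence of the Brun orbit\<close>

lemma brun_orbit_run1:
  assumes "generic x" "real i * snd x < 1 - snd x \<or> i = 0"
  shows "brun_orbit x i = (fst x / (1 - real i * snd x), snd x / (1 - real i * snd x))"
    "\<And>j. j < i \<Longrightarrow> brun_index (brun_orbit x j) = 1"
proof -
  note b = generic_bounds[OF assms(1)]
  have "brun_orbit x i = (fst x / (1 - real i * snd x), snd x / (1 - real i * snd x)) \<and>
    (\<forall>j<i. brun_index (brun_orbit x j) = 1)"
    using assms(2)
  proof (induction i)
    case (Suc i)
    let ?d = "1 - real i * snd x"
    have lt: "real (Suc i) * snd x < 1 - snd x" using Suc.prems by auto
    then have "real i * snd x < 1 - snd x" using b by (simp add: algebra_simps)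
    then have IH: "brun_orbit x i = (fst x / ?d, snd x / ?d)" "\<forall>j<i. brun_index (brun_orbit x j) = 1"
      using Suc.IH by auto
    have d: "0 < ?d" "2 * snd x < ?d" "0 < ?d - snd x" using lt b by (auto simp: algebra_simps)
    have g: "generic (brun_orbit x i)" by (rule generic_brun_pow[OF assms(1)])
    have "snd (brun_orbit x i) < 1/2" using d by (simp add: IH)
    then have i1: "brun_index (brun_orbit x i) = 1" using brun_index_generic(1)[OF g] by simp
    have "brun_map (brun_orbit x i) = (fst x / ?d / (1 - snd x / ?d), snd x / ?d / (1 - snd x / ?d))"
      using g i1 by (cases rule: brun_map_cases) (simp_all add: IH)
    also have "1 - snd x / ?d = (?d - snd x) / ?d" using d by (simp add: field_simps)
    also have "?d - snd x = 1 - real (Suc i) * snd x" by (simp add: algebra_simps)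
    finally show ?case using IH(2) i1 d by (auto simp: less_Suc_eq)
  qed simp
  then show "brun_orbit x i = (fst x / (1 - real i * snd x), snd x / (1 - real i * snd x))"
    "\<And>j. j < i \<Longrightarrow> brun_index (brun_orbit x j) = 1" by auto
qed

text \<open>Branch 1 subtracts x2 from the last homogeneous coordinate; this happens k - 1 times
  before 1 - i x2 falls below 2 x2. Genericity excludes the cases of equality.\<close>

lemma gmap_brun:
  assumes "generic x"
  defines "k \<equiv> fst (gblk x)"
  shows "1 \<le> k" "gmap x = brun_orbit x k" "\<And>i. i < k - 1 \<Longrightarrow> brun_index (brun_orbit x i) = 1"
    "brun_index (brun_orbit x (k - 1)) = (if snd (gblk x) then 2 else 3)"
proof -
  note b = generic_bounds[OF assms(1)]
  have s: "0 < snd x" using b by simp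
  have kf: "k = nat \<lfloor>1 / snd x\<rfloor>" by (simp add: k_def gblk_def)
  have "1 \<le> 1 / snd x" using b s by simp
  then show k1: "1 \<le> k" unfolding kf by linarith
  have k2: "real k \<le> 1 / snd x" "1 / snd x < real k + 1" using k1 unfolding kf by linarith+
  have fr: "frac (1 / snd x) = 1 / snd x - real k"
    using k1 unfolding kf frac_def by simp
  have k3: "real k * snd x \<le> 1" "1 < (real k + 1) * snd x" using k2 s by (simp_all add: field_simps)
  have "real k * snd x \<noteq> 1"
  proof
    assume "real k * snd x = 1"
    then have "real_of_int 0 * fst x + real_of_int (int k) * snd x + real_of_int (-1) = 0" by simp
    from genericD[OF assms(1) this] show False by simp
  qed
  with k3 have k4: "real k * snd x < 1" by simp
  define i where "i = k - 1"
  have ki: "k = Suc i" using k1 by (simp add: i_def)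
  let ?d = "1 - real i * snd x"
  have "real i * snd x < 1 - snd x" using k4 by (simp add: ki algebra_simps)
  note r = brun_orbit_run1[OF assms(1), of i, OF disjI1[OF this]]
  show "\<And>i. i < k - 1 \<Longrightarrow> brun_index (brun_orbit x i) = 1" using r(2) by (simp add: i_def)
  have d: "0 < ?d" "?d < 2 * snd x" using k4 k3 s by (auto simp: ki algebra_simps)
  let ?y = "brun_orbit x i"
  have g: "generic ?y" by (rule generic_brun_pow[OF assms(1)])
  have y2: "1/2 < snd ?y" using d by (simp add: r(1) field_simps)
  have cmp: "fst ?y + snd ?y < 1 \<longleftrightarrow> snd (gblk x)"
  proof -
    have "fst ?y + snd ?y = (fst x + snd x) / ?d" by (simp add: r(1) add_divide_distrib)
    then have "fst ?y + snd ?y < 1 \<longleftrightarrow> fst x + snd x < ?d" using d(1) by (simp only: divide_less_eq_1_pos)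
    also have "\<dots> \<longleftrightarrow> fst x / snd x < 1 / snd x - real k" using s by (simp add: ki field_simps)
    also have "\<dots> \<longleftrightarrow> fst x / snd x \<le> 1 / snd x - real k"
    proof -
      have "fst x / snd x \<noteq> 1 / snd x - real k"
      proof
        assume "fst x / snd x = 1 / snd x - real k"
        then have "real_of_int 1 * fst x + real_of_int (int k) * snd x + real_of_int (-1) = 0" using s by (simp add: field_simps)
        from genericD[OF assms(1) this] show False by simp
      qed
      then show ?thesis by linarith
    qed
    finally show ?thesis by (simp add: gblk_def fr)
  qed
  have idx: "brun_index ?y = (if snd (gblk x) then 2 else 3)"
    using brun_index_generic[OF g] y2 cmp generic_bounds(5)[OF g] by auto
  then show "brun_index (brun_orbit x (k - 1)) = (if snd (gblk x) then 2 else 3)" by (simp add: i_def)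
  have q: "fst ?y / snd ?y = fst x / snd x" "(1 - snd ?y) / snd ?y = 1 / snd x - real k"
    using d s by (simp_all add: r(1) ki field_simps)
  have "brun_map ?y = gmap x"
  proof (cases "snd (gblk x)")
    case True
    have "brun_map ?y = (fst x / snd x, 1 / snd x - real k)"
      by (rule brun_map_cases[OF g]) (use True idx q in simp_all)
    then show ?thesis using True by (auto simp: gmap_def fr gblk_def)
  next
    case False
    have "brun_map ?y = (1 / snd x - real k, fst x / snd x)"
      by (rule brun_map_cases[OF g]) (use False idx q in simp_all)
    then show ?thesis using False by (auto simp: gmap_def fr gblk_def)
  qed
  then show "gmap x = brun_orbit x k" by (simp add: ki)
qed

primrec exit_time :: "nat \<Rightarrow> real \<times> real \<Rightarrow> nat" where
  "exit_time 0 x = 0"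
| "exit_time (Suc m) x = exit_time m x + fst (gblk ((gmap ^^ m) x))"

lemma gmap_pow_brun: "generic x \<Longrightarrow> (gmap ^^ m) x = brun_orbit x (exit_time m x)"
proof (induction m)
  case (Suc m)
  have g: "generic (brun_orbit x (exit_time m x))" by (rule generic_brun_pow[OF Suc.prems])
  have "(gmap ^^ Suc m) x = gmap (brun_orbit x (exit_time m x))" using Suc by simp
  also have "\<dots> = brun_orbit (brun_orbit x (exit_time m x)) (fst (gblk (brun_orbit x (exit_time m x))))"
    by (rule gmap_brun(2)[OF g])
  also have "\<dots> = brun_orbit x (exit_time m x + fst (gblk (brun_orbit x (exit_time m x))))"
    by (simp only: brun_orbit_add)
  also have "\<dots> = brun_orbit x (exit_time (Suc m) x)" using Suc by simp
  finally show ?case .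
qed simp

lemma exit_time_ge: "generic x \<Longrightarrow> m \<le> exit_time m x"
proof (induction m)
  case (Suc m)
  have "generic ((gmap ^^ m) x)" using gmap_pow_brun[OF Suc.prems] generic_brun_pow[OF Suc.prems] by simp
  from gmap_brun(1)[OF this] show ?case using Suc by simp
qed simp

lemma exit_time_run3:
  assumes "generic x" "bl N ((gmap ^^ m) x) = run3 N" "i \<le> N"
  shows "exit_time (m + i) x = exit_time m x + i"
    "i < N \<Longrightarrow> brun_index (brun_orbit x (exit_time m x + i)) = 3"
proof -
  have nth: "gblk ((gmap ^^ (m + i)) x) = (Suc 0, False)" if "i < N" for i
  proof -
    have "bl N y ! i = gblk ((gmap ^^ i) y)" if "i < N" for y
      using that
    proof (induction N arbitrary: i y)
      case (Suc N)
      then show ?case by (cases i) (simp_all add: funpow_swap1)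
    qed simp
    from this[OF that, of "(gmap ^^ m) x"] show ?thesis
      using that assms(2) by (simp add: funpow_add add.commute[of m])
  qed
  have e: "exit_time (m + i) x = exit_time m x + i" if "i \<le> N" for i
    using that
  proof (induction i)
    case (Suc i)
    then show ?case using nth[of i] by simp
  qed simp
  show "exit_time (m + i) x = exit_time m x + i" using e assms(3) by simp
  assume i: "i < N"
  have "generic ((gmap ^^ (m + i)) x)" using gmap_pow_brun[OF assms(1)] generic_brun_pow[OF assms(1)] by simp
  from gmap_brun(4)[OF this] show "brun_index (brun_orbit x (exit_time m x + i)) = 3"
    using nth[OF i] gmap_pow_brun[OF assms(1), of "m + i"] e[of i] i by simp
qed

text \<open>Only the last index of a block differs from 1, so each block contributes a single
  term.\<close>

lemma exit_err_exit_time: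
  assumes "generic x"
  shows "exit_err x (exit_time M x) = (\<Sum>m\<le>M. max_err x (exit_time m x))"
proof (induction M)
  case (Suc M)
  let ?y = "(gmap ^^ M) x" and ?t = "exit_time M x"
  let ?f = "\<lambda>k. if brun_index (brun_orbit x k) = 1 then 0 else max_err x (Suc k)"
  have y: "?y = brun_orbit x ?t" by (rule gmap_pow_brun[OF assms])
  have g: "generic ?y" unfolding y by (rule generic_brun_pow[OF assms])
  define k where "k = fst (gblk ?y)"
  note k = gmap_brun[OF g, folded k_def]
  obtain k' where k': "k = Suc k'" using k(1) by (cases k) auto
  have "sum ?f {..<?t + k} = sum ?f {..<?t} + sum ?f {?t..<?t + k'} + ?f (?t + k')"
    by (simp add: k' lessThan_atLeast0 sum.atLeastLessThan_concat del: sum.op_ivl_Suc)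
      (simp add: sum.atLeastLessThan_concat)
  also have "sum ?f {?t..<?t + k'} = 0"
  proof (intro sum.neutral ballI)
    fix j assume j: "j \<in> {?t..<?t + k'}"
    then have "brun_index (brun_orbit ?y (j - ?t)) = 1" using k(3)[of "j - ?t"] k' by auto
    also have "brun_orbit ?y (j - ?t) = brun_orbit x j" using j unfolding y by (simp only: brun_orbit_add[symmetric]) simp
    finally show "?f j = 0" by simp
  qed
  also have "?f (?t + k') = max_err x (exit_time (Suc M) x)"
  proof -
    have "brun_orbit ?y k' = brun_orbit x (?t + k')" unfolding y by (simp only: brun_orbit_add)
    then show ?thesis using k(4) by (simp add: k' k_def[symmetric])
  qed
  finally show ?case using Suc by (simp add: exit_err_def k_def[symmetric])
qed (simp add: exit_err_def)

lemma max_err_contr: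
  assumes "generic x"
  shows "ennreal (max_err x (exit_time (6 * j) x)) \<le> ennreal (max_err x 0) * contr j x"
proof (induction j)
  case (Suc j)
  let ?t = "exit_time (6 * j) x"
  have t: "exit_time (6 * Suc j) x = exit_time (6 * j + 6) x" by (simp add: add.commute)
  show ?case
  proof (cases "bl 6 ((gmap ^^ (6 * j)) x) = run3 6")
    case True
    have "max_err x (?t + 6) \<le> 5/6 * max_err x ?t"
      by (rule max_err_contract[OF assms exit_time_run3(2)[OF assms True]]) auto
    then have "ennreal (max_err x (exit_time (6 * Suc j) x)) \<le> ennreal (max_err x ?t * (5/6))"
      unfolding t exit_time_run3(1)[OF assms True order_refl] by (intro ennreal_leI) simp
    also have "\<dots> = ennreal (max_err x ?t) * ennreal (5/6)" by (rule ennreal_mult) (auto intro: max_err_nonneg)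
    also have "\<dots> \<le> ennreal (max_err x 0) * contr j x * ennreal (5/6)" using Suc by (intro mult_right_mono) auto
    finally show ?thesis using True by (simp add: mult.assoc)
  next
    case False
    have "exit_time m x \<le> exit_time (m + n) x" for m n by (induction n) auto
    then have "max_err x (exit_time (6 * Suc j) x) \<le> max_err x ?t" unfolding t by (intro max_err_antimono[OF assms])
    then have "ennreal (max_err x (exit_time (6 * Suc j) x)) \<le> ennreal (max_err x ?t)" by (rule ennreal_leI)
    also note Suc
    finally show ?thesis using False by simp
  qed
qed simp

lemma max_err_0_le:
  assumes "generic x"
  shows "max_err x 0 \<le> 2"
  unfolding max_err_le_iff
proof
  fix j :: 3
  let ?a = "freq x 1 - of_bool (j = 1)" and ?b = "freq x 2 - of_bool (j = 2)"
  have "\<bar>?a\<bar> \<le> 1" "\<bar>?b\<bar> \<le> 1"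
    using freq_pos[OF assms, of 1] freq_pos[OF assms, of 2] freq_le_1[OF assms, of 1] freq_le_1[OF assms, of 2] by auto
  moreover have "norm (err x 0 j) \<le> \<bar>?a\<bar> + \<bar>?b\<bar>"
    using norm_Pair_le[of ?a ?b] by (simp add: err0_def rotation_freq)
  ultimately show "norm (err x 0 j) \<le> 2" by linarith
qed

text \<open>The constant 12 is 6 times 2: a window has six blocks, each bounded by the value at the
  start of the window, and the initial discrepancy is at most 2.\<close>

lemma err_bounded_contr:
  assumes "generic x" "total_contr x \<le> ennreal c" "0 \<le> c"
  shows "err_bounded x (12 * c)"
  unfolding err_bounded_def
proof
  fix n
  let ?e = "\<lambda>m. max_err x (exit_time m x)"
  have mono: "exit_time m x \<le> exit_time (m + i) x" for m i by (induction i) auto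
  have "exit_err x n \<le> exit_err x (exit_time (6 * n) x)"
  proof -
    have "n \<le> exit_time (6 * n) x" using exit_time_ge[OF assms(1), of "6 * n"] by simp
    then show ?thesis unfolding exit_err_def using max_err_nonneg by (intro add_left_mono sum_mono2) auto
  qed
  also have "\<dots> \<le> (\<Sum>m<6 * Suc n. ?e m)"
    unfolding exit_err_exit_time[OF assms(1)] using max_err_nonneg by (intro sum_mono2) auto
  also have "\<dots> \<le> 6 * (\<Sum>j<Suc n. ?e (6 * j))"
  proof (induction n)
    case 0
    have "?e i \<le> ?e 0" for i using mono[of 0 i] by (intro max_err_antimono[OF assms(1)]) simp
    from sum_mono[of "{..<6}" ?e "\<lambda>_. ?e 0", OF this] show ?case by simp
  next
    case (Suc n)
    let ?a = "6 * Suc n"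
    have "sum ?e {..<6 * Suc (Suc n)} = sum ?e {..<?a} + sum ?e {?a..<?a + 6}"
      by (subst sum.union_disjoint[symmetric]) (auto intro!: sum.cong)
    moreover have "?e i \<le> ?e ?a" if "i \<in> {?a..<?a + 6}" for i
      using mono[of ?a "i - ?a"] that by (intro max_err_antimono[OF assms(1)]) simp
    then have "sum ?e {?a..<?a + 6} \<le> sum (\<lambda>_. ?e ?a) {?a..<?a + 6}" by (rule sum_mono)
    ultimately show ?case using Suc by simp
  qed
  also have "(\<Sum>j<Suc n. ?e (6 * j)) \<le> 2 * c"
  proof -
    have "ennreal (\<Sum>j<Suc n. ?e (6 * j)) = (\<Sum>j<Suc n. ennreal (?e (6 * j)))"
      by (rule sum_ennreal[symmetric]) (rule max_err_nonneg)
    also have "\<dots> \<le> (\<Sum>j<Suc n. ennreal 2 * contr j x)"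
      using max_err_contr[OF assms(1)] ennreal_leI[OF max_err_0_le[OF assms(1)]]
      by (intro sum_mono) (meson mult_right_mono order_trans zero_le)
    also have "\<dots> \<le> (\<Sum>j. ennreal 2 * contr j x)" by (rule sum_le_suminf) auto
    also have "\<dots> = ennreal 2 * total_contr x" unfolding total_contr_def by (rule ennreal_suminf_cmult)
    also have "\<dots> \<le> ennreal 2 * ennreal c" using assms(2) by (rule mult_left_mono) simp
    also have "\<dots> = ennreal (2 * c)" using assms(3) by (intro ennreal_mult[symmetric]) auto
    finally show ?thesis using assms(3) by simp
  qed
  finally show "exit_err x n \<le> 12 * c" by simp
qed

text \<open>The order matters: \<open>B\<close> is fixed first, then come infinitely many times.
  \<open>B\<close> bounds the orbit point after the run and at the same time prescribes the length
  \<open>Nf B\<close> of the run; \<open>Nf\<close> will be supplied by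
  \<open>deep_tile\<close>.\<close>

definition recurrent :: "(nat \<Rightarrow> nat) \<Rightarrow> real \<times> real \<Rightarrow> bool" where
  "recurrent Nf x \<longleftrightarrow> generic x \<and> (\<exists>B. err_bounded x B) \<and>
     (\<exists>B. \<forall>n0. \<exists>n\<ge>n0. (\<forall>k<Nf B. brun_index (brun_orbit x (n + k)) = 3) \<and>
        err_bounded (brun_orbit x (n + Nf B)) (real B))"

lemma AE_recurrent: "AE x in lebesgue_on Delta2. recurrent Nf x"
proof -
  \<comment> \<open>\<open>total_contr\<close> at most C gives the discrepancy bound 12 C, so the
    run length is taken at 12 C.\<close>
  have "AE x in lebesgue. x \<in> Delta2 \<longrightarrow> total_contr x < \<infinity> \<and>
     (\<exists>C. \<forall>m0. \<exists>m\<ge>m0. bl (Nf (12 * C)) ((gmap ^^ m) x) = run3 (Nf (12 * C)) \<and>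
        total_contr ((gmap ^^ (m + Nf (12 * C))) x) \<le> of_nat C)"
    by (rule AE_completion) (rule AE_blocks_recurrent[of "\<lambda>C. Nf (12 * C)"])
  then have "AE x in lebesgue_on Delta2. total_contr x < \<infinity> \<and>
     (\<exists>C. \<forall>m0. \<exists>m\<ge>m0. bl (Nf (12 * C)) ((gmap ^^ m) x) = run3 (Nf (12 * C)) \<and>
        total_contr ((gmap ^^ (m + Nf (12 * C))) x) \<le> of_nat C)"
    by (rule AE_restrict_space_iff[OF Delta2_lebesgue, THEN iffD2])
  then show ?thesis using AE_generic
  proof eventually_elim
    case (elim x)
    then have g: "generic x" and fin: "total_contr x < \<infinity>" by auto
    obtain c where c: "0 \<le> c" "total_contr x = ennreal c" using fin by (auto simp: less_top_ennreal)
    have "err_bounded x (12 * c)" by (rule err_bounded_contr[OF g]) (simp_all add: c)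
    moreover obtain C where C: "\<And>m0. \<exists>m\<ge>m0. bl (Nf (12 * C)) ((gmap ^^ m) x) = run3 (Nf (12 * C)) \<and>
        total_contr ((gmap ^^ (m + Nf (12 * C))) x) \<le> of_nat C" using elim by blast
    have "\<exists>n\<ge>n0. (\<forall>k<Nf (12 * C). brun_index (brun_orbit x (n + k)) = 3) \<and>
        err_bounded (brun_orbit x (n + Nf (12 * C))) (real (12 * C))" for n0
    proof -
      let ?N = "Nf (12 * C)"
      obtain m where m: "n0 \<le> m" "bl ?N ((gmap ^^ m) x) = run3 ?N" "total_contr ((gmap ^^ (m + ?N)) x) \<le> of_nat C"
        using C by blast
      have e: "(gmap ^^ (m + ?N)) x = brun_orbit x (exit_time m x + ?N)"
        using gmap_pow_brun[OF g, of "m + ?N"] exit_time_run3(1)[OF g m(2) order_refl] by simp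
      have "err_bounded (brun_orbit x (exit_time m x + ?N)) (12 * real C)"
        using m(3) unfolding e by (intro err_bounded_contr generic_brun_pow[OF g]) (simp_all add: ennreal_of_nat_eq_real_of_nat)
      then show ?thesis
        using exit_time_run3(2)[OF g m(2)] exit_time_ge[OF g, of m] m(1)
        by (intro exI[of _ "exit_time m x"]) auto
    qed
    ultimately show "recurrent Nf x" unfolding recurrent_def using g by blast
  qed
qed

section \<open>Limit words\<close>

lemma shift_eq_shift_le_ex:
  "u @- \<alpha> = v @- \<beta> \<Longrightarrow> length u \<le> length v \<Longrightarrow> \<exists>v'. v = u @ v' \<and> \<alpha> = v' @- \<beta>"
proof (induction u arbitrary: v)
  case (Cons a u)
  then obtain b v0 where v: "v = b # v0" by (cases v) auto
  with Cons.prems have "u @- \<alpha> = v0 @- \<beta>" "length u \<le> length v0" "a = b" by auto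
  with Cons.IH[of v0] v show ?case by auto
qed simp

lemma shift_eq_shift_le:
  assumes "u @- \<alpha> = v @- \<beta>" "length u \<le> length v"
  obtains v' where "v = u @ v'" "\<alpha> = v' @- \<beta>"
  using shift_eq_shift_le_ex[OF assms] by blast

lemma stake_Suc_length_iff: "stake (Suc (length p)) \<omega> = p @ [i] \<longleftrightarrow> (\<exists>\<omega>'. \<omega> = p @- (i ## \<omega>'))"
proof
  assume "stake (Suc (length p)) \<omega> = p @ [i]"
  then have "\<omega> = (p @ [i]) @- sdrop (Suc (length p)) \<omega>" by (metis stake_sdrop)
  then show "\<exists>\<omega>'. \<omega> = p @- (i ## \<omega>')" by (metis shift.simps(1) shift.simps(2) shift_append)
next
  assume "\<exists>\<omega>'. \<omega> = p @- (i ## \<omega>')"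
  then obtain \<omega>' where "\<omega> = (p @ [i]) @- \<omega>'" by auto
  then show "stake (Suc (length p)) \<omega> = p @ [i]" by (simp add: stake_shift del: shift_append)
qed

definition nonerasing :: "(nat \<Rightarrow> substitution) \<Rightarrow> bool" where
  "nonerasing \<sigma> \<longleftrightarrow> (\<forall>n j. \<sigma> n j \<noteq> [])"

lemma nonerasing_shift: "nonerasing \<sigma> \<Longrightarrow> nonerasing (\<lambda>k. \<sigma> (m + k))"
  by (simp add: nonerasing_def)

lemma nonerasing_brun: "nonerasing (brun_Phi x)"
  by (auto simp: nonerasing_def brun_Phi_def brun_subst_def split: if_splits)

lemma subst_stream_Stream:
  "(\<And>j. s j \<noteq> []) \<Longrightarrow> subst_stream s (a ## \<omega>) = s a @- subst_stream s \<omega>"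
  by (simp add: subst_stream_def flat_Stream)

lemma subst_stream_shift:
  "(\<And>j. s j \<noteq> []) \<Longrightarrow> subst_stream s (w @- \<omega>) = subst_word s w @- subst_stream s \<omega>"
  by (induction w) (auto simp: subst_stream_Stream)

lemma subst_stream_split:
  assumes "\<And>j. s j \<noteq> []" "subst_stream s \<omega> = v @- (i ## \<omega>')"
  shows "\<exists>q j \<omega>'' r t. \<omega> = q @- (j ## \<omega>'') \<and> s j = r @ i # t \<and> v = subst_word s q @ r"
  using assms(2)
proof (induction "length v" arbitrary: v \<omega> rule: less_induct)
  case less
  obtain a \<omega>1 where \<omega>: "\<omega> = a ## \<omega>1" by (cases \<omega>)
  have e: "s a @- subst_stream s \<omega>1 = v @- (i ## \<omega>')"
    using less.prems by (simp add: \<omega> subst_stream_Stream[OF assms(1)])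
  show ?case
  proof (cases "length v < length (s a)")
    case True
    from e have "(v @ [i]) @- \<omega>' = s a @- subst_stream s \<omega>1" by simp
    then obtain v' where "s a = (v @ [i]) @ v'" by (rule shift_eq_shift_le) (use True in simp)
    then show ?thesis using \<omega> by (intro exI[of _ "[]"] exI[of _ a] exI[of _ \<omega>1] exI[of _ v] exI[of _ v']) simp
  next
    case False
    then obtain v' where v': "v = s a @ v'" "subst_stream s \<omega>1 = v' @- (i ## \<omega>')"
      using e by (elim shift_eq_shift_le) auto
    moreover have "length v' < length v" using v'(1) assms(1)[of a] by (cases "s a") auto
    ultimately obtain q j \<omega>'' r t where "\<omega>1 = q @- (j ## \<omega>'')" "s j = r @ i # t" "v' = subst_word s q @ r"
      using less.hyps[of v' \<omega>1] by blast
    then show ?thesis using \<omega> v'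
      by (intro exI[of _ "a # q"] exI[of _ j] exI[of _ \<omega>''] exI[of _ r] exI[of _ t]) simp
  qed
qed

lemma limit_word_step:
  "limit_word \<sigma> \<omega> \<longleftrightarrow> (\<exists>\<omega>1. limit_word (\<lambda>k. \<sigma> (Suc k)) \<omega>1 \<and> \<omega> = subst_stream (\<sigma> 0) \<omega>1)"
proof
  assume "limit_word \<sigma> \<omega>"
  then obtain W where W0: "W 0 = \<omega>" and W: "\<And>n. W n = subst_stream (\<sigma> n) (W (Suc n))"
    unfolding limit_word_def by blast
  have "limit_word (\<lambda>k. \<sigma> (Suc k)) (W 1)"
    unfolding limit_word_def by (rule exI[of _ "\<lambda>n. W (Suc n)"]) (intro conjI allI, simp, rule W)
  moreover have "\<omega> = subst_stream (\<sigma> 0) (W 1)" using W[of 0] W0 by simp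
  ultimately show "\<exists>\<omega>1. limit_word (\<lambda>k. \<sigma> (Suc k)) \<omega>1 \<and> \<omega> = subst_stream (\<sigma> 0) \<omega>1" by blast
next
  assume "\<exists>\<omega>1. limit_word (\<lambda>k. \<sigma> (Suc k)) \<omega>1 \<and> \<omega> = subst_stream (\<sigma> 0) \<omega>1"
  then obtain W \<omega>1 where W: "W 0 = \<omega>1" "\<And>n. W n = subst_stream (\<sigma> (Suc n)) (W (Suc n))"
    and \<omega>: "\<omega> = subst_stream (\<sigma> 0) \<omega>1" unfolding limit_word_def by blast
  show "limit_word \<sigma> \<omega>"
    unfolding limit_word_def
  proof (intro exI[of _ "case_nat \<omega> W"] conjI allI)
    show "case_nat \<omega> W n = subst_stream (\<sigma> n) (case_nat \<omega> W (Suc n))" for n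
    proof (cases n)
      case (Suc k)
      show ?thesis unfolding Suc nat.case by (rule W(2))
    qed (simp add: \<omega> W(1))
  qed simp
qed

definition pre :: "(nat \<Rightarrow> substitution) \<Rightarrow> 3 list \<Rightarrow> 3 \<Rightarrow> bool" where
  "pre \<sigma> p i \<longleftrightarrow> (\<exists>\<omega>. limit_word \<sigma> (p @- (i ## \<omega>)))"

lemma pre_step:
  assumes "nonerasing \<sigma>"
  shows "pre \<sigma> p i \<longleftrightarrow> (\<exists>q j r t. pre (\<lambda>k. \<sigma> (Suc k)) q j \<and> \<sigma> 0 j = r @ i # t \<and> p = subst_word (\<sigma> 0) q @ r)"
proof
  have ne: "\<And>j. \<sigma> 0 j \<noteq> []" using assms by (auto simp: nonerasing_def)
  assume "pre \<sigma> p i"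
  then obtain \<omega> \<omega>1 where 1: "limit_word (\<lambda>k. \<sigma> (Suc k)) \<omega>1" "subst_stream (\<sigma> 0) \<omega>1 = p @- (i ## \<omega>)"
    unfolding pre_def limit_word_step[of \<sigma>] by metis
  from subst_stream_split[OF ne 1(2)] 1(1)
  show "\<exists>q j r t. pre (\<lambda>k. \<sigma> (Suc k)) q j \<and> \<sigma> 0 j = r @ i # t \<and> p = subst_word (\<sigma> 0) q @ r"
    unfolding pre_def by blast
next
  have ne: "\<And>j. \<sigma> 0 j \<noteq> []" using assms by (auto simp: nonerasing_def)
  assume "\<exists>q j r t. pre (\<lambda>k. \<sigma> (Suc k)) q j \<and> \<sigma> 0 j = r @ i # t \<and> p = subst_word (\<sigma> 0) q @ r"
  then obtain q j r t \<omega> where h: "limit_word (\<lambda>k. \<sigma> (Suc k)) (q @- (j ## \<omega>))" "\<sigma> 0 j = r @ i # t" "p = subst_word (\<sigma> 0) q @ r"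
    by (auto simp: pre_def)
  have "subst_stream (\<sigma> 0) (q @- (j ## \<omega>)) = p @- (i ## (t @- subst_stream (\<sigma> 0) \<omega>))"
    using h by (simp add: subst_stream_shift[OF ne] subst_stream_Stream[OF ne])
  with h(1) show "pre \<sigma> p i" unfolding pre_def limit_word_step[of \<sigma>] by metis
qed

lemma subst_upto_split:
  assumes "subst_upto \<sigma> m w = r @ i # t"
  shows "\<exists>w1 j w2 r' t'. w = w1 @ j # w2 \<and> subst_upto \<sigma> m [j] = r' @ i # t' \<and> r = subst_upto \<sigma> m w1 @ r'"
  using assms
proof (induction w arbitrary: r)
  case (Cons a w)
  have "subst_upto \<sigma> m [a] @ subst_upto \<sigma> m w = r @ i # t"
    using Cons.prems by (subst (asm) subst_upto_Cons)
  then show ?case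
  proof (cases rule: append_eq_append_Cons_cases)
    case (1 s')
    then show ?thesis by (intro exI[of _ "[]"] exI[of _ a] exI[of _ w] exI[of _ r] exI[of _ s']) simp
  next
    case (2 p')
    from Cons.IH[OF 2(2)] obtain w1 j w2 r' t' where
      "w = w1 @ j # w2" "subst_upto \<sigma> m [j] = r' @ i # t'" "p' = subst_upto \<sigma> m w1 @ r'" by blast
    then show ?thesis using 2(1) subst_upto_Cons[of \<sigma> m a w1]
      by (intro exI[of _ "a # w1"] exI[of _ j] exI[of _ w2] exI[of _ r'] exI[of _ t']) simp
  qed
qed simp

text \<open>The prefix-suffix expansion of a position in a limit word, truncated after
  \<open>m\<close> levels. It will become the set equation of the tiles.\<close>

lemma pre_multi:
  assumes "nonerasing \<sigma>"
  shows "pre \<sigma> p i \<longleftrightarrow> (\<exists>q j r t. pre (\<lambda>k. \<sigma> (m + k)) q j \<and> subst_upto \<sigma> m [j] = r @ i # t \<and> p = subst_upto \<sigma> m q @ r)"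
proof (induction m)
  case 0
  show ?case by (auto simp: Cons_eq_append_conv)
next
  case (Suc m)
  have st: "pre (\<lambda>k. \<sigma> (m + k)) q j \<longleftrightarrow> (\<exists>q' j' r t. pre (\<lambda>k. \<sigma> (Suc m + k)) q' j' \<and> \<sigma> m j' = r @ j # t \<and> q = subst_word (\<sigma> m) q' @ r)" for q j
    using pre_step[OF nonerasing_shift[OF assms], of m q j] by simp
  show ?case
  proof
    assume "pre \<sigma> p i"
    then obtain q j r t where 1: "pre (\<lambda>k. \<sigma> (m + k)) q j" "subst_upto \<sigma> m [j] = r @ i # t" "p = subst_upto \<sigma> m q @ r"
      using Suc by blast
    obtain q' j' r' t' where 2: "pre (\<lambda>k. \<sigma> (Suc m + k)) q' j'" "\<sigma> m j' = r' @ j # t'" "q = subst_word (\<sigma> m) q' @ r'"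
      using 1(1) st by blast
    have "subst_upto \<sigma> (Suc m) [j'] = (subst_upto \<sigma> m r' @ r) @ i # (t @ subst_upto \<sigma> m t')"
      using 2(2) 1(2) subst_upto_Cons[of \<sigma> m j t'] by simp
    moreover have "p = subst_upto \<sigma> (Suc m) q' @ (subst_upto \<sigma> m r' @ r)" using 1(3) 2(3) by simp
    ultimately show "\<exists>q j r t. pre (\<lambda>k. \<sigma> (Suc m + k)) q j \<and> subst_upto \<sigma> (Suc m) [j] = r @ i # t \<and> p = subst_upto \<sigma> (Suc m) q @ r"
      using 2(1) by blast
  next
    assume "\<exists>q j r t. pre (\<lambda>k. \<sigma> (Suc m + k)) q j \<and> subst_upto \<sigma> (Suc m) [j] = r @ i # t \<and> p = subst_upto \<sigma> (Suc m) q @ r"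
    then obtain q j r t where 1: "pre (\<lambda>k. \<sigma> (Suc m + k)) q j" "subst_upto \<sigma> (Suc m) [j] = r @ i # t" "p = subst_upto \<sigma> (Suc m) q @ r"
      by blast
    from 1(2) have "subst_upto \<sigma> m (\<sigma> m j) = r @ i # t" by simp
    from subst_upto_split[OF this] obtain w1 j' w2 r' t' where
      2: "\<sigma> m j = w1 @ j' # w2" "subst_upto \<sigma> m [j'] = r' @ i # t'" "r = subst_upto \<sigma> m w1 @ r'" by blast
    have "pre (\<lambda>k. \<sigma> (m + k)) (subst_word (\<sigma> m) q @ w1) j'" using st 1(1) 2(1) by blast
    moreover have "p = subst_upto \<sigma> m (subst_word (\<sigma> m) q @ w1) @ r'" using 1(3) 2(3) by simp
    ultimately show "pre \<sigma> p i" using Suc 2(2) by blast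
  qed
qed

definition unbounded_words :: "(nat \<Rightarrow> substitution) \<Rightarrow> bool" where
  "unbounded_words \<sigma> \<longleftrightarrow> (\<forall>L. \<exists>m. \<forall>j. L < length (subst_upto \<sigma> m [j]))"

lemma subst_upto_nonempty: "nonerasing \<sigma> \<Longrightarrow> w \<noteq> [] \<Longrightarrow> subst_upto \<sigma> n w \<noteq> []"
proof (induction n arbitrary: w)
  case (Suc n)
  then have "subst_word (\<sigma> n) w \<noteq> []" by (cases w) (auto simp: nonerasing_def)
  then show ?case using Suc by simp
qed simp

text \<open>Desubstitute until all images of letters are longer than \<open>p\<close>; the part of
  \<open>p\<close> that consists of whole images is then empty.\<close>

lemma pre_is_prefix:
  assumes "nonerasing \<sigma>" "unbounded_words \<sigma>" "pre \<sigma> p i"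
  shows "\<exists>m j t. subst_upto \<sigma> m [j] = p @ i # t"
proof -
  obtain m where m: "\<And>j. length p < length (subst_upto \<sigma> m [j])" using assms(2) by (auto simp: unbounded_words_def)
  obtain q j r t where 1: "subst_upto \<sigma> m [j] = r @ i # t" "p = subst_upto \<sigma> m q @ r"
    using assms pre_multi by blast
  have "q = []"
  proof (cases q)
    case (Cons a q')
    then show ?thesis using 1(2) m[of a] subst_upto_Cons[of \<sigma> m a q'] by simp
  qed simp
  then show ?thesis using 1 by auto
qed

text \<open>Letters are chosen upwards so that each one starts the image of the next. Their images
  are nested prefixes at every level, and the limits form a compatible sequence of infinite
  words.\<close>

lemma limit_word_exists:
  assumes "nonerasing \<sigma>" "unbounded_words \<sigma>" and hd: "\<And>n a. \<exists>b w. \<sigma> n b = a # w"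
  shows "\<exists>\<omega>. limit_word \<sigma> \<omega>"
proof -
  obtain g where g: "\<And>n a. \<exists>w. \<sigma> n (g n a) = a # w" using hd by metis
  define a where "a = rec_nat (1 :: 3) g"
  have a: "\<exists>w. \<sigma> n (a (Suc n)) = a n # w" for n using g[of n "a n"] by (simp add: a_def)
  define w where "w n m = subst_upto (\<lambda>k. \<sigma> (n + k)) m [a (n + m)]" for n m
  have w_Suc: "\<exists>v. w n (Suc m) = w n m @ v" for n m
  proof -
    obtain v where v: "\<sigma> (n + m) (a (Suc (n + m))) = a (n + m) # v" using a by blast
    have "w n (Suc m) = subst_upto (\<lambda>k. \<sigma> (n + k)) m (a (n + m) # v)" using v by (simp add: w_def)
    then show ?thesis by (subst (asm) subst_upto_Cons) (auto simp: w_def)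
  qed
  have w_le: "\<exists>v. w n m' = w n m @ v" if "m \<le> m'" for n m m'
    using that
  proof (induction m' rule: dec_induct)
    case (step k)
    then show ?case using w_Suc[of n k] by auto
  qed simp
  have shift: "subst_upto \<sigma> (n + m) w = subst_upto \<sigma> n (subst_upto (\<lambda>k. \<sigma> (n + k)) m w)" for n m w
    by (rule subst_upto_add)
  have w_unb: "\<exists>m. L < length (w n m)" for n L
  proof -
    have len_mono: "length v \<le> length (subst_upto \<tau> k v)" if "nonerasing \<tau>" for \<tau> k v
    proof (induction v)
      case (Cons b v)
      have "1 \<le> length (subst_upto \<tau> k [b])" using subst_upto_nonempty[OF that, of "[b]" k] by (cases "subst_upto \<tau> k [b]") auto
      then show ?case using Cons subst_upto_Cons[of \<tau> k b v] by simp
    qed simp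
    define A where "A = Max (range (\<lambda>j. length (subst_upto \<sigma> n [j])))"
    have A: "length (subst_upto \<sigma> n v) \<le> A * length v" for v
    proof (induction v)
      case (Cons b v)
      have "length (subst_upto \<sigma> n [b]) \<le> A" unfolding A_def by (rule Max_ge) auto
      then show ?case using Cons subst_upto_Cons[of \<sigma> n b v] by simp
    qed simp
    obtain m where m: "\<And>j. A * L + n < length (subst_upto \<sigma> m [j])" using assms(2) by (auto simp: unbounded_words_def)
    \<comment> \<open>The n + m levels are split in two ways: with m levels outermost the word is
      seen to be long, with n levels outermost it is at most \<open>A\<close> times as long as
      \<open>w n m\<close>.\<close>
    have "A * L + n < length (subst_upto \<sigma> (n + m) [a (n + m)])"
    proof -
      have "subst_upto \<sigma> (n + m) [a (n + m)] = subst_upto \<sigma> (m + n) [a (n + m)]" by (simp add: add.commute)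
      also have "\<dots> = subst_upto \<sigma> m (subst_upto (\<lambda>k. \<sigma> (m + k)) n [a (n + m)])" by (rule subst_upto_add)
      finally have e: "subst_upto \<sigma> (n + m) [a (n + m)] = subst_upto \<sigma> m (subst_upto (\<lambda>k. \<sigma> (m + k)) n [a (n + m)])" .
      obtain b v where bv: "subst_upto (\<lambda>k. \<sigma> (m + k)) n [a (n + m)] = b # v"
      proof -
        have "subst_upto (\<lambda>k. \<sigma> (m + k)) n [a (n + m)] \<noteq> []"
          by (intro subst_upto_nonempty nonerasing_shift assms(1)) simp
        then show ?thesis using that by (cases "subst_upto (\<lambda>k. \<sigma> (m + k)) n [a (n + m)]") auto
      qed
      show ?thesis unfolding e bv using m[of b] subst_upto_Cons[of \<sigma> m b v] by simp
    qed
    also have "\<dots> \<le> A * length (w n m)" unfolding shift w_def by (rule A)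
    finally have "A * L < A * length (w n m)" by (rule le_less_trans[OF le_add1])
    then show ?thesis using mult_less_cancel1 by blast
  qed
  define W where "W n = to_stream (\<lambda>k. w n (LEAST m. k < length (w n m)) ! k)" for n
  have W_nth: "W n !! k = w n m ! k" if "k < length (w n m)" for n m k
  proof -
    let ?m = "LEAST m. k < length (w n m)"
    have 1: "k < length (w n ?m)" using that by (rule LeastI)
    have "?m \<le> m" using that by (rule Least_le)
    then obtain v where "w n m = w n ?m @ v" using w_le by blast
    then show ?thesis using 1 by (simp add: W_def to_stream_def nth_append)
  qed
  have W_stake: "\<exists>\<rho>. W n = w n m @- \<rho>" for n m
  proof -
    have "stake (length (w n m)) (W n) = w n m" by (rule nth_equalityI) (simp_all add: W_nth)
    then show ?thesis by (metis stake_sdrop)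
  qed
  have "W n = subst_stream (\<sigma> n) (W (Suc n))" for n
  proof -
    have ne: "\<And>j. \<sigma> n j \<noteq> []" using assms(1) by (auto simp: nonerasing_def)
    have "W n !! k = subst_stream (\<sigma> n) (W (Suc n)) !! k" for k
    proof -
      obtain m where m: "k < length (w n m)" using w_unb by blast
      then have m': "k < length (w n (Suc m))" using w_Suc[of n m] by auto
      have e: "w n (Suc m) = subst_word (\<sigma> n) (w (Suc n) m)"
        using subst_upto_add[of "\<lambda>k. \<sigma> (n + k)" 1 m "[a (n + Suc m)]"] by (simp add: w_def)
      obtain \<rho> where "W (Suc n) = w (Suc n) m @- \<rho>" using W_stake by blast
      then have "subst_stream (\<sigma> n) (W (Suc n)) = w n (Suc m) @- subst_stream (\<sigma> n) \<rho>"
        by (simp add: subst_stream_shift[OF ne] e)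
      then show ?thesis using m' W_nth[OF m'] by simp
    qed
    then show ?thesis by (metis smap_alt stream.map_ident)
  qed
  then show ?thesis unfolding limit_word_def by blast
qed

section \<open>Tiles of a recurrent point\<close>

definition box3 :: "int \<Rightarrow> int3 set" where
  "box3 c = {-c..c} \<times> {-c..c} \<times> {-c..c}"

definition deep_prop :: "nat \<Rightarrow> int3 set \<Rightarrow> bool" where
  "deep_prop N Y \<longleftrightarrow> (\<forall>x m g i. (\<forall>k<N. brun_index (brun_orbit x (m + k)) = 3) \<longrightarrow> strad x m g i \<longrightarrow>
    (\<exists>g0. desc x m N g i g0 3 \<and> (\<forall>g' j z. strad x (m + N) g' j \<longrightarrow> z \<in> Y \<longrightarrow>
       g' + gam x (m + N) j = g0 + gam x (m + N) 3 + comb x (m + N) z \<longrightarrow> desc x m N g i g' j)))"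

text \<open>The box is the one that \<open>tiles_near\<close> produces from the discrepancy bound
  \<open>B\<close>; six steps leave room for a contraction and for \<open>len_run4\<close>.\<close>

definition deep_len :: "nat \<Rightarrow> nat" where
  "deep_len B = (SOME N. 6 \<le> N \<and> deep_prop N (box3 (28 * int B + 59)))"

lemma deep_len: "6 \<le> deep_len B" "deep_prop (deep_len B) (box3 (28 * int B + 59))"
proof -
  have "finite (box3 (28 * int B + 59))" by (simp add: box3_def)
  from deep_tile[OF this, of 6] have "\<exists>N. 6 \<le> N \<and> deep_prop N (box3 (28 * int B + 59))"
    unfolding deep_prop_def by blast
  from someI_ex[OF this] show "6 \<le> deep_len B" "deep_prop (deep_len B) (box3 (28 * int B + 59))"
    unfolding deep_len_def by blast+
qed

text \<open>The entries of the fourth power of the matrix of \<open>brun_subst 3\<close> lie between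
  1 and 3.\<close>

lemma len_run4:
  assumes "\<And>k. k < 4 \<Longrightarrow> brun_index (brun_orbit x (n + k)) = 3"
  shows "len x n 1 + len x n 2 + len x n 3 \<le> len x (n + 4) j"
    "len x (n + 4) j \<le> 3 * (len x n 1 + len x n 2 + len x n 3)"
proof -
  have s: "len x (Suc (n + k)) 1 = len x (n + k) 3" "len x (Suc (n + k)) 2 = len x (n + k) 1"
    "len x (Suc (n + k)) 3 = len x (n + k) 2 + len x (n + k) 3" if "k < 4" for k
    using assms[OF that] by (simp_all add: len_Suc)
  have e: "n + 4 = Suc (n + 3)" "n + 3 = Suc (n + 2)" "n + 2 = Suc (n + 1)" by simp_all
  have l: "0 < len x n 1" "0 < len x n 2" "0 < len x n 3" by (rule len_pos)+
  note s' = s[of 0] s[of 1] s[of 2] s[of 3]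
  show "len x n 1 + len x n 2 + len x n 3 \<le> len x (n + 4) j"
    "len x (n + 4) j \<le> 3 * (len x n 1 + len x n 2 + len x n 3)"
    using exhaust_3[of j] l s' unfolding e by auto
qed

definition min_len :: "real \<times> real \<Rightarrow> nat \<Rightarrow> int" where
  "min_len x n = Min (range (len x n))"

lemma min_len_le: "min_len x n \<le> len x n j"
  unfolding min_len_def by (rule Min_le) auto

lemma min_len_ge_iff: "c \<le> min_len x n \<longleftrightarrow> (\<forall>j. c \<le> len x n j)"
  unfolding min_len_def by (subst Min_ge_iff) auto

lemma min_len_Suc: "min_len x n \<le> min_len x (Suc n)"
  unfolding min_len_ge_iff
proof
  fix j
  show "min_len x n \<le> len x (Suc n) j"
    using exhaust_3[of j] exhaust_3[of "brun_index (brun_orbit x n)"] min_len_le[of x n 1] min_len_le[of x n 2]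
      min_len_le[of x n 3] len_pos[of x n 2] len_pos[of x n 3] by (auto simp: len_Suc)
qed

lemma min_len_mono: "m \<le> n \<Longrightarrow> min_len x m \<le> min_len x n"
  by (rule lift_Suc_mono_le[where f = "min_len x"]) (auto intro: min_len_Suc)

definition runs :: "real \<times> real \<Rightarrow> bool" where
  "runs x \<longleftrightarrow> (\<forall>n0. \<exists>n\<ge>n0. \<forall>k<6. brun_index (brun_orbit x (n + k)) = 3)"

lemma runs_orbit: "runs x \<Longrightarrow> runs (brun_orbit x m)"
  unfolding runs_def
proof
  fix n0 assume "\<forall>n0. \<exists>n\<ge>n0. \<forall>k<6. brun_index (brun_orbit x (n + k)) = 3"
  then obtain n where n: "m + n0 \<le> n" "\<forall>k<6. brun_index (brun_orbit x (n + k)) = 3" by blast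
  have "brun_orbit (brun_orbit x m) (n - m + k) = brun_orbit x (n + k)" for k
    using n(1) by (simp only: brun_orbit_add[symmetric]) simp
  then show "\<exists>n\<ge>n0. \<forall>k<6. brun_index (brun_orbit (brun_orbit x m) (n + k)) = 3"
    using n by (intro exI[of _ "n - m"]) auto
qed

lemma runs_unbounded:
  assumes "runs x"
  shows "unbounded_words (brun_Phi x)"
proof -
  have "\<exists>n. int L < min_len x n" for L
  proof (induction L)
    case 0
    have "1 \<le> min_len x 0" unfolding min_len_ge_iff using len_pos[of x 0] by (metis int_one_le_iff_zero_less)
    then show ?case by (intro exI[of _ 0]) simp
  next
    case (Suc L)
    then obtain n where n: "int L < min_len x n" by blast
    obtain m where m: "n \<le> m" "\<forall>k<6. brun_index (brun_orbit x (m + k)) = 3"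
      using assms by (auto simp: runs_def)
    have "int (Suc L) < len x (m + 4) j" for j
      using len_run4(1)[of m x j] m(2) min_len_le[of x m 1] min_len_le[of x m 2] len_pos[of x m 3] min_len_mono[OF m(1), of x] n
      by auto
    then have "int (Suc L) + 1 \<le> min_len x (m + 4)" unfolding min_len_ge_iff by (metis zless_iff_Suc_zadd add.commute add1_zle_eq)
    then show ?case by (intro exI[of _ "m + 4"]) simp
  qed
  then show ?thesis unfolding unbounded_words_def
    by (metis len_def min_len_le less_le_trans of_nat_less_iff)
qed

definition Z2 :: "(real \<times> real) set" where "Z2 = \<int> \<times> \<int>"

lemma countable_Z2: "countable Z2" by (simp add: Z2_def Ints_def)

text \<open>The almost sure part ends here: within the locale everything is deduced for a single
  point from \<open>recurrent deep_len\<close>.\<close>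

locale brun_point =
  fixes x :: "real \<times> real"
  assumes recurrent: "recurrent deep_len x"
begin

lemma gen: "generic x" using recurrent by (simp add: recurrent_def)

lemma gen': "generic (brun_orbit x n)" by (rule generic_brun_pow[OF gen])

definition bd where "bd = (SOME B. err_bounded x B)"

lemma bd: "err_bounded x bd"
  unfolding bd_def using recurrent by - (rule someI_ex, simp add: recurrent_def)

definition gb where "gb = (SOME B. \<forall>n0. \<exists>n\<ge>n0. (\<forall>k<deep_len B. brun_index (brun_orbit x (n + k)) = 3) \<and>
        err_bounded (brun_orbit x (n + deep_len B)) (real B))"

definition rl where "rl = deep_len gb"

text \<open>All good levels share the bound \<open>gb\<close> and the run length derived from it, so
  the constants of one run serve for all of them.\<close>

definition good where
  "good n \<longleftrightarrow> (\<forall>k<rl. brun_index (brun_orbit x (n + k)) = 3) \<and> err_bounded (brun_orbit x (n + rl)) (real gb)"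

lemma good_inf: "\<exists>n\<ge>n0. good n"
proof -
  have "\<forall>n0. \<exists>n\<ge>n0. (\<forall>k<deep_len gb. brun_index (brun_orbit x (n + k)) = 3) \<and>
        err_bounded (brun_orbit x (n + deep_len gb)) (real gb)"
    unfolding gb_def using recurrent by - (rule someI_ex, simp add: recurrent_def)
  then show ?thesis by (simp add: good_def rl_def)
qed

lemma rl: "6 \<le> rl" "deep_prop rl (box3 (28 * int gb + 59))"
  using deep_len by (simp_all add: rl_def)

lemma runs: "runs x"
  unfolding runs_def
proof
  fix n0
  obtain n where "n0 \<le> n" "good n" using good_inf by blast
  then show "\<exists>n\<ge>n0. \<forall>k<6. brun_index (brun_orbit x (n + k)) = 3"
    using rl(1) by (intro exI[of _ n]) (auto simp: good_def)
qed

lemma unbounded: "unbounded_words (\<lambda>k. brun_Phi x (n + k))"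
  unfolding brun_Phi_shift by (intro runs_unbounded runs_orbit runs)

lemma nonerasing: "nonerasing (\<lambda>k. brun_Phi x (n + k))"
  unfolding brun_Phi_shift by (rule nonerasing_brun)

lemma max_err_tendsto: "\<forall>\<^sub>F n in sequentially. max_err x n < e" if "0 < e"
proof -
  have "\<exists>n. max_err x n \<le> (5/6) ^ k * max_err x 0" for k
  proof (induction k)
    case 0
    show ?case by (intro exI[of _ 0]) simp
  next
    case (Suc k)
    then obtain n where n: "max_err x n \<le> (5/6) ^ k * max_err x 0" by blast
    obtain m where m: "n \<le> m" "\<forall>k<6. brun_index (brun_orbit x (m + k)) = 3"
      using runs by (auto simp: runs_def)
    have "max_err x (m + 6) \<le> 5/6 * max_err x m" using max_err_contract[OF gen] m(2) by simp
    also have "\<dots> \<le> 5/6 * max_err x n" using max_err_antimono[OF gen m(1)] by simp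
    also have "\<dots> \<le> 5/6 * ((5/6) ^ k * max_err x 0)" using n by simp
    finally show ?case by (intro exI[of _ "m + 6"]) simp
  qed
  moreover have "\<exists>k. (5/6) ^ k * max_err x 0 < e"
  proof -
    have "(\<lambda>k. (5/6) ^ k * max_err x 0) \<longlonglongrightarrow> 0" by (intro tendsto_mult_left_zero LIMSEQ_power_zero) auto
    from order_tendstoD(2)[OF this that] show ?thesis by (auto simp: eventually_sequentially)
  qed
  ultimately obtain n where "max_err x n < e" by (meson le_less_trans)
  then show ?thesis unfolding eventually_sequentially
    by (metis max_err_antimono[OF gen] le_less_trans)
qed

section \<open>Tile sets and their subdivision\<close>

definition W where "W m q j = subst_upto (\<lambda>k. brun_Phi x (m + k)) q [j]"

definition pre_set where "pre_set n i = word_sum (err x n) ` {p. pre (\<lambda>k. brun_Phi x (n + k)) p i}"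

text \<open>Level 0 is the Rauzy subpiece in basis coordinates; its subtiles of level
  \<open>n\<close> are translates of the sets \<open>S n j\<close>.\<close>

definition S where "S n i = closure (pre_set n i)"

definition subidx where "subidx m q i = {(j, k). k < length (W m q j) \<and> W m q j ! k = i}"

lemma finite_subidx [simp]: "finite (subidx m q i)"
  by (rule finite_subset[of _ "SIGMA j:UNIV. {..<length (W m q j)}"]) (auto simp: subidx_def)

lemma word_sum_err_subst: "word_sum (err x m) (subst_upto (\<lambda>k. brun_Phi x (m + k)) q w) = word_sum (err x (m + q)) w"
  by (simp add: word_sum_err subst_upto_add)

lemma pre_set_decomp:
  "pre_set m i = (\<Union>(j, k)\<in>subidx m q i. (+) (word_sum (err x m) (take k (W m q j))) ` pre_set (m + q) j)"
proof (intro equalityI subsetI)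
  fix v assume "v \<in> pre_set m i"
  then obtain p where p: "pre (\<lambda>k. brun_Phi x (m + k)) p i" "v = word_sum (err x m) p" by (auto simp: pre_set_def)
  obtain w j r t where 1: "pre (\<lambda>k. brun_Phi x (m + (q + k))) w j" "W m q j = r @ i # t"
    "p = subst_upto (\<lambda>k. brun_Phi x (m + k)) q w @ r"
    using pre_multi[OF nonerasing, of m p i q] p(1) unfolding W_def by blast
  have "(j, length r) \<in> subidx m q i" using 1(2) by (simp add: subidx_def)
  moreover have "v = word_sum (err x m) (take (length r) (W m q j)) + word_sum (err x (m + q)) w"
    using p(2) 1(2,3) by (simp add: word_sum_err_subst add.commute[of "word_sum (err x (m + q)) w"])
  moreover have "word_sum (err x (m + q)) w \<in> pre_set (m + q) j" using 1(1) by (auto simp: pre_set_def add.assoc)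
  ultimately show "v \<in> (\<Union>(j, k)\<in>subidx m q i. (+) (word_sum (err x m) (take k (W m q j))) ` pre_set (m + q) j)"
    by blast
next
  fix v assume "v \<in> (\<Union>(j, k)\<in>subidx m q i. (+) (word_sum (err x m) (take k (W m q j))) ` pre_set (m + q) j)"
  then obtain j k w where 1: "k < length (W m q j)" "W m q j ! k = i" "pre (\<lambda>k. brun_Phi x (m + (q + k))) w j"
    "v = word_sum (err x m) (take k (W m q j)) + word_sum (err x (m + q)) w"
    by (auto simp: subidx_def pre_set_def add.assoc)
  have "W m q j = take k (W m q j) @ i # drop (Suc k) (W m q j)" using id_take_nth_drop[OF 1(1)] 1(2) by simp
  then have "pre (\<lambda>k. brun_Phi x (m + k)) (subst_upto (\<lambda>k. brun_Phi x (m + k)) q w @ take k (W m q j)) i"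
    using pre_multi[OF nonerasing, of m _ i q] 1(3) unfolding W_def by blast
  moreover have "v = word_sum (err x m) (subst_upto (\<lambda>k. brun_Phi x (m + k)) q w @ take k (W m q j))"
    using 1(4) by (simp add: word_sum_err_subst add.commute[of "word_sum (err x (m + q)) w"])
  ultimately show "v \<in> pre_set m i" unfolding pre_set_def by (intro image_eqI) auto
qed

text \<open>Closure commutes with finite unions, so the prefix-suffix expansion becomes a
  graph-directed set equation.\<close>

lemma S_decomp:
  "S m i = (\<Union>(j, k)\<in>subidx m q i. (+) (word_sum (err x m) (take k (W m q j))) ` S (m + q) j)"
proof -
  have cl: "closure (\<Union>a\<in>A. X a) = (\<Union>a\<in>A. closure (X a))" if "finite A" for A and X :: "_ \<Rightarrow> (real \<times> real) set"
    using that by induction auto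
  have "S m i = closure (\<Union>a\<in>subidx m q i. (\<lambda>(j, k). (+) (word_sum (err x m) (take k (W m q j))) ` pre_set (m + q) j) a)"
    unfolding S_def by (subst pre_set_decomp[of m i q]) simp
  also have "\<dots> = (\<Union>a\<in>subidx m q i. closure ((\<lambda>(j, k). (+) (word_sum (err x m) (take k (W m q j))) ` pre_set (m + q) j) a))"
    by (rule cl) simp
  also have "\<dots> = (\<Union>(j, k)\<in>subidx m q i. (+) (word_sum (err x m) (take k (W m q j))) ` S (m + q) j)"
    by (intro SUP_cong refl) (auto simp: S_def closure_translation)
  finally show ?thesis .
qed

lemma pre_set_0_bound: "v \<in> pre_set 0 i \<Longrightarrow> norm v \<le> bd"
proof -
  assume "v \<in> pre_set 0 i"
  then obtain p where p: "pre (brun_Phi x) p i" "v = word_sum (err0 x) p" by (auto simp: pre_set_def)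
  obtain m j t where "subst_upto (brun_Phi x) m [j] = p @ i # t"
    using pre_is_prefix[OF nonerasing_brun _ p(1)] unbounded[of 0] by auto
  then show ?thesis using norm_prefix_sum_le[OF gen bd] p(2) by blast
qed

lemma S_0_bound: "S 0 i \<subseteq> cball 0 bd"
  unfolding S_def by (intro closure_minimal) (auto dest: pre_set_0_bound)

lemma compact_S_0: "compact (S 0 i)"
  using S_0_bound[of i] by (auto simp: compact_eq_bounded_closed S_def intro: bounded_subset[OF bounded_cball])

text \<open>Prefix sums of the orbit point after the run are bounded by \<open>gb\<close>, and
  \<open>lin\<close> carries them to level n + rl of \<open>x\<close>.\<close>

lemma S_good:
  assumes "good n"
  shows "S (n + rl) i \<subseteq> lin x (n + rl) ` cball 0 (real gb)"
  unfolding S_def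
proof (intro closure_minimal)
  let ?n = "n + rl" and ?y = "brun_orbit x (n + rl)"
  show "closed (lin x ?n ` cball 0 (real gb))"
    by (intro compact_imp_closed compact_continuous_image linear_continuous_on linear_conv_bounded_linear[THEN iffD1] linear_lin compact_cball)
  show "pre_set ?n i \<subseteq> lin x ?n ` cball 0 (real gb)"
  proof
    fix v assume "v \<in> pre_set ?n i"
    then obtain p where p: "pre (brun_Phi ?y) p i" "v = word_sum (err x ?n) p"
      by (auto simp: pre_set_def brun_Phi_shift)
    obtain m j t where "subst_upto (brun_Phi ?y) m [j] = p @ i # t"
      using pre_is_prefix[OF nonerasing_brun _ p(1)] unbounded[of ?n] unfolding brun_Phi_shift by blast
    then have "norm (word_sum (err0 ?y) p) \<le> real gb"
      using norm_prefix_sum_le[OF gen'[of ?n], of "real gb"] assms by (auto simp: good_def)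
    moreover have "v = lin x ?n (word_sum (err0 ?y) p)" using p(2) lin_word_sum[OF gen, of ?n p] by simp
    ultimately show "v \<in> lin x ?n ` cball 0 (real gb)" by auto
  qed
qed

lemma closed_S: "closed (S n i)" by (simp add: S_def)

text \<open>A position of height h lies over h times the rotation vector modulo Z^2
  (\<open>lat_iff\<close>); height 0 gives the translations of the tiling problem.\<close>

definition lat :: "pos set" where "lat = range (comb x 0)"

lemma lat_add: "g \<in> lat \<Longrightarrow> g' \<in> lat \<Longrightarrow> g + g' \<in> lat" and lat_diff: "g \<in> lat \<Longrightarrow> g' \<in> lat \<Longrightarrow> g - g' \<in> lat"
  unfolding lat_def by (auto simp: comb_add[symmetric] comb_diff[symmetric])

lemma lat_comb: "lat = range (comb x n)" unfolding lat_def by (rule range_comb[symmetric])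

lemma gam_lat: "gam x n j \<in> lat" unfolding lat_comb[of n] using comb_unit3[of x n j] by (metis rangeI)

lemma zero_lat: "0 \<in> lat" unfolding lat_def using comb_0[of x 0] by (metis rangeI)

lemma word_sum_gam_lat: "word_sum (gam x n) w \<in> lat"
  by (induction w) (auto intro: lat_add gam_lat zero_lat)

lemma comb_0_eq: "comb x 0 (a, b, c) = (real_of_int (a + b + c) *\<^sub>R rotation x - (real_of_int a, real_of_int b), a + b + c)"
  by (simp add: comb_def err0_def len_def algebra_simps)

lemma lat_iff: "(v, h) \<in> lat \<longleftrightarrow> (\<exists>a b. v = real_of_int h *\<^sub>R rotation x - (real_of_int a, real_of_int b))"
proof
  assume "(v, h) \<in> lat"
  then show "\<exists>a b. v = real_of_int h *\<^sub>R rotation x - (real_of_int a, real_of_int b)"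
    unfolding lat_def using comb_0_eq by (auto simp del: of_int_add)
next
  assume "\<exists>a b. v = real_of_int h *\<^sub>R rotation x - (real_of_int a, real_of_int b)"
  then obtain a b where "v = real_of_int h *\<^sub>R rotation x - (real_of_int a, real_of_int b)" by blast
  then have "(v, h) = comb x 0 (a, b, h - a - b)" by (simp add: comb_0_eq)
  then show "(v, h) \<in> lat" by (simp add: lat_def)
qed

text \<open>The position is subtracted, so \<open>tset 0 (z, 0) i\<close> consists of the points
  that \<open>z\<close> moves into piece \<open>i\<close>.\<close>

definition tset where "tset n g i = {y. y + fst (g :: pos) \<in> S n i}"

lemma tset_decomp: "tset m g i = (\<Union>(j, k)\<in>subidx m q i. tset (m + q) (g - word_sum (gam x m) (take k (W m q j))) j)"
proof -
  have "y + fst g \<in> S m i \<longleftrightarrow> (\<exists>(j, k)\<in>subidx m q i. y + fst g - word_sum (err x m) (take k (W m q j)) \<in> S (m + q) j)" for y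
  proof -
    have tr: "v \<in> (+) c ` T \<longleftrightarrow> v - c \<in> T" for v c :: "real \<times> real" and T
      by (rule iffI) (force, rule image_eqI[of _ _ "v - c"], auto)
    show ?thesis unfolding S_decomp[of m i q] UN_iff case_prod_beta tr ..
  qed
  moreover have "y + fst (g - word_sum (gam x m) w) = y + fst g - word_sum (err x m) w" for y w
    by (simp add: word_sum_gam)
  ultimately show ?thesis unfolding tset_def set_eq_iff UN_iff case_prod_beta mem_Collect_eq
    by (simp add: add_diff_eq)
qed

lemma desc_iff: "desc x m q g i g' j \<longleftrightarrow> (\<exists>k. (j, k) \<in> subidx m q i \<and> g' = g - word_sum (gam x m) (take k (W m q j)))"
proof
  assume "desc x m q g i g' j"
  then obtain p s where ps: "W m q j = p @ i # s" "g = g' + word_sum (gam x m) p" by (auto simp: desc_def W_def)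
  then show "\<exists>k. (j, k) \<in> subidx m q i \<and> g' = g - word_sum (gam x m) (take k (W m q j))"
    by (intro exI[of _ "length p"]) (simp add: subidx_def)
next
  assume "\<exists>k. (j, k) \<in> subidx m q i \<and> g' = g - word_sum (gam x m) (take k (W m q j))"
  then obtain k where k: "k < length (W m q j)" "W m q j ! k = i" "g' = g - word_sum (gam x m) (take k (W m q j))"
    by (auto simp: subidx_def)
  have "W m q j = take k (W m q j) @ i # drop (Suc k) (W m q j)" using id_take_nth_drop[OF k(1)] k(2) by simp
  moreover have "g = g' + word_sum (gam x m) (take k (W m q j))" using k(3) by simp
  ultimately show "desc x m q g i g' j" unfolding desc_def W_def by blast
qed

lemma desc_tset: "desc x m q g i g' j \<Longrightarrow> tset (m + q) g' j \<subseteq> tset m g i"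
  unfolding desc_iff tset_decomp[of m g i q] by blast

lemma tset_desc: "y \<in> tset m g i \<Longrightarrow> \<exists>g' j. desc x m q g i g' j \<and> y \<in> tset (m + q) g' j"
  unfolding tset_decomp[of m g i q] desc_iff by blast

lemma desc_lat: "desc x m q g i g' j \<Longrightarrow> g \<in> lat \<longleftrightarrow> g' \<in> lat"
  unfolding desc_iff using lat_add lat_diff word_sum_gam_lat by (metis diff_add_cancel)

text \<open>After renormalisation by \<open>lin\<close> a common point says that z is close to its
  coordinate sum times the frequency vector. The coordinate sum is bounded because both height
  intervals contain 0 and all lengths after the run are comparable to \<open>L\<close>.\<close>

lemma tiles_near:
  assumes n: "good n" and g: "g \<in> lat" "g0 \<in> lat" and s: "strad x (n + rl) g j" "strad x (n + rl) g0 j0"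
    and y: "y \<in> tset (n + rl) g j" "y \<in> tset (n + rl) g0 j0"
  shows "\<exists>z\<in>box3 (28 * int gb + 59). g + gam x (n + rl) j = g0 + gam x (n + rl) j0 + comb x (n + rl) z"
proof -
  let ?n = "n + rl" and ?y = "brun_orbit x (n + rl)" and ?w = "2 * real gb + 4"
  have "g + gam x ?n j - (g0 + gam x ?n j0) \<in> lat" by (intro lat_diff lat_add g gam_lat)
  then obtain z where z: "comb x ?n z = g + gam x ?n j - (g0 + gam x ?n j0)" unfolding lat_comb[of ?n] by auto
  obtain a b c where abc: "z = (a, b, c)" by (cases z)
  let ?u = "freq ?y" and ?s = "a + b + c"
  have g': "generic ?y" by (rule gen')
  obtain v v0 where v: "norm v \<le> real gb" "y + fst g = lin x ?n v" "norm v0 \<le> real gb" "y + fst g0 = lin x ?n v0"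
  proof -
    have "y + fst g \<in> lin x ?n ` cball 0 (real gb)" "y + fst g0 \<in> lin x ?n ` cball 0 (real gb)"
      using y S_good[OF n, of j] S_good[OF n, of j0] unfolding tset_def by blast+
    then show ?thesis using that unfolding image_iff Bex_def mem_cball_0 by blast
  qed
  have e0: "norm (err0 ?y k) \<le> 2" for k
    using max_err_ge[of ?y 0 k] max_err_0_le[OF g'] by simp
  define w where "w = v - v0 + err0 ?y j - err0 ?y j0"
  have "norm w \<le> ?w"
  proof -
    have "norm w \<le> norm (v - v0) + norm (err0 ?y j - err0 ?y j0)" unfolding w_def
      using norm_triangle_ineq[of "v - v0" "err0 ?y j - err0 ?y j0"] by (simp add: algebra_simps)
    then show ?thesis using norm_triangle_ineq4[of v v0] norm_triangle_ineq4[of "err0 ?y j" "err0 ?y j0"] v e0[of j] e0[of j0]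
      by linarith
  qed
  define ez where "ez = real_of_int a *\<^sub>R err0 ?y 1 + real_of_int b *\<^sub>R err0 ?y 2 + real_of_int c *\<^sub>R err0 ?y 3"
  have "lin x ?n ez = fst (comb x ?n z)"
    unfolding ez_def abc comb_def by (simp add: lin_add linear_scale[OF linear_lin] lin_err0[OF gen])
  also have "\<dots> = lin x ?n w"
  proof -
    have "fst g = lin x ?n v - y" "fst g0 = lin x ?n v0 - y"
      using v(2,4) by (metis add_diff_cancel_left')+
    then show ?thesis
      unfolding z w_def lin_add lin_diff lin_err0[OF gen] by (simp add: gam_def)
  qed
  finally have "lin x ?n (ez - w) = 0" by (simp add: lin_diff)
  then have ezw: "ez = w" using inj_lin[OF gen] by fastforce
  have ez: "ez = (?s * ?u 1 - a, ?s * ?u 2 - b)"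
    by (simp add: ez_def err0_def rotation_freq algebra_simps)
  have 12: "\<bar>?s * ?u 1 - a\<bar> \<le> ?w" "\<bar>?s * ?u 2 - b\<bar> \<le> ?w"
    using \<open>norm w \<le> ?w\<close> norm_fst_le[of "?s * ?u 1 - a" "?s * ?u 2 - b"] norm_snd_le[of "?s * ?u 2 - b" "?s * ?u 1 - a"]
    unfolding ezw[symmetric] ez by simp_all
  have "real_of_int ?s * (?u 1 + ?u 2 + ?u 3) = real_of_int ?s" unfolding freq_sum[OF g'] by simp
  then have "?s * ?u 3 - c = - (?s * ?u 1 - a) - (?s * ?u 2 - b)" by (simp add: algebra_simps)
  moreover have abs2: "\<bar>z\<bar> \<le> 2 * w" if "z = - x - y" "\<bar>x\<bar> \<le> w" "\<bar>y\<bar> \<le> w" for x y z w :: real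
    using that by linarith
  ultimately have 3: "\<bar>?s * ?u 3 - c\<bar> \<le> 2 * ?w" using 12 by (intro abs2)
  define L where "L = len x (n + (rl - 4)) 1 + len x (n + (rl - 4)) 2 + len x (n + (rl - 4)) 3"
  have L: "L \<le> len x ?n k" "len x ?n k \<le> 3 * L" for k
  proof -
    have "brun_index (brun_orbit x (n + (rl - 4) + k)) = 3" if "k < 4" for k
    proof -
      have "rl - 4 + k < rl" using that rl(1) by simp
      then show ?thesis using n unfolding good_def by (metis add.assoc)
    qed
    from len_run4[where n = "n + (rl - 4)" and x = x and j = k, OF this]
    show "L \<le> len x ?n k" "len x ?n k \<le> 3 * L" using rl(1) by (simp_all add: L_def)
  qed
  have L0: "0 < L" unfolding L_def by (intro add_pos_pos len_pos)
  have "snd (comb x ?n z) = (snd g + len x ?n j) - (snd g0 + len x ?n j0)" unfolding z by (simp add: gam_def)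
  then have h: "\<bar>a * len x ?n 1 + b * len x ?n 2 + c * len x ?n 3\<bar> \<le> 3 * L"
    using s L(2)[of j] L(2)[of j0] by (auto simp: abc comb_def strad_def)
  \<comment> \<open>The height of z is the coordinate sum times a mean length, which is at least L,
    up to an error controlled by the planar bounds.\<close>
  have "\<bar>real_of_int ?s\<bar> * L \<le> (3 + 12 * ?w) * L"
  proof -
    define l where "l k = real_of_int (len x ?n k)" for k
    have l: "L \<le> l k" "l k \<le> 3 * L" "0 < l k" for k using L[of k] len_pos[of x ?n k] by (simp_all add: l_def)
    have up: "0 < ?u k" for k by (rule freq_pos[OF g'])
    have "L = (?u 1 + ?u 2 + ?u 3) * L" using freq_sum[OF g'] by simp
    also have "\<dots> \<le> ?u 1 * l 1 + ?u 2 * l 2 + ?u 3 * l 3"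
      unfolding distrib_right using up l by (intro add_mono mult_left_mono) (auto intro: less_imp_le)
    finally have "\<bar>real_of_int ?s\<bar> * L \<le> \<bar>real_of_int ?s\<bar> * (?u 1 * l 1 + ?u 2 * l 2 + ?u 3 * l 3)"
      by (rule mult_left_mono) simp
    also have "\<dots> = \<bar>?s * (?u 1 * l 1 + ?u 2 * l 2 + ?u 3 * l 3)\<bar>"
      using up l by (subst abs_mult) (simp add: add_nonneg_nonneg less_imp_le)
    also have "?s * (?u 1 * l 1 + ?u 2 * l 2 + ?u 3 * l 3) = (a * l 1 + b * l 2 + c * l 3) +
       ((?s * ?u 1 - a) * l 1 + (?s * ?u 2 - b) * l 2 + (?s * ?u 3 - c) * l 3)"
      by (simp add: algebra_simps)
    also have "\<bar>\<dots>\<bar> \<le> 3 * L + (?w * (3 * L) + ?w * (3 * L) + 2 * ?w * (3 * L))"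
    proof -
      have "\<bar>a * l 1 + b * l 2 + c * l 3\<bar> = real_of_int \<bar>a * len x ?n 1 + b * len x ?n 2 + c * len x ?n 3\<bar>"
        by (simp add: l_def)
      also have "\<dots> \<le> real_of_int (3 * L)" using h by (simp only: of_int_le_iff)
      finally have A: "\<bar>a * l 1 + b * l 2 + c * l 3\<bar> \<le> 3 * L" by simp
      have "\<bar>(?s * ?u 1 - a) * l 1\<bar> \<le> ?w * (3 * L)" "\<bar>(?s * ?u 2 - b) * l 2\<bar> \<le> ?w * (3 * L)"
        "\<bar>(?s * ?u 3 - c) * l 3\<bar> \<le> 2 * ?w * (3 * L)"
        unfolding abs_mult using 12 3 l by (auto intro!: mult_mono intro: less_imp_le simp: abs_of_pos)
      moreover have "\<bar>p + (q1 + q2 + q3)\<bar> \<le> P + (Q1 + Q2 + Q3)" if "\<bar>p\<bar> \<le> P" "\<bar>q1\<bar> \<le> Q1" "\<bar>q2\<bar> \<le> Q2" "\<bar>q3\<bar> \<le> Q3"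
        for p q1 q2 q3 P Q1 Q2 Q3 :: real using that by linarith
      ultimately show ?thesis using A by blast
    qed
    finally show ?thesis by (simp add: algebra_simps)
  qed
  then have S: "\<bar>real_of_int ?s\<bar> \<le> 3 + 12 * ?w" using L0 by simp
  have su: "\<bar>?s * ?u k\<bar> \<le> \<bar>real_of_int ?s\<bar>" for k
    using freq_pos[OF g', of k] freq_le_1[OF g', of k] by (simp add: abs_mult mult_left_le)
  \<comment> \<open>At most 3 + 12 w from the coordinate sum and 2 w from the deviation; with w = 2
    gb + 4 this is 28 gb + 59.\<close>
  have "\<bar>real_of_int a\<bar> \<le> 28 * real gb + 59" "\<bar>real_of_int b\<bar> \<le> 28 * real gb + 59" "\<bar>real_of_int c\<bar> \<le> 28 * real gb + 59"
  proof -
    have tri: "\<bar>d\<bar> \<le> 28 * real gb + 59" if "\<bar>p\<bar> \<le> s" "\<bar>p - d\<bar> \<le> v" "s \<le> 3 + 12 * ?w" "v \<le> 2 * ?w" for p d s v :: real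
    proof -
      have "\<bar>d\<bar> \<le> \<bar>p\<bar> + \<bar>p - d\<bar>" by linarith
      then show ?thesis using that by argo
    qed
    show "\<bar>real_of_int a\<bar> \<le> 28 * real gb + 59" by (rule tri[OF su 12(1) S]) simp
    show "\<bar>real_of_int b\<bar> \<le> 28 * real gb + 59" by (rule tri[OF su 12(2) S]) simp
    show "\<bar>real_of_int c\<bar> \<le> 28 * real gb + 59" by (rule tri[OF su 3 S]) simp
  qed
  then have "z \<in> box3 (28 * int gb + 59)"
    unfolding abc box3_def by auto
  then show ?thesis using z by (intro bexI[of _ z]) (auto simp: algebra_simps)
qed

section \<open>Overlaps of translated pieces form a null set\<close>

definition Np where "Np = {y. \<exists>z\<in>Z2. \<exists>z'\<in>Z2. \<exists>i i'. (z, i) \<noteq> (z', i') \<and> y + z \<in> S 0 i \<and> y + z' \<in> S 0 i'}"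

lemma Z2_lat: "(z, 0) \<in> lat \<longleftrightarrow> z \<in> Z2"
proof -
  have "z \<in> Z2 \<longleftrightarrow> (\<exists>a b. z = - (real_of_int a, real_of_int b))"
  proof
    assume "z \<in> Z2"
    then obtain a b where "z = (real_of_int a, real_of_int b)" by (auto simp: Z2_def Ints_def)
    then show "\<exists>a b. z = - (real_of_int a, real_of_int b)" by (intro exI[of _ "-a"] exI[of _ "-b"]) simp
  qed (auto simp: Z2_def)
  then show ?thesis by (simp add: lat_iff)
qed

lemma Np_borel [measurable]: "Np \<in> sets borel"
proof -
  have cl: "closed {y. y + z \<in> S 0 i}" for z i
    using continuous_closed_vimage[OF closed_S[of 0 i], of "\<lambda>y. y + z"] by (simp add: vimage_def)
  define X where "X p = {y. y + fst p \<in> S 0 (snd p)}" for p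
  have "Np = (\<Union>p\<in>Z2 \<times> UNIV. \<Union>p'\<in>Z2 \<times> UNIV - {p}. X p \<inter> X p')"
  proof (intro equalityI subsetI)
    fix y assume "y \<in> Np"
    then obtain z z' i i' where "z \<in> Z2" "z' \<in> Z2" "(z, i) \<noteq> (z', i')" "y + z \<in> S 0 i" "y + z' \<in> S 0 i'"
      unfolding Np_def by blast
    then show "y \<in> (\<Union>p\<in>Z2 \<times> UNIV. \<Union>p'\<in>Z2 \<times> UNIV - {p}. X p \<inter> X p')"
      by (intro UN_I[of "(z, i)"] UN_I[of "(z', i')"]) (auto simp: X_def)
  next
    fix y assume "y \<in> (\<Union>p\<in>Z2 \<times> UNIV. \<Union>p'\<in>Z2 \<times> UNIV - {p}. X p \<inter> X p')"
    then obtain p p' where "p \<in> Z2 \<times> UNIV" "p' \<in> Z2 \<times> UNIV" "p' \<noteq> p" "y \<in> X p" "y \<in> X p'" by blast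
    then show "y \<in> Np" unfolding Np_def X_def
      by (intro CollectI bexI[of _ "fst p"] bexI[of _ "fst p'"] exI[of _ "snd p"] exI[of _ "snd p'"])
        (auto simp: prod_eq_iff mem_Times_iff)
  qed
  moreover have "X p \<in> sets borel" for p unfolding X_def by (rule borel_closed[OF cl])
  moreover have "countable (Z2 \<times> (UNIV :: 3 set))" by (intro countable_SIGMA countable_Z2) (simp add: countable_finite)
  ultimately show ?thesis by (auto intro!: sets.countable_UN' sets.Int countable_Diff)
qed

lemma strad_0: "strad x 0 g i \<longleftrightarrow> snd g = 0"
  by (auto simp: strad_def len_def)

text \<open>Any relevant lattice tile of that level through a point of the deep subtile is near it
  by \<open>tiles_near\<close>, hence below the same tile \<open>(g, i)\<close>. Two translated
  pieces covering the point would both be its unique relevant ancestor of level 0.\<close>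

lemma deep_avoids_Np:
  assumes n: "good n" and g: "g \<in> lat" "strad x n g i"
  shows "\<exists>g0. desc x n rl g i g0 3 \<and> tset (n + rl) g0 3 \<inter> Np = {}"
proof -
  obtain g0 where d0: "desc x n rl g i g0 3" and deep: "\<And>g' j z. strad x (n + rl) g' j \<Longrightarrow> z \<in> box3 (28 * int gb + 59) \<Longrightarrow>
       g' + gam x (n + rl) j = g0 + gam x (n + rl) 3 + comb x (n + rl) z \<Longrightarrow> desc x n rl g i g' j"
    using rl(2) n g(2) unfolding deep_prop_def good_def by metis
  have g0: "g0 \<in> lat" "strad x (n + rl) g0 3" using desc_lat[OF d0] g desc_strad[OF g(2) d0] by auto
  obtain ga a where ga: "desc x 0 n ga a g i" "strad x 0 ga a" using desc_exists[of x 0 n g i] g(2) by auto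
  have anc: "ga = (z, 0) \<and> a = k" if z: "z \<in> Z2" and y: "y \<in> tset (n + rl) g0 3" "y + z \<in> S 0 k" for y z k
  proof -
    have "y \<in> tset 0 (z, 0) k" using y by (simp add: tset_def)
    then obtain g' j where 1: "desc x 0 (n + rl) (z, 0) k g' j" "y \<in> tset (n + rl) g' j"
      using tset_desc[of y 0 "(z, 0)" k "n + rl"] by auto
    have s': "strad x (n + rl) g' j" using desc_strad[OF _ 1(1)] by (simp add: strad_0)
    have l': "g' \<in> lat" using desc_lat[OF 1(1)] z Z2_lat by simp
    obtain w where "w \<in> box3 (28 * int gb + 59)" "g' + gam x (n + rl) j = g0 + gam x (n + rl) 3 + comb x (n + rl) w"
      using tiles_near[OF n l' g0(1) s' g0(2) 1(2) y(1)] by blast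
    then have "desc x n rl g i g' j" using deep s' by blast
    then have "desc x 0 (n + rl) ga a g' j" using desc_trans[OF ga(1), of rl] by simp
    from desc_unique[OF this 1(1) ga(2)] show ?thesis by (simp add: strad_0)
  qed
  have "tset (n + rl) g0 3 \<inter> Np = {}"
  proof (rule ccontr)
    assume "tset (n + rl) g0 3 \<inter> Np \<noteq> {}"
    then obtain y z z' i1 i2 where y: "y \<in> tset (n + rl) g0 3" "z \<in> Z2" "z' \<in> Z2" "(z, i1) \<noteq> (z', i2)"
      "y + z \<in> S 0 i1" "y + z' \<in> S 0 i2" unfolding Np_def by blast
    then show False using anc[OF y(2,1,5)] anc[OF y(3,1,6)] by simp
  qed
  with d0 show ?thesis by blast
qed

end

lemma subst_upto_cong: "(\<And>k. k < n \<Longrightarrow> \<sigma> k = \<sigma>' k) \<Longrightarrow> subst_upto \<sigma> n w = subst_upto \<sigma>' n w"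
  by (induction n arbitrary: w) auto

lemma count_list_card: "count_list w a = card {k. k < length w \<and> w ! k = a}"
  by (simp add: count_list_eq_length_filter length_filter_conv_card eq_commute)

lemma measure_UNION_le':
  assumes "finite I" "\<And>i. i \<in> I \<Longrightarrow> F i \<in> lmeasurable"
  shows "measure lebesgue (\<Union>i\<in>I. F i) \<le> (\<Sum>i\<in>I. measure lebesgue (F i))"
  using assms by (intro measure_UNION_le) auto

context brun_point begin

lemma tset_compact:
  assumes "strad x n g j"
  shows "compact (tset n g j)"
proof -
  obtain g' a where "desc x 0 n g' a g j" using desc_exists[of x 0 n g j] assms by auto
  then have "tset n g j \<subseteq> tset 0 g' a" using desc_tset[of 0 n g' a g j] by simp
  moreover have "tset 0 g' a \<subseteq> cball (- fst g') bd"
  proof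
    fix y assume "y \<in> tset 0 g' a"
    then have "norm (y + fst g') \<le> bd" using S_0_bound[of a] by (auto simp: tset_def)
    then show "y \<in> cball (- fst g') bd" by (simp add: dist_norm norm_minus_commute add.commute)
  qed
  moreover have "closed (tset n g j)"
    using continuous_closed_vimage[OF closed_S[of n j], of "\<lambda>y. y + fst g"] by (simp add: tset_def vimage_def)
  ultimately show ?thesis by (meson bounded_cball bounded_subset compact_eq_bounded_closed)
qed

lemma Np_tset_measurable: "strad x n g j \<Longrightarrow> Np \<inter> tset n g j \<in> lmeasurable"
proof -
  assume "strad x n g j"
  then have "tset n g j \<in> lmeasurable" by (intro lmeasurable_compact tset_compact)
  moreover have "Np \<in> sets lebesgue" using Np_borel by (intro sets_completionI_sets) simp
  ultimately show ?thesis by (metis Int_commute fmeasurable_Int_fmeasurable)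
qed

text \<open>Overlap area relative to the weight, uniformly over the infinitely many relevant tiles
  of a level.\<close>

definition mbound where
  "mbound n \<rho> \<longleftrightarrow> (\<forall>g\<in>lat. \<forall>j. strad x n g j \<longrightarrow> measure lebesgue (Np \<inter> tset n g j) \<le> \<rho> * wt x n j)"

lemma sum_subidx: "(\<Sum>(j, k)\<in>subidx m q i. f j) = (\<Sum>j\<in>UNIV. real (count_list (W m q j) i) * f j)"
proof -
  have "subidx m q i = (SIGMA j:UNIV. {k. k < length (W m q j) \<and> W m q j ! k = i})" by (auto simp: subidx_def)
  then show ?thesis by (simp add: sum.Sigma[symmetric] count_list_card)
qed

lemma wt_subidx: "wt x m i = (\<Sum>(j, k)\<in>subidx m q i. wt x (m + q) j)"
  unfolding sum_subidx W_def by (rule wt_add[OF gen])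

lemma wt_le_3: "wt x n j \<le> wt x n 3"
  using hom_le_1[OF gen'[of n], of j] by (simp add: wt_def mult_left_le)

lemma Np_tset_le:
  assumes "strad x m g i"
  shows "measure lebesgue (Np \<inter> tset m g i) \<le>
    (\<Sum>(j, k)\<in>subidx m q i. measure lebesgue (Np \<inter> tset (m + q) (g - word_sum (gam x m) (take k (W m q j))) j))"
proof -
  let ?F = "\<lambda>p. Np \<inter> tset (m + q) (g - word_sum (gam x m) (take (snd p) (W m q (fst p)))) (fst p)"
  have "Np \<inter> tset m g i = (\<Union>p\<in>subidx m q i. ?F p)"
    unfolding tset_decomp[of m g i q] by (auto simp: case_prod_beta)
  moreover have "?F p \<in> lmeasurable" if "p \<in> subidx m q i" for p
  proof (rule Np_tset_measurable)
    have "desc x m q g i (g - word_sum (gam x m) (take (snd p) (W m q (fst p)))) (fst p)"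
      unfolding desc_iff using that by (intro exI[of _ "snd p"]) simp
    then show "strad x (m + q) (g - word_sum (gam x m) (take (snd p) (W m q (fst p)))) (fst p)" by (rule desc_strad[OF assms])
  qed
  ultimately show ?thesis using measure_UNION_le'[of "subidx m q i" ?F] by (simp add: case_prod_beta)
qed

text \<open>Measure is subadditive and weight additive under subdivision, so bounds travel towards
  level 0.\<close>

lemma mbound_mono:
  assumes "mbound (m + q) \<rho>"
  shows "mbound m \<rho>"
  unfolding mbound_def
proof (intro ballI allI impI)
  fix g i assume g: "g \<in> lat" "strad x m g i"
  have "measure lebesgue (Np \<inter> tset m g i) \<le>
    (\<Sum>(j, k)\<in>subidx m q i. measure lebesgue (Np \<inter> tset (m + q) (g - word_sum (gam x m) (take k (W m q j))) j))"
    by (rule Np_tset_le[OF g(2)])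
  also have "\<dots> \<le> (\<Sum>(j, k)\<in>subidx m q i. \<rho> * wt x (m + q) j)"
  proof (rule sum_mono)
    fix p assume p: "p \<in> subidx m q i"
    obtain j k where jk: "p = (j, k)" by (cases p)
    have d: "desc x m q g i (g - word_sum (gam x m) (take k (W m q j))) j"
      unfolding desc_iff using p jk by blast
    show "(case p of (j, k) \<Rightarrow> measure lebesgue (Np \<inter> tset (m + q) (g - word_sum (gam x m) (take k (W m q j))) j))
      \<le> (case p of (j, k) \<Rightarrow> \<rho> * wt x (m + q) j)"
      using assms desc_lat[OF d] g(1) desc_strad[OF g(2) d] unfolding mbound_def jk by simp
  qed
  also have "\<dots> = \<rho> * wt x m i" unfolding wt_subidx[of m i q] by (simp add: sum_distrib_left case_prod_beta)
  finally show "measure lebesgue (Np \<inter> tset m g i) \<le> \<rho> * wt x m i" .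
qed

text \<open>Bounds the number of subtiles across a run. It is the same for all good levels, since
  every substitution of a run is \<open>brun_subst 3\<close>.\<close>

definition cn where "cn = real (\<Sum>j\<in>UNIV. length (subst_upto (\<lambda>_. brun_subst 3) rl [j]))"

lemma W_good: "good m \<Longrightarrow> W m rl j = subst_upto (\<lambda>_. brun_subst 3) rl [j]"
  unfolding W_def by (rule subst_upto_cong) (simp add: good_def brun_Phi_def)

lemma card_subidx_good: "good m \<Longrightarrow> real (card (subidx m rl i)) \<le> cn"
proof -
  assume m: "good m"
  have "real (card (subidx m rl i)) = (\<Sum>(j, k)\<in>subidx m rl i. 1)" by (simp add: case_prod_beta)
  also have "\<dots> = (\<Sum>j\<in>UNIV. real (count_list (W m rl j) i) * 1)" by (rule sum_subidx)
  also have "\<dots> \<le> cn" unfolding cn_def W_good[OF m] of_nat_sum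
    by (intro sum_mono) (simp add: count_le_length)
  finally show ?thesis .
qed

lemma wt_good_le: "good m \<Longrightarrow> wt x m i \<le> cn * wt x (m + rl) 3"
proof -
  assume m: "good m"
  have "wt x m i = (\<Sum>(j, k)\<in>subidx m rl i. wt x (m + rl) j)" by (rule wt_subidx)
  also have "\<dots> \<le> (\<Sum>(j, k)\<in>subidx m rl i. wt x (m + rl) 3)" using wt_le_3 by (intro sum_mono) auto
  also have "\<dots> = card (subidx m rl i) * wt x (m + rl) 3" by (simp add: case_prod_beta)
  also have "\<dots> \<le> cn * wt x (m + rl) 3" using card_subidx_good[OF m] wt_pos[OF gen, of "m + rl" 3]
    by (intro mult_right_mono) auto
  finally show ?thesis .
qed

lemma strad_exists: "\<exists>g\<in>lat. strad x m g i"
  by (intro bexI[of _ 0]) (auto simp: strad_def len_pos zero_lat)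

lemma cn_ge_1: "1 \<le> cn"
proof -
  obtain m where m: "good m" using good_inf by blast
  obtain g where "g \<in> lat" "strad x m g 3" using strad_exists by blast
  from deep_avoids_Np[OF m this] obtain g0 where "desc x m rl g 3 g0 3" by blast
  then have "subidx m rl 3 \<noteq> {}" unfolding desc_iff by blast
  then have "1 \<le> card (subidx m rl 3)" by (simp add: Suc_le_eq card_gt_0_iff)
  then show ?thesis using card_subidx_good[OF m, of 3] by linarith
qed

text \<open>The deep subtile has the heaviest letter 3 and is one of at most \<open>cn\<close>
  subtiles. It therefore carries at least the fraction 1 / cn of the weight and contributes no
  overlap.\<close>

lemma mbound_good:
  assumes m: "good m" and b: "mbound (m + rl) \<rho>" "0 \<le> \<rho>"
  shows "mbound m (\<rho> * (1 - 1 / cn))"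
  unfolding mbound_def
proof (intro ballI allI impI)
  fix g i assume g: "g \<in> lat" "strad x m g i"
  obtain g0 where g0: "desc x m rl g i g0 3" "tset (m + rl) g0 3 \<inter> Np = {}"
    using deep_avoids_Np[OF m g] by blast
  then obtain k0 where k0: "(3, k0) \<in> subidx m rl i" "g0 = g - word_sum (gam x m) (take k0 (W m rl 3))"
    unfolding desc_iff by blast
  let ?f = "\<lambda>(j, k). measure lebesgue (Np \<inter> tset (m + rl) (g - word_sum (gam x m) (take k (W m rl j))) j)"
  have "measure lebesgue (Np \<inter> tset m g i) \<le> sum ?f (subidx m rl i)" by (rule Np_tset_le[OF g(2)])
  also have "\<dots> = ?f (3, k0) + sum ?f (subidx m rl i - {(3, k0)})" by (rule sum.remove) (use k0 in auto)
  also have "?f (3, k0) = 0" using g0(2) k0(2) by (simp add: Int_commute)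
  also have "sum ?f (subidx m rl i - {(3, k0)}) \<le> (\<Sum>(j, k)\<in>subidx m rl i - {(3, k0)}. \<rho> * wt x (m + rl) j)"
  proof (rule sum_mono)
    fix p assume p: "p \<in> subidx m rl i - {(3, k0)}"
    obtain j k where jk: "p = (j, k)" by (cases p)
    have d: "desc x m rl g i (g - word_sum (gam x m) (take k (W m rl j))) j"
      unfolding desc_iff using p jk by blast
    show "?f p \<le> (case p of (j, k) \<Rightarrow> \<rho> * wt x (m + rl) j)"
      using b(1) desc_lat[OF d] g(1) desc_strad[OF g(2) d] unfolding mbound_def jk by simp
  qed
  also have "(\<Sum>(j, k)\<in>subidx m rl i - {(3, k0)}. \<rho> * wt x (m + rl) j) = \<rho> * (wt x m i - wt x (m + rl) 3)"
    unfolding wt_subidx[of m i rl] using k0(1)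
    by (simp add: sum_distrib_left case_prod_beta sum.remove[of "subidx m rl i" "(3, k0)"])
  also have "\<dots> \<le> \<rho> * (wt x m i - wt x m i / cn)"
    using wt_good_le[OF m, of i] cn_ge_1 b(2) by (intro mult_left_mono diff_left_mono) (auto simp: field_simps)
  finally show "measure lebesgue (Np \<inter> tset m g i) \<le> \<rho> * (1 - 1 / cn) * wt x m i" by (simp add: algebra_simps)
qed

text \<open>After the run each tile lies in a translate of the image under \<open>lin\<close> of the
  ball of radius \<open>gb\<close>. The factor 3 bounds 1 + x1 + x2 in the Jacobian.\<close>

lemma mbound_init:
  assumes m: "good m"
  shows "mbound m (cn * 3 * measure lebesgue (cball (0 :: real \<times> real) (real gb)))"
  unfolding mbound_def
proof (intro ballI allI impI)
  let ?V = "measure lebesgue (cball (0 :: real \<times> real) (real gb))" and ?n = "m + rl"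
  fix g i assume g: "g \<in> lat" "strad x m g i"
  obtain g0 where "desc x m rl g i g0 3" using deep_avoids_Np[OF m g] by blast
  then obtain k0 where k0: "(3, k0) \<in> subidx m rl i" unfolding desc_iff by blast
  have w3: "wt x ?n 3 \<le> wt x m i"
    unfolding wt_subidx[of m i rl]
    using member_le_sum[of "(3, k0)" "subidx m rl i" "\<lambda>(j, k). wt x ?n j"] k0 wt_pos[OF gen]
    by (auto simp: less_imp_le)
  have V: "measure lebesgue (Np \<inter> tset ?n g' j) \<le> 3 * ?V * wt x ?n 3" if s: "strad x ?n g' j" for g' j
  proof -
    let ?T = "(+) (- fst g') ` (lin x ?n ` cball 0 (real gb))"
    have c: "compact (lin x ?n ` cball 0 (real gb))"
      by (intro compact_continuous_image linear_continuous_on linear_conv_bounded_linear[THEN iffD1] linear_lin compact_cball)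
    have "tset ?n g' j \<subseteq> ?T"
    proof
      fix y assume "y \<in> tset ?n g' j"
      then have "y + fst g' \<in> lin x ?n ` cball 0 (real gb)" using S_good[OF m, of j] by (auto simp: tset_def)
      then show "y \<in> ?T" by (rule image_eqI[rotated]) simp
    qed
    then have sub: "Np \<inter> tset ?n g' j \<subseteq> ?T" by blast
    have "measure lebesgue (Np \<inter> tset ?n g' j) \<le> measure lebesgue ?T"
      by (rule measure_mono_fmeasurable[OF sub fmeasurableD[OF Np_tset_measurable[OF s]] lmeasurable_compact[OF compact_translation[OF c]]])
    also have "\<dots> = measure lebesgue (lin x ?n ` cball 0 (real gb))" by (rule measure_translation)
    also have "\<dots> = \<bar>kap x ?n\<bar> * (1 + fst (brun_orbit x ?n) + snd (brun_orbit x ?n)) * ?V"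
      by (rule measure_lin_image[OF gen]) simp
    also have "\<dots> \<le> \<bar>kap x ?n\<bar> * 3 * ?V"
      using generic_bounds[OF gen'[of ?n]] by (intro mult_right_mono mult_left_mono) auto
    finally show ?thesis by (simp add: wt_def mult_ac)
  qed
  have "measure lebesgue (Np \<inter> tset m g i) \<le>
    (\<Sum>(j, k)\<in>subidx m rl i. measure lebesgue (Np \<inter> tset ?n (g - word_sum (gam x m) (take k (W m rl j))) j))"
    by (rule Np_tset_le[OF g(2)])
  also have "\<dots> \<le> (\<Sum>(j, k)\<in>subidx m rl i. 3 * ?V * wt x ?n 3)"
  proof (rule sum_mono)
    fix p assume p: "p \<in> subidx m rl i"
    obtain j k where jk: "p = (j, k)" by (cases p)
    have d: "desc x m rl g i (g - word_sum (gam x m) (take k (W m rl j))) j"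
      unfolding desc_iff using p jk by blast
    show "(case p of (j, k) \<Rightarrow> measure lebesgue (Np \<inter> tset ?n (g - word_sum (gam x m) (take k (W m rl j))) j))
      \<le> (case p of (j, k) \<Rightarrow> 3 * ?V * wt x ?n 3)"
      using V[OF desc_strad[OF g(2) d]] by (simp add: jk)
  qed
  also have "\<dots> = card (subidx m rl i) * (3 * ?V * wt x ?n 3)" by (simp add: case_prod_beta)
  also have "\<dots> \<le> cn * (3 * ?V * wt x m i)"
    using card_subidx_good[OF m, of i] w3 cn_ge_1 wt_pos[OF gen, of ?n 3] by (intro mult_mono mult_left_mono) auto
  finally show "measure lebesgue (Np \<inter> tset m g i) \<le> cn * 3 * ?V * wt x m i" by (simp add: mult_ac)
qed

text \<open>The level stays arbitrary in the induction: a factor is gained at a good level above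
  \<open>m\<close> from the bound one run further up.\<close>

lemma mbound_all: "mbound m (cn * 3 * measure lebesgue (cball (0 :: real \<times> real) (real gb)) * (1 - 1 / cn) ^ l)"
proof (induction l arbitrary: m)
  case 0
  obtain n where n: "m \<le> n" "good n" using good_inf by blast
  then show ?case using mbound_mono[of m "n - m"] mbound_init[OF n(2)] by simp
next
  case (Suc l)
  obtain n where n: "m \<le> n" "good n" using good_inf by blast
  have "mbound n (cn * 3 * measure lebesgue (cball (0 :: real \<times> real) (real gb)) * (1 - 1 / cn) ^ l * (1 - 1 / cn))"
    using cn_ge_1 by (intro mbound_good n Suc mult_nonneg_nonneg zero_le_power) auto
  then show ?case using mbound_mono[of m "n - m"] n(1) by (simp add: mult_ac)
qed

lemma negligible_Np: "negligible Np"
proof -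
  have z: "negligible (Np \<inter> tset 0 (z, 0) i)" if "z \<in> Z2" for z i
  proof -
    have s: "strad x 0 (z, 0) i" by (simp add: strad_0)
    have "measure lebesgue (Np \<inter> tset 0 (z, 0) i) \<le> cn * 3 * measure lebesgue (cball (0 :: real \<times> real) (real gb)) * (1 - 1 / cn) ^ l * wt x 0 i" for l
      using mbound_all[of 0 l] s that Z2_lat unfolding mbound_def by blast
    moreover have "(\<lambda>l. cn * 3 * measure lebesgue (cball (0 :: real \<times> real) (real gb)) * (1 - 1 / cn) ^ l * wt x 0 i) \<longlonglongrightarrow> 0"
      using cn_ge_1 by (intro tendsto_mult_left_zero tendsto_mult_right_zero LIMSEQ_power_zero) (auto simp: abs_if field_simps)
    ultimately have "measure lebesgue (Np \<inter> tset 0 (z, 0) i) \<le> 0" by (intro LIMSEQ_le_const) auto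
    then have "measure lebesgue (Np \<inter> tset 0 (z, 0) i) = 0" by (simp add: antisym)
    then show ?thesis using Np_tset_measurable[OF s] by (simp add: negligible_iff_measure)
  qed
  have "Np \<subseteq> (\<Union>p\<in>Z2 \<times> (UNIV :: 3 set). Np \<inter> tset 0 (fst p, 0) (snd p))"
  proof
    fix y assume y: "y \<in> Np"
    then obtain z i where "z \<in> Z2" "y + z \<in> S 0 i" unfolding Np_def by blast
    then show "y \<in> (\<Union>p\<in>Z2 \<times> (UNIV :: 3 set). Np \<inter> tset 0 (fst p, 0) (snd p))"
      using y by (intro UN_I[of "(z, i)"]) (auto simp: tset_def)
  qed
  moreover have "negligible (\<Union>p\<in>Z2 \<times> (UNIV :: 3 set). Np \<inter> tset 0 (fst p, 0) (snd p))"
    using z by (intro negligible_countable_Union) (auto intro!: countable_image countable_SIGMA countable_Z2 simp: countable_finite)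
  ultimately show ?thesis by (rule negligible_subset[rotated])
qed

section \<open>Density of the orbit and covering of the plane\<close>

lemma word_sum_err0_mod: "\<exists>a b. word_sum (err0 x) w = real (length w) *\<^sub>R rotation x - (real_of_int a, real_of_int b)"
proof (induction w)
  case Nil
  show ?case by (intro exI[of _ 0]) (simp add: zero_prod_def)
next
  case (Cons j w)
  then obtain a b where "word_sum (err0 x) w = real (length w) *\<^sub>R rotation x - (real_of_int a, real_of_int b)" by blast
  then have "word_sum (err0 x) (j # w) = real (length (j # w)) *\<^sub>R rotation x -
      (real_of_int (a + of_bool (j = 1)), real_of_int (b + of_bool (j = 2)))"
    using err0_def[of x j] by (simp add: prod_eq_iff algebra_simps)
  then show ?case by blast
qed

text \<open>The target is expanded in the discrepancies of a level where these are small. A multiple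
  of the frequency relation makes the coefficients nonnegative, and rounding down turns them into
  letter counts of a word.\<close>

lemma orbit_dense:
  assumes "0 < e"
  shows "\<exists>k a b. norm (v - (real k *\<^sub>R rotation x - (real_of_int a, real_of_int b))) < e"
proof -
  obtain n where n: "max_err x n < e / 4"
    using max_err_tendsto[of "e / 4"] assms by (auto simp: eventually_sequentially)
  have "surj (lin x n)"
    using linear_inj_imp_surj[OF linear_lin[of x n]] linear_injective_0[OF linear_lin[of x n]] inj_lin[OF gen] by blast
  then obtain w where w: "v = lin x n w" by (metis surjD)
  let ?u = "freq (brun_orbit x n)" and ?D = "err x n"
  have u: "0 < ?u j" for j by (rule freq_pos[OF gen'])
  \<comment> \<open>Chosen so that \<open>s\<close> times each frequency dominates the corresponding
    coefficient.\<close>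
  define s where "s = \<bar>fst w\<bar> / ?u 1 + \<bar>snd w\<bar> / ?u 2 + (\<bar>fst w\<bar> + \<bar>snd w\<bar>) / ?u 3"
  define c where "c j = (if j = 1 then - fst w else if j = 2 then - snd w else fst w + snd w) + s * ?u j" for j
  have q: "0 \<le> \<bar>fst w\<bar> / ?u 1" "0 \<le> \<bar>snd w\<bar> / ?u 2" "0 \<le> (\<bar>fst w\<bar> + \<bar>snd w\<bar>) / ?u 3"
    using u[of 1] u[of 2] u[of 3] by simp_all
  have "\<bar>fst w\<bar> / ?u 1 * ?u 1 \<le> s * ?u 1" "\<bar>snd w\<bar> / ?u 2 * ?u 2 \<le> s * ?u 2"
    "(\<bar>fst w\<bar> + \<bar>snd w\<bar>) / ?u 3 * ?u 3 \<le> s * ?u 3"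
    using q u[of 1] u[of 2] u[of 3] unfolding s_def by (intro mult_right_mono; linarith)+
  then have b: "\<bar>fst w\<bar> \<le> s * ?u 1" "\<bar>snd w\<bar> \<le> s * ?u 2" "\<bar>fst w\<bar> + \<bar>snd w\<bar> \<le> s * ?u 3"
    using u[of 1] u[of 2] u[of 3] by simp_all
  have "0 \<le> c 1" unfolding c_def using b(1) abs_ge_self[of "fst w"] by simp
  moreover have "0 \<le> c 2" unfolding c_def using b(2) abs_ge_self[of "snd w"] by simp
  moreover have "0 \<le> c 3" unfolding c_def using b(3) abs_ge_minus_self[of "snd w"] abs_ge_minus_self[of "fst w"]
    by simp
  ultimately have c0: "0 \<le> c j" for j using exhaust_3[of j] by metis
  have vc: "v = c 1 *\<^sub>R ?D 1 + c 2 *\<^sub>R ?D 2 + c 3 *\<^sub>R ?D 3"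
  proof -
    have "c 1 *\<^sub>R ?D 1 + c 2 *\<^sub>R ?D 2 + c 3 *\<^sub>R ?D 3 = lin x n w + s *\<^sub>R (?u 1 *\<^sub>R ?D 1 + ?u 2 *\<^sub>R ?D 2 + ?u 3 *\<^sub>R ?D 3)"
      by (simp add: c_def lin_def algebra_simps)
    then show ?thesis using err_freq_relation[OF gen, of n] w by simp
  qed
  define m where "m j = nat \<lfloor>c j\<rfloor>" for j
  have m: "\<bar>c j - real (m j)\<bar> \<le> 1" for j using c0[of j] unfolding m_def by linarith
  define p where "p = replicate (m 1) (1 :: 3) @ replicate (m 2) 2 @ replicate (m 3) 3"
  have rep: "word_sum f (replicate k j) = real k *\<^sub>R f j" for f :: "3 \<Rightarrow> real \<times> real" and k j
    by (induction k) (simp_all add: algebra_simps)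
  have "word_sum ?D p = real (m 1) *\<^sub>R ?D 1 + real (m 2) *\<^sub>R ?D 2 + real (m 3) *\<^sub>R ?D 3"
    by (simp add: p_def rep)
  then have "v - word_sum ?D p = (c 1 - m 1) *\<^sub>R ?D 1 + ((c 2 - m 2) *\<^sub>R ?D 2 + (c 3 - m 3) *\<^sub>R ?D 3)"
    by (simp add: vc algebra_simps)
  also have "norm \<dots> \<le> max_err x n + (max_err x n + max_err x n)"
  proof -
    have "norm ((c j - m j) *\<^sub>R ?D j) \<le> 1 * max_err x n" for j
      unfolding norm_scaleR using m[of j] max_err_ge[of x n j] by (intro mult_mono) auto
    then show ?thesis by (intro norm_triangle_le add_mono) (auto intro!: norm_triangle_le add_mono)
  qed
  also have "\<dots> < e" using n assms max_err_nonneg[of x n] by linarith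
  finally have "norm (v - word_sum ?D p) < e" .
  then show ?thesis using word_sum_err0_mod[of "subst_upto (brun_Phi x) n p"] unfolding word_sum_err by metis
qed

lemma limit_word_shift_exists: "\<exists>\<omega>. limit_word (\<lambda>k. brun_Phi x (n + k)) \<omega>"
proof (rule limit_word_exists[OF nonerasing unbounded])
  fix m and a :: 3
  show "\<exists>b w. brun_Phi x (n + m) b = a # w"
    using exhaust_3[of a] exhaust_3[of "brun_index (brun_orbit x (n + m))"] unfolding brun_Phi_def
    by (auto intro: exI[of _ 1] exI[of _ 2] exI[of _ 3])
qed

lemma pre_stake: "limit_word \<sigma> \<omega> \<Longrightarrow> pre \<sigma> (stake k \<omega>) (\<omega> !! k)"
  unfolding pre_def using id_stake_snth_sdrop[of \<omega> k] by metis

lemma finite_Z2_cball: "finite (Z2 \<inter> cball 0 r)"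
proof -
  let ?B = "{- \<lceil>r\<rceil>..\<lceil>r\<rceil>}"
  have "Z2 \<inter> cball 0 r \<subseteq> (\<lambda>(a, b). (real_of_int a, real_of_int b)) ` (?B \<times> ?B)"
  proof
    fix w assume "w \<in> Z2 \<inter> cball 0 r"
    then obtain a b where w: "w = (real_of_int a, real_of_int b)" "norm w \<le> r"
      by (auto simp: Z2_def Ints_def)
    have "\<bar>real_of_int a\<bar> \<le> r" "\<bar>real_of_int b\<bar> \<le> r"
      using w norm_fst_le[of "real_of_int a" "real_of_int b"] norm_snd_le[of "real_of_int b" "real_of_int a"] by simp_all
    then have "a \<in> ?B" "b \<in> ?B" unfolding atLeastAtMost_iff by linarith+
    then show "w \<in> (\<lambda>(a, b). (real_of_int a, real_of_int b)) ` (?B \<times> ?B)"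
      using w(1) by (intro image_eqI[of _ _ "(a, b)"]) auto
  qed
  then show ?thesis by (rule finite_subset) auto
qed

text \<open>Prefix sums of one limit word lie in the pieces and are dense modulo Z^2. The pieces are
  bounded, so only finitely many translates matter near \<open>v\<close>, and their union is
  closed.\<close>

lemma cover: "\<exists>z\<in>Z2. \<exists>i. v + z \<in> S 0 i"
proof -
  obtain \<omega> where \<omega>: "limit_word (brun_Phi x) \<omega>" using limit_word_shift_exists[of 0] by auto
  have "\<exists>z\<in>Z2. \<exists>i. \<exists>y\<in>S 0 i. norm (v + z - y) < 1 / Suc n" for n
  proof -
    obtain k a b where k: "norm (v - (real k *\<^sub>R rotation x - (real_of_int a, real_of_int b))) < 1 / Suc n"
      using orbit_dense[of "1 / Suc n" v] by auto
    obtain a' b' where e: "word_sum (err0 x) (stake k \<omega>) = real k *\<^sub>R rotation x - (real_of_int a', real_of_int b')"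
      using word_sum_err0_mod[of "stake k \<omega>"] by auto
    let ?y = "word_sum (err0 x) (stake k \<omega>)" and ?z = "(real_of_int (a - a'), real_of_int (b - b'))"
    have "?y \<in> S 0 (\<omega> !! k)" unfolding S_def pre_set_def
      using pre_stake[OF \<omega>, of k] by (intro subsetD[OF closure_subset]) auto
    moreover have "?z \<in> Z2" by (simp add: Z2_def)
    moreover have "v + ?z - ?y = v - (real k *\<^sub>R rotation x - (real_of_int a, real_of_int b))"
      unfolding e by (simp add: algebra_simps)
    ultimately show ?thesis using k by metis
  qed
  then obtain z i y where zy: "\<And>n. z n \<in> Z2" "\<And>n. y n \<in> S 0 (i n)" "\<And>n. norm (v + z n - y n) < 1 / Suc n"
    by metis
  define F where "F = Z2 \<inter> cball 0 (norm v + bd + 1)"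
  then have F: "finite F" by (simp add: finite_Z2_cball)
  have zF: "z n \<in> F" for n
  proof -
    have "y n \<in> cball 0 bd" using zy(2)[of n] S_0_bound by blast
    then have "norm (y n) \<le> bd" by simp
    moreover have "norm (v + z n - y n) < 1"
    proof -
      have "1 / real (Suc n) \<le> 1" by simp
      with zy(3)[of n] show ?thesis by linarith
    qed
    moreover have "norm (z n) \<le> norm (v + z n - y n) + norm v + norm (y n)"
      using norm_triangle_ineq4[of "v + z n - y n" "v - y n"] norm_triangle_ineq4[of v "y n"] by simp
    ultimately show ?thesis using zy(1)[of n] by (simp add: F_def)
  qed
  define T where "T = (\<Union>p\<in>F \<times> (UNIV :: 3 set). (+) (- fst p) ` S 0 (snd p))"
  have "closed T" unfolding T_def using F by (intro closed_UN finite_SigmaI ballI closed_translation closed_S) auto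
  moreover have "v \<in> closure T"
    unfolding closure_approachable
  proof (intro allI impI)
    fix e :: real assume "0 < e"
    then obtain n where n: "1 / Suc n < e" using nat_approx_posE by blast
    have "y n - z n \<in> T" unfolding T_def using zF[of n] zy(2)[of n]
      by (intro UN_I[of "(z n, i n)"] image_eqI[of _ _ "y n"]) auto
    moreover have "dist (y n - z n) v < e" using zy(3)[of n] n by (simp add: dist_norm norm_minus_commute algebra_simps)
    ultimately show "\<exists>y\<in>T. dist y v < e" by blast
  qed
  ultimately have "v \<in> T" by (simp add: closure_closed)
  then obtain p s where "p \<in> F \<times> (UNIV :: 3 set)" "s \<in> S 0 (snd p)" "v = - fst p + s" unfolding T_def by blast
  then show ?thesis by (intro bexI[of _ "fst p"] exI[of _ "snd p"]) (auto simp: F_def)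
qed

end

section \<open>The Rauzy fractal as a fundamental domain\<close>

lemma count_list_3: "real (count_list w 3) = real (length w) - real (count_list w 1) - real (count_list w 2)" for w :: "3 list"
proof (induction w)
  case (Cons a w)
  then show ?case using exhaust_3[of a] by auto
qed simp

lemma fst_word_sum_err0: "fst (word_sum (err0 x) w) = real (length w) * freq x 1 - real (count_list w 1)"
  and snd_word_sum_err0: "snd (word_sum (err0 x) w) = real (length w) * freq x 2 - real (count_list w 2)"
  by (induction w) (auto simp: err0_def rotation_freq algebra_simps)

lemma negligible_translation_eq: "negligible ((+) c ` A) \<longleftrightarrow> negligible A"
  using negligible_translation negligible_translation_rev by blast

lemma Z2_add: "z \<in> Z2 \<Longrightarrow> w \<in> Z2 \<Longrightarrow> z + w \<in> Z2" and Z2_diff: "z \<in> Z2 \<Longrightarrow> w \<in> Z2 \<Longrightarrow> z - w \<in> Z2"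
  and Z2_minus: "z \<in> Z2 \<Longrightarrow> - z \<in> Z2" and Z2_0: "0 \<in> Z2" and Z2_of_int: "(real_of_int a, real_of_int b) \<in> Z2"
  by (auto simp: Z2_def mem_Times_iff zero_prod_def)

context brun_point begin

definition R where "R = (\<Union>i. S 0 i)"

lemma compact_R: "compact R"
  unfolding R_def by (intro compact_UN) (auto intro: compact_S_0)

lemma R_bound: "y \<in> R \<Longrightarrow> norm y \<le> bd"
  using S_0_bound unfolding R_def subset_iff mem_cball_0 by blast

lemma unique_tile:
  assumes "y \<notin> Np" "z \<in> Z2" "z' \<in> Z2" "y + z \<in> S 0 i" "y + z' \<in> S 0 i'"
  shows "z = z'" "i = i'"
  using assms unfolding Np_def by blast+

lemma Np_periodic:
  assumes "w \<in> Z2"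
  shows "y + w \<in> Np \<longleftrightarrow> y \<in> Np"
proof -
  have *: "y \<in> Np" if "y + w \<in> Np" "w \<in> Z2" for y w
  proof -
    obtain z z' i i' where h: "z \<in> Z2" "z' \<in> Z2" "(z, i) \<noteq> (z', i')" "y + w + z \<in> S 0 i" "y + w + z' \<in> S 0 i'"
      using \<open>y + w \<in> Np\<close> unfolding Np_def by blast
    then have "w + z \<in> Z2" "w + z' \<in> Z2" "(w + z, i) \<noteq> (w + z', i')" "y + (w + z) \<in> S 0 i" "y + (w + z') \<in> S 0 i'"
      using that(2) by (auto simp: Z2_add add.assoc)
    then show ?thesis unfolding Np_def by blast
  qed
  show ?thesis using *[of y w] *[of "y + w" "- w"] assms Z2_minus by auto
qed

text \<open>Finitely many translates meet the unit ball around \<open>y\<close>, and the union of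
  those that miss \<open>y\<close> is closed.\<close>

lemma locally_finite:
  "\<exists>e>0. \<forall>y'. dist y' y < e \<longrightarrow> (\<forall>z\<in>Z2. \<forall>j. y' + z \<in> S 0 j \<longrightarrow> y + z \<in> S 0 j)"
proof -
  define F where "F = {p \<in> (Z2 \<inter> cball 0 (norm y + 1 + bd)) \<times> (UNIV :: 3 set). y + fst p \<notin> S 0 (snd p)}"
  define T where "T = (\<Union>p\<in>F. {y'. y' + fst p \<in> S 0 (snd p)})"
  have "finite F" unfolding F_def by (rule finite_subset[of _ "(Z2 \<inter> cball 0 (norm y + 1 + bd)) \<times> UNIV"]) (auto intro: finite_Z2_cball)
  moreover have "closed {y'. y' + z \<in> S 0 j}" for z j
    using continuous_closed_vimage[OF closed_S[of 0 j], of "\<lambda>y. y + z"] by (simp add: vimage_def)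
  ultimately have "closed T" unfolding T_def by (intro closed_UN) auto
  moreover have "y \<notin> T" by (auto simp: T_def F_def)
  ultimately obtain e where e: "0 < e" "\<And>y'. dist y' y < e \<Longrightarrow> y' \<notin> T"
    by (metis ComplI open_Compl open_dist ComplD)
  show ?thesis
  proof (intro exI[of _ "min e 1"] conjI allI impI ballI)
    fix y' z j assume h: "dist y' y < min e 1" "z \<in> Z2" "y' + z \<in> S 0 j"
    show "y + z \<in> S 0 j"
    proof (rule ccontr)
      assume n: "y + z \<notin> S 0 j"
      have "y' + z \<in> cball 0 bd" using h(3) S_0_bound by blast
      then have "norm (y' + z) \<le> bd" by simp
      moreover have "norm z \<le> norm (y' + z) + norm (y' - y) + norm y"
        using norm_triangle_ineq4[of "y' + z" y'] norm_triangle_ineq[of "y' - y" y] by simp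
      ultimately have "norm z \<le> norm y + 1 + bd" using h(1) by (simp add: dist_norm)
      then have "(z, j) \<in> F" using h n by (simp add: F_def)
      then have "y' \<in> T" unfolding T_def using h(3) by (intro UN_I[of "(z, j)"]) auto
      then show False using e(2)[of y'] h(1) by simp
    qed
  qed (use e in auto)
qed

text \<open>Points outside the piece but close to \<open>y\<close> are covered by other translates;
  by local finiteness one of these contains \<open>y\<close>.\<close>

lemma frontier_S: "frontier (S 0 i) \<subseteq> Np"
proof
  fix y assume y: "y \<in> frontier (S 0 i)"
  then have yS: "y \<in> S 0 i" using closed_S[of 0 i] by (auto simp: frontier_def closure_closed)
  obtain e where e: "0 < e" "\<And>y' z j. dist y' y < e \<Longrightarrow> z \<in> Z2 \<Longrightarrow> y' + z \<in> S 0 j \<Longrightarrow> y + z \<in> S 0 j"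
    using locally_finite[of y] by metis
  obtain y' where y': "y' \<notin> S 0 i" "dist y' y < e"
    using y e(1) unfolding frontier_straddle mem_Collect_eq by (metis dist_commute)
  obtain z j where z: "z \<in> Z2" "y' + z \<in> S 0 j" using cover by blast
  then have "(z, j) \<noteq> (0, i)" using y'(1) by auto
  moreover have "y + z \<in> S 0 j" using e(2)[OF y'(2) z] .
  ultimately show "y \<in> Np" unfolding Np_def using yS z(1) Z2_0 by (metis (mono_tags, lifting) mem_Collect_eq add_0_right)
qed

lemma negligible_frontier_S: "negligible (frontier (S 0 i))"
  using negligible_Np frontier_S by (rule negligible_subset)

lemma S_0_lebesgue: "S 0 i \<in> sets lebesgue"
  using compact_S_0 by (simp add: lmeasurable_compact fmeasurableD)

lemma pre_set_exchange: "v \<in> pre_set 0 i \<Longrightarrow> \<exists>j. v + err0 x i \<in> pre_set 0 j"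
proof -
  assume "v \<in> pre_set 0 i"
  then obtain p \<omega> where p: "limit_word (brun_Phi x) (p @- (i ## \<omega>))" "v = word_sum (err0 x) p"
    by (auto simp: pre_set_def pre_def)
  have "p @- (i ## \<omega>) = (p @ [i]) @- (shd \<omega> ## stl \<omega>)" by simp
  then have "pre (brun_Phi x) (p @ [i]) (shd \<omega>)" unfolding pre_def using p(1) by metis
  moreover have "v + err0 x i = word_sum (err0 x) (p @ [i])" by (simp add: p(2))
  ultimately show ?thesis unfolding pre_set_def err_0 by (intro exI[of _ "shd \<omega>"] image_eqI) auto
qed

text \<open>The domain exchange: reading one more letter of a limit word adds the discrepancy of
  that letter to the prefix sum.\<close>

lemma S_exchange: "y \<in> S 0 i \<Longrightarrow> y + err0 x i \<in> R"
proof -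
  assume y: "y \<in> S 0 i"
  have "pre_set 0 i \<subseteq> {v. v + err0 x i \<in> R}"
  proof
    fix v assume "v \<in> pre_set 0 i"
    then obtain j where "v + err0 x i \<in> pre_set 0 j" using pre_set_exchange by blast
    then have "v + err0 x i \<in> S 0 j" unfolding S_def by (rule subsetD[OF closure_subset])
    then show "v \<in> {v. v + err0 x i \<in> R}" by (auto simp: R_def)
  qed
  moreover have "closed {v. v + err0 x i \<in> R}"
    using continuous_closed_vimage[OF compact_imp_closed[OF compact_R], of "\<lambda>v. v + err0 x i"] by (simp add: vimage_def)
  ultimately have "S 0 i \<subseteq> {v. v + err0 x i \<in> R}" unfolding S_def by (rule closure_minimal)
  then show ?thesis using y by blast
qed

lemma err0_mod: "err0 x i - rotation x \<in> Z2"
  by (auto simp: err0_def Z2_def zero_prod_def)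

lemma negligible_Np_shift: "negligible {y. y + v \<in> Np}"
proof -
  have "negligible ((+) (- v) ` Np)" using negligible_Np by (simp only: negligible_translation_eq)
  moreover have "(+) (- v) ` Np = {y. y + v \<in> Np}"
    by (auto simp: image_iff) (metis add.commute add_diff_cancel uminus_add_conv_diff)
  ultimately show ?thesis by simp
qed

lemma AE_not_Np: "AE y in lebesgue. y + v \<notin> Np"
proof -
  have "AE y in lebesgue. y \<notin> {y. y + v \<in> Np}"
    using negligible_Np_shift by (intro AE_not_in) (simp add: negligible_iff_null_sets)
  then show ?thesis by simp
qed

text \<open>All \<open>err0 x i\<close> are congruent to the rotation vector, so the exchange is the
  induced map wherever representatives are unique.\<close>

lemma induced_eq:
  assumes "y \<in> S 0 i" "y + rotation x \<notin> Np"
  shows "induced_translation Z2 (rotation x) R y = y + err0 x i"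
  unfolding induced_translation_def
proof (rule the_equality)
  have e: "y + err0 x i - (y + rotation x) = err0 x i - rotation x" by simp
  show "y + err0 x i \<in> R \<and> y + err0 x i - (y + rotation x) \<in> Z2"
    unfolding e using S_exchange[OF assms(1)] err0_mod by blast
  fix u assume u: "u \<in> R \<and> u - (y + rotation x) \<in> Z2"
  obtain j where j: "u \<in> S 0 j" using u by (auto simp: R_def)
  obtain k where k: "y + err0 x i \<in> S 0 k" using S_exchange[OF assms(1)] by (auto simp: R_def)
  have "u - (y + rotation x) = err0 x i - rotation x"
    by (rule unique_tile(1)[OF assms(2)]) (use u j k err0_mod in \<open>auto simp: algebra_simps\<close>)
  then show "u = y + err0 x i" by (simp add: algebra_simps)
qed

lemma fundamental_domain_R: "fundamental_domain Z2 R"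
  unfolding fundamental_domain_def
proof (intro conjI)
  show "R \<in> sets lebesgue" using compact_R by (simp add: lmeasurable_compact fmeasurableD)
  show "bounded R" using compact_R by (rule compact_imp_bounded)
  show "AE y in lebesgue. \<exists>!v. v \<in> Z2 \<and> y + v \<in> R"
    using AE_not_Np[of 0]
  proof eventually_elim
    case (elim y)
    obtain z i where z: "z \<in> Z2" "y + z \<in> S 0 i" using cover by blast
    show ?case
    proof (rule ex1I[of _ z])
      show "z \<in> Z2 \<and> y + z \<in> R" using z by (auto simp: R_def)
      fix v assume "v \<in> Z2 \<and> y + v \<in> R"
      then obtain j where "v \<in> Z2" "y + v \<in> S 0 j" by (auto simp: R_def)
      then show "v = z" using unique_tile(1)[of y v z j i] elim z by simp
    qed
  qed
qed

lemma natural_partition_S: "natural_partition Z2 (rotation x) R (S 0) (err0 x)"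
  unfolding natural_partition_def
proof (intro conjI allI impI)
  show "fundamental_domain Z2 R" by (rule fundamental_domain_R)
  show "S 0 i \<in> sets lebesgue" for i by (rule S_0_lebesgue)
  show "negligible (frontier (S 0 i))" for i by (rule negligible_frontier_S)
  show "R = (\<Union>i. S 0 i)" by (rule R_def)
  show "negligible (S 0 i \<inter> S 0 j)" if "i \<noteq> j" for i j
  proof (rule negligible_subset[OF negligible_Np])
    show "S 0 i \<inter> S 0 j \<subseteq> Np"
    proof
      fix y assume "y \<in> S 0 i \<inter> S 0 j"
      then show "y \<in> Np" unfolding Np_def using that Z2_0
        by (intro CollectI bexI[of _ 0] exI[of _ i] exI[of _ j]) auto
    qed
  qed
  show "AE y in lebesgue. y \<in> S 0 i \<longrightarrow> induced_translation Z2 (rotation x) R y = y + err0 x i" for i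
    using AE_not_Np[of "rotation x"] by eventually_elim (auto intro: induced_eq)
qed

section \<open>Occurrence of every letter at every level, and pieces of positive measure\<close>

lemma three_persists: "3 \<in> set (subst_upto (brun_Phi y) n [3])"
proof (induction n)
  case (Suc n)
  have "3 \<in> set (brun_subst (brun_index (brun_orbit y n)) 3)"
    using exhaust_3[of "brun_index (brun_orbit y n)"] by auto
  then obtain u v where "brun_subst (brun_index (brun_orbit y n)) 3 = u @ 3 # v" by (auto simp: in_set_conv_decomp)
  then have "subst_upto (brun_Phi y) (Suc n) [3] = subst_upto (brun_Phi y) n u @ subst_upto (brun_Phi y) n [3] @ subst_upto (brun_Phi y) n v"
    using subst_upto_Cons[of "brun_Phi y" n 3 v] by (simp add: brun_Phi_def)
  then show ?case using Suc by simp
qed simp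

lemma three_in_W: "\<exists>q. \<forall>j. 3 \<in> set (W n q j)"
proof -
  obtain m where m: "n \<le> m" "good m" using good_inf by blast
  have "3 \<in> set (W n (m - n + rl) j)" for j
  proof -
    define r where "r = rl - 2"
    then have r: "rl = Suc (Suc r)" using rl(1) by simp
    obtain p where p: "subst_upto (\<lambda>k. brun_Phi x (m + k)) rl [j] = p @ [3]"
      using subst_upto_3_last[of r "\<lambda>k. brun_Phi x (m + k)" j] m(2) unfolding r[symmetric] good_def brun_Phi_def by metis
    have "W n (m - n + rl) j = subst_upto (\<lambda>k. brun_Phi x (n + k)) (m - n) (p @ [3])"
      unfolding W_def subst_upto_add using m(1) p by (simp add: add.assoc[symmetric])
    then show ?thesis using three_persists[of "brun_orbit x n" "m - n"] by (simp add: brun_Phi_shift)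
  qed
  then show ?thesis by blast
qed

lemma subidx_nonempty: "subidx m q i \<noteq> {}"
  using wt_subidx[of m i q] wt_pos[OF gen, of m i] by force

text \<open>\<open>deep_avoids_Np\<close> is used merely as a source of subtiles with letter
  3.\<close>

lemma letter_below_three: "\<exists>q k. (3, k) \<in> subidx n q i"
proof -
  obtain m where m: "n \<le> m" "good m" using good_inf by blast
  obtain b k where b: "(b, k) \<in> subidx n (m - n) i" using subidx_nonempty by fast
  obtain g where g: "g \<in> lat" "strad x m g b" using strad_exists by blast
  obtain g0 where g0: "desc x m rl g b g0 3" using deep_avoids_Np[OF m(2) g] by blast
  define g' where "g' = g + word_sum (gam x n) (take k (W n (m - n) b))"
  have "desc x n (m - n) g' i g b" unfolding desc_iff using b by (intro exI[of _ k]) (simp add: g'_def)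
  then have "desc x n (m - n + rl) g' i g0 3" using g0 m(1) by (intro desc_trans[of x n "m - n"]) auto
  then show ?thesis unfolding desc_iff by blast
qed

lemma pre_from_subidx: "(j, k) \<in> subidx n q i \<Longrightarrow> pre (\<lambda>k. brun_Phi x (n + q + k)) w j \<Longrightarrow> \<exists>p. pre (\<lambda>k. brun_Phi x (n + k)) p i"
proof -
  assume h: "(j, k) \<in> subidx n q i" "pre (\<lambda>k. brun_Phi x (n + q + k)) w j"
  then have k: "k < length (W n q j)" "W n q j ! k = i" by (auto simp: subidx_def)
  have "W n q j = take k (W n q j) @ i # drop (Suc k) (W n q j)" using id_take_nth_drop[OF k(1)] k(2) by simp
  then show ?thesis
    using pre_multi[OF nonerasing, of n _ i q] h(2) unfolding W_def add.assoc by blast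
qed

lemma pre_three: "\<exists>p. pre (\<lambda>k. brun_Phi x (n + k)) p 3"
proof -
  obtain q where q: "\<And>j. 3 \<in> set (W n q j)" using three_in_W by blast
  obtain \<omega> where "limit_word (\<lambda>k. brun_Phi x (n + q + k)) \<omega>" using limit_word_shift_exists by blast
  from pre_stake[OF this, of 0] have 1: "pre (\<lambda>k. brun_Phi x (n + q + k)) [] (shd \<omega>)" by simp
  obtain k where "(shd \<omega>, k) \<in> subidx n q 3" using q[of "shd \<omega>"] by (auto simp: subidx_def in_set_conv_nth)
  then show ?thesis using 1 by (rule pre_from_subidx)
qed

lemma pre_all: "\<exists>p. pre (\<lambda>k. brun_Phi x (n + k)) p i"
proof -
  obtain q k where "(3, k) \<in> subidx n q i" using letter_below_three by blast
  then show ?thesis using pre_three[of "n + q"] pre_from_subidx by blast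
qed

lemma limit_word_descend:
  "limit_word (\<lambda>k. brun_Phi x (n + k)) (w @- \<rho>) \<Longrightarrow> \<exists>\<rho>'. limit_word (brun_Phi x) (subst_upto (brun_Phi x) n w @- \<rho>')"
proof (induction n arbitrary: w \<rho>)
  case (Suc n)
  let ?s = "brun_Phi x n"
  have "limit_word (\<lambda>k. brun_Phi x (n + k)) (subst_stream ?s (w @- \<rho>))"
    unfolding limit_word_step[of "\<lambda>k. brun_Phi x (n + k)"] using Suc.prems by (intro exI[of _ "w @- \<rho>"]) simp
  moreover have "subst_stream ?s (w @- \<rho>) = subst_word ?s w @- subst_stream ?s \<rho>"
    using nonerasing_brun[of x] by (intro subst_stream_shift) (auto simp: nonerasing_def)
  ultimately show ?case using Suc.IH by simp
qed auto

text \<open>The language is generated by images of letters, and each letter of each level occurs in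
  a limit word of that level; substituting carries the occurrence down to level 0.\<close>

lemma language_occurs:
  assumes "w \<in> sadic_language (brun_Phi x)"
  shows "\<exists>p \<rho>. limit_word (brun_Phi x) (p @- (w @- \<rho>))"
proof -
  obtain i n u v where "subst_upto (brun_Phi x) n [i] = u @ w @ v"
    using assms by (auto simp: sadic_language_def sublist_def)
  moreover obtain q \<omega> where "limit_word (\<lambda>k. brun_Phi x (n + k)) (q @- (i ## \<omega>))"
    using pre_all[of n i] by (auto simp: pre_def)
  then have "limit_word (\<lambda>k. brun_Phi x (n + k)) ((q @ [i]) @- \<omega>)" by simp
  then obtain \<rho> where "limit_word (brun_Phi x) (subst_upto (brun_Phi x) n (q @ [i]) @- \<rho>)"
    using limit_word_descend by blast
  ultimately have "limit_word (brun_Phi x) ((subst_upto (brun_Phi x) n q @ u) @- (w @- (v @- \<rho>)))" by simp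
  then show ?thesis by blast
qed

lemma limit_word_factor:
  assumes "limit_word (brun_Phi x) (p @- (w @- \<rho>))"
  shows "w \<in> sadic_language (brun_Phi x)"
proof -
  have "p @- (w @- \<rho>) = (p @ w) @- (shd \<rho> ## stl \<rho>)" by simp
  then have "pre (brun_Phi x) (p @ w) (shd \<rho>)" unfolding pre_def using assms by metis
  then obtain m j t where "subst_upto (brun_Phi x) m [j] = (p @ w) @ shd \<rho> # t"
    using pre_is_prefix[OF nonerasing_brun, of x "p @ w" "shd \<rho>"] unbounded[of 0] by auto
  then show ?thesis unfolding sadic_language_def sublist_def by auto
qed

lemma limit_word_pre:
  assumes "limit_word (brun_Phi x) (p @- (w @- \<rho>))" "k < length w"
  shows "pre (brun_Phi x) (p @ take k w) (w ! k)"
proof -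
  have "p @- (w @- \<rho>) = (p @ take k w) @- ((w ! k) ## (drop (Suc k) w @- \<rho>))"
    using id_take_nth_drop[OF assms(2)] by (metis append.assoc shift.simps(2) shift_append)
  then show ?thesis unfolding pre_def using assms(1) by metis
qed

text \<open>Each piece contains a translate of a piece with letter 3 of a higher level, and that one
  contains translates of all pieces of a still higher level. If the first were null, every piece of
  level 0 would be null, against \<open>cover\<close>.\<close>

lemma not_negligible_S: "\<not> negligible (S n i)"
proof
  assume "negligible (S n i)"
  obtain q k where qk: "(3, k) \<in> subidx n q i" using letter_below_three by blast
  have sub: "(+) (word_sum (err x m) (take k (W m q j))) ` S (m + q) j \<subseteq> S m i" if "(j, k) \<in> subidx m q i" for m q i j k
    unfolding S_decomp[of m i q] using that by blast
  have "negligible ((+) (word_sum (err x n) (take k (W n q 3))) ` S (n + q) 3)"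
    using sub[OF qk] \<open>negligible (S n i)\<close> by (rule negligible_subset[rotated])
  then have 3: "negligible (S (n + q) 3)" by (simp only: negligible_translation_eq)
  obtain r where r: "\<And>j. 3 \<in> set (W (n + q) r j)" using three_in_W by blast
  have all: "negligible (S (n + q + r) j)" for j
  proof -
    obtain k where "(j, k) \<in> subidx (n + q) r 3" using r[of j] by (auto simp: subidx_def in_set_conv_nth)
    from sub[OF this] 3 have "negligible ((+) (word_sum (err x (n + q)) (take k (W (n + q) r j))) ` S (n + q + r) j)"
      by (rule negligible_subset[rotated])
    then show ?thesis by (simp only: negligible_translation_eq)
  qed
  have "negligible (S 0 i)" for i
    unfolding S_decomp[of 0 i "n + q + r"]
    by (intro negligible_Union finite_imageI finite_subidx) (use all in \<open>auto simp: negligible_translation_eq\<close>)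
  then have "negligible (\<Union>p\<in>Z2 \<times> (UNIV :: 3 set). (+) (- fst p) ` S 0 (snd p))"
    using \<open>\<And>i. negligible (S 0 i)\<close>
    by (intro negligible_countable_Union countable_image countable_SIGMA countable_Z2)
      (auto simp: countable_finite negligible_translation_eq simp del: uminus_add_conv_diff add_uminus_conv_diff intro!: negligible_translation)
  moreover have "(\<Union>p\<in>Z2 \<times> (UNIV :: 3 set). (+) (- fst p) ` S 0 (snd p)) = UNIV"
  proof (intro equalityI subsetI UNIV_I)
    fix v
    obtain z i where "z \<in> Z2" "v + z \<in> S 0 i" using cover by blast
    then show "v \<in> (\<Union>p\<in>Z2 \<times> (UNIV :: 3 set). (+) (- fst p) ` S 0 (snd p))"
      by (intro UN_I[of "(z, i)"] image_eqI[of _ _ "v + z"]) auto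
  qed
  ultimately show False by simp
qed

section \<open>Existence of codings and balance\<close>

definition follow where
  "follow \<omega> n = {y. \<forall>k<n. y + word_sum (err0 x) (stake k \<omega>) \<in> S 0 (\<omega> !! k)}"

lemma closed_follow: "closed (follow \<omega> n)"
proof -
  have "follow \<omega> n = (\<Inter>k\<in>{..<n}. {y. y + word_sum (err0 x) (stake k \<omega>) \<in> S 0 (\<omega> !! k)})"
    by (auto simp: follow_def)
  moreover have c: "closed {y. y + v \<in> S 0 j}" for v j
    using continuous_closed_vimage[OF closed_S[of 0 j], of "\<lambda>y. y + v"] by (simp add: vimage_def)
  have "closed (\<Inter>k\<in>{..<n}. {y. y + word_sum (err0 x) (stake k \<omega>) \<in> S 0 (\<omega> !! k)})"
    by (intro closed_INT ballI c)
  ultimately show ?thesis by simp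
qed

lemma occurrence_follow:
  assumes "limit_word (brun_Phi x) (p @- (stake n \<omega> @- \<rho>))"
  shows "word_sum (err0 x) p \<in> follow \<omega> n"
  unfolding follow_def
proof (intro CollectI allI impI)
  fix k assume k: "k < n"
  have "pre (brun_Phi x) (p @ stake k \<omega>) (\<omega> !! k)"
    using limit_word_pre[OF assms, of k] k by (simp add: take_stake min_def)
  then have "word_sum (err0 x) (p @ stake k \<omega>) \<in> pre_set 0 (\<omega> !! k)"
    unfolding pre_set_def err_0 by (intro image_eqI) auto
  then show "word_sum (err0 x) p + word_sum (err0 x) (stake k \<omega>) \<in> S 0 (\<omega> !! k)"
    using closure_subset by (auto simp: S_def)
qed

text \<open>The occurrence belongs to a small tile of a high level, all of whose points follow the block.\<close>

lemma not_negligible_follow: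
  assumes l: "limit_word (brun_Phi x) (p @- (stake n \<omega> @- \<rho>))" and e: "0 < e"
  shows "\<not> negligible (follow \<omega> n \<inter> ball (word_sum (err0 x) p) e)"
proof -
  let ?u = "p @ stake n \<omega>"
  \<comment> \<open>From this level on prefix and block together fit into the image of a single
    letter.\<close>
  obtain L where L: "\<And>j. length ?u < length (subst_upto (brun_Phi x) L [j])"
    using unbounded[of 0] unfolding unbounded_words_def by auto
  \<comment> \<open>By \<open>norm_lin_le\<close> the map \<open>lin\<close> stretches by at most
    four times \<open>max_err\<close>, so the image of the ball of radius \<open>gb\<close> becomes
    smaller than \<open>e\<close>.\<close>
  have "0 < e / (4 * (real gb + 1))" using e by simp
  from max_err_tendsto[OF this] obtain n0 where n0: "\<And>n. n0 \<le> n \<Longrightarrow> max_err x n < e / (4 * (real gb + 1))"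
    by (auto simp: eventually_sequentially)
  obtain m where m: "max L n0 \<le> m" "good m" using good_inf by blast
  let ?l = "m + rl"
  have "min_len x L \<le> min_len x ?l" using m by (intro min_len_mono) auto
  moreover have "int (length ?u) + 1 \<le> min_len x L" unfolding min_len_ge_iff len_def
    using L by (metis Suc_leI add.commute of_nat_Suc of_nat_mono)
  ultimately have len: "length ?u < length (subst_upto (brun_Phi x) ?l [j])" for j
    using min_len_le[of x ?l j] by (simp add: len_def)
  have "pre (brun_Phi x) ?u (shd \<rho>)"
  proof -
    have "p @- (stake n \<omega> @- \<rho>) = ?u @- (shd \<rho> ## stl \<rho>)" by simp
    then show ?thesis unfolding pre_def using l by metis
  qed
  then obtain q a r t where q: "subst_upto (brun_Phi x) ?l [a] = r @ shd \<rho> # t" "?u = subst_upto (brun_Phi x) ?l q @ r"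
    using pre_multi[OF nonerasing_brun, of x ?u "shd \<rho>" ?l] by blast
  have "q = []"
  proof (cases q)
    case (Cons b q')
    then show ?thesis using q(2) len[of b] subst_upto_Cons[of "brun_Phi x" ?l b q'] by (metis append.assoc length_append not_add_less1)
  qed simp
  then have W: "subst_upto (brun_Phi x) ?l [a] = ?u @ (shd \<rho> # t)" using q by simp
  have "pre_set ?l a \<subseteq> {v. v + word_sum (err0 x) p \<in> follow \<omega> n}"
  proof
    fix v assume "v \<in> pre_set ?l a"
    then obtain w \<omega>' where w: "limit_word (\<lambda>k. brun_Phi x (?l + k)) (w @- (a ## \<omega>'))" "v = word_sum (err x ?l) w"
      by (auto simp: pre_set_def pre_def)
    then have "limit_word (\<lambda>k. brun_Phi x (?l + k)) ((w @ [a]) @- \<omega>')" by simp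
    then obtain \<rho>' where "limit_word (brun_Phi x) (subst_upto (brun_Phi x) ?l (w @ [a]) @- \<rho>')"
      using limit_word_descend by blast
    then have "limit_word (brun_Phi x) ((subst_upto (brun_Phi x) ?l w @ p) @- (stake n \<omega> @- ((shd \<rho> # t) @- \<rho>')))"
      using W by simp
    from occurrence_follow[OF this] show "v \<in> {v. v + word_sum (err0 x) p \<in> follow \<omega> n}"
      by (simp add: w(2) word_sum_err)
  qed
  moreover have "closed {v. v + word_sum (err0 x) p \<in> follow \<omega> n}"
    using continuous_closed_vimage[OF closed_follow[of \<omega> n], of "\<lambda>v. v + word_sum (err0 x) p"] by (simp add: vimage_def)
  ultimately have 1: "S ?l a \<subseteq> {v. v + word_sum (err0 x) p \<in> follow \<omega> n}" unfolding S_def by (rule closure_minimal)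
  have 2: "norm v < e" if "v \<in> S ?l a" for v
  proof -
    obtain w where w: "v = lin x ?l w" "norm w \<le> real gb" using \<open>v \<in> S ?l a\<close> S_good[OF m(2), of a]
      unfolding subset_iff image_iff Bex_def mem_cball_0 by blast
    have "norm v \<le> 4 * max_err x ?l * norm w" unfolding w(1) by (rule norm_lin_le)
    also have "\<dots> \<le> 4 * max_err x ?l * (real gb + 1)" using w(2) max_err_nonneg[of x ?l] by (intro mult_left_mono) auto
    also have "\<dots> < e" using n0[of ?l] m(1) by (simp add: field_simps)
    finally show ?thesis .
  qed
  have "(+) (word_sum (err0 x) p) ` S ?l a \<subseteq> follow \<omega> n \<inter> ball (word_sum (err0 x) p) e"
  proof
    fix v' assume "v' \<in> (+) (word_sum (err0 x) p) ` S ?l a"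
    then obtain v where v: "v \<in> S ?l a" "v' = v + word_sum (err0 x) p" by (metis imageE add.commute)
    have "dist (word_sum (err0 x) p) v' = norm v" unfolding v(2) dist_norm
      using norm_minus_commute[of "word_sum (err0 x) p" "v + word_sum (err0 x) p"] by simp
    then show "v' \<in> follow \<omega> n \<inter> ball (word_sum (err0 x) p) e" using 1 2[OF v(1)] v by auto
  qed
  moreover have "\<not> negligible ((+) (word_sum (err0 x) p) ` S ?l a)"
    unfolding negligible_translation_eq by (rule not_negligible_S)
  ultimately show ?thesis using negligible_subset by blast
qed

lemma follow_induced:
  assumes "y \<in> follow \<omega> n" "\<And>k. k < n \<Longrightarrow> y + (word_sum (err0 x) (stake k \<omega>) + rotation x) \<notin> Np" "k < n"
  shows "(induced_translation Z2 (rotation x) R ^^ k) y = y + word_sum (err0 x) (stake k \<omega>)"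
  using assms(3)
proof (induction k)
  case (Suc k)
  have "stake (Suc k) \<omega> = stake k \<omega> @ [\<omega> !! k]" by (rule stake_Suc)
  moreover have "induced_translation Z2 (rotation x) R (y + word_sum (err0 x) (stake k \<omega>)) = y + word_sum (err0 x) (stake k \<omega>) + err0 x (\<omega> !! k)"
    by (rule induced_eq) (use assms(1) assms(2)[of k] Suc.prems in \<open>auto simp: follow_def add.assoc\<close>)
  ultimately show ?case using Suc by (simp add: add.assoc)
qed simp

text \<open>The closures of the positions where longer and longer initial blocks occur are nested,
  and compact for nonempty blocks. A common point follows the word, and the occurrences close to it
  supply the non-null sets.\<close>

lemma codes_exists:
  assumes "\<omega> \<in> sadic_shift (brun_Phi x)"
  shows "\<exists>y\<in>R. codes_point Z2 (rotation x) R (S 0) (err0 x) \<omega> y"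
proof -
  define K where "K n = closure {word_sum (err0 x) p | p. \<exists>\<rho>. limit_word (brun_Phi x) (p @- (stake n \<omega> @- \<rho>))}" for n
  have sub: "K n \<subseteq> follow \<omega> n" for n
    unfolding K_def using occurrence_follow by (intro closure_minimal closed_follow) blast
  have ne: "K n \<noteq> {}" for n
  proof -
    have "stake n (sdrop 0 \<omega>) \<in> sadic_language (brun_Phi x)" using assms unfolding sadic_shift_def by blast
    then have "stake n \<omega> \<in> sadic_language (brun_Phi x)" by simp
    from language_occurs[OF this] show ?thesis unfolding K_def closure_eq_empty by blast
  qed
  have dec: "K n \<subseteq> K m" if "m \<le> n" for m n
    unfolding K_def
  proof (intro closure_mono subsetI)
    fix v assume "v \<in> {word_sum (err0 x) p | p. \<exists>\<rho>. limit_word (brun_Phi x) (p @- (stake n \<omega> @- \<rho>))}"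
    then obtain p \<rho> where v: "v = word_sum (err0 x) p" and h: "limit_word (brun_Phi x) (p @- (stake n \<omega> @- \<rho>))" by blast
    have "stake n \<omega> = stake m \<omega> @ stake (n - m) (sdrop m \<omega>)" using that by (metis stake_add le_add_diff_inverse)
    then have "p @- (stake n \<omega> @- \<rho>) = p @- (stake m \<omega> @- (stake (n - m) (sdrop m \<omega>) @- \<rho>))"
      by (simp only: shift_append)
    then have "limit_word (brun_Phi x) (p @- (stake m \<omega> @- (stake (n - m) (sdrop m \<omega>) @- \<rho>)))" using h by simp
    then show "v \<in> {word_sum (err0 x) p | p. \<exists>\<rho>. limit_word (brun_Phi x) (p @- (stake m \<omega> @- \<rho>))}" using v by blast
  qed
  have "compact (K (Suc n))" for n
  proof -
    have "K (Suc n) \<subseteq> S 0 (\<omega> !! 0)"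
    proof
      fix v assume "v \<in> K (Suc n)"
      then have "v \<in> follow \<omega> (Suc n)" using sub by blast
      then have "v + word_sum (err0 x) (stake 0 \<omega>) \<in> S 0 (\<omega> !! 0)" unfolding follow_def by blast
      then show "v \<in> S 0 (\<omega> !! 0)" by simp
    qed
    then show ?thesis unfolding K_def using compact_S_0
      by (meson bounded_subset closed_closure compact_eq_bounded_closed)
  qed
  then have "(\<Inter>n. K (Suc n)) \<noteq> {}" using ne dec by (intro compact_nest) auto
  then obtain y where y: "\<And>n. y \<in> K (Suc n)" by blast
  have f: "y + word_sum (err0 x) (stake n \<omega>) \<in> S 0 (\<omega> !! n)" for n
    using y[of n] sub[of "Suc n"] by (auto simp: follow_def)
  have ws: "word_sum (err0 x) (stake n \<omega>) = (\<Sum>k<n. err0 x (\<omega> !! k))" for n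
    by (induction n) (simp_all add: stake_Suc del: stake.simps(2))
  have "\<not> negligible {y' \<in> ball y e. \<forall>k<n. (induced_translation Z2 (rotation x) R ^^ k) y' \<in> S 0 (\<omega> !! k)}" if "0 < e" for n e
  proof
    let ?A = "{y' \<in> ball y e. \<forall>k<n. (induced_translation Z2 (rotation x) R ^^ k) y' \<in> S 0 (\<omega> !! k)}"
    assume A: "negligible ?A"
    have "y \<in> K n" using y[of n] dec[of n "Suc n"] by auto
    then obtain p \<rho> where p: "limit_word (brun_Phi x) (p @- (stake n \<omega> @- \<rho>))" "dist (word_sum (err0 x) p) y < e / 2"
      unfolding K_def closure_approachable using half_gt_zero[OF \<open>0 < e\<close>] by blast
    let ?N = "\<Union>k<n. {y'. y' + (word_sum (err0 x) (stake k \<omega>) + rotation x) \<in> Np}"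
    have "negligible ?N" by (intro negligible_Union) (auto intro: negligible_Np_shift)
    with A have "negligible (?A \<union> ?N)" by (rule negligible_Un)
    moreover have "follow \<omega> n \<inter> ball (word_sum (err0 x) p) (e / 2) \<subseteq> ?A \<union> ?N"
    proof
      fix y' assume y': "y' \<in> follow \<omega> n \<inter> ball (word_sum (err0 x) p) (e / 2)"
      show "y' \<in> ?A \<union> ?N"
      proof (cases "y' \<in> ?N")
        case False
        have "dist y y' < e" using y' p(2) dist_triangle[of y y' "word_sum (err0 x) p"] by (simp add: dist_commute)
        moreover have "(induced_translation Z2 (rotation x) R ^^ k) y' \<in> S 0 (\<omega> !! k)" if "k < n" for k
          using follow_induced[of y' \<omega> n k] y' False that by (auto simp: follow_def)
        ultimately show ?thesis by auto
      qed simp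
    qed
    ultimately have "negligible (follow \<omega> n \<inter> ball (word_sum (err0 x) p) (e / 2))" by (rule negligible_subset)
    then show False using not_negligible_follow[OF p(1), of "e / 2"] that by simp
  qed
  then have "codes_point Z2 (rotation x) R (S 0) (err0 x) \<omega> y"
    unfolding codes_point_def using f by (simp add: ws[symmetric])
  moreover have "y \<in> R" using f[of 0] by (auto simp: R_def)
  ultimately show ?thesis by blast
qed

text \<open>A factor is a difference of two prefixes, so its sum is at most 2 bd. Comparing two
  factors gives 4 bd for the letters 1 and 2, hence 8 bd for the letter 3, whose count the others
  determine.\<close>

lemma balanced: "balanced_language (sadic_language (brun_Phi x))"
proof -
  have bnd: "norm (word_sum (err0 x) w) \<le> 2 * bd" if "w \<in> sadic_language (brun_Phi x)" for w
  proof -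
    obtain p \<rho> where l: "limit_word (brun_Phi x) (p @- (w @- \<rho>))"
      using language_occurs[OF \<open>w \<in> sadic_language (brun_Phi x)\<close>] by blast
    have "p @- (w @- \<rho>) = p @- (shd (w @- \<rho>) ## stl (w @- \<rho>))" "p @- (w @- \<rho>) = (p @ w) @- (shd \<rho> ## stl \<rho>)"
      by (simp_all only: stream.collapse shift_append)
    then have "pre (brun_Phi x) p (shd (w @- \<rho>))" "pre (brun_Phi x) (p @ w) (shd \<rho>)" unfolding pre_def using l by metis+
    then have "norm (word_sum (err0 x) p) \<le> bd" "norm (word_sum (err0 x) (p @ w)) \<le> bd"
      by (auto intro!: pre_set_0_bound simp: pre_set_def simp del: word_sum_simps)
    then show ?thesis using norm_triangle_ineq4[of "word_sum (err0 x) (p @ w)" "word_sum (err0 x) p"] by simp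
  qed
  have c: "\<bar>real (count_list u j) - real (count_list v j)\<bar> \<le> 8 * bd"
    if "u \<in> sadic_language (brun_Phi x)" "v \<in> sadic_language (brun_Phi x)" "length u = length v" for u v j
  proof -
    have n: "\<bar>fst (word_sum (err0 x) w)\<bar> \<le> 2 * bd" "\<bar>snd (word_sum (err0 x) w)\<bar> \<le> 2 * bd" if "w \<in> sadic_language (brun_Phi x)" for w
      using bnd[OF that] norm_fst_le[of "fst (word_sum (err0 x) w)" "snd (word_sum (err0 x) w)"]
        norm_snd_le[of "snd (word_sum (err0 x) w)" "fst (word_sum (err0 x) w)"] by simp_all
    have 12: "\<bar>real (count_list u 1) - real (count_list v 1)\<bar> \<le> 4 * bd" "\<bar>real (count_list u 2) - real (count_list v 2)\<bar> \<le> 4 * bd"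
      using n[OF that(1)] n[OF that(2)] unfolding fst_word_sum_err0 snd_word_sum_err0 that(3) by linarith+
    have "0 \<le> bd" using n(1)[OF that(1)] by linarith
    then show ?thesis using 12 exhaust_3[of j] count_list_3[of u] count_list_3[of v] that(3) by auto
  qed
  show ?thesis
    unfolding balanced_language_def
  proof (intro exI[of _ "\<lceil>8 * bd\<rceil>"] ballI impI allI)
    fix u v j assume h: "u \<in> sadic_language (brun_Phi x)" "v \<in> sadic_language (brun_Phi x)" "length u = length v"
    show "\<bar>int (count_list u j) - int (count_list v j)\<bar> \<le> \<lceil>8 * bd\<rceil>"
      using c[OF h, of j] by linarith
  qed
qed

end

section \<open>Translations of the torus\<close>

definition unit_square :: "(real \<times> real) set" where
  "unit_square = {0..<1} \<times> {0..<1}"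

definition frac2 :: "real \<times> real \<Rightarrow> real \<times> real" where
  "frac2 v = (frac (fst v), frac (snd v))"

lemma frac2_unit_square: "frac2 v \<in> unit_square"
  by (simp add: frac2_def unit_square_def frac_lt_1)

lemma frac2_eq: "v \<in> unit_square \<Longrightarrow> frac2 v = v"
  by (cases v) (auto simp: frac2_def unit_square_def frac_eq)

lemma frac2_diff: "frac2 v - v \<in> Z2"
  by (cases v) (simp add: frac2_def frac_def Z2_def mem_Times_iff)

lemma frac2_add_Z2: "z \<in> Z2 \<Longrightarrow> frac2 (v + z) = frac2 v"
  by (cases v) (auto simp: frac2_def Z2_def frac_def elim!: Ints_cases)

lemma frac2_eq_iff: "frac2 v = frac2 w \<longleftrightarrow> v - w \<in> Z2"
proof
  assume "frac2 v = frac2 w"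
  then have "v - w = (frac2 w - w) - (frac2 v - v)" by simp
  then show "v - w \<in> Z2" using frac2_diff Z2_diff by metis
next
  assume "v - w \<in> Z2"
  from frac2_add_Z2[OF this, of w] show "frac2 v = frac2 w" by simp
qed

lemma frac2_unique: "v \<in> unit_square \<Longrightarrow> v - w \<in> Z2 \<Longrightarrow> frac2 w = v"
  using frac2_eq_iff[of v w] frac2_eq by simp

lemma torus2_translation_eq: "torus2_translation t p = frac2 (p + t)"
  by (simp add: torus2_translation_def frac2_def)

lemma torus2_translation_pow:
  assumes "p \<in> unit_square"
  shows "(torus2_translation t ^^ k) p = frac2 (p + real k *\<^sub>R t)"
proof (induction k)
  case 0
  show ?case using assms by (simp add: frac2_eq)
next
  case (Suc k)
  have "(torus2_translation t ^^ Suc k) p = frac2 (frac2 (p + real k *\<^sub>R t) + t)"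
    using Suc by (simp add: torus2_translation_eq[of t "frac2 (p + real k *\<^sub>R t)"])
  also have "\<dots> = frac2 (p + real (Suc k) *\<^sub>R t)"
    unfolding frac2_eq_iff using frac2_diff[of "p + real k *\<^sub>R t"] by (simp add: algebra_simps)
  finally show ?case .
qed

lemma unit_square_borel [measurable]: "unit_square \<in> sets borel"
  unfolding unit_square_def by (intro borel_Times) auto

lemma frac2_measurable [measurable]: "frac2 \<in> borel \<rightarrow>\<^sub>M borel"
  unfolding frac2_def borel_prod[symmetric] frac_def by measurable

lemma torus2_eq: "torus2 = restrict_space lborel unit_square"
  by (simp add: torus2_def unit_square_def)

lemma space_torus2 [simp]: "space torus2 = unit_square"
  by (simp add: torus2_eq space_restrict_space)

lemma sets_torus2: "A \<in> sets torus2 \<longleftrightarrow> A \<in> sets borel \<and> A \<subseteq> unit_square"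
  by (auto simp: torus2_eq sets_restrict_space_iff)

lemma emeasure_torus2: "A \<subseteq> unit_square \<Longrightarrow> emeasure torus2 A = emeasure lborel A"
  by (simp add: torus2_eq emeasure_restrict_space)

lemma prob_space_torus2: "prob_space torus2"
proof
  have "emeasure lborel (unit_square) = 1"
    unfolding unit_square_def lborel_prod[symmetric] by (subst lborel.emeasure_pair_measure_Times) auto
  then show "emeasure torus2 (space torus2) = 1" by (simp add: emeasure_torus2)
qed

lemma torus2_translation_measurable [measurable]: "torus2_translation t \<in> torus2 \<rightarrow>\<^sub>M torus2"
proof -
  have "torus2_translation t \<in> borel \<rightarrow>\<^sub>M borel" unfolding torus2_translation_eq[abs_def] by measurable
  then show ?thesis unfolding torus2_eq
    by (intro measurable_restrict_space2 measurable_restrict_space1)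
      (auto simp: torus2_translation_eq frac2_unit_square)
qed

lemma nn_integral_lborel_shift:
  fixes f :: "'a::euclidean_space \<Rightarrow> ennreal"
  assumes "f \<in> borel_measurable borel"
  shows "(\<integral>\<^sup>+v. f (c + v) \<partial>lborel) = (\<integral>\<^sup>+v. f v \<partial>lborel)"
  by (subst lborel_distr_plus[of c, symmetric], subst nn_integral_distr) (use assms in auto)

definition corners :: "(real \<times> real) set" where "corners = {0, 1} \<times> {0, 1}"

lemma corners_Z2: "corners \<subseteq> Z2" and finite_corners [simp]: "finite corners"
  by (auto simp: corners_def Z2_def)

lemma corner_up:
  assumes "v \<in> unit_square" "t \<in> unit_square"
  shows "v + t - frac2 (v + t) \<in> corners"
proof -
  have f: "a - frac a \<in> {0, 1}" if "0 \<le> a" "a < 2" for a :: real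
  proof -
    have "\<lfloor>a\<rfloor> = 0 \<or> \<lfloor>a\<rfloor> = 1" using that by linarith
    then show ?thesis by (auto simp: frac_def)
  qed
  obtain a b c d where "v = (a, b)" "t = (c, d)" by (metis prod.exhaust)
  then show ?thesis using assms f[of "a + c"] f[of "b + d"] by (auto simp: frac2_def corners_def unit_square_def)
qed

lemma corner_down:
  assumes "v \<in> unit_square" "t \<in> unit_square"
  shows "frac2 (v - t) - (v - t) \<in> corners"
proof -
  have f: "frac a - a \<in> {0, 1}" if "-1 < a" "a < 1" for a :: real
  proof -
    have "\<lfloor>a\<rfloor> = 0 \<or> \<lfloor>a\<rfloor> = -1" using that by linarith
    then show ?thesis by (auto simp: frac_def)
  qed
  obtain a b c d where "v = (a, b)" "t = (c, d)" by (metis prod.exhaust)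
  then show ?thesis using assms f[of "a - c"] f[of "b - d"] by (auto simp: frac2_def corners_def unit_square_def)
qed

lemma sum_indicator_single:
  assumes "finite F" "w \<in> F" "\<And>z. z \<in> F \<Longrightarrow> g z \<in> A \<longleftrightarrow> z = w"
  shows "(\<Sum>z\<in>F. indicator A (g z)) = (1 :: ennreal)"
proof -
  have "(\<Sum>z\<in>F. indicator A (g z)) = (\<Sum>z\<in>F. if z = w then 1 else 0 :: ennreal)"
    using assms(3) by (intro sum.cong) (auto simp: indicator_def)
  then show ?thesis using assms(1,2) by simp
qed

text \<open>The unit square splits into four pieces, each of which the translation modulo \<open>\<int>\<^sup>2\<close>
  moves rigidly.\<close>

lemma emeasure_torus2_translation:
  assumes t: "t \<in> unit_square" and A: "A \<in> sets torus2"
  shows "emeasure torus2 {v \<in> unit_square. torus2_translation t v \<in> A} = emeasure torus2 A"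
proof -
  have A': "A \<in> sets borel" "A \<subseteq> unit_square" using A by (auto simp: sets_torus2)
  note [measurable] = A'(1)
  let ?Q = "unit_square"
  let ?B = "{v \<in> ?Q. torus2_translation t v \<in> A}"
  have up: "(\<Sum>z\<in>corners. indicator ?Q (v + t - z)) = (1 :: ennreal)" if "v \<in> ?Q" for v
  proof (rule sum_indicator_single[OF finite_corners, where w = "v + t - frac2 (v + t)"])
    show "v + t - frac2 (v + t) \<in> corners" using corner_up that t .
    show "v + t - z \<in> ?Q \<longleftrightarrow> z = v + t - frac2 (v + t)" if "z \<in> corners" for z
    proof
      assume "v + t - z \<in> ?Q"
      then have "frac2 (v + t) = v + t - z"
        using that corners_Z2 by (intro frac2_unique) (auto intro: Z2_minus)
      then show "z = v + t - frac2 (v + t)" by simp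
    qed (simp add: frac2_unit_square)
  qed
  have down: "(\<Sum>z\<in>corners. indicator ?Q (v - t + z)) = (1 :: ennreal)" if "v \<in> ?Q" for v
  proof (rule sum_indicator_single[OF finite_corners, where w = "frac2 (v - t) - (v - t)"])
    show "frac2 (v - t) - (v - t) \<in> corners" using corner_down that t .
    show "v - t + z \<in> ?Q \<longleftrightarrow> z = frac2 (v - t) - (v - t)" if "z \<in> corners" for z
    proof
      assume "v - t + z \<in> ?Q"
      then have "frac2 (v - t) = v - t + z"
        using that corners_Z2 by (intro frac2_unique) auto
      then show "z = frac2 (v - t) - (v - t)" by simp
    qed (simp add: frac2_unit_square)
  qed
  have "?B = ?Q \<inter> torus2_translation t -` A" by auto
  moreover have "torus2_translation t \<in> borel \<rightarrow>\<^sub>M borel" unfolding torus2_translation_eq[abs_def] by measurable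
  ultimately have B: "?B \<in> sets borel" using measurable_sets[of "torus2_translation t" borel borel A] A' by auto
  have "emeasure torus2 ?B = (\<integral>\<^sup>+v. indicator ?B v \<partial>lborel)"
    using B by (subst emeasure_torus2) auto
  also have "\<dots> = (\<integral>\<^sup>+v. (\<Sum>z\<in>corners. indicator ?Q v * indicator A (v + t - z)) \<partial>lborel)"
  proof (rule nn_integral_cong)
    fix v
    show "indicator ?B v = (\<Sum>z\<in>corners. indicator ?Q v * indicator A (v + t - z) :: ennreal)"
    proof (cases "v \<in> ?Q")
      case v: True
      have "indicator A (v + t - z) = indicator ?B v * (indicator ?Q (v + t - z) :: ennreal)" if "z \<in> corners" for z
      proof (cases "v + t - z \<in> ?Q")
        case True
        then have "frac2 (v + t) = v + t - z" using that corners_Z2 by (intro frac2_unique) (auto intro: Z2_minus)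
        then show ?thesis using v True by (simp add: indicator_def torus2_translation_eq)
      qed (use A'(2) in \<open>auto simp: indicator_def\<close>)
      then have "(\<Sum>z\<in>corners. indicator ?Q v * indicator A (v + t - z) :: ennreal) =
          indicator ?B v * (\<Sum>z\<in>corners. indicator ?Q (v + t - z))"
        using v unfolding sum_distrib_left by (intro sum.cong) auto
      then show ?thesis using up[OF v] by simp
    qed auto
  qed
  also have "\<dots> = (\<Sum>z\<in>corners. \<integral>\<^sup>+v. indicator ?Q v * indicator A (v + t - z) \<partial>lborel)"
    by (rule nn_integral_sum) measurable
  also have "\<dots> = (\<Sum>z\<in>corners. \<integral>\<^sup>+v. indicator ?Q (v - t + z) * indicator A v \<partial>lborel)"
  proof (rule sum.cong[OF refl])
    fix z :: "real \<times> real"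
    have "(\<integral>\<^sup>+v. indicator ?Q (v - t + z) * indicator A v \<partial>lborel) =
      (\<integral>\<^sup>+v. indicator ?Q ((t - z) + v - t + z) * indicator A ((t - z) + v) \<partial>lborel)"
      by (rule nn_integral_lborel_shift[symmetric, of "\<lambda>v. indicator ?Q (v - t + z) * indicator A v"]) measurable
    then show "(\<integral>\<^sup>+v. indicator ?Q v * indicator A (v + t - z) \<partial>lborel) =
      (\<integral>\<^sup>+v. indicator ?Q (v - t + z) * indicator A v \<partial>lborel)" by (simp add: algebra_simps)
  qed
  also have "\<dots> = (\<integral>\<^sup>+v. (\<Sum>z\<in>corners. indicator ?Q (v - t + z) * indicator A v) \<partial>lborel)"
    by (rule nn_integral_sum[symmetric]) measurable
  also have "\<dots> = (\<integral>\<^sup>+v. indicator A v \<partial>lborel)"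
  proof (rule nn_integral_cong)
    fix v
    show "(\<Sum>z\<in>corners. indicator ?Q (v - t + z) * indicator A v) = (indicator A v :: ennreal)"
      unfolding sum_distrib_right[symmetric] using down[of v] A'(2) by (cases "v \<in> A") auto
  qed
  also have "\<dots> = emeasure torus2 A" using A' by (simp add: emeasure_torus2)
  finally show ?thesis .
qed

lemma torus2_translation_frac2: "torus2_translation (frac2 t) = torus2_translation t"
  unfolding torus2_translation_eq[abs_def] frac2_eq_iff fun_eq_iff using frac2_diff[of t] by simp

lemma distr_torus2_translation: "distr torus2 torus2 (torus2_translation t) = torus2"
proof (rule measure_eqI)
  fix A assume "A \<in> sets (distr torus2 torus2 (torus2_translation t))"
  then have A: "A \<in> sets torus2" by simp
  have "emeasure (distr torus2 torus2 (torus2_translation t)) A = emeasure torus2 (torus2_translation t -` A \<inter> space torus2)"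
    using A by (intro emeasure_distr) auto
  also have "torus2_translation t -` A \<inter> space torus2 = {v \<in> unit_square. torus2_translation (frac2 t) v \<in> A}"
    by (auto simp: torus2_translation_frac2)
  also have "emeasure torus2 \<dots> = emeasure torus2 A"
    by (rule emeasure_torus2_translation[OF frac2_unit_square A])
  finally show "emeasure (distr torus2 torus2 (torus2_translation t)) A = emeasure torus2 A" .
qed simp

section \<open>Unique ergodicity of a translation with dense orbit\<close>

lemma closed_Z2: "closed Z2"
  unfolding Z2_def by (intro closed_Times closed_Ints)

lemma dist_shift: "dist (p + a + - z) (p + s) = norm (s - (a - z))" for p :: "'a::real_normed_vector"
  unfolding dist_norm by (subst norm_minus_commute) (simp add: algebra_simps)

text \<open>Since the translates by multiples of \<open>t\<close> are dense modulo \<open>\<int>\<^sup>2\<close>, a compact set can be moved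
  into any translate of its \<open>\<eta>\<close>-neighbourhood; averaging over all translates gives \<open>\<kappa> K \<le> \<lambda> K\<close>.\<close>

lemma invariant_measure_compact_le:
  assumes dense: "\<And>v e. 0 < e \<Longrightarrow> \<exists>k a b. norm (v - (real k *\<^sub>R t - (real_of_int a, real_of_int b))) < e"
    and \<kappa>: "prob_space \<kappa>" "sets \<kappa> = sets torus2" "distr \<kappa> \<kappa> (torus2_translation t) = \<kappa>"
    and K: "compact K" "K \<subseteq> unit_square"
  shows "emeasure \<kappa> K \<le> emeasure torus2 K"
proof -
  interpret \<kappa>: prob_space \<kappa> by fact
  interpret L: prob_space torus2 by (rule prob_space_torus2)
  have sp: "space \<kappa> = unit_square" using sets_eq_imp_space_eq[OF \<kappa>(2)] by simp
  have Tm: "torus2_translation t \<in> \<kappa> \<rightarrow>\<^sub>M \<kappa>"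
    using torus2_translation_measurable[of t] measurable_cong_sets[OF \<kappa>(2) \<kappa>(2)] by simp
  have Tk: "(torus2_translation t ^^ k) \<in> \<kappa> \<rightarrow>\<^sub>M \<kappa>" for k by (intro measurable_compose_n Tm)
  have dk: "distr \<kappa> \<kappa> (torus2_translation t ^^ k) = \<kappa>" for k
  proof (induction k)
    case 0
    then show ?case by (simp add: distr_id[unfolded id_def] id_def)
  next
    case (Suc k)
    have "distr \<kappa> \<kappa> (torus2_translation t ^^ Suc k) = distr (distr \<kappa> \<kappa> (torus2_translation t ^^ k)) \<kappa> (torus2_translation t)"
      by (subst distr_distr[OF Tm Tk]) simp
    then show ?case by (simp only: Suc \<kappa>(3))
  qed
  have shift: "emeasure \<kappa> {p \<in> unit_square. frac2 (p + real k *\<^sub>R t) \<in> A} = emeasure \<kappa> A" if "A \<in> sets \<kappa>" for A k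
  proof -
    have "emeasure \<kappa> A = emeasure (distr \<kappa> \<kappa> (torus2_translation t ^^ k)) A" by (simp add: dk)
    also have "\<dots> = emeasure \<kappa> ((torus2_translation t ^^ k) -` A \<inter> space \<kappa>)" by (rule emeasure_distr[OF Tk that])
    also have "(torus2_translation t ^^ k) -` A \<inter> space \<kappa> = {p \<in> unit_square. frac2 (p + real k *\<^sub>R t) \<in> A}"
      using torus2_translation_pow[where t = t and k = k] by (auto simp: sp)
    finally show ?thesis by simp
  qed
  \<comment> \<open>The lift of \<open>K\<close> to the plane. Neighbourhoods are taken there in
    order to respect the identification of opposite sides of the square.\<close>
  define C where "C = {v. frac2 v \<in> K}"
  have C_per: "v + z \<in> C \<longleftrightarrow> v \<in> C" if "z \<in> Z2" for v z using frac2_add_Z2[OF that, of v] by (simp add: C_def)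
  have C_eq: "C = (\<Union>k\<in>K. \<Union>z\<in>Z2. {k + z})"
  proof (intro equalityI subsetI)
    fix v assume "v \<in> C"
    then show "v \<in> (\<Union>k\<in>K. \<Union>z\<in>Z2. {k + z})"
      using Z2_minus[OF frac2_diff[of v]] by (intro UN_I[of "frac2 v"] UN_I[of "- (frac2 v - v)"]) (auto simp: C_def)
  next
    fix v assume "v \<in> (\<Union>k\<in>K. \<Union>z\<in>Z2. {k + z})"
    then obtain k z where "k \<in> K" "z \<in> Z2" "v = k + z" by blast
    moreover from this have "k \<in> unit_square" using K(2) by blast
    ultimately show "v \<in> C" by (simp add: C_def frac2_add_Z2 frac2_eq)
  qed
  have closedC: "closed C" unfolding C_eq by (rule compact_closed_sums[OF K(1) closed_Z2])
  have CK: "C \<inter> unit_square = K" using K(2) by (auto simp: C_def frac2_eq)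
  define U where "U n = (\<Union>c\<in>C. ball c (1 / Suc n))" for n
  have openU: "open (U n)" for n unfolding U_def by auto
  note [measurable] = borel_open[OF openU]
  have U_per: "frac2 v \<in> U n \<longleftrightarrow> v \<in> U n" for v n
  proof -
    have *: "v + z \<in> U n" if v: "v \<in> U n" and z: "z \<in> Z2" for v z
    proof -
      obtain c where c: "c \<in> C" "dist c v < 1 / Suc n" using v by (auto simp: U_def)
      then have "c + z \<in> C" "dist (c + z) (v + z) < 1 / Suc n" using C_per[OF z] by auto
      then show ?thesis unfolding U_def UN_iff mem_ball by (rule bexI[rotated])
    qed
    have "v - frac2 v \<in> Z2" using Z2_minus[OF frac2_diff[of v]] by simp
    then show ?thesis using *[of v "frac2 v - v"] *[of "frac2 v" "v - frac2 v"] frac2_diff[of v] by auto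
  qed
  have Um: "{p \<in> unit_square. p + s \<in> U n} \<in> sets \<kappa>" for s n
  proof -
    have "{p \<in> unit_square. p + s \<in> U n} = unit_square \<inter> (\<lambda>p. p + s) -` U n" by auto
    moreover have "(\<lambda>p. p + s) \<in> borel \<rightarrow>\<^sub>M borel" by measurable
    from measurable_sets[OF this borel_open[OF openU]] have "(\<lambda>p. p + s) -` U n \<in> sets borel" by simp
    ultimately show ?thesis unfolding \<kappa>(2) sets_torus2 by auto
  qed
  \<comment> \<open>The shift by \<open>s\<close> is approximated modulo Z^2 by a multiple of
    \<open>t\<close>, for which \<kappa> is invariant.\<close>
  have le: "emeasure \<kappa> K \<le> emeasure \<kappa> {p \<in> unit_square. p + s \<in> U n}" for s n
  proof -
    obtain k a b where k: "norm (s - (real k *\<^sub>R t - (real_of_int a, real_of_int b))) < 1 / Suc n"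
      using dense[of "1 / Suc n" s] by auto
    let ?z = "(real_of_int a, real_of_int b)"
    have "{p \<in> unit_square. frac2 (p + real k *\<^sub>R t) \<in> K} \<subseteq> {p \<in> unit_square. p + s \<in> U n}"
    proof clarify
      fix p1 p2 assume h: "frac2 ((p1, p2) + real k *\<^sub>R t) \<in> K"
      let ?p = "(p1, p2)"
      have c: "?p + real k *\<^sub>R t + - ?z \<in> C" using h C_per[of "- ?z" "?p + real k *\<^sub>R t"] Z2_minus[OF Z2_of_int] by (simp add: C_def)
      have "dist (?p + real k *\<^sub>R t + - ?z) (?p + s) = norm (s - (real k *\<^sub>R t - ?z))"
        by (rule dist_shift)
      then have "dist (?p + real k *\<^sub>R t + - ?z) (?p + s) < 1 / Suc n" using k by (simp only:)
      with c show "?p + s \<in> U n" unfolding U_def UN_iff mem_ball by (rule bexI[rotated])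
    qed
    moreover have "{p \<in> unit_square. p + s \<in> U n} \<in> sets \<kappa>" by (rule Um)
    moreover have "K \<in> sets \<kappa>" unfolding \<kappa>(2) sets_torus2 using K by (auto intro: borel_compact)
    ultimately show ?thesis by (subst shift[of K k, symmetric]) (simp, rule emeasure_mono)
  qed
  have pair: "(\<lambda>x. indicator (U n) (snd x + fst x) :: ennreal) \<in> borel_measurable (torus2 \<Otimes>\<^sub>M \<kappa>)" for n
  proof -
    have i: "(\<lambda>x. x) \<in> torus2 \<rightarrow>\<^sub>M borel" by (simp add: torus2_eq measurable_restrict_space1)
    then have j: "(\<lambda>x. x) \<in> \<kappa> \<rightarrow>\<^sub>M borel" unfolding measurable_cong_sets[OF \<kappa>(2) refl] .
    have "(\<lambda>x. snd x + fst x) \<in> torus2 \<Otimes>\<^sub>M \<kappa> \<rightarrow>\<^sub>M borel"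
      by (intro borel_measurable_add measurable_compose[OF measurable_snd j] measurable_compose[OF measurable_fst i])
    then show ?thesis by measurable
  qed
  have psf: "pair_sigma_finite torus2 \<kappa>"
    by (intro pair_sigma_finite.intro) unfold_locales
  have "emeasure \<kappa> K \<le> emeasure torus2 (U n \<inter> unit_square)" for n
  proof -
    have "emeasure \<kappa> K = (\<integral>\<^sup>+s. emeasure \<kappa> K \<partial>torus2)" using L.emeasure_space_1 by simp
    also have "\<dots> \<le> (\<integral>\<^sup>+s. (\<integral>\<^sup>+p. indicator (U n) (p + s) \<partial>\<kappa>) \<partial>torus2)"
    proof (rule nn_integral_mono)
      fix s
      have "{p \<in> unit_square. p + s \<in> U n} \<in> sets \<kappa>" by (rule Um)
      then have "emeasure \<kappa> {p \<in> unit_square. p + s \<in> U n} = (\<integral>\<^sup>+p. indicator {p \<in> unit_square. p + s \<in> U n} p \<partial>\<kappa>)"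
        by simp
      also have "\<dots> = (\<integral>\<^sup>+p. indicator (U n) (p + s) \<partial>\<kappa>)"
        by (intro nn_integral_cong) (auto simp: sp indicator_def)
      finally show "emeasure \<kappa> K \<le> (\<integral>\<^sup>+p. indicator (U n) (p + s) \<partial>\<kappa>)" using le[of s n] by simp
    qed
    \<comment> \<open>After the exchange of integrals the inner one is the Lebesgue measure of the
      neighbourhood, whatever \<open>p\<close> is.\<close>
    also have "\<dots> = (\<integral>\<^sup>+p. (\<integral>\<^sup>+s. indicator (U n) (p + s) \<partial>torus2) \<partial>\<kappa>)"
      using pair_sigma_finite.Fubini[OF psf pair[of n]] by simp
    also have "\<dots> = (\<integral>\<^sup>+p. emeasure torus2 (U n \<inter> unit_square) \<partial>\<kappa>)"
    proof (rule nn_integral_cong)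
      fix p assume "p \<in> space \<kappa>"
      have A: "U n \<inter> unit_square \<in> sets torus2" unfolding sets_torus2 by auto
      have "emeasure torus2 (U n \<inter> unit_square) = emeasure (distr torus2 torus2 (torus2_translation p)) (U n \<inter> unit_square)"
        by (simp add: distr_torus2_translation)
      also have "\<dots> = (\<integral>\<^sup>+s. indicator (U n \<inter> unit_square) (torus2_translation p s) \<partial>torus2)"
        using A by (subst nn_integral_distr[OF torus2_translation_measurable, symmetric]) auto
      also have "\<dots> = (\<integral>\<^sup>+s. indicator (U n) (p + s) \<partial>torus2)"
        by (intro nn_integral_cong) (simp add: indicator_def torus2_translation_eq frac2_unit_square U_per add.commute)
      finally show "(\<integral>\<^sup>+s. indicator (U n) (p + s) \<partial>torus2) = emeasure torus2 (U n \<inter> unit_square)" by simp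
    qed
    also have "\<dots> = emeasure torus2 (U n \<inter> unit_square)" by (simp add: \<kappa>.emeasure_space_1)
    finally show ?thesis .
  qed
  moreover have "(\<lambda>n. emeasure torus2 (U n \<inter> unit_square)) \<longlonglongrightarrow> emeasure torus2 (\<Inter>n. U n \<inter> unit_square)"
  proof (rule Lim_emeasure_decseq)
    show "range (\<lambda>n. U n \<inter> unit_square) \<subseteq> sets torus2" by (auto simp: sets_torus2)
    show "decseq (\<lambda>n. U n \<inter> unit_square)"
      unfolding decseq_Suc_iff U_def by (intro allI Int_mono UN_mono subset_ball order_refl) (auto simp: field_simps)
    show "emeasure torus2 (U n \<inter> unit_square) \<noteq> \<infinity>" for n by simp
  qed
  moreover have "(\<Inter>n. U n \<inter> unit_square) = K"
  proof -
    have "(\<Inter>n. U n) \<subseteq> closure C"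
    proof
      fix v assume v: "v \<in> (\<Inter>n. U n)"
      show "v \<in> closure C" unfolding closure_approachable
      proof (intro allI impI)
        fix e :: real assume "0 < e"
        then obtain n where n: "1 / Suc n < e" using nat_approx_posE by blast
        have "v \<in> U n" using v by blast
        then obtain c where "c \<in> C" "dist c v < 1 / Suc n" unfolding U_def UN_iff mem_ball by blast
        then show "\<exists>y\<in>C. dist y v < e" using n less_trans by blast
      qed
    qed
    moreover have "C \<subseteq> U n" for n unfolding U_def by force
    ultimately show ?thesis using CK closedC by (auto simp: closure_closed)
  qed
  ultimately show ?thesis by (intro LIMSEQ_le_const) auto
qed

text \<open>Inner regularity extends the inequality from compact to measurable sets. Applied to a
  set and to its complement, it is an equality because both measures are probabilities.\<close>

theorem torus2_uniquely_ergodic: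
  assumes dense: "\<And>v e. 0 < e \<Longrightarrow> \<exists>k a b. norm (v - (real k *\<^sub>R t - (real_of_int a, real_of_int b))) < e"
    and \<kappa>: "prob_space \<kappa>" "sets \<kappa> = sets torus2" "distr \<kappa> \<kappa> (torus2_translation t) = \<kappa>"
  shows "\<kappa> = torus2"
proof -
  interpret \<kappa>: prob_space \<kappa> by fact
  interpret L: prob_space torus2 by (rule prob_space_torus2)
  have sp: "space \<kappa> = unit_square" using sets_eq_imp_space_eq[OF \<kappa>(2)] by simp
  have le: "emeasure \<kappa> A \<le> emeasure torus2 A" if A: "A \<in> sets torus2" for A
  proof -
    let ?N = "distr \<kappa> borel (\<lambda>x. x)"
    have i: "(\<lambda>x. x) \<in> \<kappa> \<rightarrow>\<^sub>M borel"
      unfolding measurable_cong_sets[OF \<kappa>(2) refl] by (simp add: torus2_eq measurable_restrict_space1)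
    have N: "emeasure ?N B = emeasure \<kappa> (B \<inter> unit_square)" if "B \<in> sets borel" for B
      using emeasure_distr[OF i that] by (simp add: sp)
    have A': "A \<in> sets borel" "A \<subseteq> unit_square" using A by (auto simp: sets_torus2)
    have "emeasure ?N A = (SUP K \<in> {K. K \<subseteq> A \<and> compact K}. emeasure ?N K)"
    proof (rule inner_regular)
      show "emeasure ?N (space ?N) \<noteq> \<infinity>" using N[of UNIV] by (simp add: \<kappa>.emeasure_finite)
    qed (use A' in auto)
    also have "\<dots> \<le> emeasure torus2 A"
    proof (rule SUP_least)
      fix K assume "K \<in> {K. K \<subseteq> A \<and> compact K}"
      then have K: "K \<subseteq> A" "compact K" by auto
      then have "emeasure ?N K = emeasure \<kappa> K" using A'(2) N[of K] by (simp add: borel_compact Int_absorb2)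
      also have "\<dots> \<le> emeasure torus2 K" using invariant_measure_compact_le[OF dense \<kappa> K(2)] K A' by auto
      also have "\<dots> \<le> emeasure torus2 A" using K(1) A by (rule emeasure_mono)
      finally show "emeasure ?N K \<le> emeasure torus2 A" .
    qed
    finally show ?thesis using N[OF A'(1)] A'(2) by (simp add: Int_absorb2)
  qed
  show ?thesis
  proof (rule measure_eqI[OF \<kappa>(2)])
    fix A assume "A \<in> sets \<kappa>"
    then have A: "A \<in> sets \<kappa>" "A \<in> sets torus2" by (simp_all add: \<kappa>(2))
    have c: "unit_square - A \<in> sets torus2" using sets.compl_sets[OF A(2)] by simp
    have m: "measure \<kappa> B \<le> measure torus2 B" if "B \<in> sets torus2" for B
      using le[OF that] by (simp add: \<kappa>.emeasure_eq_measure L.emeasure_eq_measure)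
    have "measure \<kappa> (unit_square - A) = 1 - measure \<kappa> A" using \<kappa>.prob_compl[OF A(1)] by (simp add: sp)
    moreover have "measure torus2 (unit_square - A) = 1 - measure torus2 A" using L.prob_compl[OF A(2)] by simp
    ultimately have "measure \<kappa> A = measure torus2 A" using m[OF A(2)] m[OF c] by linarith
    then show "emeasure \<kappa> A = emeasure torus2 A" by (simp add: \<kappa>.emeasure_eq_measure L.emeasure_eq_measure)
  qed
qed

section \<open>Itineraries\<close>

lemma stream_eqI: "(\<And>n. s !! n = s' !! n) \<Longrightarrow> s = s'"
  by (metis stream_smap_nats ext)

context brun_point begin

definition follows where
  "follows \<omega> y \<longleftrightarrow> (\<forall>n. y + word_sum (err0 x) (stake n \<omega>) \<in> S 0 (\<omega> !! n))"

lemma word_sum_err0_Z2: "\<exists>z\<in>Z2. word_sum (err0 x) w = real (length w) *\<^sub>R rotation x + z"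
proof -
  obtain a b where "word_sum (err0 x) w = real (length w) *\<^sub>R rotation x - (real_of_int a, real_of_int b)"
    using word_sum_err0_mod by blast
  then show ?thesis using Z2_minus[OF Z2_of_int[of a b]] by (intro bexI[of _ "- (real_of_int a, real_of_int b)"]) auto
qed

lemma follows_R: "follows \<omega> y \<Longrightarrow> y + word_sum (err0 x) (stake n \<omega>) \<in> R"
  by (auto simp: follows_def R_def)

lemma follows_exists: "\<omega> \<in> sadic_shift (brun_Phi x) \<Longrightarrow> \<exists>y. follows \<omega> y"
proof -
  assume "\<omega> \<in> sadic_shift (brun_Phi x)"
  then obtain y where "codes_point Z2 (rotation x) R (S 0) (err0 x) \<omega> y" using codes_exists by blast
  then have "\<forall>n. y + (\<Sum>k<n. err0 x (\<omega> !! k)) \<in> S 0 (\<omega> !! n)" unfolding codes_point_def by blast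
  moreover have "word_sum (err0 x) (stake n \<omega>) = (\<Sum>k<n. err0 x (\<omega> !! k))" for n
    by (induction n) (simp_all add: stake_Suc del: stake.simps(2))
  ultimately show ?thesis unfolding follows_def by (intro exI[of _ y]) simp
qed

text \<open>Off the overlap set only one translate contains \<open>v\<close>, and by local
  finiteness no other one comes near it.\<close>

lemma isolated_tile:
  assumes "v \<notin> Np" "v \<in> S 0 i"
  shows "\<exists>e>0. \<forall>v' z j. dist v' v < e \<longrightarrow> z \<in> Z2 \<longrightarrow> v' + z \<in> S 0 j \<longrightarrow> z = 0 \<and> j = i"
proof -
  obtain e where e: "e > 0" "\<And>v' z j. dist v' v < e \<Longrightarrow> z \<in> Z2 \<Longrightarrow> v' + z \<in> S 0 j \<Longrightarrow> v + z \<in> S 0 j"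
    using locally_finite[of v] by metis
  show ?thesis
  proof (intro exI[of _ e] conjI allI impI)
    fix v' z j assume h: "dist v' v < e" "z \<in> Z2" "v' + z \<in> S 0 j"
    have "v + 0 \<in> S 0 i" using assms(2) by simp
    then show "z = 0" "j = i"
      using unique_tile[OF assms(1) h(2) Z2_0 e(2)[OF h]] by auto
  qed (rule e)
qed

lemma pre_set_near:
  assumes "v \<in> S 0 i" "0 < e"
  obtains p \<omega> where "limit_word (brun_Phi x) (p @- (i ## \<omega>))" "dist (word_sum (err0 x) p) v < e"
proof -
  obtain w where "w \<in> pre_set 0 i" "dist w v < e" using assms unfolding S_def closure_approachable by blast
  then show ?thesis using that by (auto simp: pre_set_def pre_def)
qed

text \<open>Non-null sets of points that follow one letter accumulate at each point of a piece,
  while the overlap set is null.\<close>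

lemma not_Np_near:
  assumes "v \<in> S 0 i" "0 < e"
  obtains v' where "v' \<in> S 0 i" "v' \<notin> Np" "dist v' v < e"
proof -
  have "0 < e / 2" using assms(2) by simp
  then obtain p \<omega> where p: "limit_word (brun_Phi x) (p @- (i ## \<omega>))" "dist (word_sum (err0 x) p) v < e / 2"
    using pre_set_near[OF assms(1)] by blast
  have "limit_word (brun_Phi x) (p @- (stake 1 (i ## \<omega>) @- \<omega>))" using p(1) by simp
  from not_negligible_follow[OF this \<open>0 < e / 2\<close>]
  have "\<not> follow (i ## \<omega>) 1 \<inter> ball (word_sum (err0 x) p) (e / 2) \<subseteq> Np"
    using negligible_subset[OF negligible_Np] by blast
  then obtain v' where "v' \<in> follow (i ## \<omega>) 1 \<inter> ball (word_sum (err0 x) p) (e / 2)" "v' \<notin> Np" by blast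
  then have v': "v' \<in> follow (i ## \<omega>) 1" "dist (word_sum (err0 x) p) v' < e / 2" "v' \<notin> Np" by simp_all
  have "v' + word_sum (err0 x) (stake 0 (i ## \<omega>)) \<in> S 0 ((i ## \<omega>) !! 0)"
    using v'(1) unfolding follow_def by blast
  then have "v' \<in> S 0 i" by simp
  moreover have "dist v' v < e" using v'(2) p(2) dist_triangle[of v' v "word_sum (err0 x) p"] by (simp add: dist_commute)
  ultimately show ?thesis using that v'(3) by blast
qed

text \<open>If two points had the same itinerary, the orbit of the first could be brought close to a point
  of \<open>R\<close> that is extreme in the direction of their difference; the second would then leave \<open>R\<close>.\<close>

lemma follows_unique:
  assumes "follows \<omega> y" "follows \<omega> y'"
  shows "y = y'"
proof (rule ccontr)
  assume "y \<noteq> y'"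
  define \<delta> where "\<delta> = y' - y"
  have d: "0 < norm \<delta>" using \<open>y \<noteq> y'\<close> by (simp add: \<delta>_def)
  have "y \<in> R" using follows_R[OF assms(1), of 0] by simp
  then have "R \<noteq> {}" by blast
  moreover have "continuous_on R (\<lambda>v. v \<bullet> \<delta>)" by (intro continuous_intros)
  ultimately obtain m where m: "m \<in> R" "\<And>v. v \<in> R \<Longrightarrow> v \<bullet> \<delta> \<le> m \<bullet> \<delta>"
    using continuous_attains_sup[OF compact_R] by metis
  obtain i where i: "m \<in> S 0 i" using m(1) by (auto simp: R_def)
  \<comment> \<open>Two errors of this size keep the orbit point within half the norm of \<delta>
    from the extreme point, so a further shift by \<delta> must pass it.\<close>
  have "0 < norm \<delta> / 4" using d by simp
  then obtain v where v: "v \<in> S 0 i" "v \<notin> Np" "dist v m < norm \<delta> / 4" using not_Np_near[OF i] by blast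
  obtain e where e: "e > 0" "\<And>v' z j. dist v' v < e \<Longrightarrow> z \<in> Z2 \<Longrightarrow> v' + z \<in> S 0 j \<Longrightarrow> z = 0 \<and> j = i"
    using isolated_tile[OF v(2,1)] by metis
  have "0 < min e (norm \<delta> / 4)" using e(1) d by simp
  then obtain k a b where k: "norm ((v - y) - (real k *\<^sub>R rotation x - (real_of_int a, real_of_int b))) < min e (norm \<delta> / 4)"
    using orbit_dense by blast
  obtain z where z: "z \<in> Z2" "word_sum (err0 x) (stake k \<omega>) = real k *\<^sub>R rotation x + z"
    using word_sum_err0_Z2[of "stake k \<omega>"] by auto
  let ?q = "y + (real k *\<^sub>R rotation x - (real_of_int a, real_of_int b))" and ?z = "z + (real_of_int a, real_of_int b)"
  have q: "dist ?q v < min e (norm \<delta> / 4)" using k unfolding dist_norm by (subst norm_minus_commute) (simp add: algebra_simps)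
  have eq: "y + word_sum (err0 x) (stake k \<omega>) = ?q + ?z" by (simp add: z(2))
  have "?q + ?z \<in> S 0 (\<omega> !! k)" using assms(1) unfolding follows_def eq[symmetric] by blast
  then have "?z = 0" using e(2)[of ?q ?z] q Z2_add[OF z(1) Z2_of_int] by auto
  then have p: "y + word_sum (err0 x) (stake k \<omega>) = ?q" using eq by simp
  have "?q + \<delta> \<in> R" using follows_R[OF assms(2), of k] unfolding p[symmetric] by (simp add: \<delta>_def add.commute)
  then have "(?q + \<delta>) \<bullet> \<delta> \<le> m \<bullet> \<delta>" by (rule m(2))
  then have "\<delta> \<bullet> \<delta> \<le> (m - ?q) \<bullet> \<delta>" unfolding inner_add_left inner_diff_left by linarith
  also have "\<dots> \<le> norm (m - ?q) * norm \<delta>" by (rule norm_cauchy_schwarz)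
  also have "\<dots> \<le> (norm \<delta> / 2) * norm \<delta>"
  proof (rule mult_right_mono)
    show "norm (m - ?q) \<le> norm \<delta> / 2"
      using q v(3) dist_triangle[of m ?q v] by (simp add: dist_norm[symmetric] dist_commute)
  qed simp
  finally have "norm \<delta> * norm \<delta> \<le> norm \<delta> / 2 * norm \<delta>" by (simp add: dot_square_norm power2_eq_square)
  then show False using mult_pos_pos[OF d d] by linarith
qed

definition psi where "psi \<omega> = (THE y. follows \<omega> y)"

lemma psi_eq: "follows \<omega> y \<Longrightarrow> psi \<omega> = y"
  unfolding psi_def using follows_unique by blast

lemma follows_psi: "\<omega> \<in> sadic_shift (brun_Phi x) \<Longrightarrow> follows \<omega> (psi \<omega>)"
  using follows_exists psi_eq by metis

lemma follows_stl: "follows \<omega> y \<Longrightarrow> follows (stl \<omega>) (y + err0 x (shd \<omega>))"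
  unfolding follows_def
proof
  fix n assume "\<forall>n. y + word_sum (err0 x) (stake n \<omega>) \<in> S 0 (\<omega> !! n)"
  then have "y + word_sum (err0 x) (stake (Suc n) \<omega>) \<in> S 0 (\<omega> !! Suc n)" by blast
  then show "y + err0 x (shd \<omega>) + word_sum (err0 x) (stake n (stl \<omega>)) \<in> S 0 (stl \<omega> !! n)"
    by (simp add: add.assoc)
qed

lemma stl_sadic_shift: "\<omega> \<in> sadic_shift \<sigma> \<Longrightarrow> stl \<omega> \<in> sadic_shift \<sigma>"
proof -
  assume "\<omega> \<in> sadic_shift \<sigma>"
  then have "stake n (sdrop (Suc m) \<omega>) \<in> sadic_language \<sigma>" for m n unfolding sadic_shift_def by blast
  then show ?thesis by (simp add: sadic_shift_def)
qed

lemma psi_stl: "\<omega> \<in> sadic_shift (brun_Phi x) \<Longrightarrow> psi (stl \<omega>) = psi \<omega> + err0 x (shd \<omega>)"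
  by (intro psi_eq follows_stl follows_psi)

section \<open>Regular points and their codes\<close>

definition regular where "regular = {y. \<forall>k. y + real k *\<^sub>R rotation x \<notin> Np}"

definition tile where "tile y = (THE i. \<exists>z\<in>Z2. y + z \<in> S 0 i)"

definition rep where "rep y = (THE v. v \<in> R \<and> v - y \<in> Z2)"

definition code where "code y = to_stream (\<lambda>k. tile (y + real k *\<^sub>R rotation x))"

lemma tile_eq:
  assumes "y \<notin> Np" "z \<in> Z2" "y + z \<in> S 0 i"
  shows "tile y = i"
  unfolding tile_def using assms unique_tile(2)[OF assms(1)] by (intro the_equality) blast+

lemma rep_eq:
  assumes "y \<notin> Np" "v \<in> R" "v - y \<in> Z2"
  shows "rep y = v"
  unfolding rep_def
proof (rule the_equality)
  fix u assume u: "u \<in> R \<and> u - y \<in> Z2"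
  have s: "y + (v - y) = v" "y + (u - y) = u" by simp_all
  obtain i j where "y + (v - y) \<in> S 0 i" "y + (u - y) \<in> S 0 j" using u assms(2) unfolding s R_def by blast
  then have "v - y = u - y" using u by (intro unique_tile(1)[OF assms(1,3)]) auto
  then show "u = v" by simp
qed (use assms in auto)

lemma rep: "y \<notin> Np \<Longrightarrow> rep y \<in> S 0 (tile y)" and rep_diff: "y \<notin> Np \<Longrightarrow> rep y - y \<in> Z2"
proof -
  assume y: "y \<notin> Np"
  obtain z i where z: "z \<in> Z2" "y + z \<in> S 0 i" using cover by blast
  have "rep y = y + z" using z by (intro rep_eq[OF y]) (auto simp: R_def)
  then show "rep y \<in> S 0 (tile y)" "rep y - y \<in> Z2" using tile_eq[OF y z] z by auto
qed

lemma tile_periodic: "z \<in> Z2 \<Longrightarrow> y \<notin> Np \<Longrightarrow> tile (y + z) = tile y"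
proof -
  assume h: "z \<in> Z2" "y \<notin> Np"
  show ?thesis
  proof (rule tile_eq[where z = "rep y - y - z"])
    show "y + z \<notin> Np" using Np_periodic[OF h(1)] h(2) by simp
    show "rep y - y - z \<in> Z2" using rep_diff[OF h(2)] h(1) by (rule Z2_diff)
    show "y + z + (rep y - y - z) \<in> S 0 (tile y)" using rep[OF h(2)] by simp
  qed
qed

lemma code_snth: "code y !! k = tile (y + real k *\<^sub>R rotation x)"
  by (simp add: code_def to_stream_def)

lemma sdrop_code: "sdrop m (code y) = code (y + real m *\<^sub>R rotation x)"
  by (rule stream_eqI) (simp add: code_snth sdrop_snth algebra_simps)

lemma stl_code: "stl (code y) = code (y + rotation x)"
  using sdrop_code[of 1 y] by simp

lemma regularD: "y \<in> regular \<Longrightarrow> y + real k *\<^sub>R rotation x \<notin> Np"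
  by (simp add: regular_def)

lemma regular_not_Np: "y \<in> regular \<Longrightarrow> y \<notin> Np"
  using regularD[of y 0] by simp

lemma regular_periodic: "z \<in> Z2 \<Longrightarrow> y + z \<in> regular \<longleftrightarrow> y \<in> regular"
proof -
  assume z: "z \<in> Z2"
  have eq: "y + z + real k *\<^sub>R rotation x = y + real k *\<^sub>R rotation x + z" for k by simp
  show ?thesis unfolding regular_def mem_Collect_eq by (simp only: eq Np_periodic[OF z])
qed

lemma code_periodic: "z \<in> Z2 \<Longrightarrow> y \<in> regular \<Longrightarrow> code (y + z) = code y"
proof (rule stream_eqI)
  fix k assume h: "z \<in> Z2" "y \<in> regular"
  have eq: "y + z + real k *\<^sub>R rotation x = y + real k *\<^sub>R rotation x + z" by simp
  show "code (y + z) !! k = code y !! k"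
    by (simp only: code_snth eq tile_periodic[OF h(1) regularD[OF h(2)]])
qed

lemma regular_step: "y \<in> regular \<Longrightarrow> y + rotation x \<in> regular"
proof -
  assume y: "y \<in> regular"
  have eq: "y + rotation x + real k *\<^sub>R rotation x = y + real (Suc k) *\<^sub>R rotation x" for k by (simp add: algebra_simps)
  show ?thesis unfolding regular_def mem_Collect_eq eq using regularD[OF y] by blast
qed

lemma regular_steps: "y \<in> regular \<Longrightarrow> y + real m *\<^sub>R rotation x \<in> regular"
proof (induction m)
  case (Suc m)
  then have "y + real m *\<^sub>R rotation x + rotation x \<in> regular" by (intro regular_step)
  then show ?case by (simp add: algebra_simps)
qed simp

text \<open>The exchange and the rotation differ by elements of Z^2, and regular points have unique
  representatives in \<open>R\<close>.\<close>

lemma rep_code: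
  assumes "y \<in> regular"
  shows "rep y + word_sum (err0 x) (stake k (code y)) = rep (y + real k *\<^sub>R rotation x)"
proof (induction k)
  case (Suc k)
  let ?y = "y + real k *\<^sub>R rotation x"
  have n: "?y \<notin> Np" "y + real (Suc k) *\<^sub>R rotation x \<notin> Np" by (rule regularD[OF assms])+
  have "rep (y + real (Suc k) *\<^sub>R rotation x) = rep ?y + err0 x (tile ?y)"
  proof (rule rep_eq[OF n(2)])
    show "rep ?y + err0 x (tile ?y) \<in> R" by (rule S_exchange[OF rep[OF n(1)]])
    have eq: "rep ?y + err0 x (tile ?y) - (y + real (Suc k) *\<^sub>R rotation x) = (rep ?y - ?y) + (err0 x (tile ?y) - rotation x)"
      by (simp add: algebra_simps)
    show "rep ?y + err0 x (tile ?y) - (y + real (Suc k) *\<^sub>R rotation x) \<in> Z2"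
      unfolding eq by (rule Z2_add[OF rep_diff[OF n(1)] err0_mod])
  qed
  then show ?case using Suc by (simp add: stake_Suc code_snth add.assoc del: stake.simps(2))
qed simp

lemma follows_code: "y \<in> regular \<Longrightarrow> follows (code y) (rep y)"
  unfolding follows_def rep_code code_snth by (intro allI rep regularD)

lemma psi_code: "y \<in> regular \<Longrightarrow> psi (code y) = rep y"
  by (intro psi_eq follows_code)

lemma code_follows:
  assumes "follows \<omega> y" "y \<in> regular"
  shows "code y = \<omega>"
proof (rule stream_eqI)
  fix k
  obtain z where z: "z \<in> Z2" "word_sum (err0 x) (stake k \<omega>) = real k *\<^sub>R rotation x + z"
    using word_sum_err0_Z2[of "stake k \<omega>"] by auto
  have "y + real k *\<^sub>R rotation x + z \<in> S 0 (\<omega> !! k)"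
    using assms(1) unfolding follows_def add.assoc z(2)[symmetric] by blast
  then show "code y !! k = \<omega> !! k"
    unfolding code_snth using z(1) regularD[OF assms(2)] by (intro tile_eq)
qed

text \<open>Each of the first orbit points has a neighbourhood that meets only its own tile. A
  prefix of a limit word whose sum is close enough to the start is therefore continued by the same
  letters.\<close>

lemma stake_code_language:
  assumes y: "y \<in> regular"
  shows "stake n (code y) \<in> sadic_language (brun_Phi x)"
proof -
  let ?v = "\<lambda>k. rep y + word_sum (err0 x) (stake k (code y))"
  have v: "?v k \<in> S 0 (code y !! k)" for k using follows_code[OF y] by (auto simp: follows_def)
  have vN: "?v k \<notin> Np" for k
  proof -
    have "?v k - (y + real k *\<^sub>R rotation x) \<in> Z2" unfolding rep_code[OF y] by (intro rep_diff regularD y)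
    from Np_periodic[OF this, of "y + real k *\<^sub>R rotation x"] show ?thesis using regularD[OF y, of k] by simp
  qed
  have "\<exists>e>0. \<forall>v' z j. dist v' (?v k) < e \<longrightarrow> z \<in> Z2 \<longrightarrow> v' + z \<in> S 0 j \<longrightarrow> z = 0 \<and> j = code y !! k" for k
    by (rule isolated_tile[OF vN v])
  then obtain e where e: "\<And>k. e k > 0"
    "\<And>k v' z j. dist v' (?v k) < e k \<Longrightarrow> z \<in> Z2 \<Longrightarrow> v' + z \<in> S 0 j \<Longrightarrow> z = 0 \<and> j = code y !! k"
    by metis
  define d where "d = Min (e ` {..n})"
  have d: "0 < d" "\<And>k. k \<le> n \<Longrightarrow> d \<le> e k" using e(1) by (auto simp: d_def)
  obtain p \<omega> where p: "limit_word (brun_Phi x) (p @- (code y !! 0 ## \<omega>))" "dist (word_sum (err0 x) p) (?v 0) < d"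
    using pre_set_near[OF v[of 0] d(1)] by blast
  let ?\<eta> = "code y !! 0 ## \<omega>"
  have "stake k ?\<eta> = stake k (code y)" if "k \<le> n" for k
    using that
  proof (induction k)
    case (Suc k)
    then have k: "k \<le> n" "stake k ?\<eta> = stake k (code y)" by auto
    have "p @- ?\<eta> = p @- (stake (Suc k) ?\<eta> @- sdrop (Suc k) ?\<eta>)" by (simp only: stake_sdrop)
    then have "limit_word (brun_Phi x) (p @- (stake (Suc k) ?\<eta> @- sdrop (Suc k) ?\<eta>))" using p(1) by simp
    from occurrence_follow[OF this]
    have "word_sum (err0 x) p + word_sum (err0 x) (stake k ?\<eta>) \<in> S 0 (?\<eta> !! k)" unfolding follow_def by blast
    moreover have "dist (word_sum (err0 x) p + word_sum (err0 x) (stake k ?\<eta>)) (?v k) < e k"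
      using p(2) d(2)[OF k(1)] unfolding k(2) by simp
    ultimately have "?\<eta> !! k = code y !! k"
      using e(2)[of "word_sum (err0 x) p + word_sum (err0 x) (stake k ?\<eta>)" k 0] Z2_0 by simp
    then show ?case using k(2) by (simp add: stake_Suc del: stake.simps(2))
  qed simp
  then have "stake n ?\<eta> = stake n (code y)" by simp
  moreover have "p @- ?\<eta> = p @- (stake n ?\<eta> @- sdrop n ?\<eta>)" by (simp only: stake_sdrop)
  ultimately show ?thesis using limit_word_factor[of p "stake n (code y)" "sdrop n ?\<eta>"] p(1) by simp
qed

lemma code_sadic_shift: "y \<in> regular \<Longrightarrow> code y \<in> sadic_shift (brun_Phi x)"
  unfolding sadic_shift_def mem_Collect_eq sdrop_code by (intro allI stake_code_language regular_steps)

lemma AE_regular: "AE y in lebesgue. y \<in> regular"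
  unfolding regular_def mem_Collect_eq by (subst AE_all_countable) (intro allI AE_not_Np)

lemma regular_borel [measurable]: "regular \<in> sets borel"
  unfolding regular_def by measurable

definition regular_square where "regular_square = regular \<inter> unit_square"

lemma regular_square_sets [measurable]: "regular_square \<in> sets torus2"
  unfolding regular_square_def sets_torus2 by auto

lemma AE_regular_square: "AE p in torus2. p \<in> regular_square"
proof -
  have "AE y in lborel. y \<in> regular" using AE_regular by (simp add: AE_completion_iff)
  then show ?thesis unfolding torus2_eq regular_square_def
    by (subst AE_restrict_space_iff) (auto simp: elim: eventually_mono)
qed

lemma frac2_regular: "frac2 v \<in> regular \<longleftrightarrow> v \<in> regular"
  using regular_periodic[OF frac2_diff[of v], of v] by simp

lemma code_frac2: "v \<in> regular \<Longrightarrow> code (frac2 v) = code v"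
  using code_periodic[OF frac2_diff[of v], of v] by simp

lemma frac2_rep: "p \<in> unit_square \<Longrightarrow> p \<notin> Np \<Longrightarrow> frac2 (rep p) = p"
  using rep_diff[of p] by (intro frac2_unique) (auto dest: Z2_minus)

end

section \<open>Bounded remainder sets and the generalized eigenvector\<close>

lemma count_freq_bound:
  assumes "generic x"
  shows "\<bar>real (count_list w i) - real (length w) * freq x i\<bar> \<le> 2 * norm (word_sum (err0 x) w)"
proof -
  let ?v = "word_sum (err0 x) w"
  have b: "\<bar>fst ?v\<bar> \<le> norm ?v" "\<bar>snd ?v\<bar> \<le> norm ?v"
    using norm_fst_le[of "fst ?v" "snd ?v"] norm_snd_le[of "snd ?v" "fst ?v"] by simp_all
  have f: "freq x 3 = 1 - freq x 1 - freq x 2" using freq_sum[OF assms] by simp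
  have 3: "real (count_list w 3) - real (length w) * freq x 3 = fst ?v + snd ?v"
    unfolding f count_list_3 fst_word_sum_err0 snd_word_sum_err0 by (simp add: algebra_simps)
  have 1: "real (count_list w 1) - real (length w) * freq x 1 = - fst ?v"
    "real (count_list w 2) - real (length w) * freq x 2 = - snd ?v"
    by (simp_all add: fst_word_sum_err0 snd_word_sum_err0)
  consider "i = 1" | "i = 2" | "i = 3" using exhaust_3[of i] by blast
  then show ?thesis
  proof cases
    case a: 1
    show ?thesis unfolding a 1 using b by linarith
  next
    case a: 2
    show ?thesis unfolding a 1 using b by linarith
  next
    case a: 3
    show ?thesis unfolding a 3 using b by linarith
  qed
qed

lemma count_list_stake: "count_list (stake N \<omega>) i = card {n. n < N \<and> \<omega> !! n = i}"
proof (induction N)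
  case (Suc N)
  have "{n. n < Suc N \<and> \<omega> !! n = i} = {n. n < N \<and> \<omega> !! n = i} \<union> (if \<omega> !! N = i then {N} else {})"
    by (auto simp: less_Suc_eq)
  then show ?case using Suc by (simp add: stake_Suc del: stake.simps(2))
qed simp

context brun_point begin

definition piece where "piece i = {p \<in> unit_square. \<exists>z\<in>Z2. p + z \<in> S 0 i}"

lemma piece_sets [measurable]: "piece i \<in> sets torus2"
proof -
  have "closed {p. p + z \<in> S 0 i}" for z
    using continuous_closed_vimage[OF closed_S[of 0 i], of "\<lambda>y. y + z"] by (simp add: vimage_def)
  then have "(\<Union>z\<in>Z2. {p. p + z \<in> S 0 i}) \<in> sets borel"
    by (intro sets.countable_UN'[OF countable_Z2]) (auto intro: borel_closed)
  moreover have "piece i = unit_square \<inter> (\<Union>z\<in>Z2. {p. p + z \<in> S 0 i})" by (auto simp: piece_def)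
  ultimately show ?thesis unfolding sets_torus2 by auto
qed

lemma frac2_piece:
  assumes "v \<notin> Np"
  shows "frac2 v \<in> piece i \<longleftrightarrow> tile v = i"
proof
  assume "frac2 v \<in> piece i"
  then obtain z where z: "z \<in> Z2" "frac2 v + z \<in> S 0 i" by (auto simp: piece_def)
  show "tile v = i"
  proof (rule tile_eq[OF assms, of "frac2 v - v + z"])
    show "frac2 v - v + z \<in> Z2" by (intro Z2_add frac2_diff z)
    have "v + (frac2 v - v + z) = frac2 v + z" by simp
    then show "v + (frac2 v - v + z) \<in> S 0 i" using z(2) by simp
  qed
next
  assume i: "tile v = i"
  have "(rep v - v) - (frac2 v - v) \<in> Z2" by (intro Z2_diff frac2_diff rep_diff assms)
  moreover have "frac2 v + ((rep v - v) - (frac2 v - v)) = rep v" by simp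
  ultimately show "frac2 v \<in> piece i"
    unfolding piece_def using rep[OF assms] i by (intro CollectI conjI frac2_unit_square bexI) auto
qed

lemma orbit_piece:
  assumes "p \<in> regular_square"
  shows "(torus2_translation (rotation x) ^^ k) p \<in> piece i \<longleftrightarrow> code p !! k = i"
proof -
  have p: "p \<in> unit_square" "p \<in> regular" using assms by (auto simp: regular_square_def)
  show ?thesis unfolding torus2_translation_pow[OF p(1)] code_snth by (rule frac2_piece[OF regularD[OF p(2)]])
qed

text \<open>Visits are letter counts of the code, and the discrepancy of the code telescopes to a
  difference of two points of \<open>R\<close>.\<close>

lemma visits_bound:
  assumes "p \<in> regular_square"
  shows "\<bar>real (card {n. n < N \<and> (torus2_translation (rotation x) ^^ n) p \<in> piece i}) - real N * freq x i\<bar> \<le> 4 * bd"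
proof -
  have p: "p \<in> regular" using assms by (auto simp: regular_square_def)
  let ?w = "stake N (code p)"
  have "card {n. n < N \<and> (torus2_translation (rotation x) ^^ n) p \<in> piece i} = count_list ?w i"
    by (simp add: orbit_piece[OF assms] count_list_stake)
  moreover have "norm (word_sum (err0 x) ?w) \<le> 2 * bd"
  proof -
    have r: "norm (rep (p + real k *\<^sub>R rotation x)) \<le> bd" for k
      using rep[OF regularD[OF p]] by (intro R_bound) (auto simp: R_def)
    have "word_sum (err0 x) ?w = rep (p + real N *\<^sub>R rotation x) - rep (p + real 0 *\<^sub>R rotation x)"
      using rep_code[OF p, of N] by (simp add: algebra_simps)
    then show ?thesis using r[of N] r[of 0] norm_triangle_ineq4 by (smt (verit, best))
  qed
  ultimately show ?thesis using count_freq_bound[OF gen, of ?w i] by simp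
qed

lemma torus2_translation_pow_measurable: "torus2_translation t ^^ n \<in> torus2 \<rightarrow>\<^sub>M torus2"
  by (intro measurable_compose_n torus2_translation_measurable)

lemma distr_torus2_translation_pow: "distr torus2 torus2 (torus2_translation t ^^ n) = torus2"
proof (induction n)
  case 0
  then show ?case by (simp add: distr_id[unfolded id_def] id_def)
next
  case (Suc n)
  have "distr torus2 torus2 (torus2_translation t ^^ Suc n) =
      distr (distr torus2 torus2 (torus2_translation t ^^ n)) torus2 (torus2_translation t)"
    by (subst distr_distr[OF torus2_translation_measurable torus2_translation_pow_measurable]) simp
  then show ?case by (simp only: Suc distr_torus2_translation)
qed

text \<open>Integrating the visit bound over the torus shows that N times the difference of measure
  and frequency stays bounded for all N.\<close>

lemma measure_piece: "measure torus2 (piece i) = freq x i"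
proof -
  interpret L: prob_space torus2 by (rule prob_space_torus2)
  let ?T = "torus2_translation (rotation x)" and ?m = "measure torus2 (piece i)"
  have pre: "measure torus2 ((?T ^^ n) -` piece i \<inter> unit_square) = ?m" for n
    using measure_distr[OF torus2_translation_pow_measurable[where t = "rotation x" and n = n] piece_sets[of i]]
    by (simp add: distr_torus2_translation_pow)
  have pres: "(?T ^^ n) -` piece i \<inter> unit_square \<in> sets torus2" for n
    using measurable_sets[OF torus2_translation_pow_measurable[where t = "rotation x" and n = n] piece_sets[of i]] by simp
  have bound: "\<bar>real N * ?m - real N * freq x i\<bar> \<le> 4 * bd" for N
  proof -
    let ?f = "\<lambda>p. \<Sum>n<N. indicator ((?T ^^ n) -` piece i \<inter> unit_square) p :: real"
    have f: "?f p = real (card {n. n < N \<and> (?T ^^ n) p \<in> piece i})" if "p \<in> unit_square" for p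
    proof -
      have "?f p = (\<Sum>n<N. if (?T ^^ n) p \<in> piece i then 1 else 0)"
        using that by (intro sum.cong) (auto simp: indicator_def)
      also have "\<dots> = real (card ({..<N} \<inter> {n. (?T ^^ n) p \<in> piece i}))"
        by (simp add: sum.If_cases)
      also have "{..<N} \<inter> {n. (?T ^^ n) p \<in> piece i} = {n. n < N \<and> (?T ^^ n) p \<in> piece i}" by auto
      finally show ?thesis .
    qed
    have int: "integrable torus2 (indicator ((?T ^^ n) -` piece i \<inter> unit_square) :: _ \<Rightarrow> real)" for n
      using pres[of n] by (intro integrable_real_indicator) (auto simp: L.emeasure_eq_measure)
    then have intf: "integrable torus2 ?f" by (intro Bochner_Integration.integrable_sum)
    have val: "integral\<^sup>L torus2 ?f = real N * ?m"
      using int pre by (subst Bochner_Integration.integral_sum) (simp_all add: Int_absorb2 Int_commute)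
    have ae: "AE p in torus2. real N * freq x i - 4 * bd \<le> ?f p \<and> ?f p \<le> real N * freq x i + 4 * bd"
      using AE_regular_square
    proof eventually_elim
      case (elim p)
      then have "p \<in> unit_square" by (simp add: regular_square_def)
      from f[OF this] show ?case using visits_bound[OF elim, of N i] by linarith
    qed
    have "(\<integral>p. real N * freq x i - 4 * bd \<partial>torus2) \<le> integral\<^sup>L torus2 ?f"
      using ae by (intro integral_mono_AE intf) (auto elim: eventually_mono)
    moreover have "integral\<^sup>L torus2 ?f \<le> (\<integral>p. real N * freq x i + 4 * bd \<partial>torus2)"
      using ae by (intro integral_mono_AE intf) (auto elim: eventually_mono)
    ultimately have "real N * freq x i - 4 * bd \<le> real N * ?m" "real N * ?m \<le> real N * freq x i + 4 * bd"
      using L.prob_space unfolding val by simp_all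
    then show ?thesis by linarith
  qed
  show ?thesis
  proof (rule ccontr)
    assume "?m \<noteq> freq x i"
    then have "0 < \<bar>?m - freq x i\<bar>" by simp
    then obtain N where N: "4 * bd < real N * \<bar>?m - freq x i\<bar>" using reals_Archimedean3 by blast
    have "real N * \<bar>?m - freq x i\<bar> = \<bar>real N * ?m - real N * freq x i\<bar>"
      by (simp add: right_diff_distrib[symmetric] abs_mult)
    then show False using bound[of N] N by linarith
  qed
qed

lemma bounded_remainder_piece: "bounded_remainder_set torus2 (torus2_translation (rotation x)) (piece i)"
  unfolding bounded_remainder_set_def
proof (intro conjI exI[of _ "4 * \<bar>bd\<bar> + 1"])
  interpret L: prob_space torus2 by (rule prob_space_torus2)
  show "AE p in torus2. \<forall>N. \<bar>real (card {n. n < N \<and> (torus2_translation (rotation x) ^^ n) p \<in> piece i}) -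
      real N * (measure torus2 (piece i) / measure torus2 (space torus2))\<bar> < 4 * \<bar>bd\<bar> + 1"
    using AE_regular_square
  proof eventually_elim
    case (elim p)
    have "measure torus2 (piece i) / measure torus2 (space torus2) = freq x i"
      using measure_piece[of i] L.prob_space by simp
    moreover have "\<bar>real (card {n. n < N \<and> (torus2_translation (rotation x) ^^ n) p \<in> piece i}) - real N * freq x i\<bar>
        < 4 * \<bar>bd\<bar> + 1" for N
      using visits_bound[OF elim, of N i] by linarith
    ultimately show ?case by simp
  qed
qed auto

section \<open>The Rauzy fractal in coordinates and the generalized eigenvector\<close>

definition u_vec :: "real^3" where "u_vec = (\<chi> j. freq x j)"

definition embed :: "real \<times> real \<Rightarrow> real^3" where
  "embed v = fst v *\<^sub>R (axis 3 1 - axis 1 1) + snd v *\<^sub>R (axis 3 1 - axis 2 1)"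

lemma embed_nth: "embed v $ 1 = - fst v" "embed v $ 2 = - snd v" "embed v $ 3 = fst v + snd v"
  by (simp_all add: embed_def axis_def)

lemma linear_embed: "linear embed"
  by (rule linearI) (simp_all add: embed_def algebra_simps)

lemma inj_embed: "inj embed"
proof (rule injI)
  fix v w assume "embed v = embed w"
  then have "embed v $ 1 = embed w $ 1" "embed v $ 2 = embed w $ 2" by simp_all
  then show "v = w" by (simp add: embed_nth prod_eq_iff)
qed

lemma proj_along_abelianization: "proj_along u_vec (abelianization p) = embed (word_sum (err0 x) p)"
proof -
  have u1: "u_vec \<bullet> 1 = 1" using freq_sum[OF gen] by (simp add: inner_vec_def sum_3 u_vec_def)
  have a1: "abelianization p \<bullet> 1 = real (length p)"
    using count_list_3[of p] by (simp add: inner_vec_def sum_3 abelianization_def)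
  have f: "freq x 3 = 1 - freq x 1 - freq x 2" using freq_sum[OF gen] by simp
  have "proj_along u_vec (abelianization p) = abelianization p - real (length p) *\<^sub>R u_vec"
    by (simp add: proj_along_def u1 a1)
  then show ?thesis unfolding vec_eq_iff forall_3 embed_nth fst_word_sum_err0 snd_word_sum_err0
    by (simp add: u_vec_def f abelianization_def count_list_3 algebra_simps)
qed

lemma rauzy_subpiece_eq: "rauzy_subpiece (brun_Phi x) u_vec i = embed ` S 0 i"
proof -
  have "{proj_along u_vec (abelianization p) | p. \<exists>\<omega>. limit_word (brun_Phi x) \<omega> \<and> stake (Suc (length p)) \<omega> = p @ [i]} = embed ` pre_set 0 i"
    unfolding stake_Suc_length_iff proj_along_abelianization pre_set_def pre_def err_0 add_0
    by (intro equalityI subsetI; blast)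
  then show ?thesis unfolding rauzy_subpiece_def S_def
    by (simp add: closure_injective_linear_image[OF linear_embed inj_embed])
qed

lemma torus2_image_rauzy: "torus2_image (rauzy_subpiece (brun_Phi x) u_vec i) = piece i"
proof -
  have e: "(a + real_of_int m) *\<^sub>R (axis 3 1 - axis 1 1) + (b + real_of_int n) *\<^sub>R (axis 3 1 - axis 2 1) \<in> embed ` S 0 i \<longleftrightarrow>
    (a, b) + (real_of_int m, real_of_int n) \<in> S 0 i" for a b m n
    using inj_image_mem_iff[OF inj_embed, of "(a + real_of_int m, b + real_of_int n)" "S 0 i"] by (simp add: embed_def)
  have z: "(\<exists>z\<in>Z2. P z) \<longleftrightarrow> (\<exists>m n. P (real_of_int m, real_of_int n))" for P by (auto simp: Z2_def Ints_def)
  show ?thesis unfolding torus2_image_def rauzy_subpiece_eq e piece_def z unit_square_def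
    by (auto; intro exI, assumption)
qed

end

lemma word_sum_count: "word_sum \<gamma> w = (\<Sum>i\<in>UNIV. real (count_list w i) *\<^sub>R \<gamma> i)" for \<gamma> :: "3 \<Rightarrow> 'a::real_vector"
proof (induction w)
  case (Cons a w)
  have "(\<Sum>i\<in>UNIV. real (count_list (a # w) i) *\<^sub>R \<gamma> i) = (\<Sum>i\<in>UNIV. real (count_list w i) *\<^sub>R \<gamma> i) + (\<Sum>i\<in>UNIV. if i = a then \<gamma> i else 0)"
    unfolding sum.distrib[symmetric] by (intro sum.cong) (auto simp: algebra_simps)
  then show ?case using Cons by simp
qed simp

text \<open>Incidence matrices and \<open>lift\<close> are adjoint to each other. With
  discrepancies, respectively the constant 1, as values this turns the intersection of cones into an
  estimate by \<open>max_err\<close>.\<close>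

lemma incidence_lift:
  fixes \<gamma> :: "3 \<Rightarrow> 'a::real_vector"
  shows "(\<Sum>i\<in>UNIV. (incidence_upto \<sigma> n *v w) $ i *\<^sub>R \<gamma> i) = (\<Sum>j\<in>UNIV. w $ j *\<^sub>R lift \<sigma> \<gamma> n j)"
proof (induction n arbitrary: w)
  case (Suc n)
  let ?A = "incidence_matrix (\<sigma> n)"
  have "(\<Sum>i\<in>UNIV. (incidence_upto \<sigma> (Suc n) *v w) $ i *\<^sub>R \<gamma> i) = (\<Sum>i\<in>UNIV. (?A *v w) $ i *\<^sub>R lift \<sigma> \<gamma> n i)"
    using Suc[of "?A *v w"] by (simp add: matrix_vector_mul_assoc)
  also have "\<dots> = (\<Sum>i\<in>UNIV. \<Sum>j\<in>UNIV. w $ j *\<^sub>R real (count_list (\<sigma> n j) i) *\<^sub>R lift \<sigma> \<gamma> n i)"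
    by (simp add: matrix_vector_mult_def incidence_matrix_def scaleR_sum_left mult.commute)
  also have "\<dots> = (\<Sum>j\<in>UNIV. \<Sum>i\<in>UNIV. w $ j *\<^sub>R real (count_list (\<sigma> n j) i) *\<^sub>R lift \<sigma> \<gamma> n i)"
    by (rule sum.swap)
  also have "\<dots> = (\<Sum>j\<in>UNIV. w $ j *\<^sub>R lift \<sigma> \<gamma> (Suc n) j)"
    unfolding lift_Suc word_sum_count[of "lift \<sigma> \<gamma> n"] by (simp add: scaleR_sum_right)
  finally show ?case .
qed simp

definition hom_vec :: "real \<times> real \<Rightarrow> real^3" where "hom_vec x = (\<chi> j. hom x j)"

lemma hom_vec_step:
  assumes "generic y"
  shows "\<exists>c>0. hom_vec y = incidence_matrix (brun_subst (brun_index y)) *v (c *\<^sub>R hom_vec (brun_map y))"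
  using assms
proof (cases rule: brun_map_cases)
  case 1
  then show ?thesis
    by (intro exI[of _ "1 - snd y"])
      (simp add: vec_eq_iff forall_3 matrix_vector_mult_def sum_3 incidence_matrix_def hom_vec_def hom_def)
next
  case 2
  then show ?thesis
    by (intro exI[of _ "snd y"])
      (simp add: vec_eq_iff forall_3 matrix_vector_mult_def sum_3 incidence_matrix_def hom_vec_def hom_def)
next
  case 3
  then show ?thesis
    by (intro exI[of _ "snd y"])
      (simp add: vec_eq_iff forall_3 matrix_vector_mult_def sum_3 incidence_matrix_def hom_vec_def hom_def)
qed

lemma hom_vec_upto:
  assumes "generic x"
  shows "\<exists>c>0. hom_vec x = incidence_upto (brun_Phi x) n *v (c *\<^sub>R hom_vec (brun_orbit x n))"
proof (induction n)
  case 0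
  show ?case by (intro exI[of _ 1]) simp
next
  case (Suc n)
  then obtain c where c: "c > 0" "hom_vec x = incidence_upto (brun_Phi x) n *v (c *\<^sub>R hom_vec (brun_orbit x n))" by blast
  obtain d where d: "d > 0" "hom_vec (brun_orbit x n) = incidence_matrix (brun_Phi x n) *v (d *\<^sub>R hom_vec (brun_orbit x (Suc n)))"
    using hom_vec_step[OF generic_brun_pow[OF assms, of n]] by (auto simp: brun_Phi_def)
  have "hom_vec x = incidence_upto (brun_Phi x) (Suc n) *v ((c * d) *\<^sub>R hom_vec (brun_orbit x (Suc n)))"
    unfolding c(2) d(2) by (simp add: matrix_vector_mul_assoc[symmetric] matrix_vector_mult_scaleR del: funpow.simps)
  then show ?case using c(1) d(1) by (intro exI[of _ "c * d"]) simp
qed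

context brun_point begin

lemma eigenvector: "generalized_right_eigenvector (brun_Phi x) u_vec"
  unfolding generalized_right_eigenvector_def
proof (intro conjI allI)
  show "0 < u_vec $ i" for i using freq_pos[OF gen] by (simp add: u_vec_def)
  show "u_vec $ 1 + u_vec $ 2 + u_vec $ 3 = 1" using freq_sum[OF gen] by (simp add: u_vec_def)
  let ?M = "incidence_upto (brun_Phi x)"
  show "(\<Inter>n. (\<lambda>v. ?M n *v v) ` nonneg_cone) = {c *\<^sub>R u_vec | c. 0 \<le> c}"
  proof (intro equalityI subsetI)
    fix v assume "v \<in> {c *\<^sub>R u_vec | c. 0 \<le> c}"
    then obtain c where c: "0 \<le> c" "v = c *\<^sub>R u_vec" by blast
    let ?N = "1 + fst x + snd x"
    have N: "0 < ?N" using generic_bounds[OF gen] by simp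
    have u: "u_vec = (1 / ?N) *\<^sub>R hom_vec x" by (simp add: vec_eq_iff u_vec_def hom_vec_def freq_def)
    show "v \<in> (\<Inter>n. (\<lambda>v. ?M n *v v) ` nonneg_cone)"
    proof (rule INT_I)
      fix n
      obtain d where d: "d > 0" "hom_vec x = ?M n *v (d *\<^sub>R hom_vec (brun_orbit x n))"
        using hom_vec_upto[OF gen] by blast
      have "v = ?M n *v ((c / ?N * d) *\<^sub>R hom_vec (brun_orbit x n))"
        unfolding c(2) u d(2) by (simp add: matrix_vector_mult_scaleR)
      moreover have "0 \<le> hom (brun_orbit x n) i" for i
        using hom_pos[OF gen'[of n], of i] by simp
      then have "(c / ?N * d) *\<^sub>R hom_vec (brun_orbit x n) \<in> nonneg_cone"
        unfolding nonneg_cone_def using c(1) d(1) N by (auto simp: hom_vec_def)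
      ultimately show "v \<in> (\<lambda>v. ?M n *v v) ` nonneg_cone" by blast
    qed
  next
    fix v assume v: "v \<in> (\<Inter>n. (\<lambda>v. ?M n *v v) ` nonneg_cone)"
    then have "v \<in> (\<lambda>v. ?M 0 *v v) ` nonneg_cone" by blast
    then have v0: "0 \<le> v $ i" for i by (auto simp: nonneg_cone_def)
    define s where "s = v $ 1 + v $ 2 + v $ 3"
    have s0: "0 \<le> s" using v0 by (simp add: s_def)
    let ?e = "\<Sum>i\<in>UNIV. v $ i *\<^sub>R err0 x i"
    \<comment> \<open>Pulled back to level n, v has the discrepancy of w, and the coordinate sum of
      w is at most that of v because images of letters are nonempty.\<close>
    have le: "norm ?e \<le> max_err x n * s" for n
    proof -
      obtain w where w: "v = ?M n *v w" "\<And>i. 0 \<le> w $ i" using v by (auto simp: nonneg_cone_def)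
      have "?e = (\<Sum>j\<in>UNIV. w $ j *\<^sub>R err x n j)" unfolding w(1) incidence_lift err_def ..
      also have "norm \<dots> \<le> (\<Sum>j\<in>UNIV. w $ j * max_err x n)"
        by (rule sum_norm_le) (simp add: w(2) mult_left_mono max_err_ge)
      also have "\<dots> = max_err x n * (\<Sum>j\<in>UNIV. w $ j)" by (simp add: sum_distrib_left mult.commute)
      also have "\<dots> \<le> max_err x n * s"
      proof (rule mult_left_mono[OF _ max_err_nonneg])
        have l1: "1 \<le> lift (brun_Phi x) (\<lambda>_. 1 :: real) n j" for j
        proof -
          have "word_sum (\<lambda>_. 1 :: real) u = real (length u)" for u by (induction u) auto
          then show ?thesis using len_pos[of x n j] by (simp add: lift_def len_def Suc_le_eq)
        qed
        have "(\<Sum>j\<in>UNIV. w $ j) \<le> (\<Sum>j\<in>UNIV. w $ j *\<^sub>R lift (brun_Phi x) (\<lambda>_. 1 :: real) n j)"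
          using mult_left_mono[OF l1 w(2)] by (intro sum_mono) simp
        also have "\<dots> = (\<Sum>i\<in>UNIV. v $ i *\<^sub>R 1)" unfolding w(1) incidence_lift ..
        also have "\<dots> = s" by (simp add: s_def sum_3)
        finally show "(\<Sum>j\<in>UNIV. w $ j) \<le> s" .
      qed
      finally show ?thesis .
    qed
    have "norm ?e \<le> 0"
    proof (rule ccontr)
      assume "\<not> norm ?e \<le> 0"
      then have "0 < norm ?e / (s + 1)" using s0 by simp
      from max_err_tendsto[OF this] obtain n where "max_err x n < norm ?e / (s + 1)"
        by (auto simp: eventually_sequentially)
      then have "max_err x n * (s + 1) < norm ?e" using s0 by (simp add: pos_less_divide_eq)
      then show False using le[of n] max_err_nonneg[of x n] by (simp add: distrib_left)
    qed
    then have "?e = 0" by simp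
    then have e: "v $ 1 = s * freq x 1" "v $ 2 = s * freq x 2"
      by (simp_all add: sum_3 err0_def rotation_freq prod_eq_iff s_def algebra_simps)
    have "v $ 3 = s * freq x 3"
    proof -
      have f: "freq x 3 = 1 - freq x 1 - freq x 2" using freq_sum[OF gen] by simp
      have "v $ 3 = s - v $ 1 - v $ 2" by (simp add: s_def)
      then show ?thesis unfolding f e by (simp add: algebra_simps)
    qed
    then have "v = s *\<^sub>R u_vec" using e by (simp add: vec_eq_iff forall_3 u_vec_def)
    then show "v \<in> {c *\<^sub>R u_vec | c. 0 \<le> c}" using s0 by blast
  qed
qed

end

section \<open>The conjugacy\<close>

abbreviation (input) words :: "3 stream measure" where
  "words \<equiv> stream_space (count_space UNIV)"

lemma space_words: "space words = UNIV"
  by (simp add: space_stream_space)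

lemma stake_pred_sets: "{\<omega>. P (stake n (sdrop m \<omega>))} \<in> sets words"
proof -
  have "(\<lambda>\<omega>. stake n (sdrop m \<omega>)) \<in> words \<rightarrow>\<^sub>M count_space UNIV" by measurable
  from measurable_sets[OF this, of "{w. P w}"] show ?thesis by (simp add: space_words vimage_def)
qed

lemma sadic_shift_sets: "sadic_shift \<sigma> \<in> sets words"
proof -
  have "sadic_shift \<sigma> = (\<Inter>m. \<Inter>n. {\<omega>. stake n (sdrop m \<omega>) \<in> sadic_language \<sigma>})"
    by (auto simp: sadic_shift_def)
  also have "\<dots> \<in> sets words"
    using sets.top[of words] stake_pred_sets[of "\<lambda>w. w \<in> sadic_language \<sigma>"]
    by (intro sets.countable_INT'') (simp_all add: space_words)
  finally show ?thesis .
qed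

context brun_point begin

definition X where "X = sadic_shift (brun_Phi x)"

definition shift_space where "shift_space = restrict_space words X"

lemma X_sets: "X \<in> sets words" unfolding X_def by (rule sadic_shift_sets)

lemma space_shift_space [simp]: "space shift_space = X"
  by (simp add: shift_space_def space_restrict_space space_words)

lemma sets_shift_space: "A \<in> sets shift_space \<longleftrightarrow> A \<subseteq> X \<and> A \<in> sets words"
  unfolding shift_space_def using X_sets by (intro sets_restrict_space_iff) (simp add: space_words)

lemma stl_shift_space: "stl \<in> shift_space \<rightarrow>\<^sub>M shift_space"
  unfolding shift_space_def X_def
  by (intro measurable_restrict_space3) (auto intro: stl_sadic_shift measurable_stl)

definition follow_word where
  "follow_word w = {y. \<forall>k<length w. y + word_sum (err0 x) (take k w) \<in> S 0 (w ! k)}"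

lemma follow_stake: "follow \<omega> n = follow_word (stake n \<omega>)"
  by (auto simp: follow_def follow_word_def take_stake min_def)

text \<open>By compactness, a closed set contains \<open>psi\<close> of a word as soon as every
  initial block can be followed from some point of it. This condition depends on finite prefixes
  only, which makes \<open>psi\<close> measurable.\<close>

lemma psi_in_closed:
  assumes "closed C" "\<omega> \<in> X"
  shows "psi \<omega> \<in> C \<longleftrightarrow> (\<forall>n. C \<inter> follow_word (stake (Suc n) \<omega>) \<noteq> {})"
proof
  have f: "follows \<omega> (psi \<omega>)" using assms(2) follows_psi by (simp add: X_def)
  assume "psi \<omega> \<in> C"
  moreover have "psi \<omega> \<in> follow \<omega> (Suc n)" for n using f by (simp add: follows_def follow_def)
  ultimately show "\<forall>n. C \<inter> follow_word (stake (Suc n) \<omega>) \<noteq> {}" unfolding follow_stake by blast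
next
  assume h: "\<forall>n. C \<inter> follow_word (stake (Suc n) \<omega>) \<noteq> {}"
  have "\<Inter> (range (\<lambda>n. C \<inter> follow \<omega> (Suc n))) \<noteq> {}"
  proof (rule compact_nest)
    fix n
    have "C \<inter> follow \<omega> (Suc n) \<subseteq> S 0 (\<omega> !! 0)"
    proof
      fix v assume "v \<in> C \<inter> follow \<omega> (Suc n)"
      then have "v + word_sum (err0 x) (stake 0 \<omega>) \<in> S 0 (\<omega> !! 0)" unfolding follow_def by blast
      then show "v \<in> S 0 (\<omega> !! 0)" by simp
    qed
    moreover have "closed (C \<inter> follow \<omega> (Suc n))" by (intro closed_Int assms(1) closed_follow)
    ultimately show "compact (C \<inter> follow \<omega> (Suc n))"
      using compact_S_0 by (meson bounded_subset compact_eq_bounded_closed)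
    show "C \<inter> follow \<omega> (Suc n) \<noteq> {}" unfolding follow_stake using h by blast
  next
    fix m n :: nat assume "m \<le> n"
    then show "C \<inter> follow \<omega> (Suc n) \<subseteq> C \<inter> follow \<omega> (Suc m)" by (auto simp: follow_def)
  qed
  then obtain y where y: "\<And>n. y \<in> C" "\<And>n. y \<in> follow \<omega> (Suc n)" by blast
  have "follows \<omega> y" unfolding follows_def
  proof
    fix n
    show "y + word_sum (err0 x) (stake n \<omega>) \<in> S 0 (\<omega> !! n)" using y(2)[of n] unfolding follow_def by blast
  qed
  then show "psi \<omega> \<in> C" using psi_eq y(1) by simp
qed

lemma psi_measurable: "psi \<in> shift_space \<rightarrow>\<^sub>M borel"
proof (rule borel_measurableI)
  fix U :: "(real \<times> real) set" assume "open U"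
  then have c: "closed (- U)" by (simp add: closed_Compl)
  have "psi -` U \<inter> space shift_space = X - (\<Inter>n. {\<omega>. - U \<inter> follow_word (stake (Suc n) (sdrop 0 \<omega>)) \<noteq> {}})"
  proof (rule set_eqI)
    fix \<omega>
    show "\<omega> \<in> psi -` U \<inter> space shift_space \<longleftrightarrow>
        \<omega> \<in> X - (\<Inter>n. {\<omega>. - U \<inter> follow_word (stake (Suc n) (sdrop 0 \<omega>)) \<noteq> {}})"
      using psi_in_closed[OF c, of \<omega>]
      unfolding space_shift_space Int_iff Diff_iff INT_iff mem_Collect_eq vimage_eq Compl_iff sdrop.simps(1) by blast
  qed
  moreover have "(\<Inter>n. {\<omega>. - U \<inter> follow_word (stake (Suc n) (sdrop 0 \<omega>)) \<noteq> {}}) \<in> sets words"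
    using sets.top[of words] stake_pred_sets[of "\<lambda>w. - U \<inter> follow_word w \<noteq> {}" _ 0]
    by (intro sets.countable_INT'') (simp_all only: space_words countableI_type)
  ultimately show "psi -` U \<inter> space shift_space \<in> sets shift_space"
    unfolding sets_shift_space using X_sets by auto
qed

definition phi where "phi \<omega> = frac2 (psi \<omega>)"

lemma phi_measurable: "phi \<in> shift_space \<rightarrow>\<^sub>M torus2"
proof -
  have "(\<lambda>\<omega>. frac2 (psi \<omega>)) \<in> shift_space \<rightarrow>\<^sub>M borel"
    by (rule measurable_compose[OF psi_measurable frac2_measurable])
  then show ?thesis unfolding torus2_eq phi_def[abs_def]
    by (intro measurable_restrict_space2) (auto simp: frac2_unit_square)
qed

lemma phi_stl:
  assumes "\<omega> \<in> X"
  shows "phi (stl \<omega>) = torus2_translation (rotation x) (phi \<omega>)"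
proof -
  have p: "psi (stl \<omega>) = psi \<omega> + err0 x (shd \<omega>)" using assms by (simp add: psi_stl X_def)
  have "psi \<omega> + err0 x (shd \<omega>) - (frac2 (psi \<omega>) + rotation x) = (err0 x (shd \<omega>) - rotation x) - (frac2 (psi \<omega>) - psi \<omega>)"
    by simp
  also have "\<dots> \<in> Z2" by (intro Z2_diff err0_mod frac2_diff)
  finally show ?thesis unfolding phi_def torus2_translation_eq frac2_eq_iff p .
qed

definition regular_words where "regular_words = {\<omega> \<in> X. phi \<omega> \<in> regular_square}"

lemma regular_words_sets: "regular_words \<in> sets shift_space"
proof -
  have "regular_words = phi -` regular_square \<inter> space shift_space" by (auto simp: regular_words_def)
  then show ?thesis using measurable_sets[OF phi_measurable regular_square_sets] by simp
qed

lemma regular_squareD: "p \<in> regular_square \<Longrightarrow> p \<in> regular" "p \<in> regular_square \<Longrightarrow> p \<in> unit_square"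
  by (simp_all add: regular_square_def)

lemma phi_code: "p \<in> regular_square \<Longrightarrow> phi (code p) = p"
  unfolding phi_def by (simp add: psi_code regular_squareD frac2_rep regular_not_Np)

lemma code_phi: "\<omega> \<in> regular_words \<Longrightarrow> code (phi \<omega>) = \<omega>"
proof -
  assume w: "\<omega> \<in> regular_words"
  then have "phi \<omega> \<in> regular" "\<omega> \<in> X" by (auto simp: regular_words_def regular_square_def)
  then have r: "psi \<omega> \<in> regular" by (simp add: phi_def frac2_regular)
  then have "code (phi \<omega>) = code (psi \<omega>)" by (simp add: phi_def code_frac2)
  also have "\<dots> = \<omega>" using follows_psi \<open>\<omega> \<in> X\<close> r by (intro code_follows) (simp_all add: X_def)
  finally show ?thesis .
qed

lemma code_X: "p \<in> regular_square \<Longrightarrow> code p \<in> X"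
  unfolding X_def by (intro code_sadic_shift regular_squareD)

lemma code_regular_words: "p \<in> regular_square \<Longrightarrow> code p \<in> regular_words"
  by (simp add: regular_words_def code_X phi_code)

definition regular_torus where "regular_torus = restrict_space torus2 regular_square"

lemma space_regular_torus [simp]: "space regular_torus = regular_square"
  by (auto simp: regular_torus_def space_restrict_space regular_square_def)

lemma sets_regular_torus: "A \<in> sets regular_torus \<longleftrightarrow> A \<subseteq> regular_square \<and> A \<in> sets torus2"
  unfolding regular_torus_def using regular_square_sets sets.sets_into_space[OF regular_square_sets]
  by (intro sets_restrict_space_iff) (simp add: Int_absorb2)

lemma emeasure_regular_torus: "A \<subseteq> regular_square \<Longrightarrow> emeasure regular_torus A = emeasure torus2 A"
  unfolding regular_torus_def using regular_square_sets sets.sets_into_space[OF regular_square_sets]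
  by (intro emeasure_restrict_space) (simp_all add: Int_absorb2)

lemma emeasure_regular_square: "emeasure torus2 regular_square = 1"
  by (intro prob_space.emeasure_eq_1_AE[OF prob_space_torus2] regular_square_sets AE_regular_square)

lemma prob_space_regular_torus: "prob_space regular_torus"
  unfolding regular_torus_def
  by (rule prob_space_restrict_space[OF regular_square_sets emeasure_regular_square])

lemma code_measurable: "code \<in> regular_torus \<rightarrow>\<^sub>M shift_space"
  unfolding shift_space_def
proof (rule measurable_restrict_space2)
  show "code \<in> space regular_torus \<rightarrow> X" using code_X by auto
  show "code \<in> regular_torus \<rightarrow>\<^sub>M words"
  proof (rule measurable_stream_space2)
    fix n
    have "(\<lambda>p. code p !! n) -` {i} \<inter> space regular_torus \<in> sets regular_torus" for i
    proof -
      have "(\<lambda>p. code p !! n) -` {i} \<inter> space regular_torus =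
          ((torus2_translation (rotation x) ^^ n) -` piece i \<inter> space torus2) \<inter> regular_square"
      proof (rule set_eqI)
        fix p
        show "p \<in> (\<lambda>p. code p !! n) -` {i} \<inter> space regular_torus \<longleftrightarrow>
            p \<in> ((torus2_translation (rotation x) ^^ n) -` piece i \<inter> space torus2) \<inter> regular_square"
          by (cases "p \<in> regular_square") (simp_all add: orbit_piece regular_squareD)
      qed
      also have "\<dots> \<in> sets torus2"
        by (intro sets.Int measurable_sets[OF torus2_translation_pow_measurable piece_sets] regular_square_sets)
      finally show ?thesis unfolding sets_regular_torus by auto
    qed
    then show "(\<lambda>p. code p !! n) \<in> regular_torus \<rightarrow>\<^sub>M count_space UNIV"
      by (subst measurable_count_space_eq2) auto
  qed
qed

lemma code_vimage_sets: "A \<in> sets shift_space \<Longrightarrow> {p \<in> regular_square. code p \<in> A} \<in> sets torus2"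
proof -
  assume "A \<in> sets shift_space"
  from measurable_sets[OF code_measurable this] have "code -` A \<inter> regular_square \<in> sets torus2"
    by (simp add: sets_regular_torus)
  moreover have "code -` A \<inter> regular_square = {p \<in> regular_square. code p \<in> A}" by auto
  ultimately show ?thesis by simp
qed

text \<open>Lebesgue measure carried over by \<open>code\<close>; since \<open>phi\<close> inverts
  \<open>code\<close> on regular points, the conjugacy preserves measure by construction.\<close>

definition mu where "mu = distr regular_torus shift_space code"

lemma sets_mu [simp]: "sets mu = sets shift_space" and space_mu [simp]: "space mu = X"
  by (simp_all add: mu_def)

lemma emeasure_mu:
  assumes "A \<in> sets shift_space"
  shows "emeasure mu A = emeasure torus2 {p \<in> regular_square. code p \<in> A}"
proof -
  have "code -` A \<inter> space regular_torus = {p \<in> regular_square. code p \<in> A}" by auto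
  then show ?thesis unfolding mu_def emeasure_distr[OF code_measurable assms] by (simp add: emeasure_regular_torus)
qed

lemma prob_space_mu: "prob_space mu"
  unfolding mu_def by (intro prob_space.prob_space_distr prob_space_regular_torus code_measurable)

lemma translation_regular_square: "p \<in> regular_square \<Longrightarrow> torus2_translation (rotation x) p \<in> regular_square"
  unfolding regular_square_def torus2_translation_eq
  using regular_step frac2_regular by (auto intro: frac2_unit_square)

lemma code_translation: "p \<in> regular_square \<Longrightarrow> code (torus2_translation (rotation x) p) = stl (code p)"
  unfolding torus2_translation_eq stl_code by (intro code_frac2 regular_step regular_squareD)

lemma invariant_mu: "distr mu mu stl = mu"
proof (rule measure_eqI)
  have m: "stl \<in> mu \<rightarrow>\<^sub>M mu" using stl_shift_space by (simp cong: measurable_cong_sets)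
  fix A assume "A \<in> sets (distr mu mu stl)"
  then have A: "A \<in> sets shift_space" by simp
  let ?B = "{p \<in> regular_square. code p \<in> A}"
  let ?T = "torus2_translation (rotation x)"
  have s: "stl -` A \<inter> X \<in> sets shift_space" using measurable_sets[OF stl_shift_space A] by simp
  have "emeasure (distr mu mu stl) A = emeasure mu (stl -` A \<inter> X)"
    using A by (subst emeasure_distr[OF m]) simp_all
  also have "\<dots> = emeasure torus2 {p \<in> regular_square. code p \<in> stl -` A \<inter> X}" by (rule emeasure_mu[OF s])
  also have "\<dots> = emeasure torus2 (?T -` ?B \<inter> space torus2)"
  proof (rule emeasure_eq_AE)
    show "AE p in torus2. p \<in> {p \<in> regular_square. code p \<in> stl -` A \<inter> X} \<longleftrightarrow> p \<in> ?T -` ?B \<inter> space torus2"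
      using AE_regular_square
    proof eventually_elim
      case (elim p)
      then show ?case
        using translation_regular_square[OF elim] code_translation[OF elim] code_X[OF elim] regular_squareD(2)[OF elim] by simp
    qed
    show "{p \<in> regular_square. code p \<in> stl -` A \<inter> X} \<in> sets torus2" by (rule code_vimage_sets[OF s])
    show "?T -` ?B \<inter> space torus2 \<in> sets torus2"
      by (rule measurable_sets[OF torus2_translation_measurable code_vimage_sets[OF A]])
  qed
  also have "\<dots> = emeasure (distr torus2 torus2 ?T) ?B"
    by (rule emeasure_distr[OF torus2_translation_measurable code_vimage_sets[OF A], symmetric])
  also have "\<dots> = emeasure mu A" by (simp add: distr_torus2_translation emeasure_mu[OF A])
  finally show "emeasure (distr mu mu stl) A = emeasure mu A" .
qed simp

lemma shift_invariant_mu: "shift_invariant_prob X mu"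
  unfolding shift_invariant_prob_def
  using stl_shift_space prob_space_mu invariant_mu
  by (simp add: shift_space_def[symmetric] cong: measurable_cong_sets)

text \<open>The image of an invariant measure under \<open>phi\<close> is invariant under the
  translation, hence Lebesgue. So almost every word has a regular image, from which
  \<open>code\<close> recovers the word.\<close>

lemma shift_invariant_unique:
  assumes "shift_invariant_prob X \<nu>"
  shows "\<nu> = mu"
proof -
  have n: "sets \<nu> = sets shift_space" "prob_space \<nu>" "stl \<in> \<nu> \<rightarrow>\<^sub>M \<nu>" "distr \<nu> \<nu> stl = \<nu>"
    using assms by (simp_all add: shift_invariant_prob_def shift_space_def)
  interpret N: prob_space \<nu> by (rule n(2))
  have sp: "space \<nu> = X" using sets_eq_imp_space_eq[OF n(1)] by simp
  have ph: "phi \<in> \<nu> \<rightarrow>\<^sub>M torus2" unfolding measurable_cong_sets[OF n(1) refl] by (rule phi_measurable)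
  let ?T = "torus2_translation (rotation x)"
  define \<kappa> where "\<kappa> = distr \<nu> torus2 phi"
  have "distr \<kappa> \<kappa> ?T = distr \<kappa> torus2 ?T" by (intro distr_cong) (simp_all add: \<kappa>_def)
  also have "\<dots> = distr \<nu> torus2 (?T \<circ> phi)" unfolding \<kappa>_def by (rule distr_distr[OF torus2_translation_measurable ph])
  also have "\<dots> = distr \<nu> torus2 (phi \<circ> stl)"
    by (intro distr_cong refl) (simp add: sp phi_stl)
  also have "\<dots> = distr (distr \<nu> \<nu> stl) torus2 phi" by (rule distr_distr[OF ph n(3), symmetric])
  also have "\<dots> = \<kappa>" by (simp add: n(4) \<kappa>_def)
  finally have "\<kappa> = torus2"
    by (intro torus2_uniquely_ergodic[OF orbit_dense]) (simp_all add: \<kappa>_def N.prob_space_distr[OF ph])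
  then have d: "distr \<nu> torus2 phi = torus2" by (simp add: \<kappa>_def)
  have ae: "AE \<omega> in \<nu>. phi \<omega> \<in> regular_square"
    by (rule AE_distrD[OF ph]) (simp only: d AE_regular_square)
  show ?thesis
  proof (rule measure_eqI)
    fix A assume "A \<in> sets \<nu>"
    then have A: "A \<in> sets \<nu>" "A \<in> sets shift_space" by (simp_all add: n(1))
    let ?B = "{p \<in> regular_square. code p \<in> A}"
    have "emeasure \<nu> A = emeasure \<nu> (phi -` ?B \<inter> space \<nu>)"
    proof (rule emeasure_eq_AE[OF _ A(1)])
      show "AE \<omega> in \<nu>. \<omega> \<in> A \<longleftrightarrow> \<omega> \<in> phi -` ?B \<inter> space \<nu>"
        using ae AE_space
      proof eventually_elim
        case (elim \<omega>)
        then have "\<omega> \<in> regular_words" by (simp add: regular_words_def sp)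
        from code_phi[OF this] elim show ?case by simp
      qed
      show "phi -` ?B \<inter> space \<nu> \<in> sets \<nu>" by (rule measurable_sets[OF ph code_vimage_sets[OF A(2)]])
    qed
    also have "\<dots> = emeasure (distr \<nu> torus2 phi) ?B"
      by (rule emeasure_distr[OF ph code_vimage_sets[OF A(2)], symmetric])
    also have "\<dots> = emeasure mu A" by (simp add: d emeasure_mu[OF A(2)])
    finally show "emeasure \<nu> A = emeasure mu A" .
  qed (simp add: n(1))
qed

text \<open>\<open>phi\<close> and \<open>code\<close> are inverse bijections between
  \<open>regular_words\<close> and \<open>regular_square\<close>, which have full measure and are
  mapped into themselves by the dynamics.\<close>

lemma conjugate_mu: "measurably_conjugate mu stl torus2 (torus2_translation (rotation x))"
proof -
  have X0: "regular_words \<in> sets mu" by (simp add: regular_words_sets)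
  have sp: "space (restrict_space mu regular_words) = regular_words"
    using sets.sets_into_space[OF X0] by (auto simp: space_restrict_space)
  have sets0: "A \<in> sets (restrict_space mu regular_words) \<longleftrightarrow> A \<subseteq> regular_words \<and> A \<in> sets shift_space" for A
    using X0 sets.sets_into_space[OF X0] sets_restrict_space_iff[of regular_words mu A] by (simp add: Int_absorb2)
  have bij: "bij_betw phi regular_words regular_square"
  proof (rule bij_betw_byWitness[where f' = code])
    show "\<forall>\<omega>\<in>regular_words. code (phi \<omega>) = \<omega>" by (simp add: code_phi)
    show "\<forall>p\<in>regular_square. phi (code p) = p" by (simp add: phi_code)
    show "phi ` regular_words \<subseteq> regular_square" by (auto simp: regular_words_def)
    show "code ` regular_square \<subseteq> regular_words" using code_regular_words by blast
  qed
  have inv: "the_inv_into regular_words phi p = code p" if "p \<in> regular_square" for p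
    using bij that by (intro the_inv_into_f_eq) (auto simp: bij_betw_def phi_code code_regular_words)
  have phi_m: "phi \<in> restrict_space mu regular_words \<rightarrow>\<^sub>M restrict_space torus2 regular_square"
  proof (rule measurable_restrict_space3)
    show "phi \<in> mu \<rightarrow>\<^sub>M torus2" using phi_measurable by (simp cong: measurable_cong_sets)
    show "phi \<in> regular_words \<rightarrow> regular_square" by (auto simp: regular_words_def)
  qed
  have code_m: "code \<in> regular_torus \<rightarrow>\<^sub>M restrict_space mu regular_words"
  proof (rule measurable_restrict_space2)
    show "code \<in> space regular_torus \<rightarrow> regular_words" using code_regular_words by simp
    show "code \<in> regular_torus \<rightarrow>\<^sub>M mu" using code_measurable by (simp cong: measurable_cong_sets)
  qed
  have inv_m: "the_inv_into regular_words phi \<in> restrict_space torus2 regular_square \<rightarrow>\<^sub>M restrict_space mu regular_words"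
    using code_m unfolding regular_torus_def[symmetric] by (subst measurable_cong[where g = code]) (simp_all add: inv)
  have distr: "distr (restrict_space mu regular_words) (restrict_space torus2 regular_square) phi = restrict_space torus2 regular_square"
    (is "distr ?M _ phi = _")
    unfolding regular_torus_def[symmetric]
  proof (rule measure_eqI)
    fix A assume "A \<in> sets (distr ?M regular_torus phi)"
    then have A: "A \<in> sets regular_torus" by simp
    have A': "A \<subseteq> regular_square" using A by (simp add: sets_regular_torus)
    have m: "phi \<in> ?M \<rightarrow>\<^sub>M regular_torus" using phi_m by (simp add: regular_torus_def)
    have B: "phi -` A \<inter> regular_words \<in> sets shift_space"
      using measurable_sets[OF m A] by (simp only: sp sets0)
    have "emeasure (distr ?M regular_torus phi) A = emeasure ?M (phi -` A \<inter> regular_words)"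
      by (subst emeasure_distr[OF m A]) (simp only: sp)
    also have "\<dots> = emeasure mu (phi -` A \<inter> regular_words)"
      using X0 sets.sets_into_space[OF X0] by (intro emeasure_restrict_space) (auto simp: Int_absorb2)
    also have "\<dots> = emeasure torus2 {p \<in> regular_square. code p \<in> phi -` A \<inter> regular_words}" by (rule emeasure_mu[OF B])
    also have "{p \<in> regular_square. code p \<in> phi -` A \<inter> regular_words} = A"
      using A' phi_code code_regular_words by auto
    also have "emeasure torus2 A = emeasure regular_torus A" using A' by (simp add: emeasure_regular_torus)
    finally show "emeasure (distr ?M regular_torus phi) A = emeasure regular_torus A" .
  qed simp
  have ae: "AE \<omega> in mu. \<omega> \<in> regular_words"
    unfolding mu_def
  proof (subst AE_distr_iff[OF code_measurable])
    show "{\<omega> \<in> space shift_space. \<omega> \<in> regular_words} \<in> sets shift_space"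
      using regular_words_sets sets.sets_into_space[OF X0] by (simp add: Collect_conj_eq Int_absorb1)
    show "AE p in regular_torus. code p \<in> regular_words"
      by (rule AE_I2) (simp add: code_regular_words)
  qed
  have stl_inv: "stl ` regular_words \<subseteq> regular_words"
  proof clarify
    fix \<omega> assume "\<omega> \<in> regular_words"
    then have w: "\<omega> \<in> X" "phi \<omega> \<in> regular_square" by (simp_all add: regular_words_def)
    then have "stl \<omega> \<in> X" by (simp add: X_def stl_sadic_shift)
    moreover have "phi (stl \<omega>) \<in> regular_square"
      unfolding phi_stl[OF w(1)] by (rule translation_regular_square[OF w(2)])
    ultimately show "stl \<omega> \<in> regular_words" by (simp add: regular_words_def)
  qed
  show ?thesis
    unfolding measurably_conjugate_def
    by (intro bexI[OF _ X0] bexI[OF _ regular_square_sets] exI[of _ phi] conjI ae AE_regular_square stl_inv bij phi_m inv_m distr ballI phi_stl)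
      (auto simp: translation_regular_square regular_words_def)
qed

end

theorem theorem3p11:
  shows "AE x in lebesgue_on Delta2.
    (let \<sigma> = brun_Phi x;
         t = (fst x / (1 + fst x + snd x), snd x / (1 + fst x + snd x))
     in (\<exists>\<mu>. shift_invariant_prob (sadic_shift \<sigma>) \<mu> \<and>
             (\<forall>\<nu>. shift_invariant_prob (sadic_shift \<sigma>) \<nu> \<longrightarrow> \<nu> = \<mu>) \<and>
             measurably_conjugate \<mu> stl torus2 (torus2_translation t)) \<and>
        (\<exists>R (P :: 3 \<Rightarrow> (real \<times> real) set) \<tau>. \<forall>\<omega> \<in> sadic_shift \<sigma>.
             natural_coding (\<int> \<times> \<int>) t R P \<tau> \<omega>) \<and>
        balanced_language (sadic_language \<sigma>) \<and>
        (\<exists>u. generalized_right_eigenvector \<sigma> u \<and>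
             (\<forall>i. bounded_remainder_set torus2 (torus2_translation t)
                    (torus2_image (rauzy_subpiece \<sigma> u i)))))"
  using AE_recurrent[of deep_len]
proof eventually_elim
  case (elim x)
  then interpret brun_point x by unfold_locales
  have coding: "natural_coding (\<int> \<times> \<int>) (rotation x) R (S 0) (err0 x) \<omega>" if "\<omega> \<in> sadic_shift (brun_Phi x)" for \<omega>
    using natural_partition_S codes_exists[OF that] unfolding natural_coding_def Z2_def by blast
  show ?case
    unfolding Let_def rotation_def[symmetric]
  proof (intro conjI)
    show "\<exists>\<mu>. shift_invariant_prob (sadic_shift (brun_Phi x)) \<mu> \<and>
        (\<forall>\<nu>. shift_invariant_prob (sadic_shift (brun_Phi x)) \<nu> \<longrightarrow> \<nu> = \<mu>) \<and>
        measurably_conjugate \<mu> stl torus2 (torus2_translation (rotation x))"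
      using shift_invariant_mu shift_invariant_unique conjugate_mu unfolding X_def by blast
    show "\<exists>R (P :: 3 \<Rightarrow> (real \<times> real) set) \<tau>. \<forall>\<omega> \<in> sadic_shift (brun_Phi x). natural_coding (\<int> \<times> \<int>) (rotation x) R P \<tau> \<omega>"
      using coding by blast
    show "balanced_language (sadic_language (brun_Phi x))" by (rule balanced)
    show "\<exists>u. generalized_right_eigenvector (brun_Phi x) u \<and>
        (\<forall>i. bounded_remainder_set torus2 (torus2_translation (rotation x)) (torus2_image (rauzy_subpiece (brun_Phi x) u i)))"
      using eigenvector bounded_remainder_piece torus2_image_rauzy by (intro exI[of _ u_vec]) simp
  qed
qed

end
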